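(* Let $a>0$, $q\ge1$, $H\in(\frac12,1)$, and let $U_t=\int_{-\infty}^t e^{-a(t-s)}dZ^{H,q}_s$, $t\ge0$, be the stationary Hermite–Ornstein–Uhlenbeck process driven by the Hermite process $Z^{H,q}$. Let $f:\mathbb{R}\to\mathbb{R}$ be measurable with $|f(y)|\le\exp(|y|^\gamma)$ for all $y$, for some $\gamma<\frac2q$. Then $$\lim_{T\to\infty}\frac1T\int_0^Tf(U_s)\,ds=\mathbb{E}[f(U_0)]\quad\text{almost surely}.$$
   Context: $B$ is a two-sided standard Brownian motion and $I^B_q$ the $q$-th multiple Wiener–Itô integral w.r.t. $B$. For $q\ge1$, $H\in(\frac12,1)$, $H_0=1-\frac{1-H}{q}$, the Hermite process of order $q$ and Hurst parameter $H$ is $Z^{H,q}(t)=c_{H,q}I^B_q\big(\int_0^t\prod_{j=1}^q(s-x_j)_+^{H_0-3/2}ds\big)$ with $c_{H,q}>0$ normalizing $\mathrm{Var}(Z^{H,q}(1))=1$, and for suitable $h$ (e.g. $h\in L^1\cap L^{1/H}$), $\int_{\mathbb{R}} h\,dZ^{H,q}:=c_{H,q}I^B_q\big(\int h(u)\prod_{j=1}^q(u-\xi_j)_+^{H_0-3/2}du\big)$. Thus $U_t=\int_{\mathbb{R}}x(t-s)dZ^{H,q}_s$ with $x(s)=e^{-as}\mathbf 1_{s>0}$.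
   Formalization: The exponent γ is assumed positive: for γ<0 the bound is undefined at y=0 and E[f(U_0)] may not exist (q=1, f(y)=sign(y)exp(1/|y|)); γ=0 (bounded f) follows by rescaling f. *)

theory Defs
  imports "HOL-Probability.Probability"
begin

definition two_sided_BM :: "'a measure \<Rightarrow> (real \<Rightarrow> 'a \<Rightarrow> real) \<Rightarrow> bool" where
  "two_sided_BM M B \<longleftrightarrow> prob_space M \<and>
     (\<forall>t. B t \<in> borel_measurable M) \<and>
     (\<forall>\<omega>\<in>space M. B 0 \<omega> = 0 \<and> continuous_on UNIV (\<lambda>t. B t \<omega>)) \<and>
     (\<forall>ts :: real list. sorted_wrt (<) ts \<longrightarrow>
        prob_space.indep_vars M (\<lambda>_. borel) (\<lambda>i \<omega>. B (ts ! Suc i) \<omega> - B (ts ! i) \<omega>) {..<length ts - 1} \<and>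
        (\<forall>i < length ts - 1. distributed M lborel (\<lambda>\<omega>. B (ts ! Suc i) \<omega> - B (ts ! i) \<omega>)
            (\<lambda>x. ennreal (normal_density 0 (sqrt (ts ! Suc i - ts ! i)) x))))"

text \<open>Elementary (off-diagonal) kernels on R^q built on a partition p_0 < ... < p_n:
  g(x) = sum over index maps i : {..<q} -> {..<n} of c i * prod_j 1_[p_(i j), p_(i j + 1)) (x_j),
  with c i = 0 whenever two indices coincide. Points of R^q are extensional functions on {..<q}.\<close>
definition elem_admissible :: "nat \<Rightarrow> real list \<Rightarrow> ((nat \<Rightarrow> nat) \<Rightarrow> real) \<Rightarrow> bool" where
  "elem_admissible q p c \<longleftrightarrow> sorted_wrt (<) p \<and>
     (\<forall>i \<in> {..<q} \<rightarrow>\<^sub>E {..<length p - 1}. \<not> inj_on i {..<q} \<longrightarrow> c i = 0)"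

definition elem_fun :: "nat \<Rightarrow> real list \<Rightarrow> ((nat \<Rightarrow> nat) \<Rightarrow> real) \<Rightarrow> (nat \<Rightarrow> real) \<Rightarrow> real" where
  "elem_fun q p c x = (\<Sum>i \<in> {..<q} \<rightarrow>\<^sub>E {..<length p - 1}.
       c i * (\<Prod>j<q. indicator {p ! (i j) ..< p ! Suc (i j)} (x j)))"

definition elem_int :: "nat \<Rightarrow> real list \<Rightarrow> ((nat \<Rightarrow> nat) \<Rightarrow> real) \<Rightarrow> (real \<Rightarrow> 'a \<Rightarrow> real) \<Rightarrow> 'a \<Rightarrow> real" where
  "elem_int q p c B \<omega> = (\<Sum>i \<in> {..<q} \<rightarrow>\<^sub>E {..<length p - 1}.
       c i * (\<Prod>j<q. B (p ! Suc (i j)) \<omega> - B (p ! (i j)) \<omega>))"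

text \<open>q-th multiple Wiener-Ito integral I_q^B(g), g in L^2(R^q): the L^2(M)-limit of the
  integrals of elementary kernels converging to g in L^2(R^q) (defined up to a null set).\<close>
definition mwi_integral :: "'a measure \<Rightarrow> (real \<Rightarrow> 'a \<Rightarrow> real) \<Rightarrow> nat \<Rightarrow> ((nat \<Rightarrow> real) \<Rightarrow> real) \<Rightarrow> 'a \<Rightarrow> real" where
  "mwi_integral M B q g = (SOME X. X \<in> borel_measurable M \<and>
     (\<exists>P C. (\<forall>k. elem_admissible q (P k) (C k)) \<and>
        (\<lambda>k. \<integral>\<^sup>+x. ennreal ((g x - elem_fun q (P k) (C k) x)\<^sup>2) \<partial>(Pi\<^sub>M {..<q} (\<lambda>_. lborel))) \<longlonglongrightarrow> 0 \<and>
        (\<lambda>k. \<integral>\<^sup>+\<omega>. ennreal ((X \<omega> - elem_int q (P k) (C k) B \<omega>)\<^sup>2) \<partial>M) \<longlonglongrightarrow> 0))"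

definition hermite_kernel :: "nat \<Rightarrow> real \<Rightarrow> (real \<Rightarrow> real) \<Rightarrow> (nat \<Rightarrow> real) \<Rightarrow> real" where
  "hermite_kernel q H h \<xi> =
     (let H0 = 1 - (1 - H) / real q in
      \<integral>u. h u * (\<Prod>j<q. if \<xi> j < u then (u - \<xi> j) powr (H0 - 3/2) else 0) \<partial>lborel)"

text \<open>Normalising constant c_{H,q} > 0 with Var(Z^{H,q}(1)) = 1.\<close>
definition hermite_const :: "'a measure \<Rightarrow> (real \<Rightarrow> 'a \<Rightarrow> real) \<Rightarrow> nat \<Rightarrow> real \<Rightarrow> real" where
  "hermite_const M B q H =
     1 / sqrt (\<integral>\<omega>. (mwi_integral M B q (hermite_kernel q H (indicator {0..1})) \<omega>)\<^sup>2 \<partial>M)"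

definition hermite_integral :: "'a measure \<Rightarrow> (real \<Rightarrow> 'a \<Rightarrow> real) \<Rightarrow> nat \<Rightarrow> real \<Rightarrow> (real \<Rightarrow> real) \<Rightarrow> 'a \<Rightarrow> real" where
  "hermite_integral M B q H h \<omega> =
     hermite_const M B q H * mwi_integral M B q (hermite_kernel q H h) \<omega>"

end

theory Submission
  imports Defs
begin

text \<open>The kernel of \<open>U t\<close> is the translate by \<open>t\<close>
  of a fixed kernel in \<open>L\<^sup>2(R\<^sup>q)\<close>; approximating the latter by elementary kernels approximates all the
  \<open>U t\<close> at once, uniformly in mean square, by polynomials in the increments of \<open>B\<close> over a translated
  bounded window. Since the law of the increments is translation invariant and increments over disjoint
  windows are independent, \<open>n \<mapsto> U (s + n)\<close> is stationary and mixing for every \<open>s\<close>. Garsia's maximal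
  inequality turns mixing into almost sure convergence of the averages of \<open>f (U (s + n))\<close>, and it bounds
  their supremum in mean, so that one may integrate over \<open>s \<in> (0, 1]\<close> by dominated convergence. Square
  integrability of \<open>f (U 0)\<close> comes from hypercontractivity:
  \<open>E (U 0)\<^sup>2\<^sup>n \<le> (D (2n - 1)\<^sup>q)\<^sup>n\<close>, which makes \<open>exp (\<kappa> \<bar>U 0\<bar> powr \<gamma>)\<close> integrable for \<open>\<gamma> q < 2\<close>.\<close>

section \<open>Maximal inequality for stationary sequences\<close>

text \<open>Each \<open>U t\<close> is determined only up to a null set, and its paths are merely
  jointly measurable. Pathwise arguments are therefore made for one offset \<open>s\<close> at a
  time, where countably many times \<open>s + n\<close> occur; the null set left over depends on
  \<open>s\<close>, and Fubini turns it into a null set of offsets for almost every path. Mixing is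
  taken in a weak form, decorrelation of \<open>g (X i)\<close> and \<open>g (X j)\<close> for one
  bounded Lipschitz \<open>g\<close>, because mean-square approximation by functionals of separated
  windows yields this directly and a variance computation consumes no more. Square integrability of
  \<open>f (U 0)\<close> is what makes the supremum of the averages integrable. The bound
  \<open>2 / q\<close> reflects the growth of moments in the \<open>q\<close>-th chaos: the
  \<open>2n\<close>-th moment is used at \<open>x\<close> with \<open>n\<close> of order
  \<open>\<bar>x\<bar> powr \<gamma>\<close>, where \<open>x\<^sup>2 / n ^ q\<close> is of order
  \<open>\<bar>x\<bar> powr (2 - \<gamma> * q)\<close> and has to grow. The kernels are not
  symmetrized, so a bound with the factor \<open>q ^ q\<close> stands where symmetric kernels would
  give an isometry.\<close>

abbreviation seq_space :: "(nat \<Rightarrow> real) measure" where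
  "seq_space \<equiv> \<Pi>\<^sub>M (_::nat)\<in>UNIV. (borel :: real measure)"

lemma measurable_seq_spaceI:
  "(\<And>n. (\<lambda>\<omega>. X n \<omega>) \<in> borel_measurable M) \<Longrightarrow> (\<lambda>\<omega> n. X n \<omega>) \<in> M \<rightarrow>\<^sub>M seq_space"
  by (rule measurable_PiM_single') (auto simp: space_PiM)

lemma measurable_seq_shift: "(\<lambda>x i. x (f i)) \<in> seq_space \<rightarrow>\<^sub>M seq_space"
  by (rule measurable_seq_spaceI) simp

text \<open>Phrased through the law on the sequence space, because the shift acts on sequences and
  not on \<open>M\<close>. One step of the shift is enough; larger steps follow by
  iteration.\<close>

definition stationary :: "'a measure \<Rightarrow> (nat \<Rightarrow> 'a \<Rightarrow> real) \<Rightarrow> bool" where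
  "stationary M X \<longleftrightarrow> (\<forall>n. X n \<in> borel_measurable M) \<and>
     distr M seq_space (\<lambda>\<omega> n. X (Suc n) \<omega>) = distr M seq_space (\<lambda>\<omega> n. X n \<omega>)"

lemma stationary_measurable: "stationary M X \<Longrightarrow> X n \<in> borel_measurable M"
  unfolding stationary_def by blast

lemma stationary_nn_integral:
  assumes "stationary M X" and [measurable]: "F \<in> borel_measurable seq_space"
  shows "(\<integral>\<^sup>+\<omega>. F (\<lambda>n. X (Suc n) \<omega>) \<partial>M) = (\<integral>\<^sup>+\<omega>. F (\<lambda>n. X n \<omega>) \<partial>M)"
proof -
  have [measurable]: "\<And>n. X n \<in> borel_measurable M" using assms(1) by (rule stationary_measurable)
  have "(\<integral>\<^sup>+\<omega>. F (\<lambda>n. X (Suc n) \<omega>) \<partial>M) = integral\<^sup>N (distr M seq_space (\<lambda>\<omega> n. X (Suc n) \<omega>)) F"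
    by (subst nn_integral_distr) (auto intro!: measurable_seq_spaceI)
  also have "distr M seq_space (\<lambda>\<omega> n. X (Suc n) \<omega>) = distr M seq_space (\<lambda>\<omega> n. X n \<omega>)"
    using assms(1) unfolding stationary_def by blast
  also have "integral\<^sup>N (distr M seq_space (\<lambda>\<omega> n. X n \<omega>)) F = (\<integral>\<^sup>+\<omega>. F (\<lambda>n. X n \<omega>) \<partial>M)"
    by (subst nn_integral_distr) (auto intro!: measurable_seq_spaceI)
  finally show ?thesis .
qed

text \<open>The map \<open>\<Psi>\<close>, which sends a path to the path of its block functionals,
  commutes with the shift and so carries the equality of the two laws over. It serves both functions
  of single terms and block averages.\<close>

lemma stationary_block:
  assumes "stationary M X" and [measurable]: "G \<in> borel_measurable seq_space"
  shows "stationary M (\<lambda>n \<omega>. G (\<lambda>i. X (n + i) \<omega>))"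
proof -
  have [measurable]: "\<And>n. X n \<in> borel_measurable M" using assms(1) by (rule stationary_measurable)
  define \<Psi> where "\<Psi> = (\<lambda>(x::nat \<Rightarrow> real) (n::nat). G (\<lambda>i. x (n + i)))"
  have \<Psi>: "\<Psi> \<in> seq_space \<rightarrow>\<^sub>M seq_space"
    unfolding \<Psi>_def by (intro measurable_seq_spaceI measurable_compose[OF measurable_seq_shift assms(2)])
  have X: "(\<lambda>\<omega> n. X (f n) \<omega>) \<in> M \<rightarrow>\<^sub>M seq_space" for f
    by (intro measurable_seq_spaceI) simp
  have "distr M seq_space (\<lambda>\<omega> n. G (\<lambda>i. X (Suc n + i) \<omega>)) = distr (distr M seq_space (\<lambda>\<omega> n. X (Suc n) \<omega>)) seq_space \<Psi>"
    by (subst distr_distr[OF \<Psi> X]) (simp add: o_def, simp add: \<Psi>_def)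
  also have "distr M seq_space (\<lambda>\<omega> n. X (Suc n) \<omega>) = distr M seq_space (\<lambda>\<omega> n. X n \<omega>)"
    using assms(1) unfolding stationary_def by blast
  also have "distr (distr M seq_space (\<lambda>\<omega> n. X n \<omega>)) seq_space \<Psi> = distr M seq_space (\<lambda>\<omega> n. G (\<lambda>i. X (n + i) \<omega>))"
    by (subst distr_distr[OF \<Psi> X]) (simp add: o_def, simp add: \<Psi>_def)
  finally show ?thesis
    unfolding stationary_def
    by (auto intro!: measurable_compose[OF measurable_seq_spaceI assms(2)])
qed

lemma stationary_compose:
  assumes "stationary M X" "h \<in> borel_measurable borel"
  shows "stationary M (\<lambda>n \<omega>. h (X n \<omega>))"
  using stationary_block[OF assms(1), of "\<lambda>x. h (x 0)"] assms(2) by simp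

lemma stationary_nn_integral_nth:
  assumes "stationary M X" "F \<in> borel_measurable borel"
  shows "(\<integral>\<^sup>+\<omega>. F (X n \<omega>) \<partial>M) = (\<integral>\<^sup>+\<omega>. F (X 0 \<omega>) \<partial>M)"
proof (induction n)
  case (Suc n)
  have "(\<lambda>x. F (x n)) \<in> borel_measurable seq_space" using assms(2) by measurable
  from stationary_nn_integral[OF assms(1) this] Suc show ?case by simp
qed simp

lemma stationary_distr:
  assumes "stationary M X"
  shows "distr M borel (X n) = distr M borel (X 0)"
proof (rule measure_eqI)
  have [measurable]: "\<And>n. X n \<in> borel_measurable M" using assms(1) by (rule stationary_measurable)
  fix A assume "A \<in> sets (distr M borel (X n))"
  then have [measurable]: "A \<in> sets borel" by simp
  have "emeasure (distr M borel (X k)) A = (\<integral>\<^sup>+\<omega>. indicator A (X k \<omega>) \<partial>M)" for k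
  proof -
    have "emeasure (distr M borel (X k)) A = (\<integral>\<^sup>+x. indicator A x \<partial>distr M borel (X k))" by simp
    also have "\<dots> = (\<integral>\<^sup>+\<omega>. indicator A (X k \<omega>) \<partial>M)" by (subst nn_integral_distr) auto
    finally show ?thesis .
  qed
  then show "emeasure (distr M borel (X n)) A = emeasure (distr M borel (X 0)) A"
    using stationary_nn_integral_nth[OF assms, of "indicator A" n] by simp
qed simp

lemma
  assumes "stationary M X" and [measurable]: "h \<in> borel_measurable borel"
  shows stationary_integrable: "integrable M (\<lambda>\<omega>. h (X 0 \<omega>)) \<Longrightarrow> integrable M (\<lambda>\<omega>. h (X n \<omega>) :: real)"
    and stationary_integral: "(\<integral>\<omega>. h (X n \<omega>) \<partial>M) = (\<integral>\<omega>. h (X 0 \<omega>) \<partial>M :: real)"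
proof -
  have [measurable]: "\<And>n. X n \<in> borel_measurable M" using assms(1) by (rule stationary_measurable)
  have i: "integrable M (\<lambda>\<omega>. h (X n \<omega>)) \<longleftrightarrow> integrable (distr M borel (X n)) h" for n
    by (subst integrable_distr_eq) auto
  have e: "(\<integral>\<omega>. h (X n \<omega>) \<partial>M) = integral\<^sup>L (distr M borel (X n)) h" for n
    by (subst integral_distr) auto
  show "integrable M (\<lambda>\<omega>. h (X 0 \<omega>)) \<Longrightarrow> integrable M (\<lambda>\<omega>. h (X n \<omega>))"
    unfolding i stationary_distr[OF assms(1), of n] .
  show "(\<integral>\<omega>. h (X n \<omega>) \<partial>M) = (\<integral>\<omega>. h (X 0 \<omega>) \<partial>M)"
    unfolding e stationary_distr[OF assms(1), of n] ..
qed

text \<open>\<open>maxsum n z\<close> is the maximum of the partial sums of \<open>z\<close> of length at most \<open>n\<close>, in the recursive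
  form that drives Garsia's proof of the maximal ergodic lemma.\<close>
primrec maxsum :: "nat \<Rightarrow> (nat \<Rightarrow> real) \<Rightarrow> real" where
  "maxsum 0 z = 0"
| "maxsum (Suc n) z = max 0 (z 0 + maxsum n (\<lambda>i. z (Suc i)))"

lemma maxsum_nonneg: "maxsum n z \<ge> 0"
  by (cases n) auto

lemma maxsum_Suc_ge: "maxsum n z \<le> maxsum (Suc n) z"
proof (induction n arbitrary: z)
  case (Suc n)
  from Suc[of "\<lambda>i. z (Suc i)"] show ?case by simp
qed simp

lemma sum_le_maxsum: "k \<le> n \<Longrightarrow> (\<Sum>i<k. z i) \<le> maxsum n z"
proof (induction n arbitrary: z k)
  case (Suc n)
  show ?case
  proof (cases k)
    case (Suc j)
    with Suc.IH[of j "\<lambda>i. z (Suc i)"] Suc.prems show ?thesis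
      by (simp add: sum.lessThan_Suc_shift del: sum.lessThan_Suc)
  qed simp
qed simp

lemma maxsum_le_sum_abs: "maxsum n z \<le> (\<Sum>i<n. \<bar>z i\<bar>)"
proof (induction n arbitrary: z)
  case (Suc n)
  have "(\<Sum>i<n. \<bar>z (Suc i)\<bar>) \<ge> 0" by (simp add: sum_nonneg)
  with Suc[of "\<lambda>i. z (Suc i)"] show ?case by (auto simp add: sum.lessThan_Suc_shift simp del: sum.lessThan_Suc)
qed simp

lemma measurable_maxsum [measurable]: "maxsum n \<in> borel_measurable seq_space"
proof (induction n)
  case (Suc n)
  have "(\<lambda>x. maxsum n (\<lambda>i. x (Suc i))) \<in> borel_measurable seq_space"
    by (rule measurable_compose[OF measurable_seq_shift Suc])
  then show ?case by simp
qed simp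

text \<open>Garsia's argument: \<open>h\<close> and its shifted copy \<open>h'\<close> have equal
  integrals by stationarity, while \<open>h - h'\<close> is at most \<open>Z 0\<close> where
  \<open>h\<close> is positive and at most \<open>0\<close> elsewhere. Integrating this pointwise
  inequality gives the claim.\<close>

lemma (in prob_space) maximal_ergodic_lemma:
  assumes Z: "stationary M Z" and int: "integrable M (Z 0)"
  shows "0 \<le> (\<integral>\<omega>. Z 0 \<omega> * indicator {\<omega>. maxsum (Suc n) (\<lambda>i. Z i \<omega>) > 0} \<omega> \<partial>M)"
proof -
  have [measurable]: "\<And>n. Z n \<in> borel_measurable M" using Z by (rule stationary_measurable)
  have mZ[measurable]: "(\<lambda>\<omega> n. Z (f n) \<omega>) \<in> M \<rightarrow>\<^sub>M seq_space" for f
    by (intro measurable_seq_spaceI) simp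
  define h where "h \<omega> = maxsum (Suc n) (\<lambda>i. Z i \<omega>)" for \<omega>
  define h' where "h' \<omega> = maxsum (Suc n) (\<lambda>i. Z (Suc i) \<omega>)" for \<omega>
  have [measurable]: "h \<in> borel_measurable M" "h' \<in> borel_measurable M"
    unfolding h_def h'_def by (auto intro!: measurable_compose[OF mZ measurable_maxsum] simp del: maxsum.simps)
  have intZ: "integrable M (\<lambda>\<omega>. \<bar>Z i \<omega>\<bar>)" for i
    using stationary_integrable[OF Z, of "\<lambda>x. x" i] int by simp
  have ih: "integrable M h"
    by (rule Bochner_Integration.integrable_bound[of _ "\<lambda>\<omega>. \<Sum>i<Suc n. \<bar>Z i \<omega>\<bar>"])
      (auto simp: h_def maxsum_nonneg intro!: maxsum_le_sum_abs order.trans[OF _ abs_ge_self] Bochner_Integration.integrable_sum intZ simp del: maxsum.simps sum.lessThan_Suc)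
  have ih': "integrable M h'"
    by (rule Bochner_Integration.integrable_bound[of _ "\<lambda>\<omega>. \<Sum>i<Suc n. \<bar>Z (Suc i) \<omega>\<bar>"])
      (auto simp: h'_def maxsum_nonneg intro!: maxsum_le_sum_abs order.trans[OF _ abs_ge_self] Bochner_Integration.integrable_sum intZ simp del: maxsum.simps sum.lessThan_Suc)
  have "(\<integral>\<^sup>+\<omega>. ennreal (h' \<omega>) \<partial>M) = (\<integral>\<^sup>+\<omega>. ennreal (h \<omega>) \<partial>M)"
    unfolding h_def h'_def by (rule stationary_nn_integral[OF Z]) (simp del: maxsum.simps)
  then have eq: "integral\<^sup>L M h' = integral\<^sup>L M h"
    using maxsum_nonneg by (subst (1 2) integral_eq_nn_integral) (auto simp: h_def h'_def simp del: maxsum.simps)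
  have iZ: "integrable M (\<lambda>\<omega>. Z 0 \<omega> * indicator {\<omega>. h \<omega> > 0} \<omega>)"
    by (rule Bochner_Integration.integrable_bound[OF int]) (auto simp: indicator_def)
  have pw: "h \<omega> - h' \<omega> \<le> Z 0 \<omega> * indicator {\<omega>. h \<omega> > 0} \<omega>" for \<omega>
  proof (cases "h \<omega> > 0")
    case True
    then have "h \<omega> = Z 0 \<omega> + maxsum n (\<lambda>i. Z (Suc i) \<omega>)" by (auto simp: h_def)
    also have "\<dots> \<le> Z 0 \<omega> + h' \<omega>" unfolding h'_def using maxsum_Suc_ge by simp
    finally show ?thesis using True by simp
  next
    case False
    moreover have "h' \<omega> \<ge> 0" unfolding h'_def by (rule maxsum_nonneg)
    ultimately show ?thesis by simp
  qed
  have "0 = (\<integral>\<omega>. h \<omega> - h' \<omega> \<partial>M)" using ih ih' eq by simp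
  also have "\<dots> \<le> (\<integral>\<omega>. Z 0 \<omega> * indicator {\<omega>. h \<omega> > 0} \<omega> \<partial>M)"
    by (intro integral_mono ih ih' iZ pw Bochner_Integration.integrable_diff)
  finally show ?thesis by (simp add: h_def del: maxsum.simps)
qed

text \<open>A partial sum of \<open>W\<close> above \<open>c * k\<close> is a positive partial sum
  of \<open>Z = W - c\<close>. On the event \<open>E n\<close> that such a sum occurs early, the
  maximal ergodic lemma says that the integral of \<open>W 0\<close> is at least \<open>c\<close>
  times the probability; the events increase with \<open>n\<close>, so the bound survives in the
  union.\<close>

lemma (in prob_space) maximal_ergodic_inequality:
  assumes W: "stationary M W" and int: "integrable M (W 0)" and nonneg: "\<And>\<omega>. W 0 \<omega> \<ge> 0" and c: "c > 0"
  shows "emeasure M {\<omega>\<in>space M. \<exists>k. (\<Sum>i<k. W i \<omega>) > c * real k} \<le> ennreal ((\<integral>\<omega>. W 0 \<omega> \<partial>M) / c)"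
proof -
  have [measurable]: "\<And>n. W n \<in> borel_measurable M" using W by (rule stationary_measurable)
  define Z where "Z = (\<lambda>n \<omega>. W n \<omega> - c)"
  have Z: "stationary M Z" unfolding Z_def by (rule stationary_compose[OF W]) simp
  have [measurable]: "\<And>n. Z n \<in> borel_measurable M" using Z by (rule stationary_measurable)
  have mZ[measurable]: "(\<lambda>\<omega> n. Z n \<omega>) \<in> M \<rightarrow>\<^sub>M seq_space"
    by (intro measurable_seq_spaceI) simp
  define E where "E n = {\<omega>\<in>space M. maxsum (Suc n) (\<lambda>i. Z i \<omega>) > 0}" for n
  have hm[measurable]: "(\<lambda>\<omega>. maxsum m (\<lambda>i. Z i \<omega>)) \<in> borel_measurable M" for m
    by (rule measurable_compose[OF mZ measurable_maxsum])
  have E[measurable]: "E n \<in> sets M" for n unfolding E_def by (simp del: maxsum.simps)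
  have le: "emeasure M (E n) \<le> ennreal ((\<integral>\<omega>. W 0 \<omega> \<partial>M) / c)" for n
  proof -
    have iW: "integrable M (\<lambda>\<omega>. W 0 \<omega> * indicator (E n) \<omega>)"
      by (rule Bochner_Integration.integrable_bound[OF int]) (auto simp: indicator_def)
    have "0 \<le> (\<integral>\<omega>. Z 0 \<omega> * indicator {\<omega>. maxsum (Suc n) (\<lambda>i. Z i \<omega>) > 0} \<omega> \<partial>M)"
      by (rule maximal_ergodic_lemma[OF Z]) (simp add: Z_def int)
    also have "\<dots> = (\<integral>\<omega>. W 0 \<omega> * indicator (E n) \<omega> - c * indicator (E n) \<omega> \<partial>M)"
      by (intro Bochner_Integration.integral_cong) (auto simp: Z_def E_def indicator_def simp del: maxsum.simps)
    also have "\<dots> = (\<integral>\<omega>. W 0 \<omega> * indicator (E n) \<omega> \<partial>M) - c * prob (E n)"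
      using iW by (simp add: Bochner_Integration.integral_diff less_top[symmetric])
    also have "(\<integral>\<omega>. W 0 \<omega> * indicator (E n) \<omega> \<partial>M) \<le> (\<integral>\<omega>. W 0 \<omega> \<partial>M)"
      using nonneg by (intro integral_mono iW int) (auto simp: indicator_def)
    finally have "prob (E n) \<le> (\<integral>\<omega>. W 0 \<omega> \<partial>M) / c" using c by (simp add: field_simps)
    then show ?thesis by (simp add: emeasure_eq_measure ennreal_leI)
  qed
  have "{\<omega>\<in>space M. \<exists>k. (\<Sum>i<k. W i \<omega>) > c * real k} \<subseteq> (\<Union>n. E n)"
  proof clarify
    fix \<omega> k assume \<omega>: "\<omega> \<in> space M" "c * real k < (\<Sum>i<k. W i \<omega>)"
    then have "0 < (\<Sum>i<k. Z i \<omega>)" by (simp add: Z_def sum_subtractf mult.commute)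
    also have "\<dots> \<le> maxsum (Suc k) (\<lambda>i. Z i \<omega>)" by (rule sum_le_maxsum) simp
    finally show "\<omega> \<in> (\<Union>n. E n)" using \<omega> by (auto simp: E_def simp del: maxsum.simps)
  qed
  then have "emeasure M {\<omega>\<in>space M. \<exists>k. (\<Sum>i<k. W i \<omega>) > c * real k} \<le> emeasure M (\<Union>n. E n)"
    by (intro emeasure_mono) auto
  also have "\<dots> = (SUP n. emeasure M (E n))"
  proof (rule SUP_emeasure_incseq[symmetric])
    show "incseq E"
    proof (rule incseq_SucI)
      fix n show "E n \<le> E (Suc n)"
        unfolding E_def using maxsum_Suc_ge[of "Suc n"] by (auto intro: less_le_trans simp del: maxsum.simps)
    qed
  qed auto
  also have "\<dots> \<le> ennreal ((\<integral>\<omega>. W 0 \<omega> \<partial>M) / c)" by (intro SUP_least le)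
  finally show ?thesis .
qed

text \<open>A discrete layer-cake bound: the series counts the naturals below \<open>x\<close>, of
  which there are at least as many as the floor of \<open>x\<close>. Integrated, it turns tail
  estimates into an estimate of the mean, the value infinity included.\<close>

lemma ennreal_le_Suc_count:
  fixes x :: ennreal
  shows "x \<le> 1 + (\<Sum>n. indicator {of_nat n<..} x)"
proof -
  have *: "(of_nat m::ennreal) \<le> (\<Sum>n. indicator {of_nat n<..} x)" if "of_nat m \<le> x" for m
  proof -
    have "of_nat m = (\<Sum>n<m. (1::ennreal))" by simp
    also have "\<dots> = (\<Sum>n<m. indicator {of_nat n<..} x)"
      using that by (intro sum.cong) (auto intro!: less_le_trans[OF _ that] simp: indicator_def)
    also have "\<dots> \<le> (\<Sum>n. indicator {of_nat n<..} x)" by (rule sum_le_suminf) auto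
    finally show ?thesis .
  qed
  show ?thesis
  proof (cases x)
    case (real r)
    have "x \<le> 1 + of_nat (nat \<lfloor>r\<rfloor>)"
    proof -
      have "r \<le> 1 + real (nat \<lfloor>r\<rfloor>)" using real by linarith
      then have "ennreal r \<le> ennreal (1 + real (nat \<lfloor>r\<rfloor>))" by (rule ennreal_leI)
      then show ?thesis using real by (simp add: ennreal_of_nat_eq_real_of_nat)
    qed
    also have "\<dots> \<le> 1 + (\<Sum>n. indicator {of_nat n<..} x)"
    proof (intro add_left_mono *)
      have "real (nat \<lfloor>r\<rfloor>) \<le> r" using real by linarith
      then show "of_nat (nat \<lfloor>r\<rfloor>) \<le> x" using real by (simp add: ennreal_of_nat_eq_real_of_nat)
    qed
    finally show ?thesis .
  next
    case top
    have "(SUP m. of_nat m :: ennreal) \<le> (\<Sum>n. indicator {of_nat n<..} x)"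
      by (intro SUP_least *) (simp add: top)
    then have "(\<Sum>n. indicator {of_nat n<..} x) = (top::ennreal)"
      by (simp only: ennreal_SUP_of_nat_eq_top top.extremum_unique)
    then show ?thesis by simp
  qed
qed

text \<open>A maximal inequality delivers its conclusion off events of small but positive
  probability. The intersection of such events along a null sequence of bounds is a null
  set.\<close>

lemma (in prob_space) AE_I_small:
  assumes "\<And>e. e > 0 \<Longrightarrow> \<exists>A\<in>sets M. emeasure M A \<le> ennreal e \<and> (AE \<omega> in M. \<omega> \<notin> A \<longrightarrow> P \<omega>)"
  shows "AE \<omega> in M. P \<omega>"
proof -
  have "\<exists>A\<in>sets M. emeasure M A \<le> ennreal (1 / real (Suc n)) \<and> (AE \<omega> in M. \<omega> \<notin> A \<longrightarrow> P \<omega>)" for n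
    by (rule assms) simp
  then obtain A where A: "\<And>n. A n \<in> sets M" "\<And>n. emeasure M (A n) \<le> ennreal (1 / real (Suc n))"
    "\<And>n. AE \<omega> in M. \<omega> \<notin> A n \<longrightarrow> P \<omega>" by metis
  have "emeasure M (\<Inter>n. A n) = 0"
  proof -
    have "emeasure M (\<Inter>n. A n) \<le> ennreal (1 / real (Suc n))" for n
      using A by (intro order.trans[OF emeasure_mono A(2)]) auto
    moreover have "(\<lambda>n. ennreal (1 / real (Suc n))) \<longlonglongrightarrow> ennreal 0"
      by (intro tendsto_ennrealI LIMSEQ_inverse_real_of_nat[unfolded inverse_eq_divide])
    ultimately have "emeasure M (\<Inter>n. A n) \<le> ennreal 0"
      by (intro LIMSEQ_le_const) auto
    then show ?thesis by simp
  qed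
  then have "AE \<omega> in M. \<omega> \<notin> (\<Inter>n. A n)"
    using A(1) by (intro AE_not_in) (auto simp: null_sets_def intro!: sets.countable_INT)
  moreover have "AE \<omega> in M. \<forall>n. \<omega> \<notin> A n \<longrightarrow> P \<omega>" using A(3) by (subst AE_all_countable) auto
  ultimately show ?thesis by eventually_elim auto
qed

section \<open>Almost sure convergence of averages\<close>

lemma AE_tendsto_zero_of_nn_integral_summable:
  fixes u :: "nat \<Rightarrow> 'a \<Rightarrow> real"
  assumes [measurable]: "\<And>n. u n \<in> borel_measurable M"
    and fin: "(\<Sum>n. \<integral>\<^sup>+\<omega>. ennreal ((u n \<omega>)\<^sup>2) \<partial>M) < \<infinity>"
  shows "AE \<omega> in M. (\<lambda>n. u n \<omega>) \<longlonglongrightarrow> 0"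
proof -
  have "(\<integral>\<^sup>+\<omega>. (\<Sum>n. ennreal ((u n \<omega>)\<^sup>2)) \<partial>M) < \<infinity>"
    using fin by (subst nn_integral_suminf) auto
  then have "AE \<omega> in M. (\<Sum>n. ennreal ((u n \<omega>)\<^sup>2)) \<noteq> \<infinity>"
    by (intro nn_integral_noteq_infinite) auto
  then show ?thesis
  proof eventually_elim
    case (elim \<omega>)
    then have "summable (\<lambda>n. (u n \<omega>)\<^sup>2)" by (intro summable_suminf_not_top) auto
    then have "(\<lambda>n. sqrt ((u n \<omega>)\<^sup>2)) \<longlonglongrightarrow> sqrt 0"
      by (intro tendsto_real_sqrt summable_LIMSEQ_zero)
    then show ?case by (simp add: tendsto_rabs_zero_iff)
  qed
qed

lemma suminf_inverse_squares_finite: "(\<Sum>n. ennreal (c / (real (Suc n))\<^sup>2)) < \<infinity>" if "c \<ge> 0" for c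
proof -
  have "summable (\<lambda>n. 1 / (real n)^2)" using inverse_power_summable[of 2, where 'a=real] by (simp add: inverse_eq_divide)
  then have "summable (\<lambda>n. 1 / (real (Suc n))^2)" by (subst summable_Suc_iff)
  then have "summable (\<lambda>n. c * (1 / (real (Suc n))^2))" by (rule summable_mult)
  then have "summable (\<lambda>n. c / (real (Suc n))\<^sup>2)" by simp
  then show ?thesis using that by (subst suminf_ennreal2) auto
qed

text \<open>By stationarity the second moments are those of \<open>V 0\<close> divided by
  \<open>(n + 1)\<^sup>2\<close>, hence summable. This disposes of the boundary terms that appear
  when a summation range is shifted.\<close>

lemma (in prob_space) stationary_over_index_tendsto_zero:
  assumes V: "stationary M V" and sq: "(\<integral>\<^sup>+\<omega>. ennreal ((V 0 \<omega>)\<^sup>2) \<partial>M) < \<infinity>"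
  shows "AE \<omega> in M. (\<lambda>n. V n \<omega> / real (Suc n)) \<longlonglongrightarrow> 0"
proof (rule AE_tendsto_zero_of_nn_integral_summable)
  have [measurable]: "\<And>n. V n \<in> borel_measurable M" using V by (rule stationary_measurable)
  show "(\<lambda>\<omega>. V n \<omega> / real (Suc n)) \<in> borel_measurable M" for n by simp
  obtain c where c: "c \<ge> 0" "(\<integral>\<^sup>+\<omega>. ennreal ((V 0 \<omega>)\<^sup>2) \<partial>M) = ennreal c"
    using sq by (cases "(\<integral>\<^sup>+\<omega>. ennreal ((V 0 \<omega>)\<^sup>2) \<partial>M)") auto
  have "(\<integral>\<^sup>+\<omega>. ennreal ((V n \<omega> / real (Suc n))\<^sup>2) \<partial>M) = ennreal (c / (real (Suc n))\<^sup>2)" for n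
  proof -
    have "(\<integral>\<^sup>+\<omega>. ennreal ((V n \<omega> / real (Suc n))\<^sup>2) \<partial>M) = (\<integral>\<^sup>+\<omega>. ennreal ((V 0 \<omega> / real (Suc n))\<^sup>2) \<partial>M)"
      by (rule stationary_nn_integral_nth[OF V, of "\<lambda>x. ennreal ((x / real (Suc n))\<^sup>2)"]) measurable
    also have "\<dots> = (\<integral>\<^sup>+\<omega>. ennreal (1 / (real (Suc n))\<^sup>2) * ennreal ((V 0 \<omega>)\<^sup>2) \<partial>M)"
      by (intro nn_integral_cong) (simp add: ennreal_mult[symmetric] power_divide del: of_nat_Suc)
    also have "\<dots> = ennreal (1 / (real (Suc n))\<^sup>2) * ennreal c"
      by (subst nn_integral_cmult) (auto simp: c)
    also have "\<dots> = ennreal (c / (real (Suc n))\<^sup>2)"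
      using c by (subst ennreal_mult[symmetric]) auto
    finally show ?thesis .
  qed
  then show "(\<Sum>n. \<integral>\<^sup>+\<omega>. ennreal ((V n \<omega> / real (Suc n))\<^sup>2) \<partial>M) < \<infinity>"
    using suminf_inverse_squares_finite[OF c(1)] by simp
qed

lemma sum_shift_diff:
  fixes v :: "nat \<Rightarrow> real"
  shows "(\<Sum>i<n. v (i + r)) - (\<Sum>i<n. v i) = (\<Sum>i<r. v (n + i)) - (\<Sum>i<r. v i)"
proof -
  have "(\<Sum>i<r. v i) + (\<Sum>i<n. v (i + r)) = (\<Sum>i<r+n. v i)" for r n
    by (induction n) (auto simp: add.commute)
  from this[of r n] this[of n r] show ?thesis by (simp add: add.commute)
qed

text \<open>Shifting the summation range by \<open>r\<close> exchanges only \<open>r\<close> terms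
  at either end (\<open>sum_shift_diff\<close>), and each of them is negligible against
  \<open>n\<close> by the assumption on \<open>v\<close>. The averages of the block averages are the
  mean of \<open>K\<close> such shifts.\<close>

lemma averages_of_block_averages:
  fixes v :: "nat \<Rightarrow> real"
  assumes v: "(\<lambda>n. v n / real (Suc n)) \<longlonglongrightarrow> 0" and K: "K \<ge> 1"
  shows "(\<lambda>n. (\<Sum>i<n. v i) / real n - (\<Sum>i<n. (\<Sum>j<K. v (i + j*m)) / real K) / real n) \<longlonglongrightarrow> 0"
proof -
  have inv: "(\<lambda>n. 1 / real n) \<longlonglongrightarrow> 0" by (rule lim_1_over_n)
  have A: "(\<lambda>n. v (n + i) / real n) \<longlonglongrightarrow> 0" for i
  proof -
    have "(\<lambda>n. v (n + i) / real (Suc (n + i)) * (1 + real (Suc i) * (1 / real n))) \<longlonglongrightarrow> 0 * (1 + real (Suc i) * 0)"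
      by (intro tendsto_mult tendsto_add tendsto_const inv LIMSEQ_ignore_initial_segment[OF v, of i])
    moreover have "\<forall>\<^sub>F n in sequentially. v (n + i) / real (Suc (n + i)) * (1 + real (Suc i) * (1 / real n)) = v (n + i) / real n"
      using eventually_gt_at_top[of 0]
    proof eventually_elim
      case (elim n)
      then have "1 + real (Suc i) * (1 / real n) = real (Suc (n + i)) / real n" by (simp add: field_simps)
      then show ?case by (simp del: of_nat_Suc)
    qed
    ultimately show ?thesis by (simp add: tendsto_cong)
  qed
  have B: "(\<lambda>n. ((\<Sum>i<n. v (i + r)) - (\<Sum>i<n. v i)) / real n) \<longlonglongrightarrow> 0" for r
  proof -
    have "(\<lambda>n. (\<Sum>i<r. v (n + i) / real n) - (\<Sum>i<r. v i) * (1 / real n)) \<longlonglongrightarrow> (\<Sum>i<r. 0) - (\<Sum>i<r. v i) * 0"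
      by (intro tendsto_diff tendsto_sum tendsto_mult tendsto_const inv A)
    then show ?thesis unfolding sum_shift_diff by (simp add: diff_divide_distrib sum_divide_distrib)
  qed
  have "(\<lambda>n. \<Sum>j<K. - (((\<Sum>i<n. v (i + j*m)) - (\<Sum>i<n. v i)) / real n) / real K) \<longlonglongrightarrow> (\<Sum>j<K. - 0 / real K)"
    by (intro tendsto_sum tendsto_divide tendsto_minus B tendsto_const) (use K in auto)
  also have "(\<lambda>n. \<Sum>j<K. - (((\<Sum>i<n. v (i + j*m)) - (\<Sum>i<n. v i)) / real n) / real K) =
    (\<lambda>n. (\<Sum>i<n. v i) / real n - (\<Sum>i<n. (\<Sum>j<K. v (i + j*m)) / real K) / real n)"
  proof
    fix n
    define A B where "A = (\<Sum>i<n. v i)" and "B j = (\<Sum>i<n. v (i + j*m))" for j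
    have "(\<Sum>i<n. (\<Sum>j<K. v (i + j*m)) / real K) = (\<Sum>j<K. B j / real K)"
      unfolding sum_divide_distrib B_def by (rule sum.swap)
    moreover have "(\<Sum>j<K. - ((B j - A) / real n) / real K) = A / real n - (\<Sum>j<K. B j / real K) / real n"
    proof -
      have "(\<Sum>j<K. - ((B j - A) / real n) / real K) = (\<Sum>j<K. A / real n / real K - B j / real K / real n)"
        by (intro sum.cong refl) (simp add: diff_divide_distrib mult.commute)
      also have "\<dots> = real K * (A / real n / real K) - (\<Sum>j<K. B j / real K / real n)"
        by (simp add: sum_subtractf)
      finally show ?thesis using K by (simp add: sum_divide_distrib)
    qed
    ultimately show "(\<Sum>j<K. - (((\<Sum>i<n. v (i + j*m)) - (\<Sum>i<n. v i)) / real n) / real K)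
        = (\<Sum>i<n. v i) / real n - (\<Sum>i<n. (\<Sum>j<K. v (i + j*m)) / real K) / real n"
      unfolding A_def[symmetric] B_def[symmetric] by simp
  qed
  finally show ?thesis by simp
qed

text \<open>Convergence in mean of some averages along an arithmetic progression already forces almost sure
  convergence: the ordinary averages differ from averages of these block averages by a null sequence,
  and the maximal inequality controls the latter.\<close>
lemma (in prob_space) pointwise_ergodic:
  assumes V: "stationary M V" and sq: "(\<integral>\<^sup>+\<omega>. ennreal ((V 0 \<omega>)\<^sup>2) \<partial>M) < \<infinity>" and int: "integrable M (V 0)"
    and mean: "\<And>e. e > 0 \<Longrightarrow> \<exists>K m. K \<ge> 1 \<and> (\<integral>\<omega>. \<bar>(\<Sum>j<K. V (j*m) \<omega>) / real K\<bar> \<partial>M) \<le> e"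
  shows "AE \<omega> in M. (\<lambda>n. (\<Sum>i<n. V i \<omega>) / real n) \<longlonglongrightarrow> 0"
proof -
  have [measurable]: "\<And>n. V n \<in> borel_measurable M" using V by (rule stationary_measurable)
  have intV: "integrable M (V n)" for n
    using stationary_integrable[OF V, of "\<lambda>x. x" n] int by simp
  \<comment> \<open>One \<open>c\<close> bounds the averages of the block averages off a set of
    small probability, the other \<open>c\<close> their distance to the ordinary averages.\<close>
  have key: "AE \<omega> in M. \<forall>\<^sub>F n in sequentially. \<bar>(\<Sum>i<n. V i \<omega>) / real n\<bar> \<le> 2 * c" if c: "c > 0" for c
  proof (rule AE_I_small)
    fix e :: real assume e: "e > 0"
    \<comment> \<open>The tolerance \<open>e * c\<close> makes up for the factor
      \<open>1 / c\<close> of the maximal inequality.\<close>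
    obtain K m where K: "K \<ge> 1" and Ke: "(\<integral>\<omega>. \<bar>(\<Sum>j<K. V (j*m) \<omega>) / real K\<bar> \<partial>M) \<le> e * c"
      using mean[of "e * c"] e c by auto
    define W where "W n \<omega> = \<bar>(\<Sum>j<K. V (n + j*m) \<omega>) / real K\<bar>" for n \<omega>
    have "(\<lambda>x. \<bar>(\<Sum>j<K. x (j*m)) / real K\<bar>) \<in> borel_measurable seq_space" by simp
    from stationary_block[OF V this] have W: "stationary M W" unfolding W_def .
    have [measurable]: "\<And>n. W n \<in> borel_measurable M" using W by (rule stationary_measurable)
    have iW: "integrable M (W 0)" unfolding W_def by (intro integrable_abs integrable_divide Bochner_Integration.integrable_sum intV)
    define A where "A = {\<omega>\<in>space M. \<exists>k. (\<Sum>i<k. W i \<omega>) > c * real k}"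
    have "emeasure M A \<le> ennreal ((\<integral>\<omega>. W 0 \<omega> \<partial>M) / c)"
      unfolding A_def by (rule maximal_ergodic_inequality[OF W iW _ c]) (simp add: W_def)
    also have "(\<integral>\<omega>. W 0 \<omega> \<partial>M) = (\<integral>\<omega>. \<bar>(\<Sum>j<K. V (j*m) \<omega>) / real K\<bar> \<partial>M)" by (simp only: W_def add_0)
    also have "ennreal (\<dots> / c) \<le> ennreal e"
      using Ke c by (intro ennreal_leI) (simp only: pos_divide_le_eq)
    finally have Ae: "emeasure M A \<le> ennreal e" .
    show "\<exists>A\<in>sets M. emeasure M A \<le> ennreal e \<and> (AE \<omega> in M. \<omega> \<notin> A \<longrightarrow> (\<forall>\<^sub>F n in sequentially. \<bar>(\<Sum>i<n. V i \<omega>) / real n\<bar> \<le> 2 * c))"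
    proof (intro bexI[of _ A] conjI Ae)
      show "A \<in> sets M" unfolding A_def by measurable
      from stationary_over_index_tendsto_zero[OF V sq] AE_space
      show "AE \<omega> in M. \<omega> \<notin> A \<longrightarrow> (\<forall>\<^sub>F n in sequentially. \<bar>(\<Sum>i<n. V i \<omega>) / real n\<bar> \<le> 2 * c)"
      proof (eventually_elim, intro impI)
        fix \<omega> assume v: "(\<lambda>n. V n \<omega> / real (Suc n)) \<longlonglongrightarrow> 0" and "\<omega> \<in> space M" and "\<omega> \<notin> A"
        then have le: "(\<Sum>i<k. W i \<omega>) \<le> c * real k" for k by (auto simp: A_def not_less)
        from averages_of_block_averages[OF v K, of m]
        have "\<forall>\<^sub>F n in sequentially. \<bar>(\<Sum>i<n. V i \<omega>) / real n - (\<Sum>i<n. (\<Sum>j<K. V (i + j*m) \<omega>) / real K) / real n\<bar> < c"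
          using c by (auto dest!: tendstoD simp: dist_real_def)
        with eventually_gt_at_top[of 0]
        show "\<forall>\<^sub>F n in sequentially. \<bar>(\<Sum>i<n. V i \<omega>) / real n\<bar> \<le> 2 * c"
        proof eventually_elim
          fix n :: nat assume n: "n > 0" and d: "\<bar>(\<Sum>i<n. V i \<omega>) / real n - (\<Sum>i<n. (\<Sum>j<K. V (i + j*m) \<omega>) / real K) / real n\<bar> < c"
          have "\<bar>\<Sum>i<n. (\<Sum>j<K. V (i + j*m) \<omega>) / real K\<bar> \<le> (\<Sum>i<n. W i \<omega>)"
            unfolding W_def by (rule sum_abs)
          also have "\<dots> \<le> c * real n" by (rule le)
          finally have "\<bar>(\<Sum>i<n. (\<Sum>j<K. V (i + j*m) \<omega>) / real K) / real n\<bar> \<le> c" using n by (simp add: field_simps)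
          with d show "\<bar>(\<Sum>i<n. V i \<omega>) / real n\<bar> \<le> 2 * c" by linarith
        qed
      qed
    qed
  qed
  have "AE \<omega> in M. \<forall>k. \<forall>\<^sub>F n in sequentially. \<bar>(\<Sum>i<n. V i \<omega>) / real n\<bar> \<le> 2 * (1 / real (Suc k))"
    by (subst AE_all_countable) (intro allI key, simp)
  then show ?thesis
  proof eventually_elim
    fix \<omega> assume *: "\<forall>k. \<forall>\<^sub>F n in sequentially. \<bar>(\<Sum>i<n. V i \<omega>) / real n\<bar> \<le> 2 * (1 / real (Suc k))"
    show "(\<lambda>n. (\<Sum>i<n. V i \<omega>) / real n) \<longlonglongrightarrow> 0"
    proof (rule tendstoI)
      fix e :: real assume "e > 0"
      then obtain k where "1 / real (Suc k) < e / 2"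
        using reals_Archimedean[of "e/2"] by (auto simp: inverse_eq_divide)
      with * show "\<forall>\<^sub>F n in sequentially. dist ((\<Sum>i<n. V i \<omega>) / real n) 0 < e"
        by (auto simp: dist_real_def elim!: allE[of _ k] eventually_mono)
    qed
  qed
qed

text \<open>By Cauchy-Schwarz, an average of \<open>\<bar>Y\<bar>\<close> above \<open>n + 1\<close>
  forces an average of \<open>Y\<^sup>2\<close> above \<open>(n + 1)\<^sup>2\<close>. The maximal
  inequality for the squares thus gives tails of order \<open>1 / n\<^sup>2\<close>, which are
  summable; for \<open>\<bar>Y\<bar>\<close> itself it would give tails of order
  \<open>1 / n\<close>, which are not.\<close>

lemma (in prob_space) nn_integral_sup_averages_finite:
  assumes Y: "stationary M Y" and sq: "(\<integral>\<^sup>+\<omega>. ennreal ((Y 0 \<omega>)\<^sup>2) \<partial>M) = ennreal C" and C: "C \<ge> 0"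
  shows "(\<integral>\<^sup>+\<omega>. (SUP n. ennreal ((\<Sum>i<n. \<bar>Y i \<omega>\<bar>) / real n)) \<partial>M) \<le> 2 + (\<Sum>n. ennreal (C / (real (Suc n))\<^sup>2))"
proof -
  have [measurable]: "\<And>n. Y n \<in> borel_measurable M" using Y by (rule stationary_measurable)
  define S where "S \<omega> = (SUP n. ennreal ((\<Sum>i<n. \<bar>Y i \<omega>\<bar>) / real n))" for \<omega>
  have [measurable]: "S \<in> borel_measurable M" unfolding S_def by measurable
  define W where "W = (\<lambda>n \<omega>. (Y n \<omega>)\<^sup>2)"
  have W: "stationary M W" unfolding W_def by (rule stationary_compose[OF Y]) simp
  have [measurable]: "\<And>n. W n \<in> borel_measurable M" using W by (rule stationary_measurable)
  have iW: "integrable M (W 0)" using sq by (intro integrableI_bounded) (auto simp: W_def)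
  have eW: "(\<integral>\<omega>. W 0 \<omega> \<partial>M) = C" using sq C by (subst integral_eq_nn_integral) (auto simp: W_def)
  have bd: "emeasure M {\<omega>\<in>space M. of_nat (Suc n) < S \<omega>} \<le> ennreal (C / (real (Suc n))\<^sup>2)" for n
  proof -
    have "{\<omega>\<in>space M. of_nat (Suc n) < S \<omega>} \<subseteq> {\<omega>\<in>space M. \<exists>k. (\<Sum>i<k. W i \<omega>) > (real (Suc n))\<^sup>2 * real k}"
    proof clarify
      fix \<omega> assume \<omega>: "\<omega> \<in> space M" "of_nat (Suc n) < S \<omega>"
      then obtain k where k: "of_nat (Suc n) < ennreal ((\<Sum>i<k. \<bar>Y i \<omega>\<bar>) / real k)" unfolding S_def less_SUP_iff by auto
      then have k': "real (Suc n) < (\<Sum>i<k. \<bar>Y i \<omega>\<bar>) / real k"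
        by (simp add: ennreal_of_nat_eq_real_of_nat ennreal_less_iff del: of_nat_Suc)
      then have k0: "k > 0" by (cases k) auto
      have "(real (Suc n) * real k)\<^sup>2 < (\<Sum>i<k. \<bar>Y i \<omega>\<bar>)\<^sup>2"
        using k' k0 by (intro power_strict_mono) (auto simp: field_simps)
      also have "\<dots> \<le> (\<Sum>i<k. \<bar>Y i \<omega>\<bar>^2) * real k"
        using sum_squared_le_sum_of_squares[of "\<lambda>i. \<bar>Y i \<omega>\<bar>" "{..<k}"] by (simp add: mult.commute)
      finally have "(real (Suc n))\<^sup>2 * real k < (\<Sum>i<k. W i \<omega>)"
        using k0 by (simp add: W_def power2_eq_square mult_ac del: of_nat_Suc)
      then show "\<exists>k. (real (Suc n))\<^sup>2 * real k < (\<Sum>i<k. W i \<omega>)" by blast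
    qed
    then have "emeasure M {\<omega>\<in>space M. of_nat (Suc n) < S \<omega>} \<le> emeasure M {\<omega>\<in>space M. \<exists>k. (\<Sum>i<k. W i \<omega>) > (real (Suc n))\<^sup>2 * real k}"
      by (intro emeasure_mono) auto
    also have "\<dots> \<le> ennreal ((\<integral>\<omega>. W 0 \<omega> \<partial>M) / (real (Suc n))\<^sup>2)"
      by (rule maximal_ergodic_inequality[OF W iW]) (auto simp: W_def)
    finally show ?thesis by (simp add: eW)
  qed
  have ind: "(\<integral>\<^sup>+\<omega>. indicator {of_nat n<..} (S \<omega>) \<partial>M) = emeasure M {\<omega>\<in>space M. of_nat n < S \<omega>}" for n
  proof -
    have "(\<integral>\<^sup>+\<omega>. indicator {of_nat n<..} (S \<omega>) \<partial>M) = (\<integral>\<^sup>+\<omega>. indicator {\<omega>\<in>space M. of_nat n < S \<omega>} \<omega> \<partial>M)"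
      by (intro nn_integral_cong) (auto simp: indicator_def)
    also have "\<dots> = emeasure M {\<omega>\<in>space M. of_nat n < S \<omega>}" by (rule nn_integral_indicator) measurable
    finally show ?thesis .
  qed
  have "(\<integral>\<^sup>+\<omega>. S \<omega> \<partial>M) \<le> (\<integral>\<^sup>+\<omega>. 1 + (\<Sum>n. indicator {of_nat n<..} (S \<omega>)) \<partial>M)"
    by (intro nn_integral_mono ennreal_le_Suc_count)
  also have "\<dots> = 1 + (\<integral>\<^sup>+\<omega>. (\<Sum>n. indicator {of_nat n<..} (S \<omega>)) \<partial>M)"
    by (subst nn_integral_add) (measurable, simp add: emeasure_space_1)
  also have "(\<integral>\<^sup>+\<omega>. (\<Sum>n. indicator {of_nat n<..} (S \<omega>)) \<partial>M) = (\<Sum>n. emeasure M {\<omega>\<in>space M. of_nat n < S \<omega>})"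
    unfolding ind[symmetric] by (rule nn_integral_suminf) measurable
  \<comment> \<open>The level \<open>0\<close> is split off, where only the trivial bound
    \<open>1\<close> is available; together with the \<open>1\<close> from the layer-cake bound it
    makes up the \<open>2\<close> of the statement.\<close>
  also have "(\<Sum>n. emeasure M {\<omega>\<in>space M. of_nat n < S \<omega>}) = emeasure M {\<omega>\<in>space M. of_nat 0 < S \<omega>} + (\<Sum>n. emeasure M {\<omega>\<in>space M. of_nat (Suc n) < S \<omega>})"
  proof -
    have "(\<lambda>n. emeasure M {\<omega>\<in>space M. of_nat (Suc n) < S \<omega>}) sums (\<Sum>n. emeasure M {\<omega>\<in>space M. of_nat (Suc n) < S \<omega>})"
      by (rule summable_sums[OF summableI])
    from sums_Suc[OF this, THEN sums_unique] show ?thesis by (simp only: add.commute)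
  qed
  also have "1 + (emeasure M {\<omega>\<in>space M. of_nat 0 < S \<omega>} + (\<Sum>n. emeasure M {\<omega>\<in>space M. of_nat (Suc n) < S \<omega>}))
     \<le> 1 + (1 + (\<Sum>n. ennreal (C / (real (Suc n))\<^sup>2)))"
    by (intro add_mono suminf_le bd emeasure_le_1 summableI order_refl)
  also have "\<dots> = 2 + (\<Sum>n. ennreal (C / (real (Suc n))\<^sup>2))" by (simp add: add.assoc[symmetric])
  finally show ?thesis unfolding S_def .
qed

section \<open>Mixing and the ergodic theorem\<close>

definition bdd_lipschitz :: "(real \<Rightarrow> real) \<Rightarrow> bool" where
  "bdd_lipschitz g \<longleftrightarrow> (\<exists>b. \<forall>x. \<bar>g x\<bar> \<le> b) \<and> (\<exists>L. \<forall>x y. \<bar>g x - g y\<bar> \<le> L * \<bar>x - y\<bar>)"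

lemma bdd_lipschitzE:
  assumes "bdd_lipschitz g"
  obtains b L where "b > 0" "L > 0" "\<And>x. \<bar>g x\<bar> \<le> b" "\<And>x y. \<bar>g x - g y\<bar> \<le> L * \<bar>x - y\<bar>"
proof -
  from assms obtain b L where b: "\<And>x. \<bar>g x\<bar> \<le> b" and L: "\<And>x y. \<bar>g x - g y\<bar> \<le> L * \<bar>x - y\<bar>"
    unfolding bdd_lipschitz_def by blast
  show ?thesis
  proof
    show "max b 1 > 0" "max L 1 > 0" by auto
    show "\<bar>g x\<bar> \<le> max b 1" for x using b[of x] by auto
    show "\<bar>g x - g y\<bar> \<le> max L 1 * \<bar>x - y\<bar>" for x y
      using L[of x y] by (rule order.trans) (intro mult_right_mono, auto)
  qed
qed

lemma bdd_lipschitz_continuous: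
  assumes "bdd_lipschitz g" shows "continuous_on UNIV g"
proof -
  obtain b L where "b > 0" "L > 0" "\<And>x. \<bar>g x\<bar> \<le> b" and L: "\<And>x y. \<bar>g x - g y\<bar> \<le> L * \<bar>x - y\<bar>"
    using assms by (rule bdd_lipschitzE) blast
  then have "L-lipschitz_on UNIV g" by (auto simp: lipschitz_on_def dist_real_def)
  then show ?thesis by (rule lipschitz_on_continuous_on)
qed

lemma bdd_lipschitz_measurable: "bdd_lipschitz g \<Longrightarrow> g \<in> borel_measurable borel"
  by (intro borel_measurable_continuous_onI bdd_lipschitz_continuous)

lemma bdd_lipschitz_const: "bdd_lipschitz (\<lambda>_. c)"
  unfolding bdd_lipschitz_def by (intro conjI exI[of _ "\<bar>c\<bar>"] exI[of _ 0]) auto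

lemma bdd_lipschitz_add:
  assumes "bdd_lipschitz f" "bdd_lipschitz g"
  shows "bdd_lipschitz (\<lambda>x. f x + g x)"
proof -
  obtain b L where 1: "b > 0" "L > 0" "\<And>x. \<bar>f x\<bar> \<le> b" "\<And>x y. \<bar>f x - f y\<bar> \<le> L * \<bar>x - y\<bar>"
    using assms(1) by (rule bdd_lipschitzE) blast
  obtain b' L' where 2: "b' > 0" "L' > 0" "\<And>x. \<bar>g x\<bar> \<le> b'" "\<And>x y. \<bar>g x - g y\<bar> \<le> L' * \<bar>x - y\<bar>"
    using assms(2) by (rule bdd_lipschitzE) blast
  have "\<bar>f x + g x\<bar> \<le> b + b'" for x using 1(3)[of x] 2(3)[of x] by linarith
  moreover have "\<bar>(f x + g x) - (f y + g y)\<bar> \<le> (L + L') * \<bar>x - y\<bar>" for x y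
    using 1(4)[of x y] 2(4)[of x y] unfolding distrib_right by linarith
  ultimately show ?thesis unfolding bdd_lipschitz_def by blast
qed

lemma bdd_lipschitz_scale:
  assumes "bdd_lipschitz f" shows "bdd_lipschitz (\<lambda>x. c * f x)"
proof -
  obtain b L where 1: "b > 0" "L > 0" "\<And>x. \<bar>f x\<bar> \<le> b" "\<And>x y. \<bar>f x - f y\<bar> \<le> L * \<bar>x - y\<bar>"
    using assms by (rule bdd_lipschitzE) blast
  have "\<bar>c * f x\<bar> \<le> \<bar>c\<bar> * b" for x using 1(3)[of x] by (simp add: abs_mult mult_left_mono)
  moreover have "\<bar>c * f x - c * f y\<bar> \<le> (\<bar>c\<bar> * L) * \<bar>x - y\<bar>" for x y
    using mult_left_mono[OF 1(4)[of x y], of "\<bar>c\<bar>"] by (simp add: right_diff_distrib[symmetric] abs_mult mult.assoc)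
  ultimately show ?thesis unfolding bdd_lipschitz_def by blast
qed

definition ramp :: "real \<Rightarrow> nat \<Rightarrow> real \<Rightarrow> real" where
  "ramp a n x = max 0 (min 1 (real n * (a - x)))"

lemma ramp_range: "0 \<le> ramp a n x" "ramp a n x \<le> 1"
  by (auto simp: ramp_def)

lemma bdd_lipschitz_ramp: "bdd_lipschitz (ramp a n)"
proof -
  have "\<bar>ramp a n x - ramp a n y\<bar> \<le> real n * \<bar>x - y\<bar>" for x y
  proof -
    have "\<bar>ramp a n x - ramp a n y\<bar> \<le> \<bar>real n * (a - x) - real n * (a - y)\<bar>" unfolding ramp_def by linarith
    also have "\<dots> = real n * \<bar>x - y\<bar>" by (simp add: right_diff_distrib[symmetric] abs_mult abs_minus_commute)
    finally show ?thesis .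
  qed
  moreover have "\<bar>ramp a n x\<bar> \<le> 1" for x using ramp_range[of a n x] by simp
  ultimately show ?thesis unfolding bdd_lipschitz_def by blast
qed

lemma ramp_tendsto: "(\<lambda>n. ramp a n x) \<longlonglongrightarrow> indicator {..<a} x"
proof (cases "x < a")
  case True
  obtain N where N: "1 / (a - x) < real N" using reals_Archimedean2 by blast
  have "\<forall>\<^sub>F n in sequentially. ramp a n x = 1"
    using eventually_ge_at_top[of N]
  proof eventually_elim
    case (elim n)
    then have "1 / (a - x) \<le> real n" using N by linarith
    then have "1 \<le> real n * (a - x)" using True by (simp add: field_simps)
    then show ?case by (simp add: ramp_def)
  qed
  with True show ?thesis by (simp add: tendsto_eventually)
next
  case False
  then have "real n * (a - x) \<le> 0" for n by (simp add: mult_nonneg_nonpos)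
  then have "ramp a n x = 0" for n by (simp add: ramp_def max_absorb1 min_le_iff_disj)
  with False show ?thesis by simp
qed

text \<open>The class \<open>P\<close> of functions that can be approximated in mean is linear and
  closed under dominated limits. It contains the half lines through the ramps, hence all Borel sets
  because half lines form an intersection-stable generator, hence all integrable functions. It is
  used with \<open>N\<close> the law of one term of the sequence.\<close>

lemma bdd_lipschitz_dense:
  fixes \<phi> :: "real \<Rightarrow> real"
  assumes N: "finite_measure N" and sets [measurable_cong]: "sets N = sets borel" and \<phi>: "integrable N \<phi>" and e: "e > 0"
  obtains g where "bdd_lipschitz g" "(\<integral>\<^sup>+x. ennreal \<bar>\<phi> x - g x\<bar> \<partial>N) \<le> ennreal e"
proof -
  interpret finite_measure N by fact
  define P where "P \<psi> \<longleftrightarrow> \<psi> \<in> borel_measurable N \<and>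
     (\<forall>e>0. \<exists>g. bdd_lipschitz g \<and> (\<integral>\<^sup>+x. ennreal \<bar>\<psi> x - g x\<bar> \<partial>N) \<le> ennreal e)" for \<psi> :: "real \<Rightarrow> real"
  have mN: "f \<in> borel_measurable N \<longleftrightarrow> f \<in> borel_measurable borel" for f :: "real \<Rightarrow> real"
    using sets by (intro measurable_cong_sets arg_cong2[of _ _ _ _ "(\<in>)"] refl) auto
  have self: "P g" if "bdd_lipschitz g" for g
    unfolding P_def using that by (auto intro!: exI[of _ g] bdd_lipschitz_measurable simp: mN)
  have close: "P \<psi>" if [measurable]: "\<psi> \<in> borel_measurable N" and
    app: "\<And>e. e > 0 \<Longrightarrow> \<exists>h. P h \<and> (\<integral>\<^sup>+x. ennreal \<bar>\<psi> x - h x\<bar> \<partial>N) \<le> ennreal e" for \<psi>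
    unfolding P_def
  proof (intro conjI allI impI)
    fix e :: real assume "e > 0"
    then have e: "e/2 > 0" by simp
    from app[OF e] obtain h where h: "P h" "(\<integral>\<^sup>+x. ennreal \<bar>\<psi> x - h x\<bar> \<partial>N) \<le> ennreal (e/2)" by blast
    then obtain g where g: "bdd_lipschitz g" "(\<integral>\<^sup>+x. ennreal \<bar>h x - g x\<bar> \<partial>N) \<le> ennreal (e/2)"
      using e unfolding P_def by blast
    have [measurable]: "h \<in> borel_measurable N" "g \<in> borel_measurable N"
      using h(1) bdd_lipschitz_measurable[OF g(1)] by (auto simp: P_def mN)
    have "(\<integral>\<^sup>+x. ennreal \<bar>\<psi> x - g x\<bar> \<partial>N) \<le> (\<integral>\<^sup>+x. ennreal \<bar>\<psi> x - h x\<bar> + ennreal \<bar>h x - g x\<bar> \<partial>N)"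
      by (intro nn_integral_mono) (auto simp: ennreal_plus[symmetric] simp del: ennreal_plus intro!: ennreal_leI)
    also have "\<dots> = (\<integral>\<^sup>+x. ennreal \<bar>\<psi> x - h x\<bar> \<partial>N) + (\<integral>\<^sup>+x. ennreal \<bar>h x - g x\<bar> \<partial>N)"
      by (rule nn_integral_add) auto
    also have "\<dots> \<le> ennreal (e/2) + ennreal (e/2)" by (intro add_mono h g)
    also have "\<dots> = ennreal e" using e by (subst ennreal_plus[symmetric]) auto
    finally show "\<exists>g. bdd_lipschitz g \<and> (\<integral>\<^sup>+x. ennreal \<bar>\<psi> x - g x\<bar> \<partial>N) \<le> ennreal e" using g by blast
  qed fact
  have limP: "P \<psi>" if s: "\<And>n. P (s n)" and conv: "\<And>x. (\<lambda>n. s n x) \<longlonglongrightarrow> \<psi> x"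
    and w: "integrable N w" and dom: "\<And>n x. \<bar>s n x\<bar> \<le> w x" for \<psi> s w
  proof (rule close)
    have sm[measurable]: "\<And>n. s n \<in> borel_measurable N" using s by (simp add: P_def)
    show [measurable]: "\<psi> \<in> borel_measurable N" by (rule borel_measurable_LIMSEQ_real[OF conv sm])
    have [measurable]: "w \<in> borel_measurable N" using w by simp
    have w0: "w x \<ge> 0" for x using dom[of 0 x] by linarith
    have "(\<lambda>n. \<integral>\<^sup>+x. norm (\<psi> x - s n x) \<partial>N) \<longlonglongrightarrow> 0"
      by (rule nn_integral_dominated_convergence_norm[where w=w])
        (use conv dom w w0 in \<open>auto simp: integrable_iff_bounded\<close>)
    then have small: "\<forall>\<^sub>F n in sequentially. (\<integral>\<^sup>+x. norm (\<psi> x - s n x) \<partial>N) < ennreal e" if "e > 0" for e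
      using that by (intro order_tendstoD) auto
    show "\<exists>h. P h \<and> (\<integral>\<^sup>+x. ennreal \<bar>\<psi> x - h x\<bar> \<partial>N) \<le> ennreal e" if e: "e > 0" for e
    proof -
      obtain n where "(\<integral>\<^sup>+x. norm (\<psi> x - s n x) \<partial>N) < ennreal e"
        using eventually_happens'[OF sequentially_bot small[OF e]] by blast
      with s[of n] show ?thesis by (intro exI[of _ "s n"]) auto
    qed
  qed
  have addP: "P (\<lambda>x. f x + g x)" if f: "P f" and g: "P g" for f g
    unfolding P_def
  proof (intro conjI allI impI)
    have [measurable]: "f \<in> borel_measurable N" "g \<in> borel_measurable N" using f g by (simp_all add: P_def)
    show "(\<lambda>x. f x + g x) \<in> borel_measurable N" by simp
    fix e :: real assume "e > 0"
    then have e: "e/2 > 0" by simp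
    from f e obtain f' where f': "bdd_lipschitz f'" "(\<integral>\<^sup>+x. ennreal \<bar>f x - f' x\<bar> \<partial>N) \<le> ennreal (e/2)" unfolding P_def by blast
    from g e obtain g' where g': "bdd_lipschitz g'" "(\<integral>\<^sup>+x. ennreal \<bar>g x - g' x\<bar> \<partial>N) \<le> ennreal (e/2)" unfolding P_def by blast
    have [measurable]: "f' \<in> borel_measurable N" "g' \<in> borel_measurable N"
      using f' g' bdd_lipschitz_measurable by (auto simp: mN)
    have "(\<integral>\<^sup>+x. ennreal \<bar>(f x + g x) - (f' x + g' x)\<bar> \<partial>N) \<le> (\<integral>\<^sup>+x. ennreal \<bar>f x - f' x\<bar> + ennreal \<bar>g x - g' x\<bar> \<partial>N)"
      by (intro nn_integral_mono) (auto simp: ennreal_plus[symmetric] simp del: ennreal_plus intro!: ennreal_leI)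
    also have "\<dots> = (\<integral>\<^sup>+x. ennreal \<bar>f x - f' x\<bar> \<partial>N) + (\<integral>\<^sup>+x. ennreal \<bar>g x - g' x\<bar> \<partial>N)"
      by (rule nn_integral_add) auto
    also have "\<dots> \<le> ennreal (e/2) + ennreal (e/2)" by (intro add_mono f' g')
    also have "\<dots> = ennreal e" using e by (subst ennreal_plus[symmetric]) auto
    finally show "\<exists>h. bdd_lipschitz h \<and> (\<integral>\<^sup>+x. ennreal \<bar>f x + g x - h x\<bar> \<partial>N) \<le> ennreal e"
      using bdd_lipschitz_add[OF f'(1) g'(1)] by blast
  qed
  have scale: "P (\<lambda>x. c * f x)" if f: "P f" for f c
    unfolding P_def
  proof (intro conjI allI impI)
    have [measurable]: "f \<in> borel_measurable N" using f by (simp add: P_def)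
    show "(\<lambda>x. c * f x) \<in> borel_measurable N" by simp
    fix e :: real assume e: "e > 0"
    then have "e / (\<bar>c\<bar> + 1) > 0" by simp
    with f obtain f' where f': "bdd_lipschitz f'" "(\<integral>\<^sup>+x. ennreal \<bar>f x - f' x\<bar> \<partial>N) \<le> ennreal (e / (\<bar>c\<bar> + 1))" unfolding P_def by blast
    have [measurable]: "f' \<in> borel_measurable N"
      using f' bdd_lipschitz_measurable by (auto simp: mN)
    have "(\<integral>\<^sup>+x. ennreal \<bar>c * f x - c * f' x\<bar> \<partial>N) = ennreal \<bar>c\<bar> * (\<integral>\<^sup>+x. ennreal \<bar>f x - f' x\<bar> \<partial>N)"
      by (subst nn_integral_cmult[symmetric]) (auto simp: right_diff_distrib[symmetric] abs_mult ennreal_mult)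
    also have "\<dots> \<le> ennreal \<bar>c\<bar> * ennreal (e / (\<bar>c\<bar> + 1))" by (intro mult_left_mono f') auto
    also have "\<dots> = ennreal (\<bar>c\<bar> * (e / (\<bar>c\<bar> + 1)))" using e by (intro ennreal_mult[symmetric]) auto
    also have "\<dots> \<le> ennreal e" using e by (intro ennreal_leI) (simp add: field_simps)
    finally show "\<exists>h. bdd_lipschitz h \<and> (\<integral>\<^sup>+x. ennreal \<bar>c * f x - h x\<bar> \<partial>N) \<le> ennreal e"
      using bdd_lipschitz_scale[OF f'(1)] by blast
  qed
  have ind: "P (indicator A)" if "A \<in> sets borel" for A
  proof -
    have A: "A \<in> sigma_sets UNIV (range lessThan)" using that by (simp add: borel_Iio)
    have "Int_stable (range lessThan :: real set set)"
    proof -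
      have "{..<a} \<inter> {..<b} = {..<min a b}" for a b :: real by auto
      then show ?thesis by (auto simp: Int_stable_def)
    qed
    moreover have "range lessThan \<subseteq> Pow (UNIV :: real set)" by simp
    ultimately show ?thesis using A
    proof (induction rule: sigma_sets_induct_disjoint)
      case (basic A)
      then obtain a where "A = {..<a}" by auto
      then show ?case
        by (simp only:) (rule limP[of "ramp a" _ "\<lambda>_. 1"], auto intro: ramp_tendsto self bdd_lipschitz_ramp simp: ramp_range)
    next
      case empty
      show ?case using self[OF bdd_lipschitz_const[of 0]] by (simp add: indicator_def)
    next
      case (compl A)
      have "P (\<lambda>x. 1 + (-1) * indicator A x)" by (intro addP scale self bdd_lipschitz_const compl)
      also have "(\<lambda>x. 1 + (-1) * indicator A x) = (indicator (UNIV - A) :: real \<Rightarrow> real)" by (auto simp: indicator_def)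
      finally show ?case .
    next
      case (union A)
      have "P (indicator (\<Union>i<n. A i))" for n
      proof (induction n)
        case (Suc n)
        have "(indicator (\<Union>i<Suc n. A i) :: real \<Rightarrow> real) = (\<lambda>x. indicator (\<Union>i<n. A i) x + indicator (A n) x)"
        proof
          fix x
          have "(\<Union>i<Suc n. A i) = (\<Union>i<n. A i) \<union> A n" by (auto simp: less_Suc_eq)
          moreover have "A i \<inter> A n = {}" if "i < n" for i using disjoint_family_onD[OF union(1), of i n] that by simp
          then have "(\<Union>i<n. A i) \<inter> A n = {}" by blast
          ultimately show "indicator (\<Union>i<Suc n. A i) x = indicator (\<Union>i<n. A i) x + (indicator (A n) x :: real)"
            by (auto simp: indicator_def)
        qed
        with addP[OF Suc union(3)[of n]] show ?case by simp
      qed (use self[OF bdd_lipschitz_const[of 0]] in \<open>simp add: indicator_def\<close>)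
      moreover have "(\<lambda>n. indicator (\<Union>i<n. A i) x) \<longlonglongrightarrow> (indicator (\<Union>i. A i) x :: real)" for x
        by (rule LIMSEQ_indicator_UN)
      ultimately show ?case
        by (rule limP[where w="\<lambda>_. 1"]) (auto simp: indicator_def)
    qed
  qed
  have "P \<phi>" using \<phi>
  proof (induction rule: integrable_induct)
    case (base A c)
    have "P (\<lambda>x. c * indicator A x)" by (intro scale ind) (use base sets in auto)
    then show ?case by (simp add: mult.commute)
  next
    case (add f g) then show ?case by (blast intro: addP)
  next
    case (lim f s)
    have U: "space N = UNIV" using sets_eq_imp_space_eq[OF sets] by simp
    show ?case
    proof (rule limP)
      show "integrable N (\<lambda>x. 2 * norm (f x))" using lim by auto
      show "P (s n)" for n using lim by simp
      show "(\<lambda>n. s n x) \<longlonglongrightarrow> f x" "\<bar>s n x\<bar> \<le> 2 * norm (f x)" for x n using lim U by auto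
    qed
  qed
  with e that show ?thesis unfolding P_def by blast
qed

text \<open>Decorrelation of one test function at two distant times, uniformly in the earlier time.
  The Lipschitz bound allows it to be checked on mean-square approximants, and boundedness controls
  the products that arise.\<close>

definition mixing :: "'a measure \<Rightarrow> (nat \<Rightarrow> 'a \<Rightarrow> real) \<Rightarrow> bool" where
  "mixing M X \<longleftrightarrow> (\<forall>g e. bdd_lipschitz g \<longrightarrow> e > 0 \<longrightarrow> (\<exists>m. \<forall>i j. i + m \<le> j \<longrightarrow>
     \<bar>(\<integral>\<omega>. g (X i \<omega>) * g (X j \<omega>) \<partial>M) - (\<integral>\<omega>. g (X 0 \<omega>) \<partial>M)\<^sup>2\<bar> \<le> e))"

text \<open>The square of the average is expanded into covariances. With times spaced beyond the
  decorrelation distance, the off-diagonal ones are at most \<open>e / 2\<close>, and the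
  \<open>K\<close> diagonal ones together contribute at most \<open>b\<^sup>2 / K\<close>.\<close>

lemma (in prob_space) mixing_mean_square:
  assumes X: "stationary M X" and mix: "mixing M X" and g: "bdd_lipschitz g" and e: "e > 0"
  obtains K m where "K \<ge> 1"
    "(\<integral>\<omega>. ((\<Sum>j<K. g (X (j*m) \<omega>) - (\<integral>\<omega>. g (X 0 \<omega>) \<partial>M)) / real K)\<^sup>2 \<partial>M) \<le> e"
proof -
  have [measurable]: "\<And>n. X n \<in> borel_measurable M" using X by (rule stationary_measurable)
  obtain b L where b: "b > 0" "\<And>x. \<bar>g x\<bar> \<le> b" using g by (rule bdd_lipschitzE) blast
  have gm[measurable]: "g \<in> borel_measurable borel" using g by (rule bdd_lipschitz_measurable)
  have "e / 2 > 0" using e by simp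
  then obtain m0 where m0: "\<And>i j. i + m0 \<le> j \<Longrightarrow>
     \<bar>(\<integral>\<omega>. g (X i \<omega>) * g (X j \<omega>) \<partial>M) - (\<integral>\<omega>. g (X 0 \<omega>) \<partial>M)\<^sup>2\<bar> \<le> e / 2"
    using mix g unfolding mixing_def by blast
  define m where "m = max m0 1"
  define \<mu> where "\<mu> = (\<integral>\<omega>. g (X 0 \<omega>) \<partial>M)"
  define G where "G j \<omega> = g (X (j*m) \<omega>) - \<mu>" for j \<omega>
  have [measurable]: "\<And>j. G j \<in> borel_measurable M" unfolding G_def by simp
  have intg: "integrable M (\<lambda>\<omega>. g (X n \<omega>))" for n
    by (rule integrable_const_bound[where B=b]) (use b in auto)
  have intgg: "integrable M (\<lambda>\<omega>. g (X n \<omega>) * g (X k \<omega>))" for n k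
    by (rule integrable_const_bound[where B="b*b"]) (use b in \<open>auto simp: abs_mult intro!: mult_mono\<close>)
  have \<mu>: "(\<integral>\<omega>. g (X n \<omega>) \<partial>M) = \<mu>" for n
    unfolding \<mu>_def by (rule stationary_integral[OF X gm])
  have \<mu>b: "\<bar>\<mu>\<bar> \<le> b"
  proof -
    have "\<bar>\<mu>\<bar> \<le> (\<integral>\<omega>. \<bar>g (X 0 \<omega>)\<bar> \<partial>M)" unfolding \<mu>_def by (rule integral_abs_bound)
    also have "\<dots> \<le> (\<integral>\<omega>. b \<partial>M)" by (intro integral_mono integrable_abs intg b) auto
    finally show ?thesis by (simp add: prob_space)
  qed
  have GG: "integrable M (\<lambda>\<omega>. G i \<omega> * G j \<omega>)" for i j
  proof -
    have "G i \<omega> * G j \<omega> = g (X (i*m) \<omega>) * g (X (j*m) \<omega>) - \<mu> * g (X (i*m) \<omega>) - \<mu> * g (X (j*m) \<omega>) + \<mu> * \<mu>" for \<omega>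
      by (simp add: G_def algebra_simps)
    then show ?thesis by (simp add: intg intgg)
  qed
  have cov: "(\<integral>\<omega>. G i \<omega> * G j \<omega> \<partial>M) = (\<integral>\<omega>. g (X (i*m) \<omega>) * g (X (j*m) \<omega>) \<partial>M) - \<mu>\<^sup>2" for i j
  proof -
    have "(\<integral>\<omega>. G i \<omega> * G j \<omega> \<partial>M)
      = (\<integral>\<omega>. g (X (i*m) \<omega>) * g (X (j*m) \<omega>) - \<mu> * g (X (i*m) \<omega>) - \<mu> * g (X (j*m) \<omega>) + \<mu> * \<mu> \<partial>M)"
      by (intro Bochner_Integration.integral_cong refl) (simp add: G_def algebra_simps)
    also have "\<dots> = (\<integral>\<omega>. g (X (i*m) \<omega>) * g (X (j*m) \<omega>) \<partial>M) - \<mu> * \<mu> - \<mu> * \<mu> + \<mu> * \<mu>"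
      by (simp add: intg intgg \<mu> prob_space)
    finally show ?thesis by (simp add: power2_eq_square)
  qed
  have off: "(\<integral>\<omega>. G i \<omega> * G j \<omega> \<partial>M) \<le> e / 2" if "i \<noteq> j" for i j
  proof -
    have *: "(\<integral>\<omega>. G i \<omega> * G j \<omega> \<partial>M) \<le> e / 2" if "i < j" for i j
    proof -
      from that obtain k where "j = i + Suc k" using less_imp_Suc_add by auto
      then have "i*m + m0 \<le> j*m" by (simp add: m_def algebra_simps)
      then show ?thesis using m0[of "i*m" "j*m"] unfolding cov \<mu>_def by linarith
    qed
    show ?thesis
    proof (cases "i < j")
      case False
      with that have "j < i" by simp
      from *[OF this] show ?thesis by (simp add: mult.commute)
    qed (rule *)
  qed
  have diag: "(\<integral>\<omega>. G i \<omega> * G i \<omega> \<partial>M) \<le> b\<^sup>2" for i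
  proof -
    have "(\<integral>\<omega>. g (X (i*m) \<omega>) * g (X (i*m) \<omega>) \<partial>M) \<le> (\<integral>\<omega>. b\<^sup>2 \<partial>M)"
    proof (intro integral_mono intgg)
      fix \<omega>
      have "\<bar>g (X (i*m) \<omega>)\<bar>^2 \<le> b\<^sup>2" using b by (intro power_mono) auto
      then show "g (X (i*m) \<omega>) * g (X (i*m) \<omega>) \<le> b\<^sup>2" by (simp add: power2_eq_square)
    qed simp
    then show ?thesis unfolding cov by (simp add: prob_space) (smt (verit) zero_le_power2)
  qed
  \<comment> \<open>This choice makes the diagonal contribution \<open>b\<^sup>2 / K\<close> at most
    \<open>e / 2\<close>.\<close>
  obtain K :: nat where K: "2 * b\<^sup>2 / e < real K" using reals_Archimedean2 by blast
  have "0 \<le> 2 * b\<^sup>2 / e" using e by simp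
  with K have K1: "K \<ge> 1" by linarith
  have "(\<integral>\<omega>. ((\<Sum>j<K. G j \<omega>) / real K)\<^sup>2 \<partial>M) = (\<integral>\<omega>. (\<Sum>i<K. \<Sum>j<K. G i \<omega> * G j \<omega>) / (real K)\<^sup>2 \<partial>M)"
    by (intro Bochner_Integration.integral_cong refl) (simp add: power_divide power2_eq_square sum_product)
  also have "\<dots> = (\<Sum>i<K. \<Sum>j<K. (\<integral>\<omega>. G i \<omega> * G j \<omega> \<partial>M)) / (real K)\<^sup>2"
    by (simp add: GG Bochner_Integration.integral_sum)
  also have "\<dots> \<le> (\<Sum>i<K. b\<^sup>2 + real K * (e/2)) / (real K)\<^sup>2"
  proof (intro divide_right_mono sum_mono)
    fix i assume i: "i \<in> {..<K}"
    have "(\<Sum>j<K. (\<integral>\<omega>. G i \<omega> * G j \<omega> \<partial>M)) \<le> (\<Sum>j<K. (if j = i then b\<^sup>2 else 0) + e/2)"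
    proof (rule sum_mono)
      fix j
      show "(\<integral>\<omega>. G i \<omega> * G j \<omega> \<partial>M) \<le> (if j = i then b\<^sup>2 else 0) + e/2"
        using off[of i j] diag[of i] e by (cases "j = i") auto
    qed
    also have "\<dots> = b\<^sup>2 + real K * (e/2)" using i by (simp add: sum.distrib)
    finally show "(\<Sum>j<K. (\<integral>\<omega>. G i \<omega> * G j \<omega> \<partial>M)) \<le> b\<^sup>2 + real K * (e/2)" .
  qed simp
  also have "\<dots> = b\<^sup>2 / real K + e/2" using K1 by (simp add: power2_eq_square field_simps)
  also have "b\<^sup>2 / real K \<le> e / 2" using K K1 e by (simp add: field_simps)
  finally have "(\<integral>\<omega>. ((\<Sum>j<K. G j \<omega>) / real K)\<^sup>2 \<partial>M) \<le> e" by simp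
  with K1 that[of K m] show ?thesis unfolding G_def \<mu>_def by simp
qed

text \<open>Mixing speaks of bounded Lipschitz functions, so \<open>\<phi>\<close> is replaced by
  such a \<open>g\<close> close to it in mean under the law of \<open>X 0\<close>; by stationarity
  the error is the same at every time. The three thirds of \<open>e\<close> pay for this
  replacement, for the centred average of \<open>g\<close>, and for the difference of the two
  means.\<close>

theorem (in prob_space) ergodic_average:
  assumes X: "stationary M X" and mix: "mixing M X" and [measurable]: "\<phi> \<in> borel_measurable borel"
    and sq: "(\<integral>\<^sup>+\<omega>. ennreal ((\<phi> (X 0 \<omega>))\<^sup>2) \<partial>M) < \<infinity>"
  shows "AE \<omega> in M. (\<lambda>n. (\<Sum>i<n. \<phi> (X i \<omega>)) / real n) \<longlonglongrightarrow> (\<integral>\<omega>. \<phi> (X 0 \<omega>) \<partial>M)"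
proof -
  have [measurable]: "\<And>n. X n \<in> borel_measurable M" using X by (rule stationary_measurable)
  have int0: "integrable M (\<lambda>\<omega>. \<phi> (X 0 \<omega>))"
  proof (rule square_integrable_imp_integrable)
    show "integrable M (\<lambda>\<omega>. (\<phi> (X 0 \<omega>))\<^sup>2)" using sq by (intro integrableI_bounded) auto
  qed simp
  have int: "integrable M (\<lambda>\<omega>. \<phi> (X n \<omega>))" for n
    using stationary_integrable[OF X _ int0] by simp
  define \<mu> where "\<mu> = (\<integral>\<omega>. \<phi> (X 0 \<omega>) \<partial>M)"
  define V where "V n \<omega> = \<phi> (X n \<omega>) - \<mu>" for n \<omega>
  have V: "stationary M V" unfolding V_def by (rule stationary_compose[OF X]) simp
  have [measurable]: "\<And>n. V n \<in> borel_measurable M" using V by (rule stationary_measurable)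
  have "AE \<omega> in M. (\<lambda>n. (\<Sum>i<n. V i \<omega>) / real n) \<longlonglongrightarrow> 0"
  proof (rule pointwise_ergodic[OF V])
    have "(\<integral>\<^sup>+\<omega>. ennreal ((V 0 \<omega>)\<^sup>2) \<partial>M) \<le> (\<integral>\<^sup>+\<omega>. 2 * ennreal ((\<phi> (X 0 \<omega>))\<^sup>2) + ennreal (2 * \<mu>\<^sup>2) \<partial>M)"
    proof (rule nn_integral_mono)
      fix \<omega>
      have "(V 0 \<omega>)\<^sup>2 \<le> 2 * (\<phi> (X 0 \<omega>))\<^sup>2 + 2 * \<mu>\<^sup>2"
        using sum_squares_bound[of "\<phi> (X 0 \<omega>)" "-\<mu>"] unfolding V_def power2_diff by simp
      then have "ennreal ((V 0 \<omega>)\<^sup>2) \<le> ennreal (2 * (\<phi> (X 0 \<omega>))\<^sup>2 + 2 * \<mu>\<^sup>2)" by (rule ennreal_leI)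
      then show "ennreal ((V 0 \<omega>)\<^sup>2) \<le> 2 * ennreal ((\<phi> (X 0 \<omega>))\<^sup>2) + ennreal (2 * \<mu>\<^sup>2)"
        by (simp add: ennreal_plus ennreal_mult)
    qed
    also have "\<dots> = 2 * (\<integral>\<^sup>+\<omega>. ennreal ((\<phi> (X 0 \<omega>))\<^sup>2) \<partial>M) + ennreal (2 * \<mu>\<^sup>2)"
      by (simp add: nn_integral_add nn_integral_cmult emeasure_space_1)
    also have "\<dots> < \<infinity>" using sq by (simp add: ennreal_mult_eq_top_iff less_top[symmetric])
    finally show "(\<integral>\<^sup>+\<omega>. ennreal ((V 0 \<omega>)\<^sup>2) \<partial>M) < \<infinity>" .
    show "integrable M (V 0)" unfolding V_def using int0 by simp
    fix e :: real assume e: "e > 0"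
    define N where "N = distr M borel (X 0)"
    have fN: "finite_measure N" unfolding N_def by (intro prob_space.finite_measure prob_space_distr) simp
    have "integrable N \<phi>" unfolding N_def by (subst integrable_distr_eq) (auto intro: int0)
    then obtain g where g: "bdd_lipschitz g" and ge: "(\<integral>\<^sup>+x. ennreal \<bar>\<phi> x - g x\<bar> \<partial>N) \<le> ennreal (e/3)"
      using bdd_lipschitz_dense[OF fN, of \<phi> "e/3"] e by (auto simp: N_def)
    have gm[measurable]: "g \<in> borel_measurable borel" using g by (rule bdd_lipschitz_measurable)
    obtain b L where b: "b > 0" "\<And>x. \<bar>g x\<bar> \<le> b" using g by (rule bdd_lipschitzE) blast
    have intg: "integrable M (\<lambda>\<omega>. g (X n \<omega>))" for n
      by (rule integrable_const_bound[where B=b]) (use b in auto)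
    define \<nu> where "\<nu> = (\<integral>\<omega>. g (X 0 \<omega>) \<partial>M)"
    have d0: "(\<integral>\<omega>. \<bar>\<phi> (X 0 \<omega>) - g (X 0 \<omega>)\<bar> \<partial>M) \<le> e/3"
    proof -
      have "ennreal (\<integral>\<omega>. \<bar>\<phi> (X 0 \<omega>) - g (X 0 \<omega>)\<bar> \<partial>M) = (\<integral>\<^sup>+\<omega>. ennreal \<bar>\<phi> (X 0 \<omega>) - g (X 0 \<omega>)\<bar> \<partial>M)"
        by (intro nn_integral_eq_integral[symmetric] integrable_abs Bochner_Integration.integrable_diff int intg) auto
      also have "\<dots> = (\<integral>\<^sup>+x. ennreal \<bar>\<phi> x - g x\<bar> \<partial>N)" unfolding N_def by (subst nn_integral_distr) auto
      also have "\<dots> \<le> ennreal (e/3)" by fact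
      finally show ?thesis using e by (simp add: ennreal_le_iff)
    qed
    have d: "(\<integral>\<omega>. \<bar>\<phi> (X n \<omega>) - g (X n \<omega>)\<bar> \<partial>M) \<le> e/3" for n
      using d0 stationary_integral[OF X, of "\<lambda>x. \<bar>\<phi> x - g x\<bar>" n] by simp
    have \<mu>\<nu>: "\<bar>\<nu> - \<mu>\<bar> \<le> e/3"
    proof -
      have "\<mu> - \<nu> = (\<integral>\<omega>. \<phi> (X 0 \<omega>) - g (X 0 \<omega>) \<partial>M)" unfolding \<mu>_def \<nu>_def by (simp add: int intg)
      also have "\<bar>\<dots>\<bar> \<le> (\<integral>\<omega>. \<bar>\<phi> (X 0 \<omega>) - g (X 0 \<omega>)\<bar> \<partial>M)" by (rule integral_abs_bound)
      finally show ?thesis using d0 by linarith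
    qed
    have "(e/3)\<^sup>2 > 0" using e by simp
    then obtain K m where K: "K \<ge> 1" and Km: "(\<integral>\<omega>. ((\<Sum>j<K. g (X (j*m) \<omega>) - \<nu>) / real K)\<^sup>2 \<partial>M) \<le> (e/3)\<^sup>2"
      using mixing_mean_square[OF X mix g, of "(e/3)\<^sup>2"] unfolding \<nu>_def by blast
    define Y where "Y \<omega> = (\<Sum>j<K. g (X (j*m) \<omega>) - \<nu>) / real K" for \<omega>
    have [measurable]: "Y \<in> borel_measurable M" unfolding Y_def by simp
    have iY: "integrable M Y" unfolding Y_def by (simp add: intg)
    have Yb: "\<bar>Y \<omega>\<bar> \<le> b + \<bar>\<nu>\<bar>" for \<omega>
    proof -
      have "\<bar>\<Sum>j<K. g (X (j*m) \<omega>) - \<nu>\<bar> \<le> (\<Sum>j<K. b + \<bar>\<nu>\<bar>)"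
      proof (rule order.trans[OF sum_abs sum_mono])
        show "\<bar>g (X (j*m) \<omega>) - \<nu>\<bar> \<le> b + \<bar>\<nu>\<bar>" for j using b(2)[of "X (j*m) \<omega>"] by linarith
      qed
      then show ?thesis using K unfolding Y_def by (simp add: field_simps)
    qed
    have iY2: "integrable M (\<lambda>\<omega>. (Y \<omega>)\<^sup>2)"
      by (rule integrable_const_bound[where B="(b + \<bar>\<nu>\<bar>)\<^sup>2"]) (use Yb b in \<open>auto simp: abs_le_square_iff[symmetric]\<close>)
    \<comment> \<open>From mean square to mean by
      \<open>2 * d * \<bar>y\<bar> \<le> d\<^sup>2 + y\<^sup>2\<close> with
      \<open>d = e / 3\<close>.\<close>
    have "(\<integral>\<omega>. \<bar>Y \<omega>\<bar> \<partial>M) \<le> (\<integral>\<omega>. (e/3 + (Y \<omega>)\<^sup>2 / (e/3)) / 2 \<partial>M)"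
    proof (intro integral_mono integrable_abs iY)
      fix \<omega>
      have "2 * (e/3) * \<bar>Y \<omega>\<bar> \<le> (e/3)\<^sup>2 + (Y \<omega>)\<^sup>2" using sum_squares_bound[of "e/3" "\<bar>Y \<omega>\<bar>"] by simp
      then have "2 * (e/3) * \<bar>Y \<omega>\<bar> / (e/3) \<le> ((e/3)\<^sup>2 + (Y \<omega>)\<^sup>2) / (e/3)"
        using e by (intro divide_right_mono) auto
      then show "\<bar>Y \<omega>\<bar> \<le> (e/3 + (Y \<omega>)\<^sup>2 / (e/3)) / 2"
        using e by (simp add: add_divide_distrib power2_eq_square[of "e/3"])
    qed (use iY2 in auto)
    also have "\<dots> = (e/3 + (\<integral>\<omega>. (Y \<omega>)\<^sup>2 \<partial>M) / (e/3)) / 2" using iY2 by (simp add: prob_space)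
    also have "(\<integral>\<omega>. (Y \<omega>)\<^sup>2 \<partial>M) / (e/3) \<le> (e/3)\<^sup>2 / (e/3)"
      using Km e unfolding Y_def by (intro divide_right_mono) auto
    finally have EY: "(\<integral>\<omega>. \<bar>Y \<omega>\<bar> \<partial>M) \<le> e/3" using e by (simp add: power2_eq_square)
    have "(\<integral>\<omega>. \<bar>(\<Sum>j<K. V (j*m) \<omega>) / real K\<bar> \<partial>M)
      \<le> (\<integral>\<omega>. (\<Sum>j<K. \<bar>\<phi> (X (j*m) \<omega>) - g (X (j*m) \<omega>)\<bar>) / real K + \<bar>Y \<omega>\<bar> + \<bar>\<nu> - \<mu>\<bar> \<partial>M)"
    proof (intro integral_mono)
      fix \<omega>
      have "(\<Sum>j<K. V (j*m) \<omega>) = (\<Sum>j<K. (\<phi> (X (j*m) \<omega>) - g (X (j*m) \<omega>)) + (g (X (j*m) \<omega>) - \<nu>) + (\<nu> - \<mu>))"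
        unfolding V_def by (intro sum.cong) auto
      also have "\<dots> = (\<Sum>j<K. \<phi> (X (j*m) \<omega>) - g (X (j*m) \<omega>)) + (\<Sum>j<K. g (X (j*m) \<omega>) - \<nu>) + real K * (\<nu> - \<mu>)"
        by (simp only: sum.distrib) simp
      finally have "(\<Sum>j<K. V (j*m) \<omega>) / real K = (\<Sum>j<K. \<phi> (X (j*m) \<omega>) - g (X (j*m) \<omega>)) / real K + Y \<omega> + (\<nu> - \<mu>)"
        using K unfolding Y_def by (simp add: add_divide_distrib)
      moreover have "\<bar>(\<Sum>j<K. \<phi> (X (j*m) \<omega>) - g (X (j*m) \<omega>)) / real K\<bar> \<le> (\<Sum>j<K. \<bar>\<phi> (X (j*m) \<omega>) - g (X (j*m) \<omega>)\<bar>) / real K"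
        unfolding abs_divide by (simp add: divide_right_mono)
      ultimately show "\<bar>(\<Sum>j<K. V (j*m) \<omega>) / real K\<bar> \<le> (\<Sum>j<K. \<bar>\<phi> (X (j*m) \<omega>) - g (X (j*m) \<omega>)\<bar>) / real K + \<bar>Y \<omega>\<bar> + \<bar>\<nu> - \<mu>\<bar>"
        by linarith
      show "integrable M (\<lambda>\<omega>. \<bar>(\<Sum>j<K. V (j*m) \<omega>) / real K\<bar>)"
        unfolding V_def by (intro integrable_abs integrable_divide Bochner_Integration.integrable_sum
            Bochner_Integration.integrable_diff int integrable_const)
      show "integrable M (\<lambda>\<omega>. (\<Sum>j<K. \<bar>\<phi> (X (j*m) \<omega>) - g (X (j*m) \<omega>)\<bar>) / real K + \<bar>Y \<omega>\<bar> + \<bar>\<nu> - \<mu>\<bar>)"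
        by (intro Bochner_Integration.integrable_add integrable_abs integrable_divide Bochner_Integration.integrable_sum
            Bochner_Integration.integrable_diff int intg iY integrable_const)
    qed
    also have "\<dots> = (\<Sum>j<K. (\<integral>\<omega>. \<bar>\<phi> (X (j*m) \<omega>) - g (X (j*m) \<omega>)\<bar> \<partial>M)) / real K + (\<integral>\<omega>. \<bar>Y \<omega>\<bar> \<partial>M) + \<bar>\<nu> - \<mu>\<bar>"
      by (simp add: int intg iY prob_space)
    also have "(\<Sum>j<K. (\<integral>\<omega>. \<bar>\<phi> (X (j*m) \<omega>) - g (X (j*m) \<omega>)\<bar> \<partial>M)) / real K \<le> (\<Sum>j<K. e/3) / real K"
      by (intro divide_right_mono sum_mono d) auto
    also have "(\<Sum>j<K. e/3) / real K = e/3" using K by simp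
    finally have "(\<integral>\<omega>. \<bar>(\<Sum>j<K. V (j*m) \<omega>) / real K\<bar> \<partial>M) \<le> e" using EY \<mu>\<nu> by linarith
    with K show "\<exists>K m. K \<ge> 1 \<and> (\<integral>\<omega>. \<bar>(\<Sum>j<K. V (j*m) \<omega>) / real K\<bar> \<partial>M) \<le> e" by blast
  qed
  then show ?thesis
  proof eventually_elim
    fix \<omega> assume "(\<lambda>n. (\<Sum>i<n. V i \<omega>) / real n) \<longlonglongrightarrow> 0"
    then have "(\<lambda>n. (\<Sum>i<n. V i \<omega>) / real n + \<mu>) \<longlonglongrightarrow> 0 + \<mu>" by (intro tendsto_add tendsto_const)
    moreover have "\<forall>\<^sub>F n in sequentially. (\<Sum>i<n. V i \<omega>) / real n + \<mu> = (\<Sum>i<n. \<phi> (X i \<omega>)) / real n"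
      using eventually_gt_at_top[of 0]
      by eventually_elim (simp add: V_def sum_subtractf diff_divide_distrib)
    ultimately show "(\<lambda>n. (\<Sum>i<n. \<phi> (X i \<omega>)) / real n) \<longlonglongrightarrow> (\<integral>\<omega>. \<phi> (X 0 \<omega>) \<partial>M)"
      unfolding \<mu>_def[symmetric] using Lim_transform_eventually by fastforce
  qed
qed

section \<open>Gaussian hypercontractivity\<close>

lemma sum_even_atMost:
  "(\<Sum>k\<le>2*n. if even k then g k else 0) = (\<Sum>j\<le>n. g (2*j))" for g :: "nat \<Rightarrow> real"
  by (induction n) simp_all

text \<open>With \<open>fact (2*j) / (2^j * fact j)\<close> the \<open>2j\<close>-th moment of a
  standard normal variable, this compares the coefficients of \<open>a^(2*(n-j)) * b^(2*j)\<close>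
  in the mean of \<open>(a + y * b)^(2*n)\<close> and in
  \<open>(a\<^sup>2 + (2*n-1) * b\<^sup>2)^n\<close>. Passing from \<open>j\<close> to
  \<open>Suc j\<close> in the cancelled form multiplies the left side by
  \<open>(n-j) * (2*n-2*j-1)\<close> and the right side by \<open>(n-j) * (2*n-1)\<close>.\<close>

lemma gaussian_binomial_le:
  assumes "j \<le> n" "n \<ge> 1"
  shows "real (2*n choose (2*j)) * (fact (2*j) / (2^j * fact j)) \<le> real (n choose j) * real (2*n-1)^j"
proof -
  have *: "fact (2*n) / (fact (2*n-2*j) * 2^j) \<le> (fact n / fact (n-j) * real (2*n-1)^j :: real)"
    using assms(1)
  proof (induction j)
    case (Suc j)
    have f1: "fact (2*n-2*j) = real (2*n-2*j) * real (2*n-2*j-1) * fact (2*n-2*Suc j)"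
    proof -
      obtain m where m: "2*n-2*j = Suc (Suc m)" using Suc.prems
        by (metis Suc_diff_Suc Suc_le_lessD diff_mult_distrib2 mult_2 add_Suc_right plus_1_eq_Suc add_Suc)
      then have "2*n-2*Suc j = m" by simp
      with m show ?thesis by (simp add: algebra_simps)
    qed
    have f2: "fact (n-j) = real (n-j) * fact (n-Suc j)"
      using Suc.prems by (metis Suc_diff_Suc Suc_le_lessD fact_Suc of_nat_fact of_nat_mult)
    have p: "real (2*n-2*j-1) > 0" "real (n-j) > 0" using Suc.prems by auto
    have "fact (2*n) / (fact (2*n-2*Suc j) * 2^Suc j)
        = fact (2*n) / (fact (2*n-2*j) * 2^j) * (real (n-j) * real (2*n-2*j-1))"
    proof -
      have "real (2*n-2*j) = 2 * real (n-j)" using Suc.prems by (simp add: of_nat_diff)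
      with p show ?thesis unfolding f1 by (simp add: divide_simps)
    qed
    also have "\<dots> \<le> (fact n / fact (n-j) * real (2*n-1)^j) * (real (n-j) * real (2*n-1))"
      using Suc.prems by (intro mult_mono Suc.IH) auto
    also have "\<dots> = fact n / fact (n-Suc j) * real (2*n-1)^Suc j"
      using p unfolding f2 by (simp add: field_simps)
    finally show ?case .
  qed simp
  have "real (2*n choose (2*j)) * (fact (2*j) / (2^j * fact j)) = fact (2*n) / (fact (2*n-2*j) * 2^j) / fact j"
    using assms by (simp add: binomial_fact field_simps)
  also have "\<dots> \<le> (fact n / fact (n-j) * real (2*n-1)^j) / fact j"
    by (intro divide_right_mono *) auto
  also have "\<dots> = real (n choose j) * real (2*n-1)^j"
    using assms by (simp add: binomial_fact field_simps)
  finally show ?thesis .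
qed

text \<open>The parameter is the standard deviation, not the variance.\<close>

definition gauss :: "real \<Rightarrow> real measure" where
  "gauss s = density lborel (\<lambda>x. ennreal (normal_density 0 s x))"

lemma sets_gauss [simp, measurable_cong]: "sets (gauss s) = sets borel"
  and space_gauss [simp]: "space (gauss s) = UNIV"
  by (simp_all add: gauss_def)

lemma prob_space_gauss: "s > 0 \<Longrightarrow> prob_space (gauss s)"
  unfolding gauss_def by (rule prob_space_normal_density)

text \<open>In the binomial expansion the odd moments vanish and the even terms are compared one by
  one through \<open>gaussian_binomial_le\<close>. The factor \<open>2*n-1\<close> is the
  hypercontractive constant between the norms of order \<open>2\<close> and
  \<open>2*n\<close>.\<close>

lemma gaussian_two_point:
  assumes n: "n \<ge> 1" and s: "s > 0"
  shows "(\<integral>\<^sup>+ y. ennreal ((a + y * b)^(2*n)) \<partial>gauss s) \<le> ennreal ((a\<^sup>2 + real (2*n-1) * s\<^sup>2 * b\<^sup>2)^n)"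
proof -
  \<comment> \<open>The \<open>k\<close>-th moment of the centred normal law.\<close>
  define m where "m k = (if even k then fact k / ((2 / s\<^sup>2)^(k div 2) * fact (k div 2)) else 0::real)" for k
  have m: "has_bochner_integral lborel (\<lambda>x. normal_density 0 s x * x ^ k) (m k)" for k
  proof (cases "even k")
    case True
    then obtain j where "k = 2*j" by (rule evenE)
    moreover from this have "m k = fact (2*j) / ((2 / s\<^sup>2)^j * fact j)" by (simp add: m_def)
    ultimately show ?thesis using normal_moment_even[OF s, of 0 j] by (simp only: diff_0_right)
  next
    case False
    then obtain j where "k = 2*j+1" by (metis oddE)
    then show ?thesis using normal_moment_odd[OF s, of 0 j] False by (simp add: m_def)
  qed
  define w where "w k = real (2*n choose k) * b^k * a^(2*n-k)" for k
  have eq: "normal_density 0 s y * (a + y * b)^(2*n) = (\<Sum>k\<le>2*n. w k * (normal_density 0 s y * y^k))" for y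
    unfolding add.commute[of a] binomial_ring[of "y*b" a] w_def
    by (simp add: sum_distrib_left power_mult_distrib mult_ac)
  have "has_bochner_integral lborel (\<lambda>y. normal_density 0 s y * (a + y * b)^(2*n)) (\<Sum>k\<le>2*n. w k * m k)"
    unfolding eq by (intro has_bochner_integral_sum has_bochner_integral_mult_right m)
  then have "(\<integral>\<^sup>+ y. ennreal (normal_density 0 s y * (a + y * b)^(2*n)) \<partial>lborel) = ennreal (\<Sum>k\<le>2*n. w k * m k)"
    by (subst nn_integral_eq_integral) (auto simp: has_bochner_integral_iff)
  then have "(\<integral>\<^sup>+ y. ennreal ((a + y * b)^(2*n)) \<partial>gauss s) = ennreal (\<Sum>k\<le>2*n. w k * m k)"
    unfolding gauss_def by (subst nn_integral_density) (auto simp: ennreal_mult)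
  also have "(\<Sum>k\<le>2*n. w k * m k) = (\<Sum>k\<le>2*n. if even k then w k * m k else 0)"
    by (intro sum.cong) (auto simp: m_def)
  also have "\<dots> = (\<Sum>j\<le>n. w (2*j) * m (2*j))" by (rule sum_even_atMost)
  also have "\<dots> \<le> (\<Sum>j\<le>n. real (n choose j) * (real (2*n-1) * s\<^sup>2 * b\<^sup>2)^j * (a\<^sup>2)^(n-j))"
  proof (intro sum_mono)
    fix j assume "j \<in> {..n}" then have j: "j \<le> n" by simp
    have "w (2*j) * m (2*j) = (real (2*n choose (2*j)) * (fact (2*j) / (2^j * fact j))) * ((s\<^sup>2 * b\<^sup>2)^j * (a\<^sup>2)^(n-j))"
    proof -
      have "2*n - 2*j = 2*(n-j)" by simp
      then have "a^(2*n-2*j) = (a\<^sup>2)^(n-j)" by (simp only: power_mult)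
      moreover have "b^(2*j) = (b\<^sup>2)^j" by (rule power_mult)
      ultimately show ?thesis using s by (simp add: w_def m_def power_mult_distrib field_simps)
    qed
    also have "\<dots> \<le> (real (n choose j) * real (2*n-1)^j) * ((s\<^sup>2 * b\<^sup>2)^j * (a\<^sup>2)^(n-j))"
      using gaussian_binomial_le[OF j n] by (intro mult_right_mono) auto
    finally show "w (2*j) * m (2*j) \<le> real (n choose j) * (real (2*n-1) * s\<^sup>2 * b\<^sup>2)^j * (a\<^sup>2)^(n-j)"
      by (simp add: power_mult_distrib mult_ac)
  qed
  also have "\<dots> = (real (2*n-1) * s\<^sup>2 * b\<^sup>2 + a\<^sup>2)^n" by (simp only: binomial_ring)
  also have "\<dots> = (a\<^sup>2 + real (2*n-1) * s\<^sup>2 * b\<^sup>2)^n" by (simp add: add.commute)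
  finally show ?thesis by (simp add: ennreal_leI)
qed

text \<open>Convexity of the power, with the weights \<open>\<alpha> / (\<alpha> + \<beta>)\<close> and \<open>\<beta> / (\<alpha> + \<beta>)\<close>.\<close>
lemma nn_integral_power_add_le:
  assumes [measurable]: "u \<in> borel_measurable M" "v \<in> borel_measurable M"
    and pos: "\<And>x. u x \<ge> 0" "\<And>x. v x \<ge> 0" "\<alpha> \<ge> 0" "\<beta> \<ge> 0"
    and u: "(\<integral>\<^sup>+x. ennreal (u x ^ n) \<partial>M) \<le> ennreal (\<alpha>^n)"
    and v: "(\<integral>\<^sup>+x. ennreal (v x ^ n) \<partial>M) \<le> ennreal (\<beta>^n)"
    and n: "n \<ge> 1"
  shows "(\<integral>\<^sup>+x. ennreal ((u x + v x) ^ n) \<partial>M) \<le> ennreal ((\<alpha> + \<beta>)^n)"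
proof -
  have vanish: "AE x in M. w x = 0"
    if [measurable]: "w \<in> borel_measurable M" and "\<And>x. w x \<ge> 0" "(\<integral>\<^sup>+x. ennreal (w x ^ n) \<partial>M) \<le> ennreal (0^n)"
    for w :: "_ \<Rightarrow> real"
  proof -
    have "(\<integral>\<^sup>+x. ennreal (w x ^ n) \<partial>M) = 0" using that n by (simp add: power_0_left)
    then have "AE x in M. ennreal (w x ^ n) = 0" by (subst (asm) nn_integral_0_iff_AE) auto
    then show ?thesis by eventually_elim (use that(2) n in \<open>auto simp: ennreal_eq_0_iff power_le_zero_eq antisym\<close>)
  qed
  consider "\<alpha> = 0" | "\<beta> = 0" | "\<alpha> > 0" "\<beta> > 0" using pos by fastforce
  then show ?thesis
  proof cases
    case 1
    then have "AE x in M. u x = 0" using vanish[of u] u pos by simp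
    then have "(\<integral>\<^sup>+x. ennreal ((u x + v x) ^ n) \<partial>M) = (\<integral>\<^sup>+x. ennreal (v x ^ n) \<partial>M)"
      by (intro nn_integral_cong_AE) auto
    with 1 v show ?thesis by simp
  next
    case 2
    then have "AE x in M. v x = 0" using vanish[of v] v pos by simp
    then have "(\<integral>\<^sup>+x. ennreal ((u x + v x) ^ n) \<partial>M) = (\<integral>\<^sup>+x. ennreal (u x ^ n) \<partial>M)"
      by (intro nn_integral_cong_AE) auto
    with 2 u show ?thesis by simp
  next
    case 3
    define s where "s = \<alpha> + \<beta>"
    have s: "s > 0" using 3 by (simp add: s_def)
    have cvx: "convex_on {0::real..} (\<lambda>x. x^n)"
      by (cases "even n") (auto intro: convex_power_odd convex_on_subset[OF convex_power_even])
    have pw: "(u x + v x) ^ n \<le> s^n * (\<alpha>/s) * (1/\<alpha>^n) * u x ^ n + s^n * (\<beta>/s) * (1/\<beta>^n) * v x ^ n" for x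
    proof -
      have "((1 - \<beta>/s) *\<^sub>R (u x/\<alpha>) + (\<beta>/s) *\<^sub>R (v x/\<beta>)) ^ n \<le> (1 - \<beta>/s) * (u x/\<alpha>)^n + (\<beta>/s) * (v x/\<beta>)^n"
        using 3 s pos by (intro convex_onD[OF cvx]) (auto simp: s_def)
      moreover have "1 - \<beta>/s = \<alpha>/s" using s by (simp add: s_def field_simps)
      moreover have "(\<alpha>/s) * (u x/\<alpha>) + (\<beta>/s) * (v x/\<beta>) = (u x + v x)/s" using 3 s by (simp add: field_simps)
      ultimately have "((u x + v x)/s)^n \<le> (\<alpha>/s) * (u x/\<alpha>)^n + (\<beta>/s) * (v x/\<beta>)^n" by simp
      then have "s^n * ((u x + v x)/s)^n \<le> s^n * ((\<alpha>/s) * (u x/\<alpha>)^n + (\<beta>/s) * (v x/\<beta>)^n)"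
        using s by (intro mult_left_mono) auto
      then show ?thesis using s by (simp add: power_divide field_simps)
    qed
    have "(\<integral>\<^sup>+x. ennreal ((u x + v x) ^ n) \<partial>M)
        \<le> (\<integral>\<^sup>+x. ennreal (s^n * (\<alpha>/s) * (1/\<alpha>^n)) * ennreal (u x ^ n) + ennreal (s^n * (\<beta>/s) * (1/\<beta>^n)) * ennreal (v x ^ n) \<partial>M)"
      using pos s 3 by (intro nn_integral_mono)
        (auto simp: ennreal_mult[symmetric] ennreal_plus[symmetric] simp del: ennreal_plus intro!: ennreal_leI order.trans[OF pw])
    also have "\<dots> = ennreal (s^n * (\<alpha>/s) * (1/\<alpha>^n)) * (\<integral>\<^sup>+x. ennreal (u x ^ n) \<partial>M) + ennreal (s^n * (\<beta>/s) * (1/\<beta>^n)) * (\<integral>\<^sup>+x. ennreal (v x ^ n) \<partial>M)"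
      by (simp add: nn_integral_add nn_integral_cmult)
    also have "\<dots> \<le> ennreal (s^n * (\<alpha>/s) * (1/\<alpha>^n)) * ennreal (\<alpha>^n) + ennreal (s^n * (\<beta>/s) * (1/\<beta>^n)) * ennreal (\<beta>^n)"
      by (intro add_mono mult_left_mono u v) auto
    also have "\<dots> = ennreal (s^n)"
    proof -
      have "s^n * (\<alpha>/s) * (1/\<alpha>^n) * \<alpha>^n + s^n * (\<beta>/s) * (1/\<beta>^n) * \<beta>^n = s^n * ((\<alpha> + \<beta>)/s)"
        using 3 s by (simp add: field_simps)
      also have "\<dots> = s^n" using s by (simp add: s_def)
      finally show ?thesis
        using 3 s by (simp add: ennreal_mult[symmetric] ennreal_plus[symmetric] del: ennreal_plus)
    qed
    finally show ?thesis by (simp add: s_def)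
  qed
qed

text \<open>Bonami's induction over the variables: a two-point inequality in one Gaussian variable is
  combined with Minkowski's inequality in the remaining ones.\<close>
lemma gaussian_hypercontractivity:
  assumes n: "n \<ge> 1" and s: "\<And>i. s i > 0" and L: "finite L"
  shows "(\<integral>\<^sup>+ x. ennreal ((\<Sum>S\<in>Pow L. d S * (\<Prod>l\<in>S. x l))^(2*n)) \<partial>(\<Pi>\<^sub>M l\<in>L. gauss (s l)))
    \<le> ennreal ((\<Sum>S\<in>Pow L. (d S)\<^sup>2 * (\<Prod>l\<in>S. real (2*n-1) * (s l)\<^sup>2))^n)"
  using L
proof (induction L arbitrary: d rule: finite_induct)
  case empty
  show ?case by (simp add: space_PiM power_mult)
next
  case (insert i L)
  interpret product_sigma_finite "\<lambda>l. gauss (s l)"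
    by (intro product_sigma_finite.intro prob_space_imp_sigma_finite prob_space_gauss s)
  let ?c = "real (2*n-1)"
  \<comment> \<open>As a function of the new variable \<open>y\<close> the polynomial is
    \<open>A + y * B\<close>: \<open>A\<close> collects the monomials without \<open>i\<close>, and
    \<open>B\<close> those containing \<open>i\<close>, with that factor removed.\<close>
  define A where "A = (\<lambda>x. \<Sum>S\<in>Pow L. d S * (\<Prod>l\<in>S. x l))"
  define B where "B = (\<lambda>x. \<Sum>S\<in>Pow L. d (insert i S) * (\<Prod>l\<in>S. x l))"
  define \<alpha> where "\<alpha> = (\<Sum>S\<in>Pow L. (d S)\<^sup>2 * (\<Prod>l\<in>S. ?c * (s l)\<^sup>2))"
  define \<beta> where "\<beta> = (\<Sum>S\<in>Pow L. (d (insert i S))\<^sup>2 * (\<Prod>l\<in>S. ?c * (s l)\<^sup>2))"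
  have fin: "finite S" if "S \<subseteq> L" for S using that insert(1) by (rule finite_subset)
  have inj: "inj_on (insert i) (Pow L)" using insert(2) unfolding inj_on_def by (auto dest: insert_ident[THEN iffD1, rotated 2])
  have split: "(\<Sum>S\<in>Pow (insert i L). h S) = (\<Sum>S\<in>Pow L. h S) + (\<Sum>S\<in>Pow L. h (insert i S))"
    for h :: "_ \<Rightarrow> real"
    unfolding Pow_insert using insert(1,2)
    by (subst sum.union_disjoint) (auto simp: sum.reindex[OF inj] o_def)
  have [measurable]: "A \<in> borel_measurable (\<Pi>\<^sub>M l\<in>L. gauss (s l))" "B \<in> borel_measurable (\<Pi>\<^sub>M l\<in>L. gauss (s l))"
    unfolding A_def B_def by (auto intro!: borel_measurable_sum borel_measurable_times borel_measurable_prod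
        measurable_component_singleton[THEN measurable_compose, where g="\<lambda>x. x"])
  have m: "(\<lambda>x. ennreal ((\<Sum>S\<in>Pow (insert i L). d S * (\<Prod>l\<in>S. x l))^(2*n))) \<in> borel_measurable (\<Pi>\<^sub>M l\<in>insert i L. gauss (s l))"
    by (intro measurable_compose[OF _ measurable_ennreal] borel_measurable_power borel_measurable_sum borel_measurable_times borel_measurable_prod)
      (auto intro!: measurable_component_singleton[THEN measurable_compose, where g="\<lambda>x. x"])
  have poly: "(\<Sum>S\<in>Pow (insert i L). d S * (\<Prod>l\<in>S. (x(i:=y)) l)) = A x + y * B x" for x y
  proof -
    have "(\<Sum>S\<in>Pow L. d S * (\<Prod>l\<in>S. (x(i:=y)) l)) = A x"
      unfolding A_def using insert(2) by (intro sum.cong arg_cong2[of _ _ _ _ "(*)"] prod.cong) auto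
    moreover have "(\<Sum>S\<in>Pow L. d (insert i S) * (\<Prod>l\<in>insert i S. (x(i:=y)) l)) = y * B x"
      unfolding B_def sum_distrib_left
    proof (intro sum.cong refl)
      fix S assume S: "S \<in> Pow L"
      then have "(\<Prod>l\<in>insert i S. (x(i:=y)) l) = y * (\<Prod>l\<in>S. (x(i:=y)) l)"
        using insert(2) fin by (subst prod.insert) auto
      also have "(\<Prod>l\<in>S. (x(i:=y)) l) = (\<Prod>l\<in>S. x l)"
        using insert(2) S by (intro prod.cong) auto
      finally show "d (insert i S) * (\<Prod>l\<in>insert i S. (x(i:=y)) l) = y * (d (insert i S) * (\<Prod>l\<in>S. x l))" by simp
    qed
    ultimately show ?thesis by (simp only: split)
  qed
  have "(\<integral>\<^sup>+ x. ennreal ((\<Sum>S\<in>Pow (insert i L). d S * (\<Prod>l\<in>S. x l))^(2*n)) \<partial>(\<Pi>\<^sub>M l\<in>insert i L. gauss (s l)))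
     = (\<integral>\<^sup>+ x. (\<integral>\<^sup>+ y. ennreal ((A x + y * B x)^(2*n)) \<partial>gauss (s i)) \<partial>(\<Pi>\<^sub>M l\<in>L. gauss (s l)))"
    by (subst product_nn_integral_insert[OF insert(1,2) m]) (simp only: poly)
  also have "\<dots> \<le> (\<integral>\<^sup>+ x. ennreal (((A x)\<^sup>2 + ?c * (s i)\<^sup>2 * (B x)\<^sup>2)^n) \<partial>(\<Pi>\<^sub>M l\<in>L. gauss (s l)))"
    by (intro nn_integral_mono gaussian_two_point n s)
  also have "\<dots> \<le> ennreal ((\<alpha> + ?c * (s i)\<^sup>2 * \<beta>)^n)"
  proof (rule nn_integral_power_add_le)
    show "0 \<le> \<alpha>" "0 \<le> ?c * (s i)\<^sup>2 * \<beta>" unfolding \<alpha>_def \<beta>_def by (auto intro!: sum_nonneg mult_nonneg_nonneg prod_nonneg)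
    show "(\<integral>\<^sup>+x. ennreal (((A x)\<^sup>2)^n) \<partial>(\<Pi>\<^sub>M l\<in>L. gauss (s l))) \<le> ennreal (\<alpha>^n)"
      using insert.IH[of d] unfolding A_def \<alpha>_def by (simp add: power_mult)
    have "(\<integral>\<^sup>+x. ennreal ((?c * (s i)\<^sup>2 * (B x)\<^sup>2)^n) \<partial>(\<Pi>\<^sub>M l\<in>L. gauss (s l)))
        = ennreal ((?c * (s i)\<^sup>2)^n) * (\<integral>\<^sup>+x. ennreal ((B x)^(2*n)) \<partial>(\<Pi>\<^sub>M l\<in>L. gauss (s l)))"
      by (subst nn_integral_cmult[symmetric]) (auto simp: power_mult_distrib power_mult ennreal_mult[symmetric])
    also have "\<dots> \<le> ennreal ((?c * (s i)\<^sup>2)^n) * ennreal (\<beta>^n)"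
      using insert.IH[of "\<lambda>S. d (insert i S)"] unfolding B_def \<beta>_def by (intro mult_left_mono) auto
    also have "\<dots> = ennreal ((?c * (s i)\<^sup>2 * \<beta>)^n)"
      by (subst ennreal_mult'[symmetric]) (auto simp: power_mult_distrib)
    finally show "(\<integral>\<^sup>+x. ennreal ((?c * (s i)\<^sup>2 * (B x)\<^sup>2)^n) \<partial>(\<Pi>\<^sub>M l\<in>L. gauss (s l))) \<le> ennreal ((?c * (s i)\<^sup>2 * \<beta>)^n)" .
  qed (use n in auto)
  also have "\<alpha> + ?c * (s i)\<^sup>2 * \<beta> = (\<Sum>S\<in>Pow (insert i L). (d S)\<^sup>2 * (\<Prod>l\<in>S. ?c * (s l)\<^sup>2))"
  proof -
    have "(\<Sum>S\<in>Pow L. (d (insert i S))\<^sup>2 * (\<Prod>l\<in>insert i S. ?c * (s l)\<^sup>2)) = ?c * (s i)\<^sup>2 * \<beta>"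
      unfolding \<beta>_def sum_distrib_left
    proof (intro sum.cong refl)
      fix S assume S: "S \<in> Pow L"
      then have "(\<Prod>l\<in>insert i S. ?c * (s l)\<^sup>2) = ?c * (s i)\<^sup>2 * (\<Prod>l\<in>S. ?c * (s l)\<^sup>2)"
        using insert(2) fin by (subst prod.insert) auto
      then show "(d (insert i S))\<^sup>2 * (\<Prod>l\<in>insert i S. ?c * (s l)\<^sup>2) = ?c * (s i)\<^sup>2 * ((d (insert i S))\<^sup>2 * (\<Prod>l\<in>S. ?c * (s l)\<^sup>2))" by simp
    qed
    then show ?thesis by (simp add: split \<alpha>_def)
  qed
  finally show ?case .
qed

section \<open>Elementary kernels\<close>

lemma sorted_wrt_less_nth_le_iff:
  fixes p :: "real list"
  assumes "sorted_wrt (<) p" "i < length p" "j < length p"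
  shows "p ! i \<le> p ! j \<longleftrightarrow> i \<le> j"
  using assms by (metis linorder_le_less_linear nle_le nless_le sorted_wrt_nth_less)

lemma elem_idx_finite [simp]: "finite ({..<q::nat} \<rightarrow>\<^sub>E {..<n::nat})"
  by (intro finite_PiE) auto

section \<open>Refinement of partitions\<close>

definition cells :: "real list \<Rightarrow> real \<Rightarrow> real \<Rightarrow> nat set" where
  "cells r a b = {m\<in>{..<length r - 1}. a \<le> r ! m \<and> r ! Suc m \<le> b}"

text \<open>Telescoping: since \<open>a\<close> and \<open>b\<close> are themselves points of
  \<open>r\<close>, the cells between them occupy a contiguous block of indices.\<close>

lemma additive_over_cells:
  fixes G :: "real \<Rightarrow> real \<Rightarrow> real"
  assumes r: "sorted_wrt (<) r" and ab: "a \<in> set r" "b \<in> set r" "a < b"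
    and G: "\<And>x y z. x < y \<Longrightarrow> y < z \<Longrightarrow> G x z = G x y + G y z"
  shows "G a b = (\<Sum>m\<in>cells r a b. G (r ! m) (r ! Suc m))"
proof -
  obtain k where k: "k < length r" "r ! k = a" using ab(1) by (auto simp: in_set_conv_nth)
  obtain l where l: "l < length r" "r ! l = b" using ab(2) by (auto simp: in_set_conv_nth)
  have kl: "k < l" using ab(3) k l sorted_wrt_less_nth_le_iff[OF r l(1) k(1)] by (metis not_le)
  have "cells r a b = {k..<l}"
    using k l kl by (auto simp: cells_def sorted_wrt_less_nth_le_iff[OF r] k(2)[symmetric] l(2)[symmetric])
  moreover have "k \<le> n \<Longrightarrow> n < length r \<Longrightarrow> k < n \<longrightarrow> G (r ! k) (r ! n) = (\<Sum>m=k..<n. G (r ! m) (r ! Suc m))" for n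
  proof (induction n rule: dec_induct)
    case (step n)
    show ?case
    proof (cases "k = n")
      case False
      then have "G (r ! k) (r ! Suc n) = G (r ! k) (r ! n) + G (r ! n) (r ! Suc n)"
        using step.hyps step.prems by (intro G sorted_wrt_nth_less[OF r]) auto
      with False step show ?thesis by simp
    qed simp
  qed simp
  ultimately show ?thesis using k l kl by auto
qed

text \<open>Two different intervals of \<open>p\<close> share at most an end point, whereas a cell
  of \<open>r\<close> has positive length.\<close>

lemma cell_parent_unique:
  assumes p: "sorted_wrt (<) p" and r: "sorted_wrt (<) r"
    and i: "i < length p - 1" and j: "j < length p - 1"
    and m: "m \<in> cells r (p ! i) (p ! Suc i)" "m \<in> cells r (p ! j) (p ! Suc j)"
  shows "i = j"
proof -
  have *: False if "i < j" "j < length p - 1" "m \<in> cells r (p ! i) (p ! Suc i)" "m \<in> cells r (p ! j) (p ! Suc j)" for i j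
  proof -
    have "p ! Suc i \<le> p ! j" using that by (subst sorted_wrt_less_nth_le_iff[OF p]) auto
    moreover have "r ! m < r ! Suc m" using that by (intro sorted_wrt_nth_less[OF r]) (auto simp: cells_def)
    ultimately show False using that by (auto simp: cells_def)
  qed
  show ?thesis using *[of i j] *[of j i] assms by (meson nat_neq_iff)
qed

text \<open>Both \<open>elem_fun\<close> and \<open>elem_int\<close> are instances of \<open>elem_sum\<close>, for the interval functions
  \<open>indicator {a..<b} (x j)\<close> and \<open>B b \<omega> - B a \<omega>\<close>.\<close>
definition elem_sum :: "nat \<Rightarrow> real list \<Rightarrow> ((nat \<Rightarrow> nat) \<Rightarrow> real) \<Rightarrow> (nat \<Rightarrow> real \<Rightarrow> real \<Rightarrow> real) \<Rightarrow> real" where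
  "elem_sum q p c G = (\<Sum>i \<in> {..<q} \<rightarrow>\<^sub>E {..<length p - 1}. c i * (\<Prod>j<q. G j (p ! (i j)) (p ! Suc (i j))))"

lemma elem_fun_eq_elem_sum: "elem_fun q p c x = elem_sum q p c (\<lambda>j a b. indicator {a..<b} (x j))"
  by (simp add: elem_fun_def elem_sum_def)

lemma elem_int_eq_elem_sum: "elem_int q p c B \<omega> = elem_sum q p c (\<lambda>j a b. B b \<omega> - B a \<omega>)"
  by (simp add: elem_int_def elem_sum_def)

text \<open>For increasing lists at most one \<open>i\<close> meets the condition
  (\<open>cell_parent_unique\<close>), so the sum just picks the coefficient of the box of
  \<open>p\<close> that contains the box \<open>l\<close> of \<open>r\<close>, and is
  \<open>0\<close> if there is none. Writing it as a sum lets linearity do the bookkeeping.\<close>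

definition refine_coeff :: "nat \<Rightarrow> real list \<Rightarrow> ((nat \<Rightarrow> nat) \<Rightarrow> real) \<Rightarrow> real list \<Rightarrow> (nat \<Rightarrow> nat) \<Rightarrow> real" where
  "refine_coeff q p c r l = (\<Sum>i \<in> {..<q} \<rightarrow>\<^sub>E {..<length p - 1}.
     if \<forall>j<q. l j \<in> cells r (p ! i j) (p ! Suc (i j)) then c i else 0)"

text \<open>Additivity splits each factor over the cells of the finer partition; the product of
  these sums is expanded into a sum over index maps, and the two summations are
  interchanged.\<close>

lemma elem_sum_refine:
  assumes p: "sorted_wrt (<) p" and r: "sorted_wrt (<) r" and sub: "set p \<subseteq> set r"
    and G: "\<And>j x y z. x < y \<Longrightarrow> y < z \<Longrightarrow> G j x z = G j x y + G j y z"
  shows "elem_sum q r (refine_coeff q p c r) G = elem_sum q p c G"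
proof -
  let ?I = "{..<q} \<rightarrow>\<^sub>E {..<length p - 1}" and ?R = "{..<q} \<rightarrow>\<^sub>E {..<length r - 1}"
  have "elem_sum q p c G = (\<Sum>i\<in>?I. c i * (\<Sum>l | l \<in> ?R \<and> (\<forall>j<q. l j \<in> cells r (p ! i j) (p ! Suc (i j))). \<Prod>j<q. G j (r ! (l j)) (r ! Suc (l j))))"
    unfolding elem_sum_def
  proof (intro sum.cong refl arg_cong2[of _ _ _ _ "(*)"])
    fix i assume i: "i \<in> ?I"
    have "(\<Prod>j<q. G j (p ! i j) (p ! Suc (i j))) = (\<Prod>j<q. \<Sum>m\<in>cells r (p ! i j) (p ! Suc (i j)). G j (r ! m) (r ! Suc m))"
    proof (intro prod.cong refl additive_over_cells[OF r _ _ _ G])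
      fix j assume "j \<in> {..<q}"
      then have "i j < length p - 1" using i by (auto simp: PiE_def Pi_def)
      then show "p ! i j \<in> set r" "p ! Suc (i j) \<in> set r" "p ! i j < p ! Suc (i j)"
        using sub by (auto intro!: subsetD[OF sub] nth_mem sorted_wrt_nth_less[OF p])
    qed
    also have "\<dots> = (\<Sum>l\<in>(\<Pi>\<^sub>E j\<in>{..<q}. cells r (p ! i j) (p ! Suc (i j))). \<Prod>j<q. G j (r ! (l j)) (r ! Suc (l j)))"
      by (rule prod_sum_PiE) (auto simp: cells_def)
    also have "(\<Pi>\<^sub>E j\<in>{..<q}. cells r (p ! i j) (p ! Suc (i j))) = {l. l \<in> ?R \<and> (\<forall>j<q. l j \<in> cells r (p ! i j) (p ! Suc (i j)))}"
    proof -
      have "m \<in> {..<length r - 1}" if "m \<in> cells r a b" for m a b using that by (simp add: cells_def)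
      then show ?thesis
        by (intro set_eqI iffI; unfold PiE_iff mem_Collect_eq; meson lessThan_iff)
    qed
    finally show "(\<Prod>j<q. G j (p ! i j) (p ! Suc (i j))) = (\<Sum>l | l \<in> ?R \<and> (\<forall>j<q. l j \<in> cells r (p ! i j) (p ! Suc (i j))). \<Prod>j<q. G j (r ! (l j)) (r ! Suc (l j)))" .
  qed
  also have "\<dots> = (\<Sum>i\<in>?I. \<Sum>l\<in>?R. (if \<forall>j<q. l j \<in> cells r (p ! i j) (p ! Suc (i j)) then c i else 0) * (\<Prod>j<q. G j (r ! (l j)) (r ! Suc (l j))))"
  proof (intro sum.cong refl)
    fix i
    show "c i * (\<Sum>l | l \<in> ?R \<and> (\<forall>j<q. l j \<in> cells r (p ! i j) (p ! Suc (i j))). \<Prod>j<q. G j (r ! (l j)) (r ! Suc (l j)))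
      = (\<Sum>l\<in>?R. (if \<forall>j<q. l j \<in> cells r (p ! i j) (p ! Suc (i j)) then c i else 0) * (\<Prod>j<q. G j (r ! (l j)) (r ! Suc (l j))))"
    proof -
      define Q where "Q l \<longleftrightarrow> (\<forall>j<q. l j \<in> cells r (p ! i j) (p ! Suc (i j)))" for l
      have "(\<Sum>l | l \<in> ?R \<and> Q l. c i * (\<Prod>j<q. G j (r ! (l j)) (r ! Suc (l j))))
        = (\<Sum>l\<in>?R. if Q l then c i * (\<Prod>j<q. G j (r ! (l j)) (r ! Suc (l j))) else 0)"
        by (rule sum.inter_filter) simp
      also have "\<dots> = (\<Sum>l\<in>?R. (if Q l then c i else 0) * (\<Prod>j<q. G j (r ! (l j)) (r ! Suc (l j))))"
        by (intro sum.cong refl) auto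
      finally show ?thesis unfolding sum_distrib_left Q_def .
    qed
  qed
  also have "\<dots> = (\<Sum>l\<in>?R. \<Sum>i\<in>?I. (if \<forall>j<q. l j \<in> cells r (p ! i j) (p ! Suc (i j)) then c i else 0) * (\<Prod>j<q. G j (r ! (l j)) (r ! Suc (l j))))"
    by (rule sum.swap)
  also have "\<dots> = elem_sum q r (refine_coeff q p c r) G"
    unfolding elem_sum_def refine_coeff_def sum_distrib_right ..
  finally show ?thesis by simp
qed

text \<open>Two coordinates in the same cell of \<open>r\<close> have the same parent interval in
  \<open>p\<close>. A diagonal box of the refinement therefore descends from a diagonal box, whose
  coefficient is \<open>0\<close>.\<close>

lemma elem_admissible_refine:
  assumes adm: "elem_admissible q p c" and r: "sorted_wrt (<) r"
  shows "elem_admissible q r (refine_coeff q p c r)"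
  unfolding elem_admissible_def
proof (intro conjI ballI impI r)
  have p: "sorted_wrt (<) p" using adm by (simp add: elem_admissible_def)
  fix l assume l: "l \<in> {..<q} \<rightarrow>\<^sub>E {..<length r - 1}" "\<not> inj_on l {..<q}"
  then obtain j k where jk: "j < q" "k < q" "j \<noteq> k" "l j = l k" by (auto simp: inj_on_def)
  show "refine_coeff q p c r l = 0"
    unfolding refine_coeff_def
  proof (intro sum.neutral ballI)
    fix i assume i: "i \<in> {..<q} \<rightarrow>\<^sub>E {..<length p - 1}"
    show "(if \<forall>j<q. l j \<in> cells r (p ! i j) (p ! Suc (i j)) then c i else 0) = 0"
    proof (cases "\<forall>j<q. l j \<in> cells r (p ! i j) (p ! Suc (i j))")
      case True
      have "i j < length p - 1" "i k < length p - 1" using i jk by (auto simp: PiE_iff)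
      then have "i j = i k" using cell_parent_unique[OF p r, of "i j" "i k" "l j"] True jk by auto
      then have "\<not> inj_on i {..<q}" using jk by (auto simp: inj_on_def)
      then show ?thesis using adm i by (auto simp: elem_admissible_def)
    qed (simp only: if_False)
  qed
qed

lemma indicator_Ico_additive:
  fixes x y z t :: real
  shows "x < y \<Longrightarrow> y < z \<Longrightarrow> (indicator {x..<z} t :: real) = indicator {x..<y} t + indicator {y..<z} t"
  by (auto simp: indicator_def)

text \<open>Both kernels are written over the union of the two partitions. The same list and
  coefficients serve the kernel and the integral, so the integral of a difference of kernels is the
  difference of the integrals.\<close>

lemma elem_lincomb:
  assumes adm: "elem_admissible q p c" "elem_admissible q p' c'"
  obtains r d where "elem_admissible q r d" "set r = set p \<union> set p'"
    "\<And>x. elem_fun q r d x = s * elem_fun q p c x + t * elem_fun q p' c' x"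
    "\<And>(B :: real \<Rightarrow> 'a \<Rightarrow> real) \<omega>. elem_int q r d B \<omega> = s * elem_int q p c B \<omega> + t * elem_int q p' c' B \<omega>"
proof -
  define r where "r = sorted_list_of_set (set p \<union> set p')"
  define d where "d l = s * refine_coeff q p c r l + t * refine_coeff q p' c' r l" for l
  have r: "sorted_wrt (<) r" unfolding r_def by (rule strict_sorted_list_of_set)
  have setr: "set r = set p \<union> set p'" by (simp add: r_def)
  have p: "sorted_wrt (<) p" "sorted_wrt (<) p'" using adm by (simp_all add: elem_admissible_def)
  have sum: "elem_sum q r d G = s * elem_sum q p c G + t * elem_sum q p' c' G"
    if G: "\<And>j x y z. x < y \<Longrightarrow> y < z \<Longrightarrow> G j x z = G j x y + G j y z" for G
  proof -
    have "elem_sum q r d G = s * elem_sum q r (refine_coeff q p c r) G + t * elem_sum q r (refine_coeff q p' c' r) G"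
      by (simp add: elem_sum_def d_def sum_distrib_left sum.distrib[symmetric] algebra_simps)
    also have "elem_sum q r (refine_coeff q p c r) G = elem_sum q p c G"
      by (rule elem_sum_refine[OF p(1) r _ G]) (auto simp: setr)
    also have "elem_sum q r (refine_coeff q p' c' r) G = elem_sum q p' c' G"
      by (rule elem_sum_refine[OF p(2) r _ G]) (auto simp: setr)
    finally show ?thesis .
  qed
  show ?thesis
  proof (rule that)
    show "elem_admissible q r d"
      using elem_admissible_refine[OF adm(1) r] elem_admissible_refine[OF adm(2) r]
      by (simp add: elem_admissible_def d_def)
    show "elem_fun q r d x = s * elem_fun q p c x + t * elem_fun q p' c' x" for x
      unfolding elem_fun_eq_elem_sum by (intro sum indicator_Ico_additive)
    show "elem_int q r d B \<omega> = s * elem_int q p c B \<omega> + t * elem_int q p' c' B \<omega>" for B :: "real \<Rightarrow> 'a \<Rightarrow> real" and \<omega>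
      unfolding elem_int_eq_elem_sum by (intro sum) simp
  qed (rule setr)
qed

section \<open>Norms of elementary kernels and moments of their integrals\<close>

definition elem_norm2 :: "nat \<Rightarrow> real list \<Rightarrow> ((nat \<Rightarrow> nat) \<Rightarrow> real) \<Rightarrow> real" where
  "elem_norm2 q p c = (\<Sum>i \<in> {..<q} \<rightarrow>\<^sub>E {..<length p - 1}. (c i)\<^sup>2 * (\<Prod>j<q. p ! Suc (i j) - p ! i j))"

abbreviation lebesgue_pow :: "nat \<Rightarrow> (nat \<Rightarrow> real) measure" where
  "lebesgue_pow q \<equiv> \<Pi>\<^sub>M (_::nat)\<in>{..<q}. (lborel :: real measure)"

lemma measurable_elem_fun [measurable]: "elem_fun q p c \<in> borel_measurable (lebesgue_pow q)"
  unfolding elem_fun_def by measurable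

text \<open>The boxes of a partition are disjoint, so squaring produces no cross terms, and each box
  contributes its volume.\<close>

lemma nn_integral_elem_fun_sq:
  assumes p: "sorted_wrt (<) p"
  shows "(\<integral>\<^sup>+x. ennreal ((elem_fun q p c x)\<^sup>2) \<partial>lebesgue_pow q) = ennreal (elem_norm2 q p c)"
proof -
  interpret product_sigma_finite "\<lambda>_::nat. lborel :: real measure"
    by (intro product_sigma_finite.intro sigma_finite_lborel)
  let ?I = "{..<q} \<rightarrow>\<^sub>E {..<length p - 1}"
  define P where "P i x = (\<Prod>j<q. indicator {p ! (i j) ..< p ! Suc (i j)} (x j) :: real)" for i and x :: "nat \<Rightarrow> real"
  have lt: "p ! i j < p ! Suc (i j)" if "i \<in> ?I" "j < q" for i j
  proof -
    have "i j < length p - 1" using that by (auto simp: PiE_iff)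
    then have "Suc (i j) < length p" by linarith
    then show ?thesis by (intro sorted_wrt_nth_less[OF p]) auto
  qed
  have nonneg: "(\<Prod>j<q. p ! Suc (i j) - p ! i j) \<ge> 0" if "i \<in> ?I" for i
    using that by (intro prod_nonneg ballI) (simp add: lt less_imp_le)
  have PP: "P i x * P k x = (if k = i then P i x else 0)" if i: "i \<in> ?I" and k: "k \<in> ?I" for i k x
  proof (cases "k = i")
    case True
    have "P i x * P i x = P i x" unfolding P_def prod.distrib[symmetric] by (intro prod.cong) (auto simp: indicator_def)
    with True show ?thesis by simp
  next
    case False
    then obtain j where j: "j < q" "k j \<noteq> i j" using PiE_ext[OF k i] by blast
    have sep: "\<not> (p ! a \<le> x j \<and> x j < p ! Suc a \<and> p ! b \<le> x j \<and> x j < p ! Suc b)" if "a < b" "b < length p - 1" for a b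
    proof -
      have "Suc a \<le> b" "Suc a < length p" "b < length p" using that by linarith+
      then show ?thesis using sorted_wrt_less_nth_le_iff[OF p, of "Suc a" b] by auto
    qed
    have "k j < length p - 1" "i j < length p - 1" using that j by (auto simp: PiE_iff)
    then have "indicator {p ! (i j) ..< p ! Suc (i j)} (x j) * indicator {p ! (k j) ..< p ! Suc (k j)} (x j) = (0::real)"
      using sep[of "i j" "k j"] sep[of "k j" "i j"] j(2) by (cases "i j < k j") (auto simp: indicator_def)
    then have "(\<Prod>j<q. indicator {p ! (i j) ..< p ! Suc (i j)} (x j) * indicator {p ! (k j) ..< p ! Suc (k j)} (x j)) = (0::real)"
      using j by (intro prod_zero) auto
    with False show ?thesis unfolding P_def prod.distrib by simp
  qed
  have sq: "(elem_fun q p c x)\<^sup>2 = (\<Sum>i\<in>?I. (c i)\<^sup>2 * P i x)" for x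
  proof -
    have "(elem_fun q p c x)\<^sup>2 = (\<Sum>i\<in>?I. \<Sum>k\<in>?I. c i * c k * (P i x * P k x))"
      unfolding elem_fun_def P_def power2_eq_square sum_product by (intro sum.cong refl) (simp add: mult_ac)
    also have "\<dots> = (\<Sum>i\<in>?I. \<Sum>k\<in>?I. if k = i then (c i)\<^sup>2 * P i x else 0)"
      by (intro sum.cong refl) (auto simp: PP power2_eq_square)
    also have "\<dots> = (\<Sum>i\<in>?I. (c i)\<^sup>2 * P i x)" by (intro sum.cong refl) (simp add: sum.delta')
    finally show ?thesis .
  qed
  have P0: "P i x \<ge> 0" for i x unfolding P_def by (intro prod_nonneg) auto
  have [measurable]: "P i \<in> borel_measurable (lebesgue_pow q)" for i unfolding P_def by measurable
  have "(\<integral>\<^sup>+x. ennreal ((elem_fun q p c x)\<^sup>2) \<partial>lebesgue_pow q) = (\<integral>\<^sup>+x. (\<Sum>i\<in>?I. ennreal ((c i)\<^sup>2) * ennreal (P i x)) \<partial>lebesgue_pow q)"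
    unfolding sq by (intro nn_integral_cong) (simp add: P0 ennreal_mult[symmetric] sum_ennreal)
  also have "\<dots> = (\<Sum>i\<in>?I. ennreal ((c i)\<^sup>2) * (\<integral>\<^sup>+x. ennreal (P i x) \<partial>lebesgue_pow q))"
    by (subst nn_integral_sum) (auto simp: nn_integral_cmult)
  also have "\<dots> = (\<Sum>i\<in>?I. ennreal ((c i)\<^sup>2 * (\<Prod>j<q. p ! Suc (i j) - p ! i j)))"
  proof (intro sum.cong refl)
    fix i assume i: "i \<in> ?I"
    have "(\<integral>\<^sup>+x. ennreal (P i x) \<partial>lebesgue_pow q) = (\<integral>\<^sup>+x. (\<Prod>j<q. indicator {p ! (i j) ..< p ! Suc (i j)} (x j)) \<partial>lebesgue_pow q)"
      unfolding P_def by (intro nn_integral_cong) (simp add: prod_ennreal[symmetric] ennreal_indicator)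
    also have "\<dots> = (\<Prod>j<q. \<integral>\<^sup>+y. indicator {p ! (i j) ..< p ! Suc (i j)} y \<partial>lborel)"
      by (rule product_nn_integral_prod) auto
    also have "\<dots> = (\<Prod>j<q. ennreal (p ! Suc (i j) - p ! i j))"
      using i by (intro prod.cong refl)
        (simp add: lt less_imp_le)
    also have "\<dots> = ennreal (\<Prod>j<q. p ! Suc (i j) - p ! i j)"
      using i by (intro prod_ennreal) (simp add: lt less_imp_le)
    finally show "ennreal ((c i)\<^sup>2) * (\<integral>\<^sup>+x. ennreal (P i x) \<partial>lebesgue_pow q) = ennreal ((c i)\<^sup>2 * (\<Prod>j<q. p ! Suc (i j) - p ! i j))"
      by (simp add: ennreal_mult nonneg[OF i])
  qed
  also have "\<dots> = ennreal (elem_norm2 q p c)"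
    unfolding elem_norm2_def by (intro sum_ennreal mult_nonneg_nonneg nonneg) auto
  finally show ?thesis .
qed

text \<open>Independence and normality of the increments in the form of a product law. The standard
  deviation \<open>1\<close> off the index range is a filler:
  \<open>gaussian_hypercontractivity\<close> asks for positivity at every index.\<close>

lemma BM_increments_distr:
  assumes BM: "two_sided_BM M B" and p: "sorted_wrt (<) p" and n: "length p - 1 \<ge> 1"
  shows "distr M (\<Pi>\<^sub>M l\<in>{..<length p - 1}. borel) (\<lambda>\<omega>. \<lambda>l\<in>{..<length p - 1}. B (p ! Suc l) \<omega> - B (p ! l) \<omega>)
    = (\<Pi>\<^sub>M l\<in>{..<length p - 1}. gauss (if l < length p - 1 then sqrt (p ! Suc l - p ! l) else 1))"
proof -
  interpret prob_space M using BM by (simp add: two_sided_BM_def)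
  have [measurable]: "B t \<in> borel_measurable M" for t using BM by (simp add: two_sided_BM_def)
  let ?X = "\<lambda>l \<omega>. B (p ! Suc l) \<omega> - B (p ! l) \<omega>"
  have ind: "indep_vars (\<lambda>_. borel) ?X {..<length p - 1}" using BM p by (simp add: two_sided_BM_def)
  have dist: "distr M borel (?X l) = gauss (sqrt (p ! Suc l - p ! l))" if "l < length p - 1" for l
  proof -
    have "distributed M lborel (?X l) (\<lambda>x. ennreal (normal_density 0 (sqrt (p ! Suc l - p ! l)) x))"
      using BM p that by (simp add: two_sided_BM_def)
    then have "distr M lborel (?X l) = gauss (sqrt (p ! Suc l - p ! l))"
      unfolding gauss_def by (rule distributed_distr_eq_density[symmetric, THEN sym])
    moreover have "distr M lborel (?X l) = distr M borel (?X l)" by (rule distr_cong) auto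
    ultimately show ?thesis by simp
  qed
  have "{..<length p - 1} \<noteq> {}" using n by (metis lessThan_empty_iff not_one_le_zero)
  then have "distr M (\<Pi>\<^sub>M l\<in>{..<length p - 1}. borel) (\<lambda>\<omega>. \<lambda>l\<in>{..<length p - 1}. ?X l \<omega>) = (\<Pi>\<^sub>M l\<in>{..<length p - 1}. distr M borel (?X l))"
    using ind by (subst (asm) indep_vars_iff_distr_eq_PiM') auto
  also have "\<dots> = (\<Pi>\<^sub>M l\<in>{..<length p - 1}. gauss (if l < length p - 1 then sqrt (p ! Suc l - p ! l) else 1))"
    by (intro PiM_cong refl) (simp add: dist)
  finally show ?thesis .
qed

text \<open>Since the coefficients vanish on diagonals, no increment occurs twice in a monomial: the
  integral is a polynomial in independent Gaussian variables, of degree at most one in each, and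
  hypercontractivity applies. Each surviving monomial has \<open>q\<close> variables, whence
  \<open>(2*n-1)^q\<close>; merging the monomials with the same variables costs \<open>q^q\<close>
  by Cauchy-Schwarz.\<close>

lemma elem_int_moment:
  assumes BM: "two_sided_BM M B" and adm: "elem_admissible q p c" and q: "q \<ge> 1" and n: "n \<ge> 1"
  shows "(\<integral>\<^sup>+\<omega>. ennreal ((elem_int q p c B \<omega>)^(2*n)) \<partial>M)
    \<le> ennreal ((real (q^q) * real (2*n-1)^q * elem_norm2 q p c)^n)"
proof (cases "length p - 1 \<ge> 1")
  \<comment> \<open>A list without cells: because \<open>q \<ge> 1\<close> there is no index map,
    and the integral is the empty sum.\<close>
  case False
  then have "{..<q} \<rightarrow>\<^sub>E {..<length p - 1} = {}"
    using q by (auto simp: PiE_eq_empty_iff not_le lessThan_empty_iff intro!: exI[of _ 0])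
  then have "elem_int q p c B \<omega> = 0" for \<omega> unfolding elem_int_def by simp
  then show ?thesis using n by (simp add: power_0_left)
next
  case True
  have p: "sorted_wrt (<) p" using adm by (simp add: elem_admissible_def)
  have [measurable]: "B t \<in> borel_measurable M" for t using BM by (simp add: two_sided_BM_def)
  define N where "N = length p - 1"
  let ?I = "{..<q} \<rightarrow>\<^sub>E {..<N}"
  define J where "J = {i\<in>?I. inj_on i {..<q}}"
  define s where "s l = (if l < N then sqrt (p ! Suc l - p ! l) else 1)" for l
  \<comment> \<open>The coefficient of the monomial with variable set \<open>S\<close>, to which all
    enumerations of \<open>S\<close> contribute as the kernel is not symmetric.\<close>
  define d where "d S = (\<Sum>i | i \<in> J \<and> i ` {..<q} = S. c i)" for S
  define X where "X \<omega> = (\<lambda>l\<in>{..<N}. B (p ! Suc l) \<omega> - B (p ! l) \<omega>)" for \<omega>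
  have inc: "p ! Suc l - p ! l > 0" if "l < N" for l
    using sorted_wrt_nth_less[OF p, of l "Suc l"] that by (simp add: N_def)
  have s: "s l > 0" for l using inc by (simp add: s_def)
  have s2: "(s l)\<^sup>2 = p ! Suc l - p ! l" if "l < N" for l using inc[OF that] that by (simp add: s_def)
  have finJ[simp]: "finite J" unfolding J_def by simp
  have JI: "i j < N" if "i \<in> J" "j < q" for i j using that by (auto simp: J_def PiE_iff)
  have grp: "(\<Sum>S\<in>Pow {..<N}. \<Sum>i | i \<in> J \<and> i ` {..<q} = S. h i) = (\<Sum>i\<in>J. h i)" for h :: "(nat \<Rightarrow> nat) \<Rightarrow> real"
    using sum.group[of J "Pow {..<N}" "\<lambda>i. i ` {..<q}" h] by (auto simp: JI image_subset_iff)
  have prodJ: "(\<Prod>l\<in>i ` {..<q}. y l) = (\<Prod>j<q. y (i j))" if "i \<in> J" for i and y :: "nat \<Rightarrow> real"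
    using that by (subst prod.reindex) (auto simp: J_def)
  have poly: "elem_int q p c B \<omega> = (\<Sum>S\<in>Pow {..<N}. d S * (\<Prod>l\<in>S. X \<omega> l))" for \<omega>
  proof -
    have "elem_int q p c B \<omega> = (\<Sum>i\<in>?I. c i * (\<Prod>j<q. X \<omega> (i j)))"
      unfolding elem_int_def N_def[symmetric] by (intro sum.cong refl arg_cong2[of _ _ _ _ "(*)"] prod.cong) (auto simp: X_def PiE_iff)
    also have "\<dots> = (\<Sum>i\<in>J. c i * (\<Prod>j<q. X \<omega> (i j)))"
      using adm by (intro sum.mono_neutral_right) (auto simp: J_def elem_admissible_def N_def)
    also have "\<dots> = (\<Sum>i\<in>J. c i * (\<Prod>l\<in>i ` {..<q}. X \<omega> l))" by (simp add: prodJ)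
    also have "\<dots> = (\<Sum>S\<in>Pow {..<N}. \<Sum>i | i \<in> J \<and> i ` {..<q} = S. c i * (\<Prod>l\<in>i ` {..<q}. X \<omega> l))" by (rule grp[symmetric])
    also have "\<dots> = (\<Sum>S\<in>Pow {..<N}. d S * (\<Prod>l\<in>S. X \<omega> l))"
      unfolding d_def sum_distrib_right by (intro sum.cong refl) auto
    finally show ?thesis .
  qed
  have Xm: "X \<in> M \<rightarrow>\<^sub>M (\<Pi>\<^sub>M l\<in>{..<N}. borel)" unfolding X_def by measurable
  have dX: "distr M (\<Pi>\<^sub>M l\<in>{..<N}. borel) X = (\<Pi>\<^sub>M l\<in>{..<N}. gauss (s l))"
    using BM_increments_distr[OF BM p True] unfolding X_def s_def N_def .
  have pm: "(\<lambda>x. ennreal ((\<Sum>S\<in>Pow {..<N}. d S * (\<Prod>l\<in>S. x l))^(2*n))) \<in> borel_measurable (\<Pi>\<^sub>M l\<in>{..<N}. (borel::real measure))"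
    by (intro measurable_compose[OF _ measurable_ennreal] borel_measurable_power borel_measurable_sum borel_measurable_times borel_measurable_prod)
      (auto intro!: measurable_component_singleton[THEN measurable_compose, where g="\<lambda>x. x"])
  have "(\<integral>\<^sup>+\<omega>. ennreal ((elem_int q p c B \<omega>)^(2*n)) \<partial>M)
      = (\<integral>\<^sup>+x. ennreal ((\<Sum>S\<in>Pow {..<N}. d S * (\<Prod>l\<in>S. x l))^(2*n)) \<partial>distr M (\<Pi>\<^sub>M l\<in>{..<N}. borel) X)"
    unfolding poly by (rule nn_integral_distr[symmetric, OF Xm]) (use pm in simp)
  also have "\<dots> \<le> ennreal ((\<Sum>S\<in>Pow {..<N}. (d S)\<^sup>2 * (\<Prod>l\<in>S. real (2*n-1) * (s l)\<^sup>2))^n)"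
    unfolding dX by (rule gaussian_hypercontractivity[OF n s]) simp
  also have "\<dots> \<le> ennreal ((real (q^q) * real (2*n-1)^q * elem_norm2 q p c)^n)"
  proof (intro ennreal_leI power_mono sum_nonneg mult_nonneg_nonneg prod_nonneg ballI)
    have "(\<Sum>S\<in>Pow {..<N}. (d S)\<^sup>2 * (\<Prod>l\<in>S. real (2*n-1) * (s l)\<^sup>2))
      \<le> (\<Sum>S\<in>Pow {..<N}. \<Sum>i | i \<in> J \<and> i ` {..<q} = S. real (q^q) * (c i)\<^sup>2 * (\<Prod>j<q. real (2*n-1) * (s (i j))\<^sup>2))"
    proof (rule sum_mono)
      fix S assume S: "S \<in> Pow {..<N}"
      let ?JS = "{i. i \<in> J \<and> i ` {..<q} = S}"
      \<comment> \<open>Every member of \<open>?JS\<close> maps \<open>{..<q}\<close> into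
        \<open>S\<close>, a set with \<open>q\<close> elements; \<open>q^q\<close> counts all such
        maps.\<close>
      have card: "real (card ?JS) \<le> real (q^q)"
      proof (cases "?JS = {}")
        case False
        then obtain i0 where "i0 \<in> J" "i0 ` {..<q} = S" by blast
        moreover from this have "inj_on i0 {..<q}" by (simp add: J_def)
        ultimately have "card S = q" using card_image[of i0 "{..<q}"] by simp
        moreover have "finite S" using S finite_subset by auto
        moreover have "?JS \<subseteq> {..<q} \<rightarrow>\<^sub>E S" by (auto simp: J_def PiE_iff extensional_def)
        ultimately have "card ?JS \<le> q ^ q"
          using card_mono[of "{..<q} \<rightarrow>\<^sub>E S" ?JS] by (simp add: card_PiE finite_PiE)
        then show ?thesis by (simp only: of_nat_le_iff)
      next
        case True
        show ?thesis unfolding True by simp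
      qed
      have "(d S)\<^sup>2 \<le> real (card ?JS) * (\<Sum>i\<in>?JS. (c i)\<^sup>2)"
        unfolding d_def using sum_squared_le_sum_of_squares[of c ?JS] by (simp add: mult.commute)
      also have "\<dots> \<le> real (q^q) * (\<Sum>i\<in>?JS. (c i)\<^sup>2)" by (intro mult_right_mono card sum_nonneg) auto
      finally have "(d S)\<^sup>2 * (\<Prod>l\<in>S. real (2*n-1) * (s l)\<^sup>2) \<le> real (q^q) * (\<Sum>i\<in>?JS. (c i)\<^sup>2) * (\<Prod>l\<in>S. real (2*n-1) * (s l)\<^sup>2)"
        by (intro mult_right_mono prod_nonneg) auto
      also have "\<dots> = (\<Sum>i\<in>?JS. real (q^q) * (c i)\<^sup>2 * (\<Prod>l\<in>i ` {..<q}. real (2*n-1) * (s l)\<^sup>2))"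
        unfolding sum_distrib_left sum_distrib_right by (intro sum.cong) auto
      also have "\<dots> = (\<Sum>i\<in>?JS. real (q^q) * (c i)\<^sup>2 * (\<Prod>j<q. real (2*n-1) * (s (i j))\<^sup>2))"
      proof (intro sum.cong refl)
        fix i assume "i \<in> ?JS"
        then have "i \<in> J" by simp
        then show "real (q^q) * (c i)\<^sup>2 * (\<Prod>l\<in>i ` {..<q}. real (2*n-1) * (s l)\<^sup>2)
          = real (q^q) * (c i)\<^sup>2 * (\<Prod>j<q. real (2*n-1) * (s (i j))\<^sup>2)"
          by (simp only: prodJ)
      qed
      finally show "(d S)\<^sup>2 * (\<Prod>l\<in>S. real (2*n-1) * (s l)\<^sup>2) \<le> (\<Sum>i\<in>?JS. real (q^q) * (c i)\<^sup>2 * (\<Prod>j<q. real (2*n-1) * (s (i j))\<^sup>2))" .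
    qed
    also have "\<dots> = (\<Sum>i\<in>J. real (q^q) * (c i)\<^sup>2 * (\<Prod>j<q. real (2*n-1) * (s (i j))\<^sup>2))" by (rule grp)
    also have "\<dots> = (\<Sum>i\<in>J. real (q^q) * real (2*n-1)^q * ((c i)\<^sup>2 * (\<Prod>j<q. p ! Suc (i j) - p ! i j)))"
    proof (intro sum.cong refl)
      fix i assume i: "i \<in> J"
      have "(\<Prod>j<q. real (2*n-1) * (s (i j))\<^sup>2) = (\<Prod>j<q. real (2*n-1)) * (\<Prod>j<q. p ! Suc (i j) - p ! i j)"
        unfolding prod.distrib[symmetric] using i by (intro prod.cong refl) (simp add: s2 JI)
      then show "real (q^q) * (c i)\<^sup>2 * (\<Prod>j<q. real (2*n-1) * (s (i j))\<^sup>2) = real (q^q) * real (2*n-1)^q * ((c i)\<^sup>2 * (\<Prod>j<q. p ! Suc (i j) - p ! i j))"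
        by simp
    qed
    also have "\<dots> \<le> (\<Sum>i\<in>?I. real (q^q) * real (2*n-1)^q * ((c i)\<^sup>2 * (\<Prod>j<q. p ! Suc (i j) - p ! i j)))"
    proof (rule sum_mono2)
      show "J \<subseteq> ?I" unfolding J_def by blast
      fix i assume "i \<in> ?I - J"
      then have "p ! Suc (i j) - p ! i j \<ge> 0" if "j < q" for j
        using that inc[of "i j"] by (auto simp: PiE_iff)
      then show "0 \<le> real (q^q) * real (2*n-1)^q * ((c i)\<^sup>2 * (\<Prod>j<q. p ! Suc (i j) - p ! i j))"
        by (intro mult_nonneg_nonneg prod_nonneg ballI) auto
    qed simp
    also have "\<dots> = real (q^q) * real (2*n-1)^q * elem_norm2 q p c"
      unfolding elem_norm2_def N_def[symmetric] by (rule sum_distrib_left[symmetric])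
    finally show "(\<Sum>S\<in>Pow {..<N}. (d S)\<^sup>2 * (\<Prod>l\<in>S. real (2*n-1) * (s l)\<^sup>2)) \<le> real (q^q) * real (2*n-1)^q * elem_norm2 q p c" .
  qed auto
  finally show ?thesis .
qed

section \<open>Density of elementary kernels\<close>

text \<open>Boxes with different indices are disjoint, so only the one containing \<open>x\<close>
  contributes.\<close>

lemma elem_fun_at:
  assumes p: "sorted_wrt (<) p" and l: "l \<in> {..<q} \<rightarrow>\<^sub>E {..<length p - 1}"
    and x: "\<And>j. j < q \<Longrightarrow> p ! l j \<le> x j \<and> x j < p ! Suc (l j)"
  shows "elem_fun q p c x = c l"
proof -
  let ?I = "{..<q} \<rightarrow>\<^sub>E {..<length p - 1}"
  have "elem_fun q p c x = (\<Sum>i\<in>{l}. c i * (\<Prod>j<q. indicator {p ! (i j) ..< p ! Suc (i j)} (x j)))"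
    unfolding elem_fun_def
  proof (intro sum.mono_neutral_right ballI)
    fix i assume i: "i \<in> ?I - {l}"
    then have i': "i \<in> ?I" "i \<noteq> l" by blast+
    obtain j where j: "j < q" "i j \<noteq> l j" using PiE_ext[OF i'(1) l] i'(2) by blast
    have sep: "\<not> (p ! a \<le> x j \<and> x j < p ! Suc a \<and> p ! b \<le> x j \<and> x j < p ! Suc b)" if "a < b" "b < length p - 1" for a b
    proof -
      have "Suc a \<le> b" "Suc a < length p" "b < length p" using that by linarith+
      then show ?thesis using sorted_wrt_less_nth_le_iff[OF p, of "Suc a" b] by auto
    qed
    have "i j < length p - 1" "l j < length p - 1" using i l j by (auto simp: PiE_iff)
    then have "indicator {p ! (i j) ..< p ! Suc (i j)} (x j) = (0::real)"
      using sep[of "i j" "l j"] sep[of "l j" "i j"] x[OF j(1)] j(2)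
      by (cases "i j < l j") (auto simp: indicator_def)
    then have "(\<Prod>j<q. indicator {p ! (i j) ..< p ! Suc (i j)} (x j)) = (0::real)"
      using j by (intro prod_zero) auto
    then show "c i * (\<Prod>j<q. indicator {p ! (i j) ..< p ! Suc (i j)} (x j)) = 0" by simp
  qed (use l in auto)
  also have "\<dots> = c l * (\<Prod>j<q. 1)" using x by (simp add: indicator_def)
  finally show ?thesis by simp
qed

section \<open>Grids approximating orthants inside a cube\<close>

definition cube :: "nat \<Rightarrow> nat \<Rightarrow> (nat \<Rightarrow> real) set" where
  "cube q m = {x. \<forall>j<q. - real m \<le> x j \<and> x j < real m}"

definition grid :: "nat \<Rightarrow> nat \<Rightarrow> real list" where
  "grid m n = map (\<lambda>i. real i / real n - real m) [0..<Suc (2*m*n)]"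

lemma length_grid [simp]: "length (grid m n) = Suc (2*m*n)"
  by (simp add: grid_def)

lemma nth_grid: "i \<le> 2*m*n \<Longrightarrow> grid m n ! i = real i / real n - real m"
  by (simp add: grid_def nth_append del: upt_Suc)

lemma sorted_grid: "n \<ge> 1 \<Longrightarrow> sorted_wrt (<) (grid m n)"
  by (auto simp: sorted_wrt_iff_nth_less nth_grid divide_strict_right_mono)

text \<open>Selects the off-diagonal boxes lying below \<open>a\<close> with their right end points
  included. This approximation from inside also gives the right value \<open>0\<close> at points
  with \<open>x j = a j\<close> for some \<open>j\<close>.\<close>

definition grid_coeff :: "nat \<Rightarrow> (nat \<Rightarrow> real) \<Rightarrow> nat \<Rightarrow> nat \<Rightarrow> (nat \<Rightarrow> nat) \<Rightarrow> real" where
  "grid_coeff q a m n l = (if inj_on l {..<q} \<and> (\<forall>j<q. grid m n ! Suc (l j) \<le> a j) then 1 else 0)"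

lemma grid_admissible: "n \<ge> 1 \<Longrightarrow> elem_admissible q (grid m n) (grid_coeff q a m n)"
  by (simp add: elem_admissible_def sorted_grid grid_coeff_def)

definition grid_index :: "nat \<Rightarrow> (nat \<Rightarrow> real) \<Rightarrow> nat \<Rightarrow> nat \<Rightarrow> nat \<Rightarrow> nat" where
  "grid_index q x m n = (\<lambda>j\<in>{..<q}. nat \<lfloor>(x j + real m) * real n\<rfloor>)"

lemma grid_index:
  assumes x: "x \<in> cube q m" and n: "n \<ge> 1"
  shows "grid_index q x m n \<in> {..<q} \<rightarrow>\<^sub>E {..<length (grid m n) - 1}"
    and "j < q \<Longrightarrow> grid m n ! grid_index q x m n j \<le> x j \<and> x j < grid m n ! Suc (grid_index q x m n j)"
    and "j < q \<Longrightarrow> grid m n ! Suc (grid_index q x m n j) \<le> x j + 1 / real n"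
proof -
  have A: "real (grid_index q x m n j) \<le> (x j + real m) * real n \<and> (x j + real m) * real n < real (grid_index q x m n j) + 1
     \<and> grid_index q x m n j < 2*m*n" if j: "j < q" for j
  proof -
    have xj: "- real m \<le> x j" "x j < real m" using x j by (auto simp: cube_def)
    have "0 \<le> (x j + real m) * real n" using xj by (intro mult_nonneg_nonneg) auto
    moreover have "(x j + real m) * real n < (real m + real m) * real n"
      using xj n by (intro mult_strict_right_mono) auto
    ultimately have *: "0 \<le> \<lfloor>(x j + real m) * real n\<rfloor>" "\<lfloor>(x j + real m) * real n\<rfloor> < int (2*m*n)"
      by (auto simp: floor_less_iff)
    then have "real (grid_index q x m n j) = of_int \<lfloor>(x j + real m) * real n\<rfloor>" using j by (simp add: grid_index_def)
    moreover have "grid_index q x m n j < 2*m*n" using j * by (simp add: grid_index_def nat_less_iff)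
    ultimately show ?thesis by linarith
  qed
  show "grid_index q x m n \<in> {..<q} \<rightarrow>\<^sub>E {..<length (grid m n) - 1}"
    using A by (auto simp: PiE_iff) (simp add: grid_index_def)
  show "grid m n ! grid_index q x m n j \<le> x j \<and> x j < grid m n ! Suc (grid_index q x m n j)"
    and "grid m n ! Suc (grid_index q x m n j) \<le> x j + 1 / real n" if j: "j < q"
  proof -
    have le: "real (grid_index q x m n j) / real n \<le> x j + real m" using A[OF j] n by (simp add: divide_le_eq)
    moreover have "x j + real m < (real (grid_index q x m n j) + 1) / real n" using A[OF j] n by (simp add: less_divide_eq)
    ultimately show "grid m n ! grid_index q x m n j \<le> x j \<and> x j < grid m n ! Suc (grid_index q x m n j)"
      using A[OF j] by (simp add: nth_grid add.commute)
    show "grid m n ! Suc (grid_index q x m n j) \<le> x j + 1 / real n"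
      using A[OF j] le by (simp add: nth_grid add_divide_distrib)
  qed
qed

lemma elem_fun_grid_outside:
  assumes "x \<notin> cube q m" "n \<ge> 1"
  shows "elem_fun q (grid m n) c x = 0"
  unfolding elem_fun_def
proof (intro sum.neutral ballI)
  fix i assume i: "i \<in> {..<q} \<rightarrow>\<^sub>E {..<length (grid m n) - 1}"
  obtain j where j: "j < q" "\<not> (- real m \<le> x j \<and> x j < real m)" using assms by (auto simp: cube_def)
  have "i j < length (grid m n) - 1" using PiE_mem[OF i, of j] j by simp
  then have ij: "Suc (i j) \<le> 2*m*n" by simp
  have "grid m n ! i j \<ge> - real m" using ij by (simp add: nth_grid)
  moreover have "grid m n ! Suc (i j) \<le> real m"
  proof -
    have "real (Suc (i j)) \<le> real (2*m*n)" using ij by (simp only: of_nat_le_iff)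
    then have "real (Suc (i j)) / real n \<le> 2 * real m" using assms(2) by (simp add: divide_le_eq mult_ac)
    then show ?thesis using ij by (simp add: nth_grid)
  qed
  ultimately have "indicator {grid m n ! (i j) ..< grid m n ! Suc (i j)} (x j) = (0::real)"
    using j by (auto simp: indicator_def)
  then have "(\<Prod>j<q. indicator {grid m n ! (i j) ..< grid m n ! Suc (i j)} (x j)) = (0::real)"
    using j by (intro prod_zero) auto
  then show "c i * (\<Prod>j<q. indicator {grid m n ! (i j) ..< grid m n ! Suc (i j)} (x j)) = 0" by simp
qed

text \<open>Off the diagonals the cells of a fine grid separate the coordinates, so discarding the diagonal
  cells does not affect the pointwise limit.\<close>
lemma elem_fun_grid_tendsto:
  assumes off: "inj_on x {..<q}"
  shows "(\<lambda>n. elem_fun q (grid m (Suc n)) (grid_coeff q a m (Suc n)) x)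
    \<longlonglongrightarrow> indicator ({x. \<forall>j<q. x j < a j} \<inter> cube q m) x"
proof (cases "x \<in> cube q m")
  case False
  then show ?thesis by (simp add: elem_fun_grid_outside)
next
  case True
  have small: "\<forall>\<^sub>F n in sequentially. 1 / real (Suc n) < e" if "e > 0" for e :: real
    using order_tendstoD(2)[OF LIMSEQ_inverse_real_of_nat[unfolded inverse_eq_divide] that] .
  have sep: "\<forall>\<^sub>F n in sequentially. \<forall>j\<in>{..<q}. \<forall>k\<in>{..<q}. j \<noteq> k \<longrightarrow> 1 / real (Suc n) < \<bar>x j - x k\<bar>"
  proof (intro eventually_ball_finite ballI finite_lessThan)
    fix j k assume "j \<in> {..<q}" "k \<in> {..<q}"
    show "\<forall>\<^sub>F n in sequentially. j \<noteq> k \<longrightarrow> 1 / real (Suc n) < \<bar>x j - x k\<bar>"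
    proof (cases "j = k")
      case False
      then have "\<bar>x j - x k\<bar> > 0" using off \<open>j \<in> _\<close> \<open>k \<in> _\<close> by (auto dest: inj_onD)
      from small[OF this] show ?thesis by eventually_elim simp
    qed simp
  qed
  \<comment> \<open>If \<open>x j < a j\<close>, the right end point of the cell of
    \<open>x j\<close> eventually lies below \<open>a j\<close>. The converse holds for every mesh,
    as \<open>x j\<close> is strictly below that end point.\<close>
  have right: "\<forall>\<^sub>F n in sequentially. \<forall>j\<in>{..<q}. x j < a j \<longrightarrow> 1 / real (Suc n) < a j - x j"
  proof (intro eventually_ball_finite ballI finite_lessThan)
    fix j
    show "\<forall>\<^sub>F n in sequentially. x j < a j \<longrightarrow> 1 / real (Suc n) < a j - x j"
    proof (cases "x j < a j")
      case True
      then have "a j - x j > 0" by simp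
      from small[OF this] show ?thesis by eventually_elim simp
    qed simp
  qed
  have "\<forall>\<^sub>F n in sequentially. elem_fun q (grid m (Suc n)) (grid_coeff q a m (Suc n)) x = indicator ({x. \<forall>j<q. x j < a j} \<inter> cube q m) x"
    using sep right
  proof eventually_elim
    case (elim n)
    let ?l = "grid_index q x m (Suc n)"
    note gi = grid_index[OF True, of "Suc n", simplified]
    have val: "elem_fun q (grid m (Suc n)) (grid_coeff q a m (Suc n)) x = grid_coeff q a m (Suc n) ?l"
      using gi by (intro elem_fun_at sorted_grid) auto
    have inj: "inj_on ?l {..<q}"
    proof (rule inj_onI, rule ccontr)
      fix j k assume jk: "j \<in> {..<q}" "k \<in> {..<q}" "?l j = ?l k" "j \<noteq> k"
      then have "1 / real (Suc n) < \<bar>x j - x k\<bar>" using elim(1) by blast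
      moreover have "\<bar>x j - x k\<bar> \<le> 1 / real (Suc n)"
        using gi(2,3)[of j] gi(2,3)[of k] jk by auto
      ultimately show False by simp
    qed
    have "(\<forall>j<q. grid m (Suc n) ! Suc (?l j) \<le> a j) \<longleftrightarrow> (\<forall>j<q. x j < a j)"
    proof (intro all_cong)
      fix j assume j: "j < q"
      show "grid m (Suc n) ! Suc (?l j) \<le> a j \<longleftrightarrow> x j < a j"
        using gi(2,3)[OF j] bspec[OF elim(2), of j] j by auto
    qed
    then show ?case using True unfolding val grid_coeff_def by (simp add: inj indicator_def)
  qed
  then show ?thesis by (rule tendsto_eventually)
qed

lemma elem_fun_grid_bounds:
  assumes n: "n \<ge> 1"
  shows "\<bar>elem_fun q (grid m n) (grid_coeff q a m n) x\<bar> \<le> indicator (cube q m) x"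
proof (cases "x \<in> cube q m")
  case True
  have "elem_fun q (grid m n) (grid_coeff q a m n) x = grid_coeff q a m n (grid_index q x m n)"
    using grid_index[OF True n] by (intro elem_fun_at sorted_grid n) auto
  then show ?thesis using True by (simp add: grid_coeff_def)
next
  case False
  then show ?thesis using elem_fun_grid_outside[OF False n] by simp
qed

lemma product_sigma_finite_lborel: "product_sigma_finite (\<lambda>_::nat. lborel :: real measure)"
  by (intro product_sigma_finite.intro sigma_finite_lborel)

text \<open>With the other coordinates fixed, \<open>x j = x k\<close> leaves a single value for
  \<open>x j\<close>. Elementary kernels vanish on diagonal boxes, so their density in L2 rests on
  this fact.\<close>

lemma AE_off_diagonal: "AE x in lebesgue_pow q. inj_on x {..<q}"
proof -
  interpret product_sigma_finite "\<lambda>_::nat. lborel :: real measure" by (rule product_sigma_finite_lborel)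
  have "AE x in lebesgue_pow q. x j \<noteq> x k" if jk: "j < q" "k < q" "j \<noteq> k" for j k
  proof -
    have [measurable]: "(\<lambda>x. x j) \<in> borel_measurable (lebesgue_pow q)" "(\<lambda>x. x k) \<in> borel_measurable (lebesgue_pow q)"
      using jk measurable_component_singleton[of j "{..<q}" "\<lambda>_. lborel"] measurable_component_singleton[of k "{..<q}" "\<lambda>_. lborel"]
      by simp_all
    have meas: "{x\<in>space (lebesgue_pow q). x j = x k} \<in> sets (lebesgue_pow q)" by measurable
    have I: "insert j ({..<q} - {j}) = {..<q}" using jk by auto
    have "emeasure (lebesgue_pow q) {x\<in>space (lebesgue_pow q). x j = x k}
      = (\<integral>\<^sup>+x. indicator {x\<in>space (lebesgue_pow q). x j = x k} x \<partial>lebesgue_pow q)" using meas by simp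
    also have "\<dots> = (\<integral>\<^sup>+x. \<integral>\<^sup>+y. indicator {x\<in>space (lebesgue_pow q). x j = x k} (x(j := y)) \<partial>lborel \<partial>(\<Pi>\<^sub>M _\<in>{..<q} - {j}. (lborel::real measure)))"
      using product_nn_integral_insert[of "{..<q} - {j}" j "indicator {x\<in>space (lebesgue_pow q). x j = x k}"] meas unfolding I by simp
    also have "\<dots> \<le> (\<integral>\<^sup>+x. \<integral>\<^sup>+y. indicator {x k} y \<partial>lborel \<partial>(\<Pi>\<^sub>M _\<in>{..<q} - {j}. (lborel::real measure)))"
    proof (intro nn_integral_mono)
      show "indicator {x\<in>space (lebesgue_pow q). x j = x k} (x(j := y)) \<le> (indicator {x k} y :: ennreal)" for x y
        using jk by (auto simp: indicator_def)
    qed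
    also have "\<dots> = 0" by simp
    finally have "emeasure (lebesgue_pow q) {x\<in>space (lebesgue_pow q). x j = x k} = 0" by simp
    then have "{x\<in>space (lebesgue_pow q). x j = x k} \<in> null_sets (lebesgue_pow q)" using meas by blast
    then show ?thesis by (rule AE_I'[of _ _]) auto
  qed
  then have "AE x in lebesgue_pow q. \<forall>j\<in>{..<q}. \<forall>k\<in>{..<q}. j \<noteq> k \<longrightarrow> x j \<noteq> x k"
    by (intro AE_ball_countable[THEN iffD2] ballI countable_finite finite_lessThan) auto
  then show ?thesis by eventually_elim (auto simp: inj_on_def)
qed

lemma cube_measurable [measurable]: "{x\<in>space (lebesgue_pow q). x \<in> cube q m} \<in> sets (lebesgue_pow q)"
  unfolding cube_def mem_Collect_eq by measurable

lemma emeasure_cube: "emeasure (lebesgue_pow q) {x\<in>space (lebesgue_pow q). x \<in> cube q m} < \<infinity>"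
proof -
  interpret product_sigma_finite "\<lambda>_::nat. lborel :: real measure" by (rule product_sigma_finite_lborel)
  have "{x\<in>space (lebesgue_pow q). x \<in> cube q m} = ({..<q} \<rightarrow>\<^sub>E {- real m..<real m})"
  proof -
    have "x \<in> space (lebesgue_pow q) \<and> x \<in> cube q m \<longleftrightarrow> x \<in> extensional {..<q} \<and> (\<forall>j<q. - real m \<le> x j \<and> x j < real m)" for x
      by (simp add: space_PiM PiE_def cube_def)
    moreover have "x \<in> ({..<q} \<rightarrow>\<^sub>E {- real m..<real m}) \<longleftrightarrow> x \<in> extensional {..<q} \<and> (\<forall>j<q. - real m \<le> x j \<and> x j < real m)" for x
      by (auto simp: PiE_def Pi_def)
    ultimately show ?thesis by blast
  qed
  then show ?thesis by (simp add: emeasure_PiM ennreal_power less_top[symmetric])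
qed

section \<open>The closure of the elementary kernels in L2\<close>

definition approximable :: "nat \<Rightarrow> ((nat \<Rightarrow> real) \<Rightarrow> real) \<Rightarrow> bool" where
  "approximable q f \<longleftrightarrow> f \<in> borel_measurable (lebesgue_pow q) \<and> (\<forall>e>0. \<exists>p c. elem_admissible q p c \<and>
     (\<integral>\<^sup>+x. ennreal ((f x - elem_fun q p c x)\<^sup>2) \<partial>lebesgue_pow q) \<le> ennreal e)"

lemma square_add_le: "(x + y)\<^sup>2 \<le> 2 * x\<^sup>2 + 2 * y\<^sup>2" for x y :: real
  using sum_squares_bound[of x y] by (simp add: power2_sum)

lemma nn_integral_square_add_le:
  fixes u v :: "'a \<Rightarrow> real"
  assumes [measurable]: "u \<in> borel_measurable M" "v \<in> borel_measurable M"
  shows "(\<integral>\<^sup>+x. ennreal ((u x + v x)\<^sup>2) \<partial>M) \<le> 2 * (\<integral>\<^sup>+x. ennreal ((u x)\<^sup>2) \<partial>M) + 2 * (\<integral>\<^sup>+x. ennreal ((v x)\<^sup>2) \<partial>M)"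
proof -
  have "(\<integral>\<^sup>+x. ennreal ((u x + v x)\<^sup>2) \<partial>M) \<le> (\<integral>\<^sup>+x. 2 * ennreal ((u x)\<^sup>2) + 2 * ennreal ((v x)\<^sup>2) \<partial>M)"
  proof (rule nn_integral_mono)
    fix x
    have "ennreal ((u x + v x)\<^sup>2) \<le> ennreal (2 * (u x)\<^sup>2 + 2 * (v x)\<^sup>2)" by (intro ennreal_leI square_add_le)
    then show "ennreal ((u x + v x)\<^sup>2) \<le> 2 * ennreal ((u x)\<^sup>2) + 2 * ennreal ((v x)\<^sup>2)"
      by (simp add: ennreal_plus ennreal_mult)
  qed
  also have "\<dots> = 2 * (\<integral>\<^sup>+x. ennreal ((u x)\<^sup>2) \<partial>M) + 2 * (\<integral>\<^sup>+x. ennreal ((v x)\<^sup>2) \<partial>M)"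
    by (simp add: nn_integral_add nn_integral_cmult)
  finally show ?thesis .
qed

lemma nn_integral_square_cmult:
  fixes u :: "'a \<Rightarrow> real"
  assumes [measurable]: "u \<in> borel_measurable M"
  shows "(\<integral>\<^sup>+x. ennreal ((s * u x)\<^sup>2) \<partial>M) = ennreal (s\<^sup>2) * (\<integral>\<^sup>+x. ennreal ((u x)\<^sup>2) \<partial>M)"
  by (subst nn_integral_cmult[symmetric]) (auto simp: power_mult_distrib ennreal_mult)

lemma approximable_elem_fun: "elem_admissible q p c \<Longrightarrow> approximable q (elem_fun q p c)"
  unfolding approximable_def by (auto intro!: exI[of _ p] exI[of _ c])

lemma approximable_zero: "approximable q (\<lambda>_. 0)"
proof -
  have "elem_admissible q [] (\<lambda>_. 0)" by (simp add: elem_admissible_def)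
  from approximable_elem_fun[OF this] show ?thesis by (simp add: elem_fun_def[abs_def])
qed

lemma approximable_close:
  assumes [measurable]: "f \<in> borel_measurable (lebesgue_pow q)"
    and app: "\<And>e. e > 0 \<Longrightarrow> \<exists>h. approximable q h \<and> (\<integral>\<^sup>+x. ennreal ((f x - h x)\<^sup>2) \<partial>lebesgue_pow q) \<le> ennreal e"
  shows "approximable q f"
  unfolding approximable_def
proof (intro conjI allI impI)
  fix e :: real assume "e > 0"
  \<comment> \<open>Two errors of squared norm \<open>e/4\<close>, each doubled by
    \<open>square_add_le\<close>, add up to \<open>e\<close>.\<close>
  then have e: "e/4 > 0" by simp
  from app[OF e] obtain h where h: "approximable q h" "(\<integral>\<^sup>+x. ennreal ((f x - h x)\<^sup>2) \<partial>lebesgue_pow q) \<le> ennreal (e/4)" by blast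
  then obtain p c where pc: "elem_admissible q p c" "(\<integral>\<^sup>+x. ennreal ((h x - elem_fun q p c x)\<^sup>2) \<partial>lebesgue_pow q) \<le> ennreal (e/4)"
    using e unfolding approximable_def by blast
  have [measurable]: "h \<in> borel_measurable (lebesgue_pow q)" using h by (simp add: approximable_def)
  have "(\<integral>\<^sup>+x. ennreal ((f x - elem_fun q p c x)\<^sup>2) \<partial>lebesgue_pow q) = (\<integral>\<^sup>+x. ennreal (((f x - h x) + (h x - elem_fun q p c x))\<^sup>2) \<partial>lebesgue_pow q)"
    by simp
  also have "\<dots> \<le> 2 * (\<integral>\<^sup>+x. ennreal ((f x - h x)\<^sup>2) \<partial>lebesgue_pow q) + 2 * (\<integral>\<^sup>+x. ennreal ((h x - elem_fun q p c x)\<^sup>2) \<partial>lebesgue_pow q)"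
    by (rule nn_integral_square_add_le) measurable
  also have "\<dots> \<le> 2 * ennreal (e/4) + 2 * ennreal (e/4)" by (intro add_mono mult_left_mono h pc) auto
  also have "\<dots> = ennreal e"
  proof -
    have "2 * ennreal (e/4) = ennreal (2 * (e/4))" using e by (subst ennreal_mult) auto
    then show ?thesis using e by (simp add: ennreal_plus[symmetric] del: ennreal_plus)
  qed
  finally show "\<exists>p c. elem_admissible q p c \<and> (\<integral>\<^sup>+x. ennreal ((f x - elem_fun q p c x)\<^sup>2) \<partial>lebesgue_pow q) \<le> ennreal e"
    using pc by blast
qed fact

lemma approximable_lincomb:
  assumes f: "approximable q f" and g: "approximable q g"
  shows "approximable q (\<lambda>x. s * f x + t * g x)"
  unfolding approximable_def
proof (intro conjI allI impI)
  have [measurable]: "f \<in> borel_measurable (lebesgue_pow q)" "g \<in> borel_measurable (lebesgue_pow q)"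
    using f g by (simp_all add: approximable_def)
  show "(\<lambda>x. s * f x + t * g x) \<in> borel_measurable (lebesgue_pow q)" by measurable
  fix e :: real assume e: "e > 0"
  \<comment> \<open>The total factor that the two errors pick up, increased by \<open>1\<close> to
    stay positive when \<open>s\<close> and \<open>t\<close> are both \<open>0\<close>.\<close>
  define k where "k = 2 * (s\<^sup>2 + t\<^sup>2) + 1"
  have k: "k > 0" unfolding k_def by (simp add: add_nonneg_pos)
  define u where "u = e / k"
  have "u > 0" using e k by (simp add: u_def)
  with f obtain p c where
    pc: "elem_admissible q p c" "(\<integral>\<^sup>+x. ennreal ((f x - elem_fun q p c x)\<^sup>2) \<partial>lebesgue_pow q) \<le> ennreal (u)"
    unfolding approximable_def by blast
  from g \<open>u > 0\<close> obtain p' c' where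
    pc': "elem_admissible q p' c'" "(\<integral>\<^sup>+x. ennreal ((g x - elem_fun q p' c' x)\<^sup>2) \<partial>lebesgue_pow q) \<le> ennreal (u)"
    unfolding approximable_def by blast
  obtain r d where rd: "elem_admissible q r d" "\<And>x. elem_fun q r d x = s * elem_fun q p c x + t * elem_fun q p' c' x"
    using elem_lincomb[OF pc(1) pc'(1), of s t] by metis
  have "(\<integral>\<^sup>+x. ennreal ((s * f x + t * g x - elem_fun q r d x)\<^sup>2) \<partial>lebesgue_pow q)
     = (\<integral>\<^sup>+x. ennreal ((s * (f x - elem_fun q p c x) + t * (g x - elem_fun q p' c' x))\<^sup>2) \<partial>lebesgue_pow q)"
    by (simp add: rd algebra_simps)
  also have "\<dots> \<le> 2 * (\<integral>\<^sup>+x. ennreal ((s * (f x - elem_fun q p c x))\<^sup>2) \<partial>lebesgue_pow q) + 2 * (\<integral>\<^sup>+x. ennreal ((t * (g x - elem_fun q p' c' x))\<^sup>2) \<partial>lebesgue_pow q)"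
    by (rule nn_integral_square_add_le) measurable
  also have "\<dots> = 2 * (ennreal (s\<^sup>2) * (\<integral>\<^sup>+x. ennreal ((f x - elem_fun q p c x)\<^sup>2) \<partial>lebesgue_pow q)) + 2 * (ennreal (t\<^sup>2) * (\<integral>\<^sup>+x. ennreal ((g x - elem_fun q p' c' x)\<^sup>2) \<partial>lebesgue_pow q))"
    by (subst (1 2) nn_integral_square_cmult) simp_all
  also have "\<dots> \<le> 2 * (ennreal (s\<^sup>2) * ennreal (u)) + 2 * (ennreal (t\<^sup>2) * ennreal (u))"
    by (intro add_mono mult_left_mono pc pc') auto
  also have "\<dots> = ennreal (2 * (s\<^sup>2 * u) + 2 * (t\<^sup>2 * u))"
    using \<open>u > 0\<close> by (simp add: ennreal_plus ennreal_mult)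
  also have "\<dots> \<le> ennreal e"
  proof (rule ennreal_leI)
    have "2 * (s\<^sup>2 * u) + 2 * (t\<^sup>2 * u) = (k - 1) * u" by (simp add: k_def algebra_simps)
    also have "\<dots> \<le> e" using e k by (simp add: u_def field_simps)
    finally show "2 * (s\<^sup>2 * u) + 2 * (t\<^sup>2 * u) \<le> e" .
  qed
  finally show "\<exists>p c. elem_admissible q p c \<and> (\<integral>\<^sup>+x. ennreal ((s * f x + t * g x - elem_fun q p c x)\<^sup>2) \<partial>lebesgue_pow q) \<le> ennreal e"
    using rd(1) by blast
qed

text \<open>Dominated convergence for the squared errors: the limit inherits the bound
  \<open>w\<close> almost everywhere, so they are at most \<open>4 * w\<^sup>2\<close>.\<close>

lemma approximable_limit:
  assumes s: "\<And>n. approximable q (s n)" and [measurable]: "f \<in> borel_measurable (lebesgue_pow q)" "w \<in> borel_measurable (lebesgue_pow q)"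
    and conv: "AE x in lebesgue_pow q. (\<lambda>n. s n x) \<longlonglongrightarrow> f x"
    and dom: "\<And>n x. x \<in> space (lebesgue_pow q) \<Longrightarrow> \<bar>s n x\<bar> \<le> w x"
    and w: "(\<integral>\<^sup>+x. ennreal ((w x)\<^sup>2) \<partial>lebesgue_pow q) < \<infinity>"
  shows "approximable q f"
proof (rule approximable_close)
  have [measurable]: "\<And>n. s n \<in> borel_measurable (lebesgue_pow q)" using s by (simp add: approximable_def)
  have "(\<lambda>n. \<integral>\<^sup>+x. ennreal ((f x - s n x)\<^sup>2) \<partial>lebesgue_pow q) \<longlonglongrightarrow> (\<integral>\<^sup>+x. 0 \<partial>lebesgue_pow q)"
  proof (rule nn_integral_dominated_convergence[where w="\<lambda>x. 4 * ennreal ((w x)\<^sup>2)"])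
    show "AE x in lebesgue_pow q. ennreal ((f x - s n x)\<^sup>2) \<le> 4 * ennreal ((w x)\<^sup>2)" for n
      using conv AE_space
    proof eventually_elim
      case (elim x)
      have b: "\<bar>s k x\<bar> \<le> w x" for k using dom elim by blast
      have "\<bar>f x\<bar> \<le> w x" by (rule LIMSEQ_le_const2[OF tendsto_rabs[OF elim(1)]]) (use b in auto)
      then have "\<bar>f x - s n x\<bar> \<le> 2 * w x" using b[of n] by linarith
      then have "\<bar>f x - s n x\<bar>\<^sup>2 \<le> (2 * w x)\<^sup>2" by (intro power_mono) auto
      then have "ennreal ((f x - s n x)\<^sup>2) \<le> ennreal (4 * (w x)\<^sup>2)" by (intro ennreal_leI) (simp add: power_mult_distrib)
      then show ?case by (simp add: ennreal_mult)
    qed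
    show "(\<integral>\<^sup>+x. 4 * ennreal ((w x)\<^sup>2) \<partial>lebesgue_pow q) < \<infinity>"
      using w by (simp add: nn_integral_cmult ennreal_mult_eq_top_iff less_top[symmetric])
    show "AE x in lebesgue_pow q. (\<lambda>n. ennreal ((f x - s n x)\<^sup>2)) \<longlonglongrightarrow> 0"
      using conv
    proof eventually_elim
      case (elim x)
      have "(\<lambda>n. ennreal ((f x - s n x)\<^sup>2)) \<longlonglongrightarrow> ennreal ((f x - f x)\<^sup>2)"
        by (intro tendsto_ennrealI tendsto_intros elim)
      then show ?case by simp
    qed
  qed measurable
  then have small: "\<forall>\<^sub>F n in sequentially. (\<integral>\<^sup>+x. ennreal ((f x - s n x)\<^sup>2) \<partial>lebesgue_pow q) < ennreal e" if "e > 0" for e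
    using that by (intro order_tendstoD) auto
  show "\<exists>h. approximable q h \<and> (\<integral>\<^sup>+x. ennreal ((f x - h x)\<^sup>2) \<partial>lebesgue_pow q) \<le> ennreal e" if e: "e > 0" for e
  proof -
    obtain n where "(\<integral>\<^sup>+x. ennreal ((f x - s n x)\<^sup>2) \<partial>lebesgue_pow q) < ennreal e"
      using eventually_happens'[OF sequentially_bot small[OF e]] by blast
    with s[of n] show ?thesis by (intro exI[of _ "s n"]) auto
  qed
qed fact

lemma lessThan_countable_cover: "\<exists>S\<subseteq>range lessThan. countable S \<and> (UNIV::real set) = \<Union>S"
proof (intro exI conjI)
  show "range (\<lambda>n::nat. {..<real n}) \<subseteq> range lessThan" by auto
  show "countable (range (\<lambda>n::nat. {..<real n}))" by simp
  show "UNIV = \<Union> (range (\<lambda>n::nat. {..<real n}))" using reals_Archimedean2 by auto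
qed

text \<open>Lower orthants are the sets that grids approximate, and they are closed under
  intersection; as a generator they start a Dynkin induction.\<close>

lemma sets_lebesgue_pow_generator:
  "sets (lebesgue_pow q) = sigma_sets (space (lebesgue_pow q))
     (range (\<lambda>a. {x\<in>space (lebesgue_pow q). \<forall>j<q. x j < a j}))"
proof -
  have "sets (lebesgue_pow q) = sets (\<Pi>\<^sub>M _\<in>{..<q}. sigma (UNIV::real set) (range lessThan))"
    by (intro sets_PiM_cong refl) (simp add: borel_Iio[symmetric])
  also have "\<dots> = sets (sigma (\<Pi>\<^sub>E i\<in>{..<q}. UNIV) {{f\<in>(\<Pi>\<^sub>E i\<in>{..<q}. UNIV). \<forall>i\<in>j. f i \<in> A i} | A j. j \<in> {{..<q}} \<and> A \<in> Pi j (\<lambda>_. range lessThan)})"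
  proof (rule sets_PiM_sigma)
    show "\<exists>S\<subseteq>range lessThan. countable S \<and> (UNIV::real set) = \<Union>S" for i :: nat by (rule lessThan_countable_cover)
  qed auto
  also have "\<dots> = sigma_sets (\<Pi>\<^sub>E i\<in>{..<q}. UNIV) {{f\<in>(\<Pi>\<^sub>E i\<in>{..<q}. UNIV). \<forall>i\<in>j. f i \<in> A i} | A j. j \<in> {{..<q}} \<and> A \<in> Pi j (\<lambda>_. range lessThan)}"
    by (rule sets_measure_of) auto
  also have "{{f\<in>(\<Pi>\<^sub>E i\<in>{..<q}. UNIV). \<forall>i\<in>j. f i \<in> A i} | A j. j \<in> {{..<q}} \<and> A \<in> Pi j (\<lambda>_. range lessThan)}
    = range (\<lambda>a. {x\<in>space (lebesgue_pow q). \<forall>j<q. x j < (a j :: real)})"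
  proof (intro set_eqI iffI)
    fix Z assume "Z \<in> {{f\<in>(\<Pi>\<^sub>E i\<in>{..<q}. UNIV). \<forall>i\<in>j. f i \<in> A i} | A j. j \<in> {{..<q}} \<and> A \<in> Pi j (\<lambda>_. range (lessThan :: real \<Rightarrow> real set))}"
    then obtain A :: "nat \<Rightarrow> real set" where A: "Z = {f\<in>(\<Pi>\<^sub>E i\<in>{..<q}. UNIV). \<forall>i\<in>{..<q}. f i \<in> A i}" "\<forall>i\<in>{..<q}. A i \<in> range lessThan" by auto
    then have "\<forall>i\<in>{..<q}. \<exists>a. A i = {..<a}" by auto
    then obtain a where "\<forall>i\<in>{..<q}. A i = {..<a i}" by metis
    with A show "Z \<in> range (\<lambda>a. {x\<in>space (lebesgue_pow q). \<forall>j<q. x j < (a j :: real)})"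
      by (intro image_eqI[of _ _ a]) (auto simp: space_PiM)
  next
    fix Z assume "Z \<in> range (\<lambda>a. {x\<in>space (lebesgue_pow q). \<forall>j<q. x j < (a j :: real)})"
    then obtain a :: "nat \<Rightarrow> real" where "Z = {x\<in>space (lebesgue_pow q). \<forall>j<q. x j < a j}" by auto
    then show "Z \<in> {{f\<in>(\<Pi>\<^sub>E i\<in>{..<q}. UNIV). \<forall>i\<in>j. f i \<in> A i} | A j. j \<in> {{..<q}} \<and> A \<in> Pi j (\<lambda>_. range (lessThan :: real \<Rightarrow> real set))}"
      by (intro CollectI exI[of _ "\<lambda>i. {..<a i}"] exI[of _ "{..<q}"]) (auto simp: space_PiM)
  qed
  finally show ?thesis by (simp add: space_PiM)
qed

text \<open>A Dynkin induction over \<open>E\<close> starting from orthants, for which the grids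
  converge off the diagonals. The cube has finite measure, so its indicator is a square integrable
  majorant, also for the indicators of the partial unions.\<close>

lemma approximable_indicator:
  assumes E: "E \<in> sets (lebesgue_pow q)"
  shows "approximable q (indicator (E \<inter> cube q m))"
proof -
  let ?N = "lebesgue_pow q"
  let ?G = "range (\<lambda>a. {x\<in>space ?N. \<forall>j<q. x j < (a j :: real)})"
  have bm: "(\<lambda>x. indicator (A \<inter> cube q m) x :: real) \<in> borel_measurable ?N" if [measurable]: "A \<in> sets ?N" for A
  proof -
    have "(\<lambda>x. indicator (A \<inter> {x\<in>space ?N. x \<in> cube q m}) x :: real) \<in> borel_measurable ?N" by measurable
    also have "?this \<longleftrightarrow> ?thesis" by (rule measurable_cong) (auto simp: indicator_def)
    finally show ?thesis .
  qed
  have wm: "(\<lambda>x. indicator (cube q m) x :: real) \<in> borel_measurable ?N"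
  proof -
    have "(\<lambda>x. indicator (space ?N \<inter> cube q m) x :: real) \<in> borel_measurable ?N" by (rule bm) auto
    also have "?this \<longleftrightarrow> ?thesis" by (rule measurable_cong) (auto simp: indicator_def)
    finally show ?thesis .
  qed
  have wf: "(\<integral>\<^sup>+x. ennreal ((indicator (cube q m) x)\<^sup>2) \<partial>?N) < \<infinity>"
  proof -
    have "(\<integral>\<^sup>+x. ennreal ((indicator (cube q m) x)\<^sup>2) \<partial>?N) = (\<integral>\<^sup>+x. indicator {x\<in>space ?N. x \<in> cube q m} x \<partial>?N)"
      by (intro nn_integral_cong) (auto simp: indicator_def)
    also have "\<dots> = emeasure ?N {x\<in>space ?N. x \<in> cube q m}" by (rule nn_integral_indicator) measurable
    finally show ?thesis using emeasure_cube by simp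
  qed
  have basic: "approximable q (indicator ({x\<in>space ?N. \<forall>j<q. x j < a j} \<inter> cube q m))" for a
  proof (rule approximable_limit)
    show "approximable q (elem_fun q (grid m (Suc n)) (grid_coeff q a m (Suc n)))" for n
      by (intro approximable_elem_fun grid_admissible) simp
    show "(\<lambda>x. indicator ({x\<in>space ?N. \<forall>j<q. x j < a j} \<inter> cube q m) x :: real) \<in> borel_measurable ?N"
      by (rule bm) measurable
    show "AE x in ?N. (\<lambda>n. elem_fun q (grid m (Suc n)) (grid_coeff q a m (Suc n)) x) \<longlonglongrightarrow> indicator ({x\<in>space ?N. \<forall>j<q. x j < a j} \<inter> cube q m) x"
      using AE_off_diagonal AE_space
    proof eventually_elim
      case (elim x)
      then show ?case using elem_fun_grid_tendsto[of x q m a] by (simp add: indicator_def)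
    qed
    show "\<bar>elem_fun q (grid m (Suc n)) (grid_coeff q a m (Suc n)) x\<bar> \<le> indicator (cube q m) x" for n x
      by (rule elem_fun_grid_bounds) simp
  qed (use wm wf in auto)
  have full: "approximable q (indicator (space ?N \<inter> cube q m))"
  proof -
    have "{x\<in>space ?N. \<forall>j<q. x j < real m} \<inter> cube q m = space ?N \<inter> cube q m" by (auto simp: cube_def)
    with basic[of "\<lambda>_. real m"] show ?thesis by simp
  qed
  have IS: "Int_stable ?G"
    unfolding Int_stable_def
  proof (intro ballI)
    fix A A' assume "A \<in> ?G" "A' \<in> ?G"
    then obtain a b where "A = {x\<in>space ?N. \<forall>j<q. x j < (a j :: real)}" "A' = {x\<in>space ?N. \<forall>j<q. x j < b j}" by blast
    then have "A \<inter> A' = {x\<in>space ?N. \<forall>j<q. x j < min (a j) (b j)}" by auto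
    then show "A \<inter> A' \<in> ?G" by (intro image_eqI[of _ _ "\<lambda>j. min (a j) (b j)"]) auto
  qed
  have sub: "?G \<subseteq> Pow (space ?N)" by auto
  have E': "E \<in> sigma_sets (space ?N) ?G" using E unfolding sets_lebesgue_pow_generator .
  from IS sub E' show ?thesis
  proof (induction rule: sigma_sets_induct_disjoint)
    case (basic A)
    then show ?case using \<open>\<And>a. approximable q (indicator ({x\<in>space ?N. \<forall>j<q. x j < a j} \<inter> cube q m))\<close> by blast
  next
    case empty
    show ?case using approximable_zero by (simp add: indicator_def[abs_def])
  next
    case (compl A)
    have "A \<subseteq> space ?N" using compl(1) sigma_sets_into_sp[OF sub] by blast
    then have "(indicator ((space ?N - A) \<inter> cube q m) :: _ \<Rightarrow> real) = (\<lambda>x. 1 * indicator (space ?N \<inter> cube q m) x + (-1) * indicator (A \<inter> cube q m) x)"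
      by (intro ext) (auto simp: indicator_def)
    with approximable_lincomb[OF full compl(2), of 1 "-1"] show ?case by simp
  next
    case (union A)
    have Am: "A i \<in> sets ?N" for i using union(2) unfolding sets_lebesgue_pow_generator by blast
    have fin: "approximable q (indicator ((\<Union>i<n. A i) \<inter> cube q m))" for n
    proof (induction n)
      case 0
      show ?case using approximable_zero by (simp add: indicator_def[abs_def])
    next
      case (Suc n)
      have "A i \<inter> A n = {}" if "i < n" for i using disjoint_family_onD[OF union(1), of i n] that by simp
      then have "(indicator ((\<Union>i<Suc n. A i) \<inter> cube q m) :: _ \<Rightarrow> real) = (\<lambda>x. 1 * indicator ((\<Union>i<n. A i) \<inter> cube q m) x + 1 * indicator (A n \<inter> cube q m) x)"
        by (auto simp: indicator_def fun_eq_iff less_Suc_eq)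
      with approximable_lincomb[OF Suc union(3)[of n], of 1 1] show ?case by simp
    qed
    show ?case
    proof (rule approximable_limit[OF fin])
      show "AE x in ?N. (\<lambda>n. indicator ((\<Union>i<n. A i) \<inter> cube q m) x) \<longlonglongrightarrow> (indicator ((\<Union>i. A i) \<inter> cube q m) x :: real)"
        using tendsto_mult[OF LIMSEQ_indicator_UN[of A] tendsto_const[of "indicator (cube q m) _"]]
        by (intro AE_I2) (simp add: indicator_inter_arith)
      show "(\<lambda>x. indicator ((\<Union>i. A i) \<inter> cube q m) x :: real) \<in> borel_measurable ?N"
        using Am by (intro bm) auto
    qed (use wm wf in \<open>auto simp: indicator_def\<close>)
  qed
qed

text \<open>Simple functions with values at distance at most \<open>2 * \<bar>f\<bar>\<close> from
  \<open>0\<close> converge to \<open>f\<close>. Cutting the \<open>i\<close>-th one off outside the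
  \<open>i\<close>-th cube makes it a combination of approximable indicators and does not affect the
  limit, since every point lies in all large cubes.\<close>

theorem elementary_dense:
  assumes [measurable]: "f \<in> borel_measurable (lebesgue_pow q)" and sq: "(\<integral>\<^sup>+x. ennreal ((f x)\<^sup>2) \<partial>lebesgue_pow q) < \<infinity>"
  shows "approximable q f"
proof -
  let ?N = "lebesgue_pow q"
  obtain F where F: "\<And>i. simple_function ?N (F i)" "\<And>x. x \<in> space ?N \<Longrightarrow> (\<lambda>i. F i x) \<longlonglongrightarrow> f x"
    "\<And>i x. x \<in> space ?N \<Longrightarrow> dist (F i x) 0 \<le> 2 * dist (f x) 0"
    using borel_measurable_implies_sequence_metric[OF assms(1), of 0] by blast
  have simple: "approximable q (\<lambda>x. \<Sum>y\<in>Y. y * indicator ((F i -` {y} \<inter> space ?N) \<inter> cube q m) x)" if "finite Y" for i m Y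
    using that
  proof induction
    case empty
    show ?case using approximable_zero by simp
  next
    case (insert y Y)
    have "approximable q (indicator ((F i -` {y} \<inter> space ?N) \<inter> cube q m))"
      by (intro approximable_indicator simple_functionD F)
    then show ?case
      unfolding sum.insert[OF insert(1,2)] using approximable_lincomb[OF _ insert.IH, of _ y 1] by (simp only: mult_1)
  qed
  define s where "s i x = (\<Sum>y\<in>F i ` space ?N. y * indicator ((F i -` {y} \<inter> space ?N) \<inter> cube q i) x)" for i x
  have sval: "s i x = F i x * indicator (cube q i) x" if x: "x \<in> space ?N" for i x
  proof -
    have "s i x = (\<Sum>y\<in>F i ` space ?N. if y = F i x then y * indicator (cube q i) x else 0)"
      unfolding s_def using x by (intro sum.cong refl) (auto simp: indicator_def)
    also have "\<dots> = F i x * indicator (cube q i) x"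
      using x simple_functionD(1)[OF F(1)[of i]] by (simp add: sum.delta)
    finally show ?thesis .
  qed
  show ?thesis
  proof (rule approximable_limit[where s=s and w="\<lambda>x. 2 * \<bar>f x\<bar>"])
    show "approximable q (s i)" for i unfolding s_def by (intro simple simple_functionD(1)[OF F(1)])
    show "\<bar>s i x\<bar> \<le> 2 * \<bar>f x\<bar>" if "x \<in> space ?N" for i x
      using F(3)[OF that, of i] sval[OF that, of i] by (auto simp: indicator_def)
    show "(\<integral>\<^sup>+x. ennreal ((2 * \<bar>f x\<bar>)\<^sup>2) \<partial>?N) < \<infinity>"
      using sq by (subst nn_integral_square_cmult) (auto simp: ennreal_mult_eq_top_iff less_top[symmetric])
    show "AE x in ?N. (\<lambda>i. s i x) \<longlonglongrightarrow> f x"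
    proof (rule AE_I2)
      fix x assume x: "x \<in> space ?N"
      obtain b where b: "\<And>j. j < q \<Longrightarrow> \<bar>x j\<bar> \<le> b" using finite_imp_bounded[of "x ` {..<q}"] by (auto simp: bounded_iff)
      obtain n0 where n0: "b < real n0" using reals_Archimedean2 by blast
      have "\<forall>\<^sub>F i in sequentially. F i x = s i x"
        using eventually_ge_at_top[of n0]
      proof eventually_elim
        case (elim i)
        have "x \<in> cube q i" unfolding cube_def
        proof clarify
          fix j assume "j < q"
          then show "- real i \<le> x j \<and> x j < real i" using b[of j] n0 elim by (auto simp: abs_le_iff)
        qed
        then show ?case by (simp add: sval[OF x])
      qed
      with F(2)[OF x] show "(\<lambda>i. s i x) \<longlonglongrightarrow> f x" by (rule Lim_transform_eventually)
    qed
  qed measurable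
qed

section \<open>Multiple integrals as limits\<close>

lemma measurable_elem_int:
  "two_sided_BM M B \<Longrightarrow> elem_int q p c B \<in> borel_measurable M"
  unfolding elem_int_def[abs_def] two_sided_BM_def
  by (intro borel_measurable_sum borel_measurable_times borel_measurable_prod borel_measurable_diff borel_measurable_const) auto

text \<open>The case \<open>n = 1\<close> of the moment bound. Without symmetry the second moment is
  the squared norm of the symmetrized kernel times the factorial of \<open>q\<close>, hence only
  bounded by the norm of the kernel; the bound is what extends the integral by continuity.\<close>

lemma elem_int_L2_le:
  assumes BM: "two_sided_BM M B" and adm: "elem_admissible q p c" and q: "q \<ge> 1"
  shows "(\<integral>\<^sup>+\<omega>. ennreal ((elem_int q p c B \<omega>)\<^sup>2) \<partial>M)
    \<le> ennreal (real (q^q)) * (\<integral>\<^sup>+x. ennreal ((elem_fun q p c x)\<^sup>2) \<partial>lebesgue_pow q)"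
proof -
  have p: "sorted_wrt (<) p" using adm by (simp add: elem_admissible_def)
  have "(\<integral>\<^sup>+\<omega>. ennreal ((elem_int q p c B \<omega>)^(2*1)) \<partial>M) \<le> ennreal ((real (q^q) * real (2*1-1)^q * elem_norm2 q p c)^1)"
    by (rule elem_int_moment[OF BM adm q]) simp
  then show ?thesis unfolding nn_integral_elem_fun_sq[OF p] by (simp add: ennreal_mult')
qed

lemma elem_int_diff_L2_le:
  assumes BM: "two_sided_BM M B" and adm: "elem_admissible q p c" "elem_admissible q p' c'" and q: "q \<ge> 1"
  shows "(\<integral>\<^sup>+\<omega>. ennreal ((elem_int q p c B \<omega> - elem_int q p' c' B \<omega>)\<^sup>2) \<partial>M)
    \<le> ennreal (real (q^q)) * (\<integral>\<^sup>+x. ennreal ((elem_fun q p c x - elem_fun q p' c' x)\<^sup>2) \<partial>lebesgue_pow q)"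
proof -
  obtain r d where rd: "elem_admissible q r d"
    "\<And>x. elem_fun q r d x = 1 * elem_fun q p c x + (-1) * elem_fun q p' c' x"
    "\<And>\<omega>. elem_int q r d B \<omega> = 1 * elem_int q p c B \<omega> + (-1) * elem_int q p' c' B \<omega>"
    using elem_lincomb[OF adm, of 1 "-1", where 'a='a] by metis
  from elem_int_L2_le[OF BM rd(1) q] show ?thesis unfolding rd(2,3) by simp
qed

text \<open>The property by which the choice operator in \<open>mwi_integral\<close> selects,
  isolated so that statements can be proved for every representative.\<close>

definition is_mwi :: "'a measure \<Rightarrow> (real \<Rightarrow> 'a \<Rightarrow> real) \<Rightarrow> nat \<Rightarrow> ((nat \<Rightarrow> real) \<Rightarrow> real) \<Rightarrow> ('a \<Rightarrow> real) \<Rightarrow> bool" where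
  "is_mwi M B q g X \<longleftrightarrow> X \<in> borel_measurable M \<and>
     (\<exists>P C. (\<forall>k. elem_admissible q (P k) (C k)) \<and>
        (\<lambda>k. \<integral>\<^sup>+x. ennreal ((g x - elem_fun q (P k) (C k) x)\<^sup>2) \<partial>lebesgue_pow q) \<longlonglongrightarrow> 0 \<and>
        (\<lambda>k. \<integral>\<^sup>+\<omega>. ennreal ((X \<omega> - elem_int q (P k) (C k) B \<omega>)\<^sup>2) \<partial>M) \<longlonglongrightarrow> 0)"

lemma elem_int_diff_L2_le_via:
  assumes BM: "two_sided_BM M B" and adm: "elem_admissible q p c" "elem_admissible q p' c'" and q: "q \<ge> 1"
    and [measurable]: "g \<in> borel_measurable (lebesgue_pow q)"
  shows "(\<integral>\<^sup>+\<omega>. ennreal ((elem_int q p c B \<omega> - elem_int q p' c' B \<omega>)\<^sup>2) \<partial>M)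
    \<le> ennreal (real (q^q)) * (2 * (\<integral>\<^sup>+x. ennreal ((g x - elem_fun q p c x)\<^sup>2) \<partial>lebesgue_pow q)
        + 2 * (\<integral>\<^sup>+x. ennreal ((g x - elem_fun q p' c' x)\<^sup>2) \<partial>lebesgue_pow q))"
proof -
  have "(\<integral>\<^sup>+x. ennreal ((elem_fun q p c x - elem_fun q p' c' x)\<^sup>2) \<partial>lebesgue_pow q)
      = (\<integral>\<^sup>+x. ennreal (((elem_fun q p c x - g x) + (g x - elem_fun q p' c' x))\<^sup>2) \<partial>lebesgue_pow q)" by simp
  also have "\<dots> \<le> 2 * (\<integral>\<^sup>+x. ennreal ((elem_fun q p c x - g x)\<^sup>2) \<partial>lebesgue_pow q) + 2 * (\<integral>\<^sup>+x. ennreal ((g x - elem_fun q p' c' x)\<^sup>2) \<partial>lebesgue_pow q)"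
    by (rule nn_integral_square_add_le) measurable
  also have "(\<integral>\<^sup>+x. ennreal ((elem_fun q p c x - g x)\<^sup>2) \<partial>lebesgue_pow q) = (\<integral>\<^sup>+x. ennreal ((g x - elem_fun q p c x)\<^sup>2) \<partial>lebesgue_pow q)"
    by (simp only: power2_commute)
  finally show ?thesis
    by (intro order.trans[OF elem_int_diff_L2_le[OF BM adm q]] mult_left_mono) simp_all
qed

text \<open>The given elementary integral is compared with the approximating sequence from the
  definition; as \<open>k\<close> grows, only the distance between the two kernels \<open>g\<close>
  and \<open>elem_fun q p c\<close> remains. Thus the hidden sequence may be replaced by any
  convenient elementary kernel. The \<open>4\<close> stems from two uses of
  \<open>square_add_le\<close>.\<close>

lemma is_mwi_elem_bound:
  assumes BM: "two_sided_BM M B" and X: "is_mwi M B q g X" and adm: "elem_admissible q p c" and q: "q \<ge> 1"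
    and g[measurable]: "g \<in> borel_measurable (lebesgue_pow q)"
  shows "(\<integral>\<^sup>+\<omega>. ennreal ((X \<omega> - elem_int q p c B \<omega>)\<^sup>2) \<partial>M)
    \<le> ennreal (4 * real (q^q)) * (\<integral>\<^sup>+x. ennreal ((g x - elem_fun q p c x)\<^sup>2) \<partial>lebesgue_pow q)"
proof -
  from X obtain P C where PC: "\<And>k. elem_admissible q (P k) (C k)"
    and e: "(\<lambda>k. \<integral>\<^sup>+x. ennreal ((g x - elem_fun q (P k) (C k) x)\<^sup>2) \<partial>lebesgue_pow q) \<longlonglongrightarrow> 0"
    and i: "(\<lambda>k. \<integral>\<^sup>+\<omega>. ennreal ((X \<omega> - elem_int q (P k) (C k) B \<omega>)\<^sup>2) \<partial>M) \<longlonglongrightarrow> 0"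
    and [measurable]: "X \<in> borel_measurable M" unfolding is_mwi_def by blast
  have [measurable]: "elem_int q p c B \<in> borel_measurable M" for p c by (rule measurable_elem_int[OF BM])
  let ?K = "ennreal (real (q^q))"
  define d where "d = (\<integral>\<^sup>+x. ennreal ((g x - elem_fun q p c x)\<^sup>2) \<partial>lebesgue_pow q)"
  have le: "(\<integral>\<^sup>+\<omega>. ennreal ((X \<omega> - elem_int q p c B \<omega>)\<^sup>2) \<partial>M)
    \<le> 2 * (\<integral>\<^sup>+\<omega>. ennreal ((X \<omega> - elem_int q (P k) (C k) B \<omega>)\<^sup>2) \<partial>M)
      + 2 * (?K * (2 * (\<integral>\<^sup>+x. ennreal ((g x - elem_fun q (P k) (C k) x)\<^sup>2) \<partial>lebesgue_pow q) + 2 * d))" for k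
  proof -
    have "(\<integral>\<^sup>+\<omega>. ennreal ((X \<omega> - elem_int q p c B \<omega>)\<^sup>2) \<partial>M)
      = (\<integral>\<^sup>+\<omega>. ennreal (((X \<omega> - elem_int q (P k) (C k) B \<omega>) + (elem_int q (P k) (C k) B \<omega> - elem_int q p c B \<omega>))\<^sup>2) \<partial>M)" by simp
    also have "\<dots> \<le> 2 * (\<integral>\<^sup>+\<omega>. ennreal ((X \<omega> - elem_int q (P k) (C k) B \<omega>)\<^sup>2) \<partial>M) + 2 * (\<integral>\<^sup>+\<omega>. ennreal ((elem_int q (P k) (C k) B \<omega> - elem_int q p c B \<omega>)\<^sup>2) \<partial>M)"
      by (rule nn_integral_square_add_le) measurable
    also have "(\<integral>\<^sup>+\<omega>. ennreal ((elem_int q (P k) (C k) B \<omega> - elem_int q p c B \<omega>)\<^sup>2) \<partial>M)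
      \<le> ?K * (2 * (\<integral>\<^sup>+x. ennreal ((g x - elem_fun q (P k) (C k) x)\<^sup>2) \<partial>lebesgue_pow q) + 2 * d)"
      unfolding d_def by (rule elem_int_diff_L2_le_via[OF BM PC adm q g])
    finally show ?thesis by (simp add: add_left_mono mult_left_mono)
  qed
  have "(\<lambda>k. 2 * (\<integral>\<^sup>+\<omega>. ennreal ((X \<omega> - elem_int q (P k) (C k) B \<omega>)\<^sup>2) \<partial>M)
      + 2 * (?K * (2 * (\<integral>\<^sup>+x. ennreal ((g x - elem_fun q (P k) (C k) x)\<^sup>2) \<partial>lebesgue_pow q) + 2 * d)))
     \<longlonglongrightarrow> 2 * 0 + 2 * (?K * (2 * 0 + 2 * d))"
    by (intro tendsto_add ennreal_tendsto_cmult tendsto_const i e) auto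
  then have "(\<integral>\<^sup>+\<omega>. ennreal ((X \<omega> - elem_int q p c B \<omega>)\<^sup>2) \<partial>M) \<le> 2 * 0 + 2 * (?K * (2 * 0 + 2 * d))"
    by (rule LIMSEQ_le_const) (use le in blast)
  also have "\<dots> = ennreal (4 * real (q^q)) * d"
  proof -
    have "2 * (?K * (2 * d)) = (2 * 2 * ?K) * d" by (simp only: mult_ac)
    also have "2 * 2 * ?K = ennreal (4 * real (q^q))" by (simp add: ennreal_mult)
    finally show ?thesis by simp
  qed
  finally show ?thesis unfolding d_def .
qed

text \<open>The rate \<open>(1/4)^k\<close> for squared norms means \<open>(1/2)^k\<close> for
  norms; this is summable and so leads to almost sure convergence without passing to
  subsequences.\<close>

lemma approximable_sequence:
  assumes "approximable q g"
  obtains P C where "\<And>k. elem_admissible q (P k) (C k)"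
    "\<And>k. (\<integral>\<^sup>+x. ennreal ((g x - elem_fun q (P k) (C k) x)\<^sup>2) \<partial>lebesgue_pow q) \<le> ennreal ((1/4)^k)"
proof -
  have "\<forall>k::nat. \<exists>pc. elem_admissible q (fst pc) (snd pc) \<and> (\<integral>\<^sup>+x. ennreal ((g x - elem_fun q (fst pc) (snd pc) x)\<^sup>2) \<partial>lebesgue_pow q) \<le> ennreal ((1/4)^k)"
  proof
    fix k :: nat
    have "(1/4::real)^k > 0" by simp
    then obtain p c where "elem_admissible q p c" "(\<integral>\<^sup>+x. ennreal ((g x - elem_fun q p c x)\<^sup>2) \<partial>lebesgue_pow q) \<le> ennreal ((1/4)^k)"
      using assms unfolding approximable_def by blast
    then show "\<exists>pc. elem_admissible q (fst pc) (snd pc) \<and> (\<integral>\<^sup>+x. ennreal ((g x - elem_fun q (fst pc) (snd pc) x)\<^sup>2) \<partial>lebesgue_pow q) \<le> ennreal ((1/4)^k)"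
      by (intro exI[of _ "(p, c)"]) simp
  qed
  from choice[OF this] obtain PC where PC: "\<And>k::nat. elem_admissible q (fst (PC k)) (snd (PC k)) \<and> (\<integral>\<^sup>+x. ennreal ((g x - elem_fun q (fst (PC k)) (snd (PC k)) x)\<^sup>2) \<partial>lebesgue_pow q) \<le> ennreal ((1/4)^k)"
    by blast
  show ?thesis by (rule that[of "\<lambda>k. fst (PC k)" "\<lambda>k. snd (PC k)"]) (use PC in auto)
qed

text \<open>Completeness of L2 along a fast sequence: the increments
  \<open>\<bar>Y (Suc k) - Y k\<bar>\<close> have summable means, so \<open>Y k\<close> converges
  almost surely, and Fatou's lemma transfers the estimate of \<open>Y j - Y k\<close> to the limit
  in \<open>j\<close>.\<close>

lemma is_mwi_exists:
  assumes BM: "two_sided_BM M B" and q: "q \<ge> 1"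
    and g[measurable]: "g \<in> borel_measurable (lebesgue_pow q)" and sq: "(\<integral>\<^sup>+x. ennreal ((g x)\<^sup>2) \<partial>lebesgue_pow q) < \<infinity>"
  shows "\<exists>X. is_mwi M B q g X"
proof -
  interpret prob_space M using BM by (simp add: two_sided_BM_def)
  obtain P C where PC: "\<And>k. elem_admissible q (P k) (C k)" and e: "\<And>k. (\<integral>\<^sup>+x. ennreal ((g x - elem_fun q (P k) (C k) x)\<^sup>2) \<partial>lebesgue_pow q) \<le> ennreal ((1/4)^k)"
    using approximable_sequence[OF elementary_dense[OF g sq]] by blast
  define Y where "Y k \<omega> = elem_int q (P k) (C k) B \<omega>" for k \<omega>
  have Ym[measurable]: "Y k \<in> borel_measurable M" for k unfolding Y_def using measurable_elem_int[OF BM] by simp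
  define K where "K = real (q^q)"
  have K: "K \<ge> 0" by (simp add: K_def)
  have diff: "(\<integral>\<^sup>+\<omega>. ennreal ((Y j \<omega> - Y k \<omega>)\<^sup>2) \<partial>M) \<le> ennreal (4 * K * (1/4)^k)" if "k \<le> j" for j k
  proof -
    have "(\<integral>\<^sup>+\<omega>. ennreal ((Y j \<omega> - Y k \<omega>)\<^sup>2) \<partial>M) \<le> ennreal K * (2 * (\<integral>\<^sup>+x. ennreal ((g x - elem_fun q (P j) (C j) x)\<^sup>2) \<partial>lebesgue_pow q)
        + 2 * (\<integral>\<^sup>+x. ennreal ((g x - elem_fun q (P k) (C k) x)\<^sup>2) \<partial>lebesgue_pow q))"
      unfolding Y_def K_def by (rule elem_int_diff_L2_le_via[OF BM PC PC q g])
    also have "\<dots> \<le> ennreal K * (2 * ennreal ((1/4)^k) + 2 * ennreal ((1/4)^k))"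
    proof (intro mult_left_mono add_mono e)
      have "(1/4::real)^j \<le> (1/4)^k" by (rule power_decreasing[OF that]) auto
      then show "(\<integral>\<^sup>+x. ennreal ((g x - elem_fun q (P j) (C j) x)\<^sup>2) \<partial>lebesgue_pow q) \<le> ennreal ((1/4)^k)"
        using e[of j] by (meson ennreal_leI order.trans)
    qed auto
    also have "\<dots> = ennreal (4 * K * (1/4)^k)"
    proof -
      have "2 * ennreal ((1/4)^k) + 2 * ennreal ((1/4)^k) = (2 + 2) * ennreal ((1/4)^k)" by (simp only: distrib_right)
      also have "\<dots> = ennreal (4 * (1/4)^k)" by (simp add: ennreal_mult)
      finally show ?thesis using K by (simp add: ennreal_mult[symmetric] mult_ac)
    qed
    finally show ?thesis .
  qed
  have abs_int: "(\<integral>\<^sup>+\<omega>. ennreal \<bar>Y (Suc k) \<omega> - Y k \<omega>\<bar> \<partial>M) \<le> ennreal ((1 + 4 * K) * (1/2)^k)" for k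
  proof -
    have "(\<integral>\<^sup>+\<omega>. ennreal \<bar>Y (Suc k) \<omega> - Y k \<omega>\<bar> \<partial>M) \<le> (\<integral>\<^sup>+\<omega>. ennreal ((1/2)^k) + ennreal (2^k) * ennreal ((Y (Suc k) \<omega> - Y k \<omega>)\<^sup>2) \<partial>M)"
    proof (rule nn_integral_mono)
      fix \<omega>
      let ?d = "\<bar>Y (Suc k) \<omega> - Y k \<omega>\<bar>"
      \<comment> \<open>Aims at \<open>d \<le> h + d\<^sup>2 / h\<close> with
        \<open>h = (1/2)^k\<close>: both terms on the right then have means of order
        \<open>(1/2)^k\<close>.\<close>
      have "2 * (1/2)^k * ?d \<le> ((1/2)^k)\<^sup>2 + ?d\<^sup>2" by (rule sum_squares_bound)
      then have "2^k * (2 * (1/2)^k * ?d) \<le> 2^k * (((1/2)^k)\<^sup>2 + ?d\<^sup>2)" by (intro mult_left_mono) auto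
      then have "2 * ?d \<le> (1/2)^k + 2^k * ?d\<^sup>2"
        by (simp add: distrib_left power_one_over power2_eq_square)
      moreover have "(1/2::real)^k \<ge> 0" "2^k * ?d\<^sup>2 \<ge> 0" by simp_all
      moreover have "x \<le> y + z" if "2 * x \<le> y + z" "y \<ge> 0" "z \<ge> 0" for x y z :: real using that by linarith
      ultimately have "?d \<le> (1/2)^k + 2^k * ?d\<^sup>2" by blast
      then have "ennreal ?d \<le> ennreal ((1/2)^k + 2^k * ?d\<^sup>2)" by (rule ennreal_leI)
      then show "ennreal ?d \<le> ennreal ((1/2)^k) + ennreal (2^k) * ennreal ((Y (Suc k) \<omega> - Y k \<omega>)\<^sup>2)"
        by (simp add: ennreal_mult)
    qed
    also have "\<dots> = ennreal ((1/2)^k) + ennreal (2^k) * (\<integral>\<^sup>+\<omega>. ennreal ((Y (Suc k) \<omega> - Y k \<omega>)\<^sup>2) \<partial>M)"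
      by (simp add: nn_integral_add nn_integral_cmult emeasure_space_1)
    also have "\<dots> \<le> ennreal ((1/2)^k) + ennreal (2^k) * ennreal (4 * K * (1/4)^k)"
      by (intro add_left_mono mult_left_mono diff) auto
    also have "\<dots> = ennreal ((1/2)^k + 2^k * (4 * K * (1/4)^k))"
      using K by (simp add: ennreal_mult[symmetric] ennreal_plus[symmetric] del: ennreal_plus)
    also have "(1/2)^k + 2^k * (4 * K * (1/4)^k) = (1 + 4 * K) * (1/2)^k"
    proof -
      have "(2::real)^k * (1/4)^k = (1/2)^k" by (simp add: power_mult_distrib[symmetric])
      then show ?thesis by (simp add: algebra_simps)
    qed
    finally show ?thesis .
  qed
  have "(\<integral>\<^sup>+\<omega>. (\<Sum>k. ennreal \<bar>Y (Suc k) \<omega> - Y k \<omega>\<bar>) \<partial>M) = (\<Sum>k. \<integral>\<^sup>+\<omega>. ennreal \<bar>Y (Suc k) \<omega> - Y k \<omega>\<bar> \<partial>M)"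
    by (rule nn_integral_suminf) measurable
  also have "\<dots> \<le> (\<Sum>k. ennreal ((1 + 4 * K) * (1/2)^k))" by (intro suminf_le abs_int summableI)
  also have "\<dots> = ennreal (\<Sum>k. (1 + 4 * K) * (1/2)^k)"
    using K by (intro suminf_ennreal2 summable_mult summable_geometric) auto
  also have "\<dots> < \<infinity>" by simp
  finally have "AE \<omega> in M. (\<Sum>k. ennreal \<bar>Y (Suc k) \<omega> - Y k \<omega>\<bar>) \<noteq> \<infinity>"
    by (intro nn_integral_noteq_infinite) auto
  then have conv: "AE \<omega> in M. (\<lambda>k. Y k \<omega>) \<longlonglongrightarrow> lim (\<lambda>k. Y k \<omega>)"
  proof eventually_elim
    case (elim \<omega>)
    then have "summable (\<lambda>k. \<bar>Y (Suc k) \<omega> - Y k \<omega>\<bar>)" by (intro summable_suminf_not_top) auto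
    then have "summable (\<lambda>k. Y (Suc k) \<omega> - Y k \<omega>)" by (rule summable_rabs_cancel)
    then have "(\<lambda>n. (\<Sum>k<n. Y (Suc k) \<omega> - Y k \<omega>) + Y 0 \<omega>) \<longlonglongrightarrow> suminf (\<lambda>k. Y (Suc k) \<omega> - Y k \<omega>) + Y 0 \<omega>"
      by (intro tendsto_add summable_LIMSEQ tendsto_const)
    then have "convergent (\<lambda>n. Y n \<omega>)" unfolding sum_lessThan_telescope[of "\<lambda>k. Y k \<omega>"] by (auto simp: convergent_def)
    then show ?case by (simp add: convergent_LIMSEQ_iff)
  qed
  \<comment> \<open>Where the sequence diverges, \<open>lim\<close> takes some default value; that
    happens on a null set only, and the function is measurable throughout.\<close>
  define X where "X \<omega> = lim (\<lambda>k. Y k \<omega>)" for \<omega>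
  have [measurable]: "X \<in> borel_measurable M" unfolding X_def by (rule borel_measurable_lim_metric) simp
  have XY: "(\<integral>\<^sup>+\<omega>. ennreal ((X \<omega> - Y k \<omega>)\<^sup>2) \<partial>M) \<le> ennreal (4 * K * (1/4)^k)" for k
  proof -
    have "(\<integral>\<^sup>+\<omega>. ennreal ((X \<omega> - Y k \<omega>)\<^sup>2) \<partial>M) = (\<integral>\<^sup>+\<omega>. liminf (\<lambda>j. ennreal ((Y j \<omega> - Y k \<omega>)\<^sup>2)) \<partial>M)"
    proof (rule nn_integral_cong_AE)
      show "AE \<omega> in M. ennreal ((X \<omega> - Y k \<omega>)\<^sup>2) = liminf (\<lambda>j. ennreal ((Y j \<omega> - Y k \<omega>)\<^sup>2))"
        using conv
      proof eventually_elim
        case (elim \<omega>)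
        have "(\<lambda>j. ennreal ((Y j \<omega> - Y k \<omega>)\<^sup>2)) \<longlonglongrightarrow> ennreal ((X \<omega> - Y k \<omega>)\<^sup>2)"
          unfolding X_def by (intro tendsto_ennrealI tendsto_intros elim)
        then show ?case by (intro lim_imp_Liminf[symmetric]) auto
      qed
    qed
    also have "\<dots> \<le> liminf (\<lambda>j. \<integral>\<^sup>+\<omega>. ennreal ((Y j \<omega> - Y k \<omega>)\<^sup>2) \<partial>M)"
      by (rule nn_integral_liminf) measurable
    also have "\<dots> \<le> limsup (\<lambda>j. \<integral>\<^sup>+\<omega>. ennreal ((Y j \<omega> - Y k \<omega>)\<^sup>2) \<partial>M)" by (rule Liminf_le_Limsup) simp
    also have "\<dots> \<le> ennreal (4 * K * (1/4)^k)"
      by (rule Limsup_bounded) (use diff in \<open>auto simp: eventually_sequentially\<close>)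
    finally show ?thesis .
  qed
  have quarter: "(\<lambda>k. ennreal (c * (1/4)^k)) \<longlonglongrightarrow> 0" for c
  proof -
    have "(\<lambda>k. c * (1/4)^k) \<longlonglongrightarrow> c * 0" by (intro tendsto_mult tendsto_const LIMSEQ_realpow_zero) auto
    then show ?thesis using tendsto_ennrealI by fastforce
  qed
  have "is_mwi M B q g X"
    unfolding is_mwi_def
  proof (intro conjI exI[of _ P] exI[of _ C] allI PC)
    show "(\<lambda>k. \<integral>\<^sup>+x. ennreal ((g x - elem_fun q (P k) (C k) x)\<^sup>2) \<partial>lebesgue_pow q) \<longlonglongrightarrow> 0"
      by (rule tendsto_sandwich[OF _ _ tendsto_const quarter[of 1]]) (use e in auto)
    show "(\<lambda>k. \<integral>\<^sup>+\<omega>. ennreal ((X \<omega> - elem_int q (P k) (C k) B \<omega>)\<^sup>2) \<partial>M) \<longlonglongrightarrow> 0"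
      by (rule tendsto_sandwich[OF _ _ tendsto_const quarter[of "4 * K"]]) (use XY in \<open>auto simp: Y_def\<close>)
  qed simp
  then show ?thesis by blast
qed

text \<open>Square integrability of \<open>g\<close> ensures existence, so that the choice in
  \<open>mwi_integral\<close> is meaningful. Everything proved below about laws and moments of
  multiple integrals goes through this estimate.\<close>

theorem mwi_integral_elem_bound:
  assumes BM: "two_sided_BM M B" and q: "q \<ge> 1" and adm: "elem_admissible q p c"
    and g[measurable]: "g \<in> borel_measurable (lebesgue_pow q)" and sq: "(\<integral>\<^sup>+x. ennreal ((g x)\<^sup>2) \<partial>lebesgue_pow q) < \<infinity>"
  shows "(\<integral>\<^sup>+\<omega>. ennreal ((mwi_integral M B q g \<omega> - elem_int q p c B \<omega>)\<^sup>2) \<partial>M)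
    \<le> ennreal (4 * real (q^q)) * (\<integral>\<^sup>+x. ennreal ((g x - elem_fun q p c x)\<^sup>2) \<partial>lebesgue_pow q)"
    and "mwi_integral M B q g \<in> borel_measurable M"
proof -
  have X: "is_mwi M B q g (mwi_integral M B q g)"
    unfolding mwi_integral_def is_mwi_def[symmetric] by (rule someI_ex[OF is_mwi_exists[OF BM q g sq]])
  from is_mwi_elem_bound[OF BM X adm q g]
  show "(\<integral>\<^sup>+\<omega>. ennreal ((mwi_integral M B q g \<omega> - elem_int q p c B \<omega>)\<^sup>2) \<partial>M)
    \<le> ennreal (4 * real (q^q)) * (\<integral>\<^sup>+x. ennreal ((g x - elem_fun q p c x)\<^sup>2) \<partial>lebesgue_pow q)" .
  show "mwi_integral M B q g \<in> borel_measurable M" using X by (simp add: is_mwi_def)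
qed

section \<open>Square integrability of the Hermite kernel\<close>

lemma nn_integral_powr_0_to:
  assumes "e > -1" "r \<ge> 0"
  shows "(\<integral>\<^sup>+y. ennreal (indicator {0..r} y * y powr e) \<partial>lborel) = ennreal (r powr (e + 1) / (e + 1))"
  using nn_integral_has_integral_lebesgue[OF _ has_integral_powr_from_0[OF assms]]
  by (simp add: ennreal_mult' ennreal_indicator mult.commute)

lemma nn_integral_powr_to_inf:
  assumes "e < -1" "r > 0"
  shows "(\<integral>\<^sup>+y. ennreal (indicator {r..} y * y powr e) \<partial>lborel) = ennreal (- (r powr (e + 1)) / (e + 1))"
  using nn_integral_has_integral_lebesgue[OF _ has_integral_powr_to_inf[OF assms]]
  by (simp add: ennreal_mult' ennreal_indicator mult.commute)

lemma nn_integral_shift_lborel: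
  fixes f :: "real \<Rightarrow> ennreal"
  assumes "f \<in> borel_measurable borel"
  shows "(\<integral>\<^sup>+x. f (t + x) \<partial>lborel) = (\<integral>\<^sup>+x. f x \<partial>lborel)" "(\<integral>\<^sup>+x. f (t - x) \<partial>lborel) = (\<integral>\<^sup>+x. f x \<partial>lborel)"
  using nn_integral_real_affine[OF assms, of 1 t] nn_integral_real_affine[OF assms, of "-1" t] by simp_all

definition frac_kernel :: "real \<Rightarrow> real \<Rightarrow> real \<Rightarrow> real" where
  "frac_kernel b u x = (if x < u then (u - x) powr b else 0)"

lemma frac_kernel_nonneg: "frac_kernel b u x \<ge> 0"
  by (simp add: frac_kernel_def)

lemma frac_kernel_measurable [measurable]: "(\<lambda>(u, x). frac_kernel b u x) \<in> borel_measurable (borel \<Otimes>\<^sub>M borel)"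
  unfolding frac_kernel_def by measurable

text \<open>The bound \<open>-1 < b\<close> gives integrability at the singularity, and \<open>b < -1/2\<close> at infinity.\<close>
lemma nn_integral_frac_prod_le:
  assumes b: "-1 < b" "b < -1/2" and uv: "u \<noteq> v"
  shows "(\<integral>\<^sup>+x. ennreal (frac_kernel b u x * frac_kernel b v x) \<partial>lborel) \<le> ennreal ((1 / (b + 1) - 1 / (2 * b + 1)) * \<bar>u - v\<bar> powr (2 * b + 1))"
proof -
  have main: "(\<integral>\<^sup>+x. ennreal (frac_kernel b u x * frac_kernel b v x) \<partial>lborel) \<le> ennreal ((1 / (b + 1) - 1 / (2 * b + 1)) * \<bar>u - v\<bar> powr (2 * b + 1))"
    if "u < v" for u v
  proof -
    define r where "r = v - u"
    have r: "r > 0" using that by (simp add: r_def)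
    have "(\<integral>\<^sup>+x. ennreal (frac_kernel b u x * frac_kernel b v x) \<partial>lborel) = (\<integral>\<^sup>+y. ennreal (frac_kernel b u (u - y) * frac_kernel b v (u - y)) \<partial>lborel)"
      by (rule nn_integral_shift_lborel(2)[symmetric]) measurable
    \<comment> \<open>In the variable \<open>y = u - x\<close> the integrand is
      \<open>y powr b * (y + r) powr b\<close> for \<open>y > 0\<close>. As \<open>b < 0\<close>,
      the second factor is at most \<open>r powr b\<close> below \<open>r\<close> and at most
      \<open>y powr b\<close> from \<open>r\<close> on.\<close>
    also have "\<dots> \<le> (\<integral>\<^sup>+y. ennreal (r powr b) * ennreal (indicator {0..r} y * y powr b) + ennreal (indicator {r..} y * y powr (2 * b)) \<partial>lborel)"
    proof (rule nn_integral_mono)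
      fix y :: real
      have "frac_kernel b u (u - y) * frac_kernel b v (u - y) \<le> r powr b * (indicator {0..r} y * y powr b) + indicator {r..} y * y powr (2 * b)"
      proof (cases "y > 0")
        case True
        have eq: "frac_kernel b u (u - y) * frac_kernel b v (u - y) = y powr b * (y + r) powr b"
          using True that by (simp add: frac_kernel_def r_def algebra_simps)
        show ?thesis
        proof (cases "y < r")
          case True
          have "(y + r) powr b \<le> r powr b" using b \<open>y > 0\<close> r by (intro powr_mono2') auto
          then have "y powr b * (y + r) powr b \<le> y powr b * r powr b" by (intro mult_left_mono) auto
          then show ?thesis unfolding eq using True \<open>y > 0\<close> by (simp add: mult.commute)
        next
          case False
          have "(y + r) powr b \<le> y powr b" using b \<open>y > 0\<close> r by (intro powr_mono2') auto
          then have "y powr b * (y + r) powr b \<le> y powr b * y powr b" by (intro mult_left_mono) auto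
          also have "\<dots> = y powr (2 * b)" by (simp add: powr_add[symmetric])
          finally have "y powr b * (y + r) powr b \<le> y powr (2 * b)" .
          moreover have "0 \<le> r powr b * (indicator {0..r} y * y powr b)" by simp
          moreover have ind: "indicator {r..} y = (1::real)" using False by simp
          ultimately show ?thesis unfolding eq ind mult_1 by linarith
        qed
      qed (simp add: frac_kernel_def)
      then show "ennreal (frac_kernel b u (u - y) * frac_kernel b v (u - y)) \<le> ennreal (r powr b) * ennreal (indicator {0..r} y * y powr b) + ennreal (indicator {r..} y * y powr (2 * b))"
        by (simp add: ennreal_mult[symmetric] ennreal_plus[symmetric] ennreal_leI del: ennreal_plus)
    qed
    also have "\<dots> = ennreal (r powr b) * ennreal (r powr (b + 1) / (b + 1)) + ennreal (- (r powr (2 * b + 1)) / (2 * b + 1))"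
      using b r by (simp add: nn_integral_add nn_integral_cmult nn_integral_powr_0_to nn_integral_powr_to_inf)
    also have "\<dots> = ennreal (r powr b * (r powr (b + 1) / (b + 1)) + - (r powr (2 * b + 1)) / (2 * b + 1))"
    proof -
      have "0 \<le> - (r powr (2 * b + 1)) / (2 * b + 1)" using b by (intro divide_nonpos_neg) auto
      moreover have "0 \<le> r powr (b + 1) / (b + 1)" using b by simp
      ultimately show ?thesis by (simp only: ennreal_mult[symmetric] ennreal_plus[symmetric] powr_ge_zero mult_nonneg_nonneg)
    qed
    also have "r powr b * (r powr (b + 1) / (b + 1)) + - (r powr (2 * b + 1)) / (2 * b + 1) = (1 / (b + 1) - 1 / (2 * b + 1)) * r powr (2 * b + 1)"
    proof -
      have "r powr b * r powr (b + 1) = r powr (2 * b + 1)" by (simp add: powr_add[symmetric])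
      then show ?thesis by (simp add: left_diff_distrib)
    qed
    finally show ?thesis using that by (simp add: r_def)
  qed
  show ?thesis
  proof (cases "u < v")
    case False
    then have "v < u" using uv by simp
    from main[OF this] show ?thesis by (simp add: mult.commute abs_minus_commute)
  qed (rule main)
qed

section \<open>The exponential weight\<close>

definition ou :: "real \<Rightarrow> real \<Rightarrow> real \<Rightarrow> real" where
  "ou a t s = (if s < t then exp (- a * (t - s)) else 0)"

lemma ou_measurable [measurable]: "ou a t \<in> borel_measurable borel"
  unfolding ou_def by measurable

lemma ou_bounds: "a > 0 \<Longrightarrow> 0 \<le> ou a t s \<and> ou a t s \<le> 1"
  by (simp add: ou_def)

text \<open>After reflection the weight is \<open>1 / a\<close> times the density of the exponential
  law.\<close>

lemma nn_integral_ou: "a > 0 \<Longrightarrow> (\<integral>\<^sup>+s. ennreal (ou a 0 s) \<partial>lborel) \<le> ennreal (1 / a)"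
proof -
  assume a: "a > 0"
  have "(\<integral>\<^sup>+s. ennreal (ou a 0 s) \<partial>lborel) = (\<integral>\<^sup>+s. ennreal (ou a 0 (0 - s)) \<partial>lborel)"
    by (rule nn_integral_shift_lborel(2)[symmetric]) measurable
  also have "\<dots> \<le> (\<integral>\<^sup>+s. ennreal (1/a) * ennreal (exponential_density a s) \<partial>lborel)"
    using a by (intro nn_integral_mono) (auto simp: ou_def exponential_density_def erlang_density_def ennreal_mult[symmetric] mult_ac)
  also have "\<dots> = ennreal (1/a) * (\<integral>\<^sup>+s. ennreal (exponential_density a s) \<partial>lborel)"
    by (rule nn_integral_cmult) measurable
  also have "(\<integral>\<^sup>+s. ennreal (exponential_density a s) \<partial>lborel) = 1"
    using prob_space.emeasure_space_1[OF prob_space_exponential_density[OF a]] by (simp add: emeasure_density)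
  finally show ?thesis by simp
qed

text \<open>The bound has to be uniform in \<open>u\<close>. At distance at most \<open>1\<close>
  from \<open>u\<close> the weight is at most \<open>1\<close> and the singularity contributes
  \<open>1 / (e + 1)\<close> on each side; farther away the power is at most \<open>1\<close> and
  the weight contributes \<open>1 / a\<close>.\<close>

lemma nn_integral_ou_powr_le:
  assumes a: "a > 0" and e: "-1 < e" "e < 0"
  shows "(\<integral>\<^sup>+v. ennreal (ou a 0 v * \<bar>u - v\<bar> powr e) \<partial>lborel) \<le> ennreal (2 / (e + 1) + 1 / a)"
proof -
  have "(\<integral>\<^sup>+v. ennreal (ou a 0 v * \<bar>u - v\<bar> powr e) \<partial>lborel)
    \<le> (\<integral>\<^sup>+v. ennreal (indicator {0..1} (-u + v) * (-u + v) powr e) + ennreal (indicator {0..1} (u - v) * (u - v) powr e) + ennreal (ou a 0 v) \<partial>lborel)"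
  proof (rule nn_integral_mono)
    fix v :: real
    have "ou a 0 v * \<bar>u - v\<bar> powr e \<le> indicator {0..1} (-u + v) * (-u + v) powr e + indicator {0..1} (u - v) * (u - v) powr e + ou a 0 v"
    proof (cases "\<bar>u - v\<bar> \<le> 1")
      case True
      have "ou a 0 v * \<bar>u - v\<bar> powr e \<le> 1 * \<bar>u - v\<bar> powr e" using ou_bounds[OF a] by (intro mult_right_mono) auto
      also have "\<dots> \<le> indicator {0..1} (-u + v) * (-u + v) powr e + indicator {0..1} (u - v) * (u - v) powr e"
        using True by (cases "u \<le> v") (auto simp: indicator_def)
      finally show ?thesis using ou_bounds[OF a, of 0 v] by linarith
    next
      case False
      have "\<bar>u - v\<bar> powr e \<le> 1 powr e" using False e by (intro powr_mono2') auto
      then have "ou a 0 v * \<bar>u - v\<bar> powr e \<le> ou a 0 v * 1" using ou_bounds[OF a, of 0 v] by (intro mult_left_mono) auto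
      moreover have "0 \<le> indicator {0..1} (-u + v) * (-u + v) powr e + indicator {0..1} (u - v) * (u - v) powr e" by simp
      ultimately show ?thesis by linarith
    qed
    then show "ennreal (ou a 0 v * \<bar>u - v\<bar> powr e) \<le> ennreal (indicator {0..1} (-u + v) * (-u + v) powr e) + ennreal (indicator {0..1} (u - v) * (u - v) powr e) + ennreal (ou a 0 v)"
      using ou_bounds[OF a, of 0 v] by (simp add: ennreal_plus[symmetric] ennreal_leI del: ennreal_plus)
  qed
  also have "\<dots> = (\<integral>\<^sup>+v. ennreal (indicator {0..1} (-u + v) * (-u + v) powr e) \<partial>lborel) + (\<integral>\<^sup>+v. ennreal (indicator {0..1} (u - v) * (u - v) powr e) \<partial>lborel) + (\<integral>\<^sup>+v. ennreal (ou a 0 v) \<partial>lborel)"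
    by (simp add: nn_integral_add)
  also have "(\<integral>\<^sup>+v. ennreal (indicator {0..1} (-u + v) * (-u + v) powr e) \<partial>lborel) = ennreal (1 / (e + 1))"
    using nn_integral_shift_lborel(1)[of "\<lambda>y. ennreal (indicator {0..1} y * y powr e)" "-u"] nn_integral_powr_0_to[OF e(1), of 1] by simp
  also have "(\<integral>\<^sup>+v. ennreal (indicator {0..1} (u - v) * (u - v) powr e) \<partial>lborel) = ennreal (1 / (e + 1))"
    using nn_integral_shift_lborel(2)[of "\<lambda>y. ennreal (indicator {0..1} y * y powr e)" u] nn_integral_powr_0_to[OF e(1), of 1] by simp
  also have "ennreal (1 / (e + 1)) + ennreal (1 / (e + 1)) + (\<integral>\<^sup>+v. ennreal (ou a 0 v) \<partial>lborel) \<le> ennreal (1 / (e + 1)) + ennreal (1 / (e + 1)) + ennreal (1 / a)"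
    by (intro add_left_mono nn_integral_ou a)
  also have "\<dots> = ennreal (2 / (e + 1) + 1 / a)"
    using a e by (simp add: ennreal_plus[symmetric] del: ennreal_plus)
  finally show ?thesis .
qed

section \<open>The Hermite kernel\<close>

definition hexp :: "nat \<Rightarrow> real \<Rightarrow> real" where
  "hexp q H = 1 - (1 - H) / real q - 3/2"

text \<open>The identity is the reason for the exponent \<open>H0\<close>: the product of
  \<open>q\<close> factors \<open>\<bar>u - v\<bar> powr (2 * hexp q H + 1)\<close> is
  \<open>\<bar>u - v\<bar> powr (2 * H - 2)\<close> whatever \<open>q\<close> is, and this is
  locally integrable because \<open>H > 1/2\<close>.\<close>

lemma hexp_bounds:
  assumes "q \<ge> 1" "1/2 < H" "H < 1"
  shows "-1 < hexp q H" "hexp q H < -1/2" "real q * (2 * hexp q H + 1) = 2 * H - 2"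
proof -
  have "(1 - H) / real q \<le> (1 - H) / 1" using assms by (intro divide_left_mono) auto
  then show "-1 < hexp q H" using assms by (simp add: hexp_def)
  have "(1 - H) / real q > 0" using assms by simp
  then show "hexp q H < -1/2" by (simp add: hexp_def)
  show "real q * (2 * hexp q H + 1) = 2 * H - 2" using assms by (simp add: hexp_def field_simps)
qed

lemma hermite_kernel_eq:
  "hermite_kernel q H h x = (\<integral>u. h u * (\<Prod>j<q. frac_kernel (hexp q H) u (x j)) \<partial>lborel)"
  by (simp only: hermite_kernel_def hexp_def frac_kernel_def Let_def)

text \<open>Weight and fractional factors depend on differences of times only, so the substitution
  \<open>t + u\<close> for \<open>u\<close> moves the shift into the argument.\<close>

lemma hermite_kernel_translate:
  "hermite_kernel q H (ou a t) x = hermite_kernel q H (ou a 0) (\<lambda>j. x j - t)"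
proof -
  have "hermite_kernel q H (ou a t) x = (\<integral>u. ou a t (t + 1 * u) * (\<Prod>j<q. frac_kernel (hexp q H) (t + 1 * u) (x j)) \<partial>lborel)"
    unfolding hermite_kernel_eq by (subst lborel_integral_real_affine[of 1 _ t]) auto
  also have "\<dots> = hermite_kernel q H (ou a 0) (\<lambda>j. x j - t)"
    unfolding hermite_kernel_eq by (intro Bochner_Integration.integral_cong refl arg_cong2[of _ _ _ _ "(*)"] prod.cong)
      (auto simp: ou_def frac_kernel_def algebra_simps)
  finally show ?thesis .
qed

lemma measurable_kernel_integrand:
  "(\<lambda>(x, u). ou a t u * (\<Prod>j<q. frac_kernel b u (x j))) \<in> borel_measurable (lebesgue_pow q \<Otimes>\<^sub>M lborel)"
proof -
  have c: "(\<lambda>z. fst z j) \<in> borel_measurable (lebesgue_pow q \<Otimes>\<^sub>M (lborel :: real measure))" if "j \<in> {..<q}" for j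
    using measurable_compose[OF measurable_fst measurable_component_singleton[OF that, of "\<lambda>_. lborel"]] by simp
  have "(\<lambda>z. frac_kernel b (snd z) (fst z j)) \<in> borel_measurable (lebesgue_pow q \<Otimes>\<^sub>M lborel)" if "j \<in> {..<q}" for j
  proof -
    have "(\<lambda>z. (snd z, fst z j)) \<in> lebesgue_pow q \<Otimes>\<^sub>M lborel \<rightarrow>\<^sub>M (borel :: real measure) \<Otimes>\<^sub>M (borel :: real measure)"
      using c[OF that] by (intro measurable_Pair) simp_all
    from measurable_compose[OF this frac_kernel_measurable[of b]] show ?thesis by simp
  qed
  then have "(\<lambda>z. \<Prod>j<q. frac_kernel b (snd z) (fst z j)) \<in> borel_measurable (lebesgue_pow q \<Otimes>\<^sub>M lborel)"
    by (rule borel_measurable_prod)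
  then show ?thesis unfolding case_prod_beta by (intro borel_measurable_times) measurable
qed

lemma measurable_hermite_kernel:
  "hermite_kernel q H (ou a t) \<in> borel_measurable (lebesgue_pow q)"
proof -
  have "(\<lambda>x. \<integral>u. ou a t u * (\<Prod>j<q. frac_kernel (hexp q H) u (x j)) \<partial>lborel) \<in> borel_measurable (lebesgue_pow q)"
    by (rule lborel.borel_measurable_lebesgue_integral[OF measurable_kernel_integrand])
  then show ?thesis by (simp add: hermite_kernel_eq[abs_def])
qed

text \<open>For a non-integrable \<open>f\<close> the Bochner integral is \<open>0\<close> by
  convention, so the bound also covers points at which the integral defining the kernel
  diverges.\<close>

lemma ennreal_integral_le: "(\<And>x. f x \<ge> 0) \<Longrightarrow> ennreal (\<integral>x. f x \<partial>M) \<le> (\<integral>\<^sup>+x. ennreal (f x) \<partial>M)"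
  by (cases "integrable M f") (auto simp: nn_integral_eq_integral not_integrable_integral_eq)

text \<open>The square of the kernel is a double integral over \<open>u\<close> and
  \<open>v\<close>. Carrying out the integration over \<open>x\<close> first splits it into
  \<open>q\<close> equal one-dimensional integrals, bounded by
  \<open>nn_integral_frac_prod_le\<close>; what remains is the integral of
  \<open>ou a 0 u * ou a 0 v * \<bar>u - v\<bar> powr (2 * H - 2)\<close>.\<close>

lemma hermite_kernel_square_integrable:
  assumes a: "a > 0" and q: "q \<ge> 1" and H: "1/2 < H" "H < 1"
  shows "(\<integral>\<^sup>+x. ennreal ((hermite_kernel q H (ou a 0) x)\<^sup>2) \<partial>lebesgue_pow q) < \<infinity>"
proof -
  interpret P: product_sigma_finite "\<lambda>_::nat. lborel :: real measure" by (rule product_sigma_finite_lborel)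
  interpret F: finite_product_sigma_finite "\<lambda>_::nat. lborel :: real measure" "{..<q}" by standard simp
  define b where "b = hexp q H"
  note b = hexp_bounds[OF q H, folded b_def]
  define A where "A = 1 / (b + 1) - 1 / (2 * b + 1)"
  have A: "A \<ge> 0"
  proof -
    have "1 / (b + 1) \<ge> 0" "1 / (2 * b + 1) \<le> 0" using b by (auto simp: divide_le_0_iff)
    then show ?thesis unfolding A_def by linarith
  qed
  define e where "e = 2 * H - 2"
  have e: "-1 < e" "e < 0" using H by (simp_all add: e_def)
  define \<Phi> where "\<Phi> x u = ou a 0 u * (\<Prod>j<q. frac_kernel b u (x j))" for x :: "nat \<Rightarrow> real" and u
  have \<Phi>0: "\<Phi> x u \<ge> 0" for x u unfolding \<Phi>_def using ou_bounds[OF a] by (intro mult_nonneg_nonneg prod_nonneg) (auto simp: frac_kernel_nonneg)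
  have \<Phi>m[measurable]: "(\<lambda>(x, u). \<Phi> x u) \<in> borel_measurable (lebesgue_pow q \<Otimes>\<^sub>M lborel)"
    unfolding \<Phi>_def by (rule measurable_kernel_integrand)
  have "(\<integral>\<^sup>+x. ennreal ((hermite_kernel q H (ou a 0) x)\<^sup>2) \<partial>lebesgue_pow q) \<le> (\<integral>\<^sup>+x. \<integral>\<^sup>+u. \<integral>\<^sup>+v. ennreal (\<Phi> x u) * ennreal (\<Phi> x v) \<partial>lborel \<partial>lborel \<partial>lebesgue_pow q)"
  proof (rule nn_integral_mono)
    fix x assume x: "x \<in> space (lebesgue_pow q)"
    have mx[measurable]: "(\<lambda>u. \<Phi> x u) \<in> borel_measurable lborel"
      using measurable_compose[OF measurable_Pair1'[OF x] \<Phi>m] by simp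
    have nn: "hermite_kernel q H (ou a 0) x \<ge> 0"
      unfolding hermite_kernel_eq b_def[symmetric] using \<Phi>0[of x] by (intro Bochner_Integration.integral_nonneg) (simp add: \<Phi>_def)
    have "ennreal (hermite_kernel q H (ou a 0) x) \<le> (\<integral>\<^sup>+u. ennreal (\<Phi> x u) \<partial>lborel)"
      unfolding hermite_kernel_eq b_def[symmetric] \<Phi>_def[symmetric] by (rule ennreal_integral_le[OF \<Phi>0])
    then have "ennreal (hermite_kernel q H (ou a 0) x) * ennreal (hermite_kernel q H (ou a 0) x) \<le> (\<integral>\<^sup>+u. ennreal (\<Phi> x u) \<partial>lborel) * (\<integral>\<^sup>+u. ennreal (\<Phi> x u) \<partial>lborel)"
      by (intro mult_mono) auto
    also have "\<dots> = (\<integral>\<^sup>+u. \<integral>\<^sup>+v. ennreal (\<Phi> x u) * ennreal (\<Phi> x v) \<partial>lborel \<partial>lborel)"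
      by (simp add: nn_integral_cmult nn_integral_multc)
    finally show "ennreal ((hermite_kernel q H (ou a 0) x)\<^sup>2) \<le> (\<integral>\<^sup>+u. \<integral>\<^sup>+v. ennreal (\<Phi> x u) * ennreal (\<Phi> x v) \<partial>lborel \<partial>lborel)"
      using nn by (simp add: power2_eq_square ennreal_mult)
  qed
  also have "\<dots> = (\<integral>\<^sup>+u. \<integral>\<^sup>+x. \<integral>\<^sup>+v. ennreal (\<Phi> x u) * ennreal (\<Phi> x v) \<partial>lborel \<partial>lebesgue_pow q \<partial>lborel)"
    by (rule pair_sigma_finite.Fubini'[symmetric]) (auto intro!: pair_sigma_finite.intro F.sigma_finite_measure_axioms sigma_finite_lborel)
  also have "\<dots> = (\<integral>\<^sup>+u. \<integral>\<^sup>+v. \<integral>\<^sup>+x. ennreal (\<Phi> x u) * ennreal (\<Phi> x v) \<partial>lebesgue_pow q \<partial>lborel \<partial>lborel)"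
  proof (rule nn_integral_cong)
    fix u :: real
    have [measurable]: "(\<lambda>x. \<Phi> x u) \<in> borel_measurable (lebesgue_pow q)"
      using measurable_compose[OF measurable_Pair2'[of u lborel] \<Phi>m] by simp
    show "(\<integral>\<^sup>+x. \<integral>\<^sup>+v. ennreal (\<Phi> x u) * ennreal (\<Phi> x v) \<partial>lborel \<partial>lebesgue_pow q) = (\<integral>\<^sup>+v. \<integral>\<^sup>+x. ennreal (\<Phi> x u) * ennreal (\<Phi> x v) \<partial>lebesgue_pow q \<partial>lborel)"
      by (rule pair_sigma_finite.Fubini'[symmetric]) (auto intro!: pair_sigma_finite.intro F.sigma_finite_measure_axioms sigma_finite_lborel)
  qed
  also have "\<dots> \<le> (\<integral>\<^sup>+u. \<integral>\<^sup>+v. ennreal (A^q) * ennreal (ou a 0 u) * ennreal (ou a 0 v * \<bar>u - v\<bar> powr e) \<partial>lborel \<partial>lborel)"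
  proof (rule nn_integral_mono, rule nn_integral_mono_AE)
    fix u :: real
    show "AE v in lborel. (\<integral>\<^sup>+x. ennreal (\<Phi> x u) * ennreal (\<Phi> x v) \<partial>lebesgue_pow q) \<le> ennreal (A^q) * ennreal (ou a 0 u) * ennreal (ou a 0 v * \<bar>u - v\<bar> powr e)"
      \<comment> \<open>The one-dimensional bound requires \<open>u \<noteq> v\<close>.\<close>
      using AE_lborel_singleton[of u]
    proof eventually_elim
      case (elim v)
      have "(\<integral>\<^sup>+x. ennreal (\<Phi> x u) * ennreal (\<Phi> x v) \<partial>lebesgue_pow q) = (\<integral>\<^sup>+x. ennreal (ou a 0 u * ou a 0 v) * (\<Prod>j<q. ennreal (frac_kernel b u (x j) * frac_kernel b v (x j))) \<partial>lebesgue_pow q)"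
      proof (rule nn_integral_cong)
        fix x :: "nat \<Rightarrow> real"
        have "ennreal (\<Phi> x u) * ennreal (\<Phi> x v) = ennreal (\<Phi> x u * \<Phi> x v)" using \<Phi>0 by (simp add: ennreal_mult)
        also have "\<Phi> x u * \<Phi> x v = (ou a 0 u * ou a 0 v) * (\<Prod>j<q. frac_kernel b u (x j) * frac_kernel b v (x j))"
          unfolding \<Phi>_def prod.distrib by (simp add: mult_ac)
        also have "ennreal \<dots> = ennreal (ou a 0 u * ou a 0 v) * ennreal (\<Prod>j<q. frac_kernel b u (x j) * frac_kernel b v (x j))"
          using ou_bounds[OF a] by (intro ennreal_mult prod_nonneg) (auto simp: frac_kernel_nonneg)
        also have "ennreal (\<Prod>j<q. frac_kernel b u (x j) * frac_kernel b v (x j)) = (\<Prod>j<q. ennreal (frac_kernel b u (x j) * frac_kernel b v (x j)))"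
          by (rule prod_ennreal[symmetric]) (auto simp: frac_kernel_nonneg)
        finally show "ennreal (\<Phi> x u) * ennreal (\<Phi> x v) = ennreal (ou a 0 u * ou a 0 v) * (\<Prod>j<q. ennreal (frac_kernel b u (x j) * frac_kernel b v (x j)))" .
      qed
      also have "\<dots> = ennreal (ou a 0 u * ou a 0 v) * (\<integral>\<^sup>+x. (\<Prod>j<q. ennreal (frac_kernel b u (x j) * frac_kernel b v (x j))) \<partial>lebesgue_pow q)"
      proof (rule nn_integral_cmult)
        show "(\<lambda>x. \<Prod>j<q. ennreal (frac_kernel b u (x j) * frac_kernel b v (x j))) \<in> borel_measurable (lebesgue_pow q)"
        proof (rule borel_measurable_prod_ennreal)
          fix j assume j: "j \<in> {..<q}"
          have "(\<lambda>y. ennreal (frac_kernel b u y * frac_kernel b v y)) \<in> borel_measurable borel" by measurable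
          moreover have "(\<lambda>x. x j) \<in> borel_measurable (lebesgue_pow q)"
            using measurable_component_singleton[OF j, of "\<lambda>_. lborel"] by simp
          ultimately show "(\<lambda>x. ennreal (frac_kernel b u (x j) * frac_kernel b v (x j))) \<in> borel_measurable (lebesgue_pow q)"
            by (rule measurable_compose[rotated])
        qed
      qed
      also have "(\<integral>\<^sup>+x. (\<Prod>j<q. ennreal (frac_kernel b u (x j) * frac_kernel b v (x j))) \<partial>lebesgue_pow q) = (\<Prod>j<q. \<integral>\<^sup>+y. ennreal (frac_kernel b u y * frac_kernel b v y) \<partial>lborel)"
        by (rule P.product_nn_integral_prod) auto
      also have "\<dots> \<le> (\<Prod>j<q. ennreal (A * \<bar>u - v\<bar> powr (2 * b + 1)))"
      proof (intro prod_mono_ennreal)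
        show "(\<integral>\<^sup>+y. ennreal (frac_kernel b u y * frac_kernel b v y) \<partial>lborel) \<le> ennreal (A * \<bar>u - v\<bar> powr (2 * b + 1))"
          unfolding A_def using nn_integral_frac_prod_le[OF b(1,2) elim[symmetric]] .
      qed
      also have "\<dots> = ennreal ((A * \<bar>u - v\<bar> powr (2 * b + 1))^q)"
        using A by (simp add: ennreal_power)
      also have "(A * \<bar>u - v\<bar> powr (2 * b + 1))^q = A^q * \<bar>u - v\<bar> powr e"
      proof -
        have "(\<bar>u - v\<bar> powr (2 * b + 1))^q = \<bar>u - v\<bar> powr (real q * (2 * b + 1))"
          using elim by (simp add: powr_realpow[symmetric] powr_powr mult.commute)
        also have "real q * (2 * b + 1) = e" using b(3) by (simp add: e_def)
        finally show ?thesis by (simp add: power_mult_distrib)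
      qed
      finally have "(\<integral>\<^sup>+x. ennreal (\<Phi> x u) * ennreal (\<Phi> x v) \<partial>lebesgue_pow q) \<le> ennreal (ou a 0 u * ou a 0 v) * ennreal (A^q * \<bar>u - v\<bar> powr e)"
        by (simp add: mult_left_mono)
      also have "\<dots> = ennreal (A^q) * ennreal (ou a 0 u) * ennreal (ou a 0 v * \<bar>u - v\<bar> powr e)"
        using A ou_bounds[OF a] by (simp add: ennreal_mult[symmetric] mult_ac)
      finally show ?case .
    qed
  qed
  also have "\<dots> = (\<integral>\<^sup>+u. ennreal (A^q) * ennreal (ou a 0 u) * (\<integral>\<^sup>+v. ennreal (ou a 0 v * \<bar>u - v\<bar> powr e) \<partial>lborel) \<partial>lborel)"
    by (intro nn_integral_cong nn_integral_cmult) measurable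
  also have "\<dots> \<le> (\<integral>\<^sup>+u. ennreal (A^q) * ennreal (ou a 0 u) * ennreal (2 / (e + 1) + 1 / a) \<partial>lborel)"
    by (intro nn_integral_mono mult_left_mono nn_integral_ou_powr_le a e) auto
  also have "\<dots> = ennreal (A^q) * (\<integral>\<^sup>+u. ennreal (ou a 0 u) \<partial>lborel) * ennreal (2 / (e + 1) + 1 / a)"
    by (simp add: nn_integral_multc nn_integral_cmult)
  also have "\<dots> \<le> ennreal (A^q) * ennreal (1 / a) * ennreal (2 / (e + 1) + 1 / a)"
    by (intro mult_left_mono mult_right_mono nn_integral_ou a) auto
  also have "\<dots> < \<infinity>" by (simp add: ennreal_mult_less_top)
  finally show ?thesis .
qed

section \<open>Translations and exponential moments\<close>

definition shift_list :: "real \<Rightarrow> real list \<Rightarrow> real list" where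
  "shift_list t p = map (\<lambda>x. x + t) p"

lemma length_shift_list [simp]: "length (shift_list t p) = length p"
  by (simp add: shift_list_def)

lemma nth_shift_list: "i < length p \<Longrightarrow> shift_list t p ! i = p ! i + t"
  by (simp add: shift_list_def)

lemma set_shift_list [simp]: "set (shift_list t p) = (\<lambda>x. x + t) ` set p"
  by (simp add: shift_list_def)

lemma shift_list_add: "shift_list (s + t) p = shift_list t (shift_list s p)"
  by (simp add: shift_list_def add.assoc o_def)

lemma sorted_shift_list: "sorted_wrt (<) p \<Longrightarrow> sorted_wrt (<) (shift_list t p)"
  by (simp add: shift_list_def sorted_wrt_map)

lemma elem_admissible_shift: "elem_admissible q p c \<Longrightarrow> elem_admissible q (shift_list t p) c"
  by (simp add: elem_admissible_def sorted_shift_list)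

lemma elem_sum_shift:
  "elem_sum q (shift_list t p) c G = elem_sum q p c (\<lambda>j a b. G j (a + t) (b + t))"
  unfolding elem_sum_def length_shift_list
proof (intro sum.cong refl arg_cong2[of _ _ _ _ "(*)"] prod.cong)
  fix i j assume "i \<in> {..<q} \<rightarrow>\<^sub>E {..<length p - 1}" "j \<in> {..<q}"
  then have "i j \<in> {..<length p - 1}" by (rule PiE_mem)
  then have "i j < length p - 1" by (rule lessThan_iff[THEN iffD1])
  then have "Suc (i j) < length p" by linarith
  then show "G j (shift_list t p ! i j) (shift_list t p ! Suc (i j)) = G j (p ! i j + t) (p ! Suc (i j) + t)"
    by (simp add: nth_shift_list)
qed

lemma elem_fun_shift: "elem_fun q (shift_list t p) c x = elem_fun q p c (\<lambda>j. x j - t)"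
proof -
  have "indicator {a + t..<b + t} (x j) = (indicator {a..<b} (x j - t) :: real)" for a b j
    by (auto simp: indicator_def)
  then show ?thesis by (simp add: elem_fun_eq_elem_sum elem_sum_shift)
qed

lemma elem_fun_restrict: "elem_fun q p c (restrict x {..<q}) = elem_fun q p c x"
  by (simp add: elem_fun_def)

lemma measurable_translate: "(\<lambda>x. \<lambda>j\<in>{..<q}. x j - t) \<in> lebesgue_pow q \<rightarrow>\<^sub>M lebesgue_pow q"
proof (rule measurable_restrict)
  fix j assume j: "j \<in> {..<q}"
  have [measurable]: "(\<lambda>x. x j) \<in> borel_measurable (lebesgue_pow q)"
    using measurable_component_singleton[OF j, of "\<lambda>_. lborel"] by simp
  show "(\<lambda>x. x j - t) \<in> lebesgue_pow q \<rightarrow>\<^sub>M lborel" by simp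
qed

lemma distr_lebesgue_pow_translate:
  "distr (lebesgue_pow q) (lebesgue_pow q) (\<lambda>x. \<lambda>j\<in>{..<q}. x j - t) = lebesgue_pow q"
proof -
  interpret product_sigma_finite "\<lambda>_::nat. lborel :: real measure" by (rule product_sigma_finite_lborel)
  show ?thesis
  proof (rule PiM_eqI)
    fix A :: "nat \<Rightarrow> real set" assume A: "\<And>i. i \<in> {..<q} \<Longrightarrow> A i \<in> sets lborel"
    have A': "(\<lambda>y. y - t) -` A j \<in> sets lborel" if "j \<in> {..<q}" for j
    proof -
      have "(\<lambda>y::real. y - t) \<in> borel_measurable borel" by simp
      from measurable_sets[OF this, of "A j"] A[OF that] show ?thesis by simp
    qed
    have "emeasure (distr (lebesgue_pow q) (lebesgue_pow q) (\<lambda>x. \<lambda>j\<in>{..<q}. x j - t)) (Pi\<^sub>E {..<q} A)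
        = emeasure (lebesgue_pow q) ((\<lambda>x. \<lambda>j\<in>{..<q}. x j - t) -` Pi\<^sub>E {..<q} A \<inter> space (lebesgue_pow q))"
      by (rule emeasure_distr[OF measurable_translate]) (auto intro!: sets_PiM_I_finite A)
    also have "(\<lambda>x. \<lambda>j\<in>{..<q}. x j - t) -` Pi\<^sub>E {..<q} A \<inter> space (lebesgue_pow q) = (\<Pi>\<^sub>E j\<in>{..<q}. (\<lambda>y. y - t) -` A j)"
      by (auto simp: space_PiM PiE_iff)
    also have "emeasure (lebesgue_pow q) \<dots> = (\<Prod>j<q. emeasure lborel ((\<lambda>y. y - t) -` A j))"
      by (rule emeasure_PiM) (use A' in auto)
    also have "\<dots> = (\<Prod>j<q. emeasure lborel (A j))"
    proof (intro prod.cong refl)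
      fix j assume "j \<in> {..<q}"
      note Aj = A[OF this]
      have "emeasure lborel (A j) = emeasure (distr lborel borel ((+) (- t))) (A j)" by (simp only: lborel_distr_plus)
      also have "\<dots> = emeasure lborel ((+) (- t) -` A j \<inter> space lborel)" using Aj by (subst emeasure_distr) auto
      also have "(+) (- t) -` A j \<inter> space lborel = (\<lambda>y. y - t) -` A j" by auto
      finally show "emeasure lborel ((\<lambda>y. y - t) -` A j) = emeasure lborel (A j)" by simp
    qed
    finally show "emeasure (distr (lebesgue_pow q) (lebesgue_pow q) (\<lambda>x. \<lambda>j\<in>{..<q}. x j - t)) (Pi\<^sub>E {..<q} A) = (\<Prod>j<q. emeasure lborel (A j))" .
  qed auto
qed

text \<open>The point \<open>\<lambda>j. x j - t\<close> is in general not extensional and then lies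
  outside the space of the product measure. By \<open>local\<close> the function depends on the
  first \<open>q\<close> coordinates only, so it takes the same value there as at the restricted
  point.\<close>

lemma nn_integral_lebesgue_pow_translate:
  assumes f: "f \<in> borel_measurable (lebesgue_pow q)" and local: "\<And>x. f (restrict x {..<q}) = f x"
  shows "(\<integral>\<^sup>+x. f (\<lambda>j. x j - t) \<partial>lebesgue_pow q) = (\<integral>\<^sup>+x. f x \<partial>lebesgue_pow q)"
proof -
  have "(\<integral>\<^sup>+x. f x \<partial>lebesgue_pow q) = (\<integral>\<^sup>+x. f x \<partial>distr (lebesgue_pow q) (lebesgue_pow q) (\<lambda>x. \<lambda>j\<in>{..<q}. x j - t))"
    by (simp only: distr_lebesgue_pow_translate)
  also have "\<dots> = (\<integral>\<^sup>+x. f (\<lambda>j\<in>{..<q}. x j - t) \<partial>lebesgue_pow q)" by (rule nn_integral_distr[OF measurable_translate]) (use f in simp)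
  also have "\<dots> = (\<integral>\<^sup>+x. f (\<lambda>j. x j - t) \<partial>lebesgue_pow q)" by (simp only: local[symmetric, of "\<lambda>j. _ j - t"])
  finally show ?thesis by simp
qed

section \<open>Moment growth and exponential integrability\<close>

lemma AE_tendsto_of_geometric_L2:
  fixes X :: "'a \<Rightarrow> real"
  assumes [measurable]: "X \<in> borel_measurable M" "\<And>k. Y k \<in> borel_measurable M" and A: "A \<ge> 0"
    and le: "\<And>k. (\<integral>\<^sup>+\<omega>. ennreal ((X \<omega> - Y k \<omega>)\<^sup>2) \<partial>M) \<le> ennreal (A * (1/4)^k)"
  shows "AE \<omega> in M. (\<lambda>k. Y k \<omega>) \<longlonglongrightarrow> X \<omega>"
proof -
  have "(\<Sum>k. \<integral>\<^sup>+\<omega>. ennreal ((X \<omega> - Y k \<omega>)\<^sup>2) \<partial>M) \<le> (\<Sum>k. ennreal (A * (1/4)^k))"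
    by (intro suminf_le le summableI)
  also have "\<dots> = ennreal (\<Sum>k. A * (1/4)^k)"
    using A by (intro suminf_ennreal2 summable_mult summable_geometric) auto
  also have "\<dots> < \<infinity>" by simp
  finally have "AE \<omega> in M. (\<lambda>k. X \<omega> - Y k \<omega>) \<longlonglongrightarrow> 0"
    by (intro AE_tendsto_zero_of_nn_integral_summable) auto
  then show ?thesis
  proof eventually_elim
    case (elim \<omega>)
    have "(\<lambda>k. X \<omega> - (X \<omega> - Y k \<omega>)) \<longlonglongrightarrow> X \<omega> - 0" by (intro tendsto_diff tendsto_const elim)
    then show ?case by simp
  qed
qed

text \<open>Hypercontractivity passes from elementary kernels to their limits by Fatou's lemma.\<close>
lemma mwi_integral_moments:
  assumes BM: "two_sided_BM M B" and q: "q \<ge> 1"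
    and g[measurable]: "g \<in> borel_measurable (lebesgue_pow q)" and sq: "(\<integral>\<^sup>+x. ennreal ((g x)\<^sup>2) \<partial>lebesgue_pow q) < \<infinity>"
  obtains D where "D > 0" "\<And>n. n \<ge> 1 \<Longrightarrow>
    (\<integral>\<^sup>+\<omega>. ennreal ((mwi_integral M B q g \<omega>)^(2*n)) \<partial>M) \<le> ennreal ((D * real (2*n-1)^q)^n)"
proof -
  obtain P C where PC: "\<And>k. elem_admissible q (P k) (C k)" and e: "\<And>k. (\<integral>\<^sup>+x. ennreal ((g x - elem_fun q (P k) (C k) x)\<^sup>2) \<partial>lebesgue_pow q) \<le> ennreal ((1/4)^k)"
    using approximable_sequence[OF elementary_dense[OF g sq]] by blast
  define Y where "Y k = elem_int q (P k) (C k) B" for k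
  define I where "I = mwi_integral M B q g"
  have Im[measurable]: "I \<in> borel_measurable M" unfolding I_def by (rule mwi_integral_elem_bound(2)[OF BM q PC g sq])
  have Ym[measurable]: "Y k \<in> borel_measurable M" for k unfolding Y_def by (rule measurable_elem_int[OF BM])
  define K where "K = real (q^q)"
  have K: "K \<ge> 0" by (simp add: K_def)
  have "(\<integral>\<^sup>+\<omega>. ennreal ((I \<omega> - Y k \<omega>)\<^sup>2) \<partial>M) \<le> ennreal (4 * K * (1/4)^k)" for k
  proof -
    have "(\<integral>\<^sup>+\<omega>. ennreal ((I \<omega> - Y k \<omega>)\<^sup>2) \<partial>M) \<le> ennreal (4 * K) * (\<integral>\<^sup>+x. ennreal ((g x - elem_fun q (P k) (C k) x)\<^sup>2) \<partial>lebesgue_pow q)"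
      unfolding I_def Y_def K_def by (rule mwi_integral_elem_bound(1)[OF BM q PC g sq])
    also have "\<dots> \<le> ennreal (4 * K) * ennreal ((1/4)^k)" by (intro mult_left_mono e) simp
    also have "\<dots> = ennreal (4 * K * (1/4)^k)" using K by (simp add: ennreal_mult[symmetric])
    finally show ?thesis .
  qed
  then have conv: "AE \<omega> in M. (\<lambda>k. Y k \<omega>) \<longlonglongrightarrow> I \<omega>"
    by (intro AE_tendsto_of_geometric_L2[where A="4 * K"]) (use K in auto)
  obtain G where G: "G \<ge> 0" "(\<integral>\<^sup>+x. ennreal ((g x)\<^sup>2) \<partial>lebesgue_pow q) = ennreal G"
    using sq by (cases "(\<integral>\<^sup>+x. ennreal ((g x)\<^sup>2) \<partial>lebesgue_pow q)") auto
  \<comment> \<open>The approximants are bounded in norm, since their squared distance from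
    \<open>g\<close> is at most \<open>1\<close>; one constant then serves all \<open>k\<close> and
    all \<open>n\<close>.\<close>
  have norm: "elem_norm2 q (P k) (C k) \<le> 2 * G + 2" for k
  proof -
    have p: "sorted_wrt (<) (P k)" using PC by (simp add: elem_admissible_def)
    have "ennreal (elem_norm2 q (P k) (C k)) = (\<integral>\<^sup>+x. ennreal ((elem_fun q (P k) (C k) x)\<^sup>2) \<partial>lebesgue_pow q)"
      by (rule nn_integral_elem_fun_sq[OF p, symmetric])
    also have "\<dots> = (\<integral>\<^sup>+x. ennreal ((g x + (-1) * (g x - elem_fun q (P k) (C k) x))\<^sup>2) \<partial>lebesgue_pow q)" by simp
    also have "\<dots> \<le> 2 * (\<integral>\<^sup>+x. ennreal ((g x)\<^sup>2) \<partial>lebesgue_pow q) + 2 * (\<integral>\<^sup>+x. ennreal (((-1) * (g x - elem_fun q (P k) (C k) x))\<^sup>2) \<partial>lebesgue_pow q)"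
      by (rule nn_integral_square_add_le) measurable
    also have "(\<integral>\<^sup>+x. ennreal (((-1) * (g x - elem_fun q (P k) (C k) x))\<^sup>2) \<partial>lebesgue_pow q) = (\<integral>\<^sup>+x. ennreal ((g x - elem_fun q (P k) (C k) x)\<^sup>2) \<partial>lebesgue_pow q)"
      by (simp add: power2_commute)
    also have "2 * (\<integral>\<^sup>+x. ennreal ((g x)\<^sup>2) \<partial>lebesgue_pow q) + 2 * (\<integral>\<^sup>+x. ennreal ((g x - elem_fun q (P k) (C k) x)\<^sup>2) \<partial>lebesgue_pow q) \<le> 2 * ennreal G + 2 * ennreal 1"
    proof (intro add_mono mult_left_mono)
      have "(1/4::real)^k \<le> 1" by (intro power_le_one) auto
      then show "(\<integral>\<^sup>+x. ennreal ((g x - elem_fun q (P k) (C k) x)\<^sup>2) \<partial>lebesgue_pow q) \<le> ennreal 1"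
        using e[of k] ennreal_leI order.trans by blast
    qed (auto simp: G)
    also have "\<dots> = ennreal (2 * G + 2)" using G by (simp add: ennreal_plus ennreal_mult)
    finally show ?thesis using G by (subst (asm) ennreal_le_iff) auto
  qed
  show ?thesis
  proof (rule that)
    show "K * (2 * G + 2) > 0" using q G by (simp add: K_def)
    fix n :: nat assume n: "n \<ge> 1"
    have "(\<integral>\<^sup>+\<omega>. ennreal ((I \<omega>)^(2*n)) \<partial>M) = (\<integral>\<^sup>+\<omega>. liminf (\<lambda>k. ennreal ((Y k \<omega>)^(2*n))) \<partial>M)"
    proof (rule nn_integral_cong_AE)
      show "AE \<omega> in M. ennreal ((I \<omega>)^(2*n)) = liminf (\<lambda>k. ennreal ((Y k \<omega>)^(2*n)))"
        using conv
      proof eventually_elim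
        case (elim \<omega>)
        have "(\<lambda>k. ennreal ((Y k \<omega>)^(2*n))) \<longlonglongrightarrow> ennreal ((I \<omega>)^(2*n))"
          by (intro tendsto_ennrealI tendsto_power elim)
        then show ?case by (intro lim_imp_Liminf[symmetric]) auto
      qed
    qed
    also have "\<dots> \<le> liminf (\<lambda>k. \<integral>\<^sup>+\<omega>. ennreal ((Y k \<omega>)^(2*n)) \<partial>M)"
      by (rule nn_integral_liminf) measurable
    also have "\<dots> \<le> limsup (\<lambda>k. \<integral>\<^sup>+\<omega>. ennreal ((Y k \<omega>)^(2*n)) \<partial>M)" by (rule Liminf_le_Limsup) simp
    also have "\<dots> \<le> ennreal ((K * (2 * G + 2) * real (2*n-1)^q)^n)"
    proof (rule Limsup_bounded, rule always_eventually, rule allI)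
      fix k
      have p: "sorted_wrt (<) (P k)" using PC by (simp add: elem_admissible_def)
      have n0: "elem_norm2 q (P k) (C k) \<ge> 0" unfolding elem_norm2_def
      proof (intro sum_nonneg mult_nonneg_nonneg prod_nonneg ballI)
        fix i j assume "i \<in> {..<q} \<rightarrow>\<^sub>E {..<length (P k) - 1}" "j \<in> {..<q}"
        then have "i j \<in> {..<length (P k) - 1}" by (rule PiE_mem)
        then have "i j < length (P k) - 1" by (rule lessThan_iff[THEN iffD1])
        then have "Suc (i j) < length (P k)" by linarith
        then show "0 \<le> P k ! Suc (i j) - P k ! i j" using sorted_wrt_nth_less[OF p, of "i j" "Suc (i j)"] by simp
      qed simp
      have "(\<integral>\<^sup>+\<omega>. ennreal ((Y k \<omega>)^(2*n)) \<partial>M) \<le> ennreal ((K * real (2*n-1)^q * elem_norm2 q (P k) (C k))^n)"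
        unfolding Y_def K_def by (rule elem_int_moment[OF BM PC q n])
      also have "\<dots> \<le> ennreal ((K * real (2*n-1)^q * (2 * G + 2))^n)"
        using K n0 norm by (intro ennreal_leI power_mono mult_left_mono mult_nonneg_nonneg) auto
      also have "\<dots> = ennreal ((K * (2 * G + 2) * real (2*n-1)^q)^n)" by (simp only: mult_ac)
      finally show "(\<integral>\<^sup>+\<omega>. ennreal ((Y k \<omega>)^(2*n)) \<partial>M) \<le> ennreal ((K * (2 * G + 2) * real (2*n-1)^q)^n)" .
    qed
    finally show "(\<integral>\<^sup>+\<omega>. ennreal ((mwi_integral M B q g \<omega>)^(2*n)) \<partial>M) \<le> ennreal ((K * (2 * G + 2) * real (2*n-1)^q)^n)"
      unfolding I_def .
  qed
qed

text \<open>For \<open>n\<close> of order \<open>\<kappa> * \<bar>x\<bar> powr \<gamma>\<close> the base of the power is eventually at least \<open>exp 1\<close>,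
  because \<open>\<gamma> * q < 2\<close>.\<close>
lemma exp_powr_le_moment_series:
  fixes D \<gamma> \<kappa> :: real and q :: nat
  assumes D: "D > 0" and \<kappa>: "\<kappa> > 0" and \<gamma>: "0 < \<gamma>" "\<gamma> * real q < 2"
  obtains R where "\<And>x. \<bar>x\<bar> \<ge> R \<Longrightarrow> \<exists>n\<ge>1. exp (\<kappa> * \<bar>x\<bar> powr \<gamma>) \<le> (x\<^sup>2 / (2 * D * real (2*n)^q))^n"
proof -
  \<comment> \<open>\<open>(2 * \<kappa> + 2) * y powr \<gamma>\<close> bounds \<open>2 * n\<close>
    for the \<open>n\<close> chosen below, and \<open>A \<le> y powr \<delta>\<close> then makes the
    base of the power at least \<open>exp 1\<close>.\<close>
  define A where "A = 2 * D * exp 1 * (2 * \<kappa> + 2)^q"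
  have A: "A > 0" using D \<kappa> by (simp add: A_def)
  define \<delta> where "\<delta> = 2 - \<gamma> * real q"
  have \<delta>: "\<delta> > 0" using \<gamma> by (simp add: \<delta>_def)
  show ?thesis
  proof (rule that[of "max 1 (A powr (1 / \<delta>))"])
    fix x :: real assume x: "\<bar>x\<bar> \<ge> max 1 (A powr (1 / \<delta>))"
    define y where "y = \<bar>x\<bar>"
    have y: "y \<ge> 1" "y \<ge> A powr (1 / \<delta>)" using x by (simp_all add: y_def)
    define n where "n = nat \<lceil>\<kappa> * y powr \<gamma>\<rceil>"
    have pos: "\<kappa> * y powr \<gamma> > 0" using \<kappa> y by simp
    have n1: "n \<ge> 1" using pos by (simp add: n_def le_nat_iff)
    have nge: "\<kappa> * y powr \<gamma> \<le> real n" using pos unfolding n_def by linarith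
    have nle: "real n \<le> \<kappa> * y powr \<gamma> + 1" using pos unfolding n_def by linarith
    have y1: "y powr \<gamma> \<ge> 1" using y \<gamma> by (simp add: ge_one_powr_ge_zero)
    have "real (2*n) \<le> (2 * \<kappa> + 2) * y powr \<gamma>" using nle y1 by (simp add: algebra_simps)
    then have "real (2*n)^q \<le> ((2 * \<kappa> + 2) * y powr \<gamma>)^q" by (intro power_mono) auto
    also have "\<dots> = (2 * \<kappa> + 2)^q * y powr (\<gamma> * real q)"
      using y by (simp add: power_mult_distrib powr_realpow[symmetric] powr_powr)
    finally have "2 * D * real (2*n)^q * exp 1 \<le> 2 * D * ((2 * \<kappa> + 2)^q * y powr (\<gamma> * real q)) * exp 1"
      using D by (intro mult_right_mono mult_left_mono) auto
    also have "\<dots> = A * y powr (\<gamma> * real q)" by (simp add: A_def)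
    also have "\<dots> \<le> y powr \<delta> * y powr (\<gamma> * real q)"
    proof (intro mult_right_mono)
      have "A = (A powr (1 / \<delta>)) powr \<delta>" using A \<delta> by (simp add: powr_powr)
      also have "\<dots> \<le> y powr \<delta>" using y \<delta> by (intro powr_mono2) auto
      finally show "A \<le> y powr \<delta>" .
    qed simp
    also have "\<dots> = y powr 2" by (simp add: powr_add[symmetric] \<delta>_def)
    also have "\<dots> = x\<^sup>2" using y by (simp add: y_def powr_numeral)
    finally have "exp 1 \<le> x\<^sup>2 / (2 * D * real (2*n)^q)" using D n1 by (simp add: field_simps)
    then have "exp 1 ^ n \<le> (x\<^sup>2 / (2 * D * real (2*n)^q))^n" by (intro power_mono) auto
    moreover have "exp (\<kappa> * \<bar>x\<bar> powr \<gamma>) \<le> exp 1 ^ n" using nge by (simp add: y_def exp_of_nat_mult[symmetric])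
    ultimately show "\<exists>n\<ge>1. exp (\<kappa> * \<bar>x\<bar> powr \<gamma>) \<le> (x\<^sup>2 / (2 * D * real (2*n)^q))^n" using n1 by (meson order.trans)
  qed
qed

text \<open>For large \<open>\<bar>x\<bar>\<close> the exponential is dominated by a single term,
  with index depending on \<open>x\<close>, of the series with terms
  \<open>(x\<^sup>2 / (2 * D * (2*n)^q))^n\<close>, hence by the whole series. The extra factor
  \<open>2\<close> in the denominator leaves the mean of the \<open>n\<close>-th term at most
  \<open>(1/2)^n\<close>.\<close>

lemma (in prob_space) exp_moment_finite:
  fixes X :: "'a \<Rightarrow> real"
  assumes [measurable]: "X \<in> borel_measurable M" and D: "D > 0" and \<kappa>: "\<kappa> > 0" and \<gamma>: "0 < \<gamma>" "\<gamma> * real q < 2"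
    and mom: "\<And>n. n \<ge> 1 \<Longrightarrow> (\<integral>\<^sup>+\<omega>. ennreal ((X \<omega>)^(2*n)) \<partial>M) \<le> ennreal ((D * real (2*n-1)^q)^n)"
  shows "(\<integral>\<^sup>+\<omega>. ennreal (exp (\<kappa> * \<bar>X \<omega>\<bar> powr \<gamma>)) \<partial>M) < \<infinity>"
proof -
  obtain R where R: "\<And>x. \<bar>x\<bar> \<ge> R \<Longrightarrow> \<exists>n\<ge>1. exp (\<kappa> * \<bar>x\<bar> powr \<gamma>) \<le> (x\<^sup>2 / (2 * D * real (2*n)^q))^n"
    using exp_powr_le_moment_series[OF D \<kappa> \<gamma>] by blast
  define R' where "R' = max R 0"
  \<comment> \<open>The index is shifted by one because the moment bounds start at
    \<open>n = 1\<close>.\<close>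
  define w where "w n x = (x\<^sup>2 / (2 * D * real (2 * Suc n)^q))^Suc n" for n and x :: real
  have w0: "w n x \<ge> 0" for n x using D by (simp add: w_def del: power_Suc)
  have pw: "ennreal (exp (\<kappa> * \<bar>x\<bar> powr \<gamma>)) \<le> ennreal (exp (\<kappa> * R' powr \<gamma>)) + (\<Sum>n. ennreal (w n x))" for x
  proof (cases "\<bar>x\<bar> \<ge> R'")
    case True
    then have "\<bar>x\<bar> \<ge> R" by (simp add: R'_def)
    from R[OF this] obtain n where "n \<ge> 1" "exp (\<kappa> * \<bar>x\<bar> powr \<gamma>) \<le> (x\<^sup>2 / (2 * D * real (2*n)^q))^n" by blast
    then have "exp (\<kappa> * \<bar>x\<bar> powr \<gamma>) \<le> w (n - 1) x" by (simp add: w_def del: power_Suc)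
    then have "ennreal (exp (\<kappa> * \<bar>x\<bar> powr \<gamma>)) \<le> ennreal (w (n - 1) x)" by (rule ennreal_leI)
    also have "\<dots> = (\<Sum>i\<in>{n - 1}. ennreal (w i x))" by simp
    also have "\<dots> \<le> (\<Sum>n. ennreal (w n x))" by (rule sum_le_suminf) auto
    finally show ?thesis by (simp add: add_increasing)
  next
    case False
    then have "\<bar>x\<bar> powr \<gamma> \<le> R' powr \<gamma>" using \<gamma> by (intro powr_mono2) auto
    then have "ennreal (exp (\<kappa> * \<bar>x\<bar> powr \<gamma>)) \<le> ennreal (exp (\<kappa> * R' powr \<gamma>))" using \<kappa> by (intro ennreal_leI) simp
    then show ?thesis by (simp add: add_increasing2)
  qed
  have summand: "(\<integral>\<^sup>+\<omega>. ennreal (w n (X \<omega>)) \<partial>M) \<le> ennreal ((1/2)^Suc n)" for n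
  proof -
    define N where "N = Suc n"
    define c where "c = (2 * D * real (2*N)^q)^N"
    have c: "c > 0" using D by (simp add: c_def N_def)
    have "w n x = (1 / c) * x^(2*N)" for x
      by (simp only: w_def N_def[symmetric] power_divide c_def power_mult times_divide_eq_left mult_1)
    then have "(\<integral>\<^sup>+\<omega>. ennreal (w n (X \<omega>)) \<partial>M) = (\<integral>\<^sup>+\<omega>. ennreal (1 / c) * ennreal ((X \<omega>)^(2*N)) \<partial>M)"
      using c by (intro nn_integral_cong) (simp add: ennreal_mult'[symmetric])
    also have "\<dots> = ennreal (1 / c) * (\<integral>\<^sup>+\<omega>. ennreal ((X \<omega>)^(2*N)) \<partial>M)" by (rule nn_integral_cmult) measurable
    also have "\<dots> \<le> ennreal (1 / c) * ennreal ((D * real (2*N-1)^q)^N)" by (intro mult_left_mono mom) (auto simp: N_def)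
    also have "\<dots> = ennreal ((D * real (2*N-1)^q)^N / c)" using c by (simp add: ennreal_mult'[symmetric])
    also have "\<dots> \<le> ennreal ((1/2)^N)"
    proof (rule ennreal_leI)
      have "(D * real (2*N-1)^q)^N \<le> (D * real (2*N)^q)^N"
        using D by (intro power_mono mult_left_mono) auto
      also have "\<dots> = (1/2)^N * c"
        unfolding c_def power_mult_distrib[symmetric] by (rule arg_cong[of _ _ "\<lambda>x. x^N"]) simp
      finally show "(D * real (2*N-1)^q)^N / c \<le> (1/2)^N" using c by (simp add: divide_le_eq)
    qed
    finally show ?thesis by (simp only: N_def)
  qed
  have [measurable]: "w n \<in> borel_measurable borel" for n unfolding w_def by measurable
  have "(\<integral>\<^sup>+\<omega>. ennreal (exp (\<kappa> * \<bar>X \<omega>\<bar> powr \<gamma>)) \<partial>M) \<le> (\<integral>\<^sup>+\<omega>. ennreal (exp (\<kappa> * R' powr \<gamma>)) + (\<Sum>n. ennreal (w n (X \<omega>))) \<partial>M)"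
    by (intro nn_integral_mono pw)
  also have "\<dots> = ennreal (exp (\<kappa> * R' powr \<gamma>)) + (\<integral>\<^sup>+\<omega>. (\<Sum>n. ennreal (w n (X \<omega>))) \<partial>M)"
    by (subst nn_integral_add) (measurable, simp add: emeasure_space_1)
  also have "(\<integral>\<^sup>+\<omega>. (\<Sum>n. ennreal (w n (X \<omega>))) \<partial>M) = (\<Sum>n. \<integral>\<^sup>+\<omega>. ennreal (w n (X \<omega>)) \<partial>M)"
    by (rule nn_integral_suminf) measurable
  also have "\<dots> \<le> (\<Sum>n. ennreal ((1/2)^Suc n))" by (intro suminf_le summand summableI)
  also have "\<dots> = ennreal (\<Sum>n. (1/2)^Suc n)" by (intro suminf_ennreal2) (auto simp del: power_Suc intro!: summable_Suc_iff[THEN iffD2] summable_geometric)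
  also have "ennreal (exp (\<kappa> * R' powr \<gamma>)) + \<dots> < \<infinity>" by simp
  finally show ?thesis by (simp add: add_left_mono)
qed

section \<open>Joint laws of elementary integrals\<close>

lemma elem_int_shift:
  "elem_int q (shift_list (t + h) p) c B \<omega> = elem_sum q (shift_list t p) c (\<lambda>j a b. B (b + h) \<omega> - B (a + h) \<omega>)"
  by (simp add: elem_int_eq_elem_sum elem_sum_shift shift_list_add)

text \<open>All the elementary integrals are rewritten over one common partition \<open>r\<close>; the law of the increments
  of \<open>B\<close> over \<open>shift_list h r\<close> does not depend on \<open>h\<close>.\<close>
lemma elem_int_joint_law:
  assumes BM: "two_sided_BM M B" and p: "sorted_wrt (<) p"
    and \<phi>: "\<And>i::nat. \<phi> i \<in> borel_measurable borel"
  shows "(\<integral>\<omega>. (\<Prod>i<n. \<phi> i (elem_int q (shift_list (\<tau> i + h) p) c B \<omega>)) \<partial>M :: real)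
    = (\<integral>\<omega>. (\<Prod>i<n. \<phi> i (elem_int q (shift_list (\<tau> i) p) c B \<omega>)) \<partial>M)"
proof -
  \<comment> \<open>The points \<open>0\<close> and \<open>1\<close> guarantee at least one cell, as
    \<open>BM_increments_distr\<close> demands, even if \<open>n = 0\<close> or \<open>p\<close> is
    empty.\<close>
  define r where "r = sorted_list_of_set ((\<Union>i<n. set (shift_list (\<tau> i) p)) \<union> {0, 1})"
  have fin: "finite ((\<Union>i<n. set (shift_list (\<tau> i) p)) \<union> {0::real, 1})" by simp
  have r: "sorted_wrt (<) r" unfolding r_def by (rule strict_sorted_list_of_set)
  have setr: "set r = (\<Union>i<n. set (shift_list (\<tau> i) p)) \<union> {0, 1}" unfolding r_def using fin by (rule set_sorted_list_of_set)
  have "card {0::real, 1} \<le> card (set r)" unfolding setr by (rule card_mono[OF fin]) simp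
  also have "card (set r) \<le> length r" by (rule card_length)
  finally have len: "length r - 1 \<ge> 1" by simp
  let ?N = "length r - 1"
  define W where "W h \<omega> = (\<lambda>l\<in>{..<?N}. B (shift_list h r ! Suc l) \<omega> - B (shift_list h r ! l) \<omega>)" for h \<omega>
  define \<Psi> where "\<Psi> i w = (\<Sum>l \<in> {..<q} \<rightarrow>\<^sub>E {..<?N}. refine_coeff q (shift_list (\<tau> i) p) c r l * (\<Prod>j<q. w (l j)))" for i and w :: "nat \<Rightarrow> real"
  have Bm[measurable]: "B t \<in> borel_measurable M" for t using BM by (simp add: two_sided_BM_def)
  have Wm: "W h \<in> M \<rightarrow>\<^sub>M (\<Pi>\<^sub>M l\<in>{..<?N}. borel)" for h unfolding W_def by measurable
  have \<Psi>m: "(\<lambda>w. \<Prod>i<n. \<phi> i (\<Psi> i w)) \<in> borel_measurable (\<Pi>\<^sub>M l\<in>{..<?N}. (borel :: real measure))"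
  proof (intro borel_measurable_prod measurable_compose[OF _ \<phi>])
    fix i
    show "\<Psi> i \<in> borel_measurable (\<Pi>\<^sub>M l\<in>{..<?N}. (borel :: real measure))"
      unfolding \<Psi>_def
    proof (intro borel_measurable_sum borel_measurable_times borel_measurable_const borel_measurable_prod)
      fix l j assume "l \<in> {..<q} \<rightarrow>\<^sub>E {..<?N}" "j \<in> {..<q}"
      then have "l j \<in> {..<?N}" by (rule PiE_mem)
      then show "(\<lambda>w. w (l j)) \<in> borel_measurable (\<Pi>\<^sub>M l\<in>{..<?N}. (borel :: real measure))"
        by (rule measurable_component_singleton)
    qed
  qed
  have dW: "distr M (\<Pi>\<^sub>M l\<in>{..<?N}. borel) (W h) = (\<Pi>\<^sub>M l\<in>{..<?N}. gauss (sqrt (r ! Suc l - r ! l)))" for h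
  proof -
    have "distr M (\<Pi>\<^sub>M l\<in>{..<?N}. borel) (W h) = (\<Pi>\<^sub>M l\<in>{..<?N}. gauss (if l < ?N then sqrt (shift_list h r ! Suc l - shift_list h r ! l) else 1))"
      using BM_increments_distr[OF BM sorted_shift_list[OF r, of h]] len unfolding W_def by simp
    also have "\<dots> = (\<Pi>\<^sub>M l\<in>{..<?N}. gauss (sqrt (r ! Suc l - r ! l)))"
      by (intro PiM_cong refl) (auto simp: nth_shift_list)
    finally show ?thesis .
  qed
  \<comment> \<open>The shift \<open>h\<close> passes from the partition of the kernel to the
    increments of \<open>B\<close>; the function \<open>\<Psi> i\<close> applied to them is free of
    \<open>h\<close>.\<close>
  have YW: "elem_int q (shift_list (\<tau> i + h) p) c B \<omega> = \<Psi> i (W h \<omega>)" if i: "i < n" for i h \<omega>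
  proof -
    have "elem_int q (shift_list (\<tau> i + h) p) c B \<omega> = elem_sum q (shift_list (\<tau> i) p) c (\<lambda>j a b. B (b + h) \<omega> - B (a + h) \<omega>)"
      by (rule elem_int_shift)
    also have "\<dots> = elem_sum q r (refine_coeff q (shift_list (\<tau> i) p) c r) (\<lambda>j a b. B (b + h) \<omega> - B (a + h) \<omega>)"
      by (rule elem_sum_refine[symmetric, OF sorted_shift_list[OF p] r]) (use i in \<open>auto simp: setr\<close>)
    also have "\<dots> = \<Psi> i (W h \<omega>)"
      unfolding elem_sum_def \<Psi>_def
    proof (intro sum.cong refl arg_cong2[of _ _ _ _ "(*)"] prod.cong)
      fix l j assume "l \<in> {..<q} \<rightarrow>\<^sub>E {..<?N}" "j \<in> {..<q}"
      then have lj: "l j \<in> {..<?N}" by (rule PiE_mem)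
      then have "l j < ?N" by (rule lessThan_iff[THEN iffD1])
      then have "Suc (l j) < length r" by linarith
      then show "B (r ! Suc (l j) + h) \<omega> - B (r ! l j + h) \<omega> = W h \<omega> (l j)"
        using lj by (simp add: W_def nth_shift_list)
    qed
    finally show ?thesis .
  qed
  have val: "(\<integral>\<omega>. (\<Prod>i<n. \<phi> i (elem_int q (shift_list (\<tau> i + h) p) c B \<omega>)) \<partial>M)
      = (\<integral>w. (\<Prod>i<n. \<phi> i (\<Psi> i w)) \<partial>(\<Pi>\<^sub>M l\<in>{..<?N}. gauss (sqrt (r ! Suc l - r ! l))))" for h
  proof -
    have "(\<integral>\<omega>. (\<Prod>i<n. \<phi> i (elem_int q (shift_list (\<tau> i + h) p) c B \<omega>)) \<partial>M) = (\<integral>\<omega>. (\<Prod>i<n. \<phi> i (\<Psi> i (W h \<omega>))) \<partial>M)"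
      by (intro Bochner_Integration.integral_cong refl prod.cong) (simp add: YW)
    also have "\<dots> = (\<integral>w. (\<Prod>i<n. \<phi> i (\<Psi> i w)) \<partial>distr M (\<Pi>\<^sub>M l\<in>{..<?N}. borel) (W h))"
      by (rule integral_distr[symmetric, OF Wm \<Psi>m])
    finally show ?thesis unfolding dW .
  qed
  show ?thesis using val[of h] val[of 0] by simp
qed

text \<open>The concatenation of the two lists is again increasing, and the two integrals are
  functions of the increments over disjoint blocks of its cells.\<close>

lemma elem_int_independent:
  assumes BM: "two_sided_BM M B" and p: "sorted_wrt (<) p" and p': "sorted_wrt (<) p'"
    and sep: "\<And>x y. x \<in> set p \<Longrightarrow> y \<in> set p' \<Longrightarrow> x < y"
    and \<phi>: "\<phi> \<in> borel_measurable borel" "\<psi> \<in> borel_measurable borel"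
    and b: "\<And>x. \<bar>\<phi> x\<bar> \<le> b" "\<And>x. \<bar>\<psi> x\<bar> \<le> b"
  shows "(\<integral>\<omega>. \<phi> (elem_int q p c B \<omega>) * \<psi> (elem_int q p' c' B \<omega>) \<partial>M :: real)
    = (\<integral>\<omega>. \<phi> (elem_int q p c B \<omega>) \<partial>M) * (\<integral>\<omega>. \<psi> (elem_int q p' c' B \<omega>) \<partial>M)"
proof -
  interpret prob_space M using BM by (simp add: two_sided_BM_def)
  have Bm[measurable]: "B t \<in> borel_measurable M" for t using BM by (simp add: two_sided_BM_def)
  have [measurable]: "elem_int q p c B \<in> borel_measurable M" for p c by (rule measurable_elem_int[OF BM])
  define r where "r = p @ p'"
  have r: "sorted_wrt (<) r" unfolding r_def using p p' sep by (auto simp: sorted_wrt_append)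
  let ?X = "\<lambda>l \<omega>. B (r ! Suc l) \<omega> - B (r ! l) \<omega>"
  define L1 where "L1 = {..<length p - 1}"
  \<comment> \<open>The index \<open>length p - 1\<close>, which belongs to the gap between the two
    lists when both are nonempty, lies in neither block.\<close>
  define L2 where "L2 = {length p..<length p + (length p' - 1)}"
  have ind: "indep_vars (\<lambda>_. borel) ?X {..<length r - 1}" using BM r by (simp add: two_sided_BM_def)
  have LL: "L1 \<inter> L2 = {}" "L1 \<subseteq> {..<length r - 1}" "L2 \<subseteq> {..<length r - 1}"
    by (auto simp: L1_def L2_def r_def)
  from indep_var_restrict[OF ind LL]
  have iv: "indep_var (PiM L1 (\<lambda>_. borel)) (\<lambda>\<omega>. restrict (\<lambda>i. ?X i \<omega>) L1) (PiM L2 (\<lambda>_. borel)) (\<lambda>\<omega>. restrict (\<lambda>i. ?X i \<omega>) L2)" .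
  define \<Psi>1 where "\<Psi>1 w = \<phi> (\<Sum>i \<in> {..<q} \<rightarrow>\<^sub>E {..<length p - 1}. c i * (\<Prod>j<q. w (i j)))" for w :: "nat \<Rightarrow> real"
  define \<Psi>2 where "\<Psi>2 w = \<psi> (\<Sum>i \<in> {..<q} \<rightarrow>\<^sub>E {..<length p' - 1}. c' i * (\<Prod>j<q. w (length p + i j)))" for w :: "nat \<Rightarrow> real"
  have m1: "\<Psi>1 \<in> borel_measurable (PiM L1 (\<lambda>_. borel))"
    unfolding \<Psi>1_def
  proof (intro measurable_compose[OF _ \<phi>(1)] borel_measurable_sum borel_measurable_times borel_measurable_const borel_measurable_prod)
    fix i j assume "i \<in> {..<q} \<rightarrow>\<^sub>E {..<length p - 1}" "j \<in> {..<q}"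
    then have "i j \<in> L1" unfolding L1_def by (rule PiE_mem)
    then show "(\<lambda>w. w (i j)) \<in> borel_measurable (PiM L1 (\<lambda>_. (borel::real measure)))" by (rule measurable_component_singleton)
  qed
  have m2: "\<Psi>2 \<in> borel_measurable (PiM L2 (\<lambda>_. borel))"
    unfolding \<Psi>2_def
  proof (intro measurable_compose[OF _ \<phi>(2)] borel_measurable_sum borel_measurable_times borel_measurable_const borel_measurable_prod)
    fix i j assume "i \<in> {..<q} \<rightarrow>\<^sub>E {..<length p' - 1}" "j \<in> {..<q}"
    then have "i j \<in> {..<length p' - 1}" by (rule PiE_mem)
    then have "length p + i j \<in> L2" unfolding L2_def by simp
    then show "(\<lambda>w. w (length p + i j)) \<in> borel_measurable (PiM L2 (\<lambda>_. (borel::real measure)))" by (rule measurable_component_singleton)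
  qed
  have e1: "\<Psi>1 (restrict (\<lambda>i. ?X i \<omega>) L1) = \<phi> (elem_int q p c B \<omega>)" for \<omega>
    unfolding \<Psi>1_def elem_int_def
  proof (intro arg_cong[of _ _ \<phi>] sum.cong refl arg_cong2[of _ _ _ _ "(*)"] prod.cong)
    fix i j assume "i \<in> {..<q} \<rightarrow>\<^sub>E {..<length p - 1}" "j \<in> {..<q}"
    then have "i j \<in> L1" unfolding L1_def by (rule PiE_mem)
    moreover from this have "Suc (i j) < length p" by (auto simp: L1_def)
    ultimately show "restrict (\<lambda>i. ?X i \<omega>) L1 (i j) = B (p ! Suc (i j)) \<omega> - B (p ! i j) \<omega>"
      by (simp add: r_def nth_append)
  qed
  have e2: "\<Psi>2 (restrict (\<lambda>i. ?X i \<omega>) L2) = \<psi> (elem_int q p' c' B \<omega>)" for \<omega>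
    unfolding \<Psi>2_def elem_int_def
  proof (intro arg_cong[of _ _ \<psi>] sum.cong refl arg_cong2[of _ _ _ _ "(*)"] prod.cong)
    fix i j assume "i \<in> {..<q} \<rightarrow>\<^sub>E {..<length p' - 1}" "j \<in> {..<q}"
    then have "i j \<in> {..<length p' - 1}" by (rule PiE_mem)
    then have "length p + i j \<in> L2" unfolding L2_def by simp
    moreover have "r ! Suc (length p + i j) = p' ! Suc (i j)" "r ! (length p + i j) = p' ! i j"
      unfolding r_def by (simp_all add: nth_append)
    ultimately show "restrict (\<lambda>i. ?X i \<omega>) L2 (length p + i j) = B (p' ! Suc (i j)) \<omega> - B (p' ! i j) \<omega>" by simp
  qed
  have "indep_var borel (\<Psi>1 \<circ> (\<lambda>\<omega>. restrict (\<lambda>i. ?X i \<omega>) L1)) borel (\<Psi>2 \<circ> (\<lambda>\<omega>. restrict (\<lambda>i. ?X i \<omega>) L2))"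
    by (rule indep_var_compose[OF iv m1 m2])
  then have "indep_var borel (\<lambda>\<omega>. \<phi> (elem_int q p c B \<omega>)) borel (\<lambda>\<omega>. \<psi> (elem_int q p' c' B \<omega>))"
    unfolding o_def e1 e2 .
  moreover have "integrable M (\<lambda>\<omega>. \<phi> (elem_int q p c B \<omega>))" "integrable M (\<lambda>\<omega>. \<psi> (elem_int q p' c' B \<omega>))"
    using b \<phi> by (auto intro!: integrable_const_bound[where B=b])
  ultimately show ?thesis by (rule indep_var_lebesgue_integral)
qed

text \<open>Only cylinders over initial segments of indices are used. They form a family indexed by
  a length and a bound, and the intersection of two of them is one over the longer segment.\<close>

lemma sets_seq_space_generator:
  "sets seq_space = sigma_sets UNIV (range (\<lambda>(n::nat, a). {x. \<forall>i<n. x i < a i}))"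
proof -
  have "sets seq_space = sets (\<Pi>\<^sub>M (_::nat)\<in>UNIV. sigma (UNIV::real set) (range lessThan))"
    by (intro sets_PiM_cong refl) (simp add: borel_Iio[symmetric])
  also have "\<dots> = sets (sigma (\<Pi>\<^sub>E i\<in>UNIV. UNIV) {{f\<in>(\<Pi>\<^sub>E i\<in>UNIV. UNIV). \<forall>i\<in>j. f i \<in> A i} | A j. j \<in> range (\<lambda>n::nat. {..<n}) \<and> A \<in> Pi j (\<lambda>_. range lessThan)})"
  proof (rule sets_PiM_sigma)
    show "\<exists>S\<subseteq>range lessThan. countable S \<and> (UNIV::real set) = \<Union>S" for i :: nat by (rule lessThan_countable_cover)
    show "\<Union> (range (\<lambda>n::nat. {..<n})) = UNIV" using lessI by blast
  qed auto
  also have "\<dots> = sigma_sets (\<Pi>\<^sub>E i\<in>UNIV. UNIV) {{f\<in>(\<Pi>\<^sub>E i\<in>UNIV. UNIV). \<forall>i\<in>j. f i \<in> A i} | A j. j \<in> range (\<lambda>n::nat. {..<n}) \<and> A \<in> Pi j (\<lambda>_. range lessThan)}"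
    by (rule sets_measure_of) auto
  also have "{{f\<in>(\<Pi>\<^sub>E i\<in>UNIV. UNIV). \<forall>i\<in>j. f i \<in> A i} | A j. j \<in> range (\<lambda>n::nat. {..<n}) \<and> A \<in> Pi j (\<lambda>_. range lessThan)}
    = range (\<lambda>(n::nat, a). {x. \<forall>i<n. x i < (a i :: real)})"
  proof (intro set_eqI iffI)
    fix Z assume "Z \<in> {{f\<in>(\<Pi>\<^sub>E i\<in>UNIV. UNIV). \<forall>i\<in>j. f i \<in> A i} | A j. j \<in> range (\<lambda>n::nat. {..<n}) \<and> A \<in> Pi j (\<lambda>_. range (lessThan :: real \<Rightarrow> real set))}"
    then obtain A :: "nat \<Rightarrow> real set" and n :: nat where A: "Z = {f\<in>(\<Pi>\<^sub>E i\<in>UNIV. UNIV). \<forall>i\<in>{..<n}. f i \<in> A i}" "\<forall>i\<in>{..<n}. A i \<in> range lessThan" by auto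
    then have "\<forall>i\<in>{..<n}. \<exists>a. A i = {..<a}" by auto
    then obtain a where "\<forall>i\<in>{..<n}. A i = {..<a i}" by metis
    with A show "Z \<in> range (\<lambda>(n::nat, a). {x. \<forall>i<n. x i < (a i :: real)})"
      by (intro image_eqI[of _ _ "(n, a)"]) auto
  next
    fix Z assume "Z \<in> range (\<lambda>(n::nat, a). {x. \<forall>i<n. x i < (a i :: real)})"
    then obtain n :: nat and a :: "nat \<Rightarrow> real" where "Z = {x. \<forall>i<n. x i < a i}" by auto
    then show "Z \<in> {{f\<in>(\<Pi>\<^sub>E i\<in>UNIV. UNIV). \<forall>i\<in>j. f i \<in> A i} | A j. j \<in> range (\<lambda>n::nat. {..<n}) \<and> A \<in> Pi j (\<lambda>_. range (lessThan :: real \<Rightarrow> real set))}"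
      by (intro CollectI exI[of _ "\<lambda>i. {..<a i}"] exI[of _ "{..<n}"]) auto
  qed
  finally show ?thesis by simp
qed

text \<open>The cylinders of \<open>sets_seq_space_generator\<close> are stable under intersection,
  so the finite-dimensional distribution functions determine the law on the sequence space.\<close>

lemma (in prob_space) stationaryI:
  assumes [measurable]: "\<And>n. X n \<in> borel_measurable M"
    and eq: "\<And>n a. prob {\<omega>\<in>space M. \<forall>i<n. X (Suc i) \<omega> < a i} = prob {\<omega>\<in>space M. \<forall>i<n. X i \<omega> < a i}"
  shows "stationary M X"
proof -
  have m: "(\<lambda>\<omega> n. X (f n) \<omega>) \<in> M \<rightarrow>\<^sub>M seq_space" for f by (intro measurable_seq_spaceI) simp
  let ?E = "range (\<lambda>(n::nat, a). {x. \<forall>i<n. x i < (a i :: real)})"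
  have "distr M seq_space (\<lambda>\<omega> n. X (Suc n) \<omega>) = distr M seq_space (\<lambda>\<omega> n. X n \<omega>)"
  proof (rule measure_eqI_generator_eq[where \<Omega>=UNIV and E="?E" and A="\<lambda>_. UNIV"])
    show "Int_stable ?E"
      unfolding Int_stable_def
    proof (intro ballI)
      fix A A' assume "A \<in> ?E" "A' \<in> ?E"
      then obtain n n' and a a' :: "nat \<Rightarrow> real" where "A = {x. \<forall>i<n. x i < a i}" "A' = {x. \<forall>i<n'. x i < a' i}" by auto
      then have "A \<inter> A' = {x. \<forall>i<max n n'. x i < (if i < n then if i < n' then min (a i) (a' i) else a i else a' i)}"
        by (auto simp: less_max_iff_disj split: if_splits)
      then show "A \<inter> A' \<in> ?E"
        by (intro image_eqI[of _ _ "(max n n', \<lambda>i. if i < n then if i < n' then min (a i) (a' i) else a i else a' i)"]) auto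
    qed
    fix Z assume "Z \<in> ?E"
    then obtain n a where Z: "Z = {x. \<forall>i<n. x i < (a i :: real)}" by auto
    have Zs: "Z \<in> sets seq_space" unfolding sets_seq_space_generator using \<open>Z \<in> ?E\<close> by (rule sigma_sets.Basic)
    have "emeasure (distr M seq_space (\<lambda>\<omega> n. X (f n) \<omega>)) Z = ennreal (prob {\<omega>\<in>space M. \<forall>i<n. X (f i) \<omega> < a i})" for f
    proof -
      have "emeasure (distr M seq_space (\<lambda>\<omega> n. X (f n) \<omega>)) Z = emeasure M ((\<lambda>\<omega> n. X (f n) \<omega>) -` Z \<inter> space M)"
        by (rule emeasure_distr[OF m Zs])
      also have "(\<lambda>\<omega> n. X (f n) \<omega>) -` Z \<inter> space M = {\<omega>\<in>space M. \<forall>i<n. X (f i) \<omega> < a i}" by (auto simp: Z)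
      finally show ?thesis by (simp add: emeasure_eq_measure)
    qed
    from this[of Suc] this[of "\<lambda>i. i"]
    show "emeasure (distr M seq_space (\<lambda>\<omega> n. X (Suc n) \<omega>)) Z = emeasure (distr M seq_space (\<lambda>\<omega> n. X n \<omega>)) Z"
      by (simp add: eq)
  next
    show "range (\<lambda>_::nat. UNIV) \<subseteq> ?E" by (auto intro!: image_eqI[of _ _ "(0, \<lambda>_. 0)"])
    show "emeasure (distr M seq_space (\<lambda>\<omega> n. X (Suc n) \<omega>)) UNIV \<noteq> \<infinity>"
      using emeasure_space[of "distr M seq_space (\<lambda>\<omega> n. X (Suc n) \<omega>)" UNIV] prob_space.emeasure_le_1[OF prob_space_distr[OF m[of Suc]], of UNIV]
      by (auto simp: top_unique)
  qed (auto simp: sets_seq_space_generator)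
  then show ?thesis unfolding stationary_def using assms(1) by blast
qed

text \<open>Ramp functions approximate the indicator of a half line from below, so agreement of the product
  integrals of all ramps gives agreement of the joint distribution functions.\<close>
lemma (in prob_space) joint_cdf_eq_of_ramps:
  fixes X Y :: "nat \<Rightarrow> 'a \<Rightarrow> real"
  assumes [measurable]: "\<And>i. X i \<in> borel_measurable M" "\<And>i. Y i \<in> borel_measurable M"
    and eq: "\<And>m. (\<integral>\<omega>. (\<Prod>i<n. ramp (a i) m (X i \<omega>)) \<partial>M) = (\<integral>\<omega>. (\<Prod>i<n. ramp (a i) m (Y i \<omega>)) \<partial>M)"
  shows "prob {\<omega>\<in>space M. \<forall>i<n. X i \<omega> < a i} = prob {\<omega>\<in>space M. \<forall>i<n. Y i \<omega> < a i}"
proof -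
  have lim: "(\<lambda>m. \<integral>\<omega>. (\<Prod>i<n. ramp (a i) m (Z i \<omega>)) \<partial>M) \<longlonglongrightarrow> prob {\<omega>\<in>space M. \<forall>i<n. Z i \<omega> < a i}"
    if [measurable]: "\<And>i. Z i \<in> borel_measurable M" for Z :: "nat \<Rightarrow> 'a \<Rightarrow> real"
  proof -
    have [measurable]: "ramp a m \<in> borel_measurable borel" for a m
      by (intro bdd_lipschitz_measurable bdd_lipschitz_ramp)
    have "(\<lambda>m. \<integral>\<omega>. (\<Prod>i<n. ramp (a i) m (Z i \<omega>)) \<partial>M) \<longlonglongrightarrow> (\<integral>\<omega>. (\<Prod>i<n. indicator {..<a i} (Z i \<omega>)) \<partial>M)"
    proof (rule integral_dominated_convergence[where w="\<lambda>_. 1"])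
      show "AE \<omega> in M. (\<lambda>m. \<Prod>i<n. ramp (a i) m (Z i \<omega>)) \<longlonglongrightarrow> (\<Prod>i<n. indicator {..<a i} (Z i \<omega>))"
        by (intro AE_I2 tendsto_prod ramp_tendsto)
      show "AE \<omega> in M. norm (\<Prod>i<n. ramp (a i) m (Z i \<omega>)) \<le> 1" for m
        by (intro AE_I2) (auto simp: abs_prod ramp_range intro!: prod_le_1)
    qed auto
    also have "(\<integral>\<omega>. (\<Prod>i<n. indicator {..<a i} (Z i \<omega>)) \<partial>M :: real) = (\<integral>\<omega>. indicator {\<omega>\<in>space M. \<forall>i<n. Z i \<omega> < a i} \<omega> \<partial>M)"
    proof (intro Bochner_Integration.integral_cong refl)
      fix \<omega> assume "\<omega> \<in> space M"
      then show "(\<Prod>i<n. indicator {..<a i} (Z i \<omega>)) = (indicator {\<omega>\<in>space M. \<forall>i<n. Z i \<omega> < a i} \<omega> :: real)"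
        by (cases "\<forall>i<n. Z i \<omega> < a i") (auto simp: indicator_def intro!: prod_zero)
    qed
    also have "\<dots> = prob {\<omega>\<in>space M. \<forall>i<n. Z i \<omega> < a i}" by simp
    finally show ?thesis .
  qed
  have "(\<lambda>m. \<integral>\<omega>. (\<Prod>i<n. ramp (a i) m (X i \<omega>)) \<partial>M) \<longlonglongrightarrow> prob {\<omega>\<in>space M. \<forall>i<n. Y i \<omega> < a i}"
    unfolding eq by (rule lim) simp
  with lim[of X] show ?thesis by (intro LIMSEQ_unique) auto
qed

section \<open>The Hermite-Ornstein-Uhlenbeck process\<close>

text \<open>\<open>U_eq\<close> pins down each \<open>U t\<close> up to a null set of its own.
  Measurability is assumed for one time at a time; joint measurability is added where time integrals
  occur.\<close>

locale hermite_ou =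
  fixes M :: "'a measure" and B U :: "real \<Rightarrow> 'a \<Rightarrow> real" and a H :: real and q :: nat
  assumes BM: "two_sided_BM M B" and a: "a > 0" and q: "q \<ge> 1" and H: "1/2 < H" "H < 1"
    and U_eq: "\<And>t. t \<ge> 0 \<Longrightarrow> AE \<omega> in M. U t \<omega> = hermite_integral M B q H (ou a t) \<omega>"
    and U_measurable: "\<And>t. U t \<in> borel_measurable M"
begin

sublocale prob_space M using BM by (simp add: two_sided_BM_def)

declare U_measurable [measurable]

lemma kernel_L2: "(\<integral>\<^sup>+x. ennreal ((hermite_kernel q H (ou a 0) x)\<^sup>2) \<partial>lebesgue_pow q) < \<infinity>"
  by (rule hermite_kernel_square_integrable[OF a q H])

text \<open>Both kernels are translated by the same vector, and Lebesgue measure does not notice: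
  one approximation at time \<open>0\<close> has the same error at every time.\<close>

lemma kernel_shift_error:
  "(\<integral>\<^sup>+x. ennreal ((hermite_kernel q H (ou a t) x - elem_fun q (shift_list t p) c x)\<^sup>2) \<partial>lebesgue_pow q)
   = (\<integral>\<^sup>+x. ennreal ((hermite_kernel q H (ou a 0) x - elem_fun q p c x)\<^sup>2) \<partial>lebesgue_pow q)"
proof -
  have [measurable]: "hermite_kernel q H (ou a 0) \<in> borel_measurable (lebesgue_pow q)" by (rule measurable_hermite_kernel)
  show ?thesis
    unfolding hermite_kernel_translate[of q H a t] elem_fun_shift
    by (rule nn_integral_lebesgue_pow_translate[of "\<lambda>x. ennreal ((hermite_kernel q H (ou a 0) x - elem_fun q p c x)\<^sup>2)"])
      (measurable, simp add: elem_fun_restrict hermite_kernel_eq)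
qed

lemma kernel_L2_shift: "(\<integral>\<^sup>+x. ennreal ((hermite_kernel q H (ou a t) x)\<^sup>2) \<partial>lebesgue_pow q) < \<infinity>"
  \<comment> \<open>The empty list represents the zero kernel, for which the error is the squared
    norm itself.\<close>
  using kernel_shift_error[of t "[]" "\<lambda>_. 0"] kernel_L2 by (simp add: elem_fun_def)

definition hconst :: real where "hconst = hermite_const M B q H"

definition elem_ou :: "real list \<Rightarrow> ((nat \<Rightarrow> nat) \<Rightarrow> real) \<Rightarrow> real \<Rightarrow> 'a \<Rightarrow> real" where
  "elem_ou p c t \<omega> = hconst * elem_int q (shift_list t p) c B \<omega>"

lemma measurable_elem_ou [measurable]: "elem_ou p c t \<in> borel_measurable M"
  unfolding elem_ou_def[abs_def] using measurable_elem_int[OF BM] by measurable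

text \<open>The point lies in the order of the quantifiers: lists, coefficients and the constant
  \<open>A\<close> do not depend on \<open>t\<close>.\<close>

lemma approximants:
  obtains P C A where "\<And>k::nat. elem_admissible q (P k) (C k)" "A \<ge> 0"
    "\<And>k t. t \<ge> 0 \<Longrightarrow> (\<integral>\<^sup>+\<omega>. ennreal ((U t \<omega> - elem_ou (P k) (C k) t \<omega>)\<^sup>2) \<partial>M) \<le> ennreal (A * (1/4)^k)"
proof -
  have m: "hermite_kernel q H (ou a t) \<in> borel_measurable (lebesgue_pow q)" for t by (rule measurable_hermite_kernel)
  obtain P C where PC: "\<And>k. elem_admissible q (P k) (C k)"
    and e: "\<And>k. (\<integral>\<^sup>+x. ennreal ((hermite_kernel q H (ou a 0) x - elem_fun q (P k) (C k) x)\<^sup>2) \<partial>lebesgue_pow q) \<le> ennreal ((1/4)^k)"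
    using approximable_sequence[OF elementary_dense[OF m kernel_L2]] by blast
  show ?thesis
  proof (rule that[OF PC])
    show "hconst\<^sup>2 * (4 * real (q^q)) \<ge> 0" by simp
    fix k :: nat and t :: real assume t: "t \<ge> 0"
    let ?I = "mwi_integral M B q (hermite_kernel q H (ou a t))"
    let ?Y = "elem_int q (shift_list t (P k)) (C k) B"
    have adm: "elem_admissible q (shift_list t (P k)) (C k)" by (rule elem_admissible_shift[OF PC])
    note bd = mwi_integral_elem_bound[OF BM q adm m kernel_L2_shift, of t]
    have [measurable]: "?I \<in> borel_measurable M" "?Y \<in> borel_measurable M" by (rule bd(2), rule measurable_elem_int[OF BM])
    have "(\<integral>\<^sup>+\<omega>. ennreal ((U t \<omega> - elem_ou (P k) (C k) t \<omega>)\<^sup>2) \<partial>M) = (\<integral>\<^sup>+\<omega>. ennreal ((hconst * (?I \<omega> - ?Y \<omega>))\<^sup>2) \<partial>M)"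
      by (intro nn_integral_cong_AE, use U_eq[OF t] in eventually_elim)
        (simp add: hermite_integral_def hconst_def elem_ou_def right_diff_distrib)
    also have "\<dots> = ennreal (hconst\<^sup>2) * (\<integral>\<^sup>+\<omega>. ennreal ((?I \<omega> - ?Y \<omega>)\<^sup>2) \<partial>M)"
      by (rule nn_integral_square_cmult) measurable
    also have "\<dots> \<le> ennreal (hconst\<^sup>2) * (ennreal (4 * real (q^q)) * ennreal ((1/4)^k))"
    proof (intro mult_left_mono order.trans[OF bd(1)])
      show "(\<integral>\<^sup>+x. ennreal ((hermite_kernel q H (ou a t) x - elem_fun q (shift_list t (P k)) (C k) x)\<^sup>2) \<partial>lebesgue_pow q) \<le> ennreal ((1/4)^k)"
        unfolding kernel_shift_error by (rule e)
    qed auto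
    also have "\<dots> = ennreal (hconst\<^sup>2 * (4 * real (q^q)) * (1/4)^k)"
      by (simp add: ennreal_mult[symmetric] mult_ac)
    finally show "(\<integral>\<^sup>+\<omega>. ennreal ((U t \<omega> - elem_ou (P k) (C k) t \<omega>)\<^sup>2) \<partial>M) \<le> ennreal (hconst\<^sup>2 * (4 * real (q^q)) * (1/4)^k)" .
  qed
qed

text \<open>Means of products of ramps agree for the approximants by
  \<open>elem_int_joint_law\<close> and pass to the limit by dominated convergence. The step
  \<open>h\<close> is left general because \<open>h = s\<close>, started at \<open>0\<close>, also
  shows that \<open>U s\<close> and \<open>U 0\<close> have the same law.\<close>

lemma stationary_ou:
  assumes s: "s \<ge> 0" and h: "h \<ge> 0"
  shows "stationary M (\<lambda>n. U (s + real n * h))"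
proof (rule stationaryI)
  obtain P C A where PC: "\<And>k::nat. elem_admissible q (P k) (C k)" and A: "A \<ge> 0"
    and le: "\<And>k t. t \<ge> 0 \<Longrightarrow> (\<integral>\<^sup>+\<omega>. ennreal ((U t \<omega> - elem_ou (P k) (C k) t \<omega>)\<^sup>2) \<partial>M) \<le> ennreal (A * (1/4)^k)"
    using approximants by blast
  show "U (s + real n * h) \<in> borel_measurable M" for n by measurable
  fix n and b :: "nat \<Rightarrow> real"
  have [measurable]: "ramp b m \<in> borel_measurable borel" for b m
    by (intro bdd_lipschitz_measurable bdd_lipschitz_ramp)
  have lim: "(\<lambda>k. \<integral>\<omega>. (\<Prod>i<n. ramp (b i) m (elem_ou (P k) (C k) (\<tau> i) \<omega>)) \<partial>M) \<longlonglongrightarrow> (\<integral>\<omega>. (\<Prod>i<n. ramp (b i) m (U (\<tau> i) \<omega>)) \<partial>M)"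
    if \<tau>: "\<And>i. \<tau> i \<ge> 0" for \<tau> m
  proof (rule integral_dominated_convergence[where w="\<lambda>_. 1"])
    have "AE \<omega> in M. \<forall>i\<in>{..<n}. (\<lambda>k. elem_ou (P k) (C k) (\<tau> i) \<omega>) \<longlonglongrightarrow> U (\<tau> i) \<omega>"
      by (intro AE_ball_countable[THEN iffD2] ballI countable_finite finite_lessThan AE_tendsto_of_geometric_L2[OF _ _ A le[OF \<tau>]]) measurable
    then show "AE \<omega> in M. (\<lambda>k. \<Prod>i<n. ramp (b i) m (elem_ou (P k) (C k) (\<tau> i) \<omega>)) \<longlonglongrightarrow> (\<Prod>i<n. ramp (b i) m (U (\<tau> i) \<omega>))"
    proof eventually_elim
      case (elim \<omega>)
      have cont: "isCont (ramp (b i) m) x" for i x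
        using bdd_lipschitz_continuous[OF bdd_lipschitz_ramp, of "b i" m] by (simp add: continuous_on_eq_continuous_at)
      show ?case
      proof (rule tendsto_prod)
        fix i assume "i \<in> {..<n}"
        with elim have "(\<lambda>k. elem_ou (P k) (C k) (\<tau> i) \<omega>) \<longlonglongrightarrow> U (\<tau> i) \<omega>" by blast
        then show "(\<lambda>k. ramp (b i) m (elem_ou (P k) (C k) (\<tau> i) \<omega>)) \<longlonglongrightarrow> ramp (b i) m (U (\<tau> i) \<omega>)"
          by (rule isCont_tendsto_compose[OF cont])
      qed
    qed
    show "AE \<omega> in M. norm (\<Prod>i<n. ramp (b i) m (elem_ou (P k) (C k) (\<tau> i) \<omega>)) \<le> 1" for k
      by (intro AE_I2) (auto simp: abs_prod ramp_range intro!: prod_le_1)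
  qed auto
  show "prob {\<omega>\<in>space M. \<forall>i<n. U (s + real (Suc i) * h) \<omega> < b i} = prob {\<omega>\<in>space M. \<forall>i<n. U (s + real i * h) \<omega> < b i}"
  proof (rule joint_cdf_eq_of_ramps)
    fix m
    have p: "sorted_wrt (<) (P k)" for k using PC by (simp add: elem_admissible_def)
    have eq: "(\<integral>\<omega>. (\<Prod>i<n. ramp (b i) m (elem_ou (P k) (C k) (s + real (Suc i) * h) \<omega>)) \<partial>M)
        = (\<integral>\<omega>. (\<Prod>i<n. ramp (b i) m (elem_ou (P k) (C k) (s + real i * h) \<omega>)) \<partial>M)" for k
    proof -
      have e: "s + real (Suc i) * h = (s + real i * h) + h" for i by (simp add: algebra_simps)
      show ?thesis unfolding elem_ou_def e
        by (rule elem_int_joint_law[OF BM p, where \<phi>="\<lambda>i x. ramp (b i) m (hconst * x)"]) measurable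
    qed
    have "(\<lambda>k. \<integral>\<omega>. (\<Prod>i<n. ramp (b i) m (elem_ou (P k) (C k) (s + real (Suc i) * h) \<omega>)) \<partial>M) \<longlonglongrightarrow> (\<integral>\<omega>. (\<Prod>i<n. ramp (b i) m (U (s + real (Suc i) * h) \<omega>)) \<partial>M)"
      by (rule lim) (use s h in auto)
    moreover have "(\<lambda>k. \<integral>\<omega>. (\<Prod>i<n. ramp (b i) m (elem_ou (P k) (C k) (s + real i * h) \<omega>)) \<partial>M) \<longlonglongrightarrow> (\<integral>\<omega>. (\<Prod>i<n. ramp (b i) m (U (s + real i * h) \<omega>)) \<partial>M)"
      by (rule lim) (use s h in auto)
    ultimately show "(\<integral>\<omega>. (\<Prod>i<n. ramp (b i) m (U (s + real (Suc i) * h) \<omega>)) \<partial>M) = (\<integral>\<omega>. (\<Prod>i<n. ramp (b i) m (U (s + real i * h) \<omega>)) \<partial>M)"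
      unfolding eq by (rule LIMSEQ_unique)
  qed measurable
qed

lemma distr_U:
  assumes "s \<ge> 0" shows "distr M borel (U s) = distr M borel (U 0)"
  using stationary_distr[OF stationary_ou[of 0 s], of 1] assms by simp

text \<open>Once two times are farther apart than the width of the window, the approximants there
  are independent and the mean of the product factorizes exactly. Only the passage between
  \<open>U\<close> and its approximants, before and after factorizing, costs anything.\<close>

lemma mixing_ou:
  assumes s: "s \<ge> 0"
  shows "mixing M (\<lambda>n. U (s + real n))"
  unfolding mixing_def
proof (intro allI impI)
  fix g and e :: real assume g: "bdd_lipschitz g" and e: "e > 0"
  obtain b L where b: "b > 0" "\<And>x. \<bar>g x\<bar> \<le> b" and L: "L > 0" "\<And>x y. \<bar>g x - g y\<bar> \<le> L * \<bar>x - y\<bar>"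
    using g by (rule bdd_lipschitzE) blast
  have gm[measurable]: "g \<in> borel_measurable borel" using g by (rule bdd_lipschitz_measurable)
  obtain P C A where PC: "\<And>k::nat. elem_admissible q (P k) (C k)" and A: "A \<ge> 0"
    and le: "\<And>k t. t \<ge> 0 \<Longrightarrow> (\<integral>\<^sup>+\<omega>. ennreal ((U t \<omega> - elem_ou (P k) (C k) t \<omega>)\<^sup>2) \<partial>M) \<le> ennreal (A * (1/4)^k)"
    using approximants by blast
  \<comment> \<open>The two passages cost \<open>2 * b * (L * \<eta>)\<close> each, together
    \<open>e\<close>.\<close>
  define \<eta> where "\<eta> = e / (4 * b * L)"
  have \<eta>: "\<eta> > 0" using e b L by (simp add: \<eta>_def)
  have "(\<lambda>k. A * (1/4)^k) \<longlonglongrightarrow> A * 0" by (intro tendsto_mult tendsto_const LIMSEQ_realpow_zero) auto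
  then have "\<forall>\<^sub>F k in sequentially. A * (1/4)^k < \<eta>\<^sup>2" using \<eta> by (intro order_tendstoD) auto
  then obtain k where k: "A * (1/4)^k < \<eta>\<^sup>2" using eventually_happens'[OF sequentially_bot] by blast
  define p where "p = P k"
  define c where "c = C k"
  have adm: "elem_admissible q p c" unfolding p_def c_def by (rule PC)
  then have p: "sorted_wrt (<) p" by (simp add: elem_admissible_def)
  define Y where "Y = elem_ou p c"
  have [measurable]: "Y t \<in> borel_measurable M" for t unfolding Y_def by measurable
  have gU: "integrable M (\<lambda>\<omega>. g (U t \<omega>))" and gY: "integrable M (\<lambda>\<omega>. g (Y t \<omega>))" for t
    by (rule integrable_const_bound[where B=b]; use b in auto)+
  have gg: "integrable M (\<lambda>\<omega>. g (X \<omega>) * g (Z \<omega>))" if [measurable]: "X \<in> borel_measurable M" "Z \<in> borel_measurable M" for X Z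
    by (rule integrable_const_bound[where B="b*b"]) (use b in \<open>auto simp: abs_mult intro!: mult_mono\<close>)
  have d: "(\<integral>\<omega>. \<bar>g (U t \<omega>) - g (Y t \<omega>)\<bar> \<partial>M) \<le> L * \<eta>" if t: "t \<ge> 0" for t
  proof -
    have "(\<integral>\<^sup>+\<omega>. ennreal ((U t \<omega> - Y t \<omega>)\<^sup>2) \<partial>M) \<le> ennreal (\<eta>\<^sup>2)"
      using le[OF t, of k] k unfolding Y_def p_def c_def by (meson ennreal_leI less_imp_le order.trans)
    then have iD: "integrable M (\<lambda>\<omega>. (U t \<omega> - Y t \<omega>)\<^sup>2)"
      by (intro integrableI_bounded) (auto intro: le_less_trans)
    have sqle: "(\<integral>\<omega>. (U t \<omega> - Y t \<omega>)\<^sup>2 \<partial>M) \<le> \<eta>\<^sup>2"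
      using \<open>_ \<le> ennreal (\<eta>\<^sup>2)\<close> nn_integral_eq_integral[OF iD] by (simp add: ennreal_le_iff)
    have "(\<integral>\<omega>. \<bar>g (U t \<omega>) - g (Y t \<omega>)\<bar> \<partial>M) \<le> (\<integral>\<omega>. L * ((\<eta> + (U t \<omega> - Y t \<omega>)\<^sup>2 / \<eta>) / 2) \<partial>M)"
    proof (rule integral_mono)
      fix \<omega>
      have "2 * \<eta> * \<bar>U t \<omega> - Y t \<omega>\<bar> \<le> \<eta>\<^sup>2 + (U t \<omega> - Y t \<omega>)\<^sup>2" using sum_squares_bound[of \<eta> "\<bar>U t \<omega> - Y t \<omega>\<bar>"] by simp
      then have "2 * \<eta> * \<bar>U t \<omega> - Y t \<omega>\<bar> / \<eta> \<le> (\<eta>\<^sup>2 + (U t \<omega> - Y t \<omega>)\<^sup>2) / \<eta>" using \<eta> by (intro divide_right_mono) auto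
      then have "\<bar>U t \<omega> - Y t \<omega>\<bar> \<le> (\<eta> + (U t \<omega> - Y t \<omega>)\<^sup>2 / \<eta>) / 2"
        using \<eta> by (simp add: add_divide_distrib power2_eq_square[of \<eta>])
      then show "\<bar>g (U t \<omega>) - g (Y t \<omega>)\<bar> \<le> L * ((\<eta> + (U t \<omega> - Y t \<omega>)\<^sup>2 / \<eta>) / 2)"
        using L by (intro order.trans[OF L(2)] mult_left_mono) auto
    qed (use gU gY iD in auto)
    also have "\<dots> = L * ((\<eta> + (\<integral>\<omega>. (U t \<omega> - Y t \<omega>)\<^sup>2 \<partial>M) / \<eta>) / 2)" using iD by (simp add: prob_space)
    also have "\<dots> \<le> L * ((\<eta> + \<eta>\<^sup>2 / \<eta>) / 2)"
      using L \<eta> sqle by (intro mult_left_mono divide_right_mono add_left_mono) auto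
    also have "\<dots> = L * \<eta>" using \<eta> by (simp add: power2_eq_square)
    finally show ?thesis .
  qed
  obtain m0 where m0: "\<And>x. x \<in> set p \<Longrightarrow> \<bar>x\<bar> \<le> m0"
    using finite_imp_bounded[of "set p"] by (auto simp: bounded_iff)
  \<comment> \<open>All points of \<open>p\<close> lie within \<open>m0\<close> of the origin, so
    windows translated by amounts differing by more than \<open>2 * m0\<close> are disjoint.\<close>
  obtain m :: nat where m: "2 * m0 < real m" using reals_Archimedean2 by blast
  have "\<bar>(\<integral>\<omega>. g (U (s + real i) \<omega>) * g (U (s + real j) \<omega>) \<partial>M) - (\<integral>\<omega>. g (U (s + real 0) \<omega>) \<partial>M)\<^sup>2\<bar> \<le> e" if ij: "i + m \<le> j" for i j
  proof -
    define t t' where "t = s + real i" and "t' = s + real j"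
    have t: "t \<ge> 0" "t' \<ge> 0" using s by (simp_all add: t_def t'_def)
    define u where "u = (\<integral>\<omega>. g (U 0 \<omega>) \<partial>M)"
    have Eu: "(\<integral>\<omega>. g (U r \<omega>) \<partial>M) = u" if "r \<ge> 0" for r
    proof -
      have "(\<integral>\<omega>. g (U r \<omega>) \<partial>M) = (\<integral>x. g x \<partial>distr M borel (U r))" for r by (subst integral_distr) auto
      then show ?thesis unfolding u_def using distr_U[OF that] by simp
    qed
    have tt: "t + real m \<le> t'"
    proof -
      have "real i + real m \<le> real j" using ij by (metis of_nat_add of_nat_le_iff)
      then show ?thesis by (simp add: t_def t'_def)
    qed
    have ind: "(\<integral>\<omega>. g (Y t \<omega>) * g (Y t' \<omega>) \<partial>M) = (\<integral>\<omega>. g (Y t \<omega>) \<partial>M) * (\<integral>\<omega>. g (Y t' \<omega>) \<partial>M)"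
      unfolding Y_def elem_ou_def
    proof (rule elem_int_independent[OF BM sorted_shift_list[OF p] sorted_shift_list[OF p], where \<phi>="\<lambda>x. g (hconst * x)" and \<psi>="\<lambda>x. g (hconst * x)" and b=b])
      fix x y assume "x \<in> set (shift_list t p)" "y \<in> set (shift_list t' p)"
      then obtain x' y' where "x' \<in> set p" "y' \<in> set p" "x = x' + t" "y = y' + t'" by auto
      then show "x < y" using m0[of x'] m0[of y'] m tt by (auto simp: abs_le_iff)
    qed (use b in auto)
    have D1: "\<bar>(\<integral>\<omega>. g (U t \<omega>) * g (U t' \<omega>) \<partial>M) - (\<integral>\<omega>. g (Y t \<omega>) * g (Y t' \<omega>) \<partial>M)\<bar> \<le> 2 * b * (L * \<eta>)"
    proof -
      have "\<bar>(\<integral>\<omega>. g (U t \<omega>) * g (U t' \<omega>) \<partial>M) - (\<integral>\<omega>. g (Y t \<omega>) * g (Y t' \<omega>) \<partial>M)\<bar>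
        = \<bar>\<integral>\<omega>. g (U t \<omega>) * g (U t' \<omega>) - g (Y t \<omega>) * g (Y t' \<omega>) \<partial>M\<bar>" by (simp add: gg)
      also have "\<dots> \<le> (\<integral>\<omega>. \<bar>g (U t \<omega>) * g (U t' \<omega>) - g (Y t \<omega>) * g (Y t' \<omega>)\<bar> \<partial>M)" by (rule integral_abs_bound)
      also have "\<dots> \<le> (\<integral>\<omega>. b * \<bar>g (U t' \<omega>) - g (Y t' \<omega>)\<bar> + b * \<bar>g (U t \<omega>) - g (Y t \<omega>)\<bar> \<partial>M)"
      proof (rule integral_mono)
        fix \<omega>
        have "g (U t \<omega>) * g (U t' \<omega>) - g (Y t \<omega>) * g (Y t' \<omega>) = g (U t \<omega>) * (g (U t' \<omega>) - g (Y t' \<omega>)) + g (Y t' \<omega>) * (g (U t \<omega>) - g (Y t \<omega>))"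
          by (simp add: algebra_simps)
        also have "\<bar>\<dots>\<bar> \<le> \<bar>g (U t \<omega>)\<bar> * \<bar>g (U t' \<omega>) - g (Y t' \<omega>)\<bar> + \<bar>g (Y t' \<omega>)\<bar> * \<bar>g (U t \<omega>) - g (Y t \<omega>)\<bar>"
          by (simp only: abs_mult[symmetric] abs_triangle_ineq)
        also have "\<dots> \<le> b * \<bar>g (U t' \<omega>) - g (Y t' \<omega>)\<bar> + b * \<bar>g (U t \<omega>) - g (Y t \<omega>)\<bar>"
          by (intro add_mono mult_right_mono b) auto
        finally show "\<bar>g (U t \<omega>) * g (U t' \<omega>) - g (Y t \<omega>) * g (Y t' \<omega>)\<bar> \<le> b * \<bar>g (U t' \<omega>) - g (Y t' \<omega>)\<bar> + b * \<bar>g (U t \<omega>) - g (Y t \<omega>)\<bar>" .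
      qed (use gg gU gY in auto)
      also have "\<dots> = b * (\<integral>\<omega>. \<bar>g (U t' \<omega>) - g (Y t' \<omega>)\<bar> \<partial>M) + b * (\<integral>\<omega>. \<bar>g (U t \<omega>) - g (Y t \<omega>)\<bar> \<partial>M)"
        using gU gY by simp
      also have "\<dots> \<le> b * (L * \<eta>) + b * (L * \<eta>)" using b by (intro add_mono mult_left_mono d t) auto
      also have "\<dots> = 2 * b * (L * \<eta>)" by simp
      finally show ?thesis .
    qed
    have Yu: "\<bar>(\<integral>\<omega>. g (Y r \<omega>) \<partial>M) - u\<bar> \<le> L * \<eta>" if r: "r \<ge> 0" for r
    proof -
      have "(\<integral>\<omega>. g (Y r \<omega>) \<partial>M) - u = - (\<integral>\<omega>. g (U r \<omega>) - g (Y r \<omega>) \<partial>M)" using gU gY Eu[OF r] by simp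
      also have "\<bar>\<dots>\<bar> \<le> (\<integral>\<omega>. \<bar>g (U r \<omega>) - g (Y r \<omega>)\<bar> \<partial>M)" unfolding abs_minus_cancel by (rule integral_abs_bound)
      finally show ?thesis using d[OF r] by linarith
    qed
    have bnd: "\<bar>\<integral>\<omega>. g (X \<omega>) \<partial>M\<bar> \<le> b" if [measurable]: "X \<in> borel_measurable M" for X
    proof -
      have iX: "integrable M (\<lambda>\<omega>. g (X \<omega>))" by (rule integrable_const_bound[where B=b]) (use b in auto)
      have "\<bar>\<integral>\<omega>. g (X \<omega>) \<partial>M\<bar> \<le> (\<integral>\<omega>. \<bar>g (X \<omega>)\<bar> \<partial>M)" by (rule integral_abs_bound)
      also have "\<dots> \<le> (\<integral>\<omega>. b \<partial>M)" using iX b by (intro integral_mono) auto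
      finally show ?thesis by (simp add: prob_space)
    qed
    have D2: "\<bar>(\<integral>\<omega>. g (Y t \<omega>) \<partial>M) * (\<integral>\<omega>. g (Y t' \<omega>) \<partial>M) - u\<^sup>2\<bar> \<le> 2 * b * (L * \<eta>)"
    proof -
      let ?y = "\<integral>\<omega>. g (Y t \<omega>) \<partial>M" and ?y' = "\<integral>\<omega>. g (Y t' \<omega>) \<partial>M"
      have "?y * ?y' - u\<^sup>2 = ?y * (?y' - u) + u * (?y - u)" by (simp add: algebra_simps power2_eq_square)
      also have "\<bar>\<dots>\<bar> \<le> \<bar>?y\<bar> * \<bar>?y' - u\<bar> + \<bar>u\<bar> * \<bar>?y - u\<bar>" by (simp only: abs_mult[symmetric] abs_triangle_ineq)
      also have "\<dots> \<le> b * (L * \<eta>) + b * (L * \<eta>)"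
        using b by (intro add_mono mult_mono Yu t bnd[of "Y t"] bnd[of "U 0", folded u_def]) auto
      also have "\<dots> = 2 * b * (L * \<eta>)" by simp
      finally show ?thesis .
    qed
    have "2 * b * (L * \<eta>) + 2 * b * (L * \<eta>) = e" using b L by (simp add: \<eta>_def field_simps)
    with D1 D2 have "\<bar>(\<integral>\<omega>. g (U t \<omega>) * g (U t' \<omega>) \<partial>M) - u\<^sup>2\<bar> \<le> e" unfolding ind by linarith
    then show ?thesis using Eu[of "s + real 0"] s by (simp add: t_def t'_def)
  qed
  then show "\<exists>m. \<forall>i j. i + m \<le> j \<longrightarrow> \<bar>(\<integral>\<omega>. g (U (s + real i) \<omega>) * g (U (s + real j) \<omega>) \<partial>M) - (\<integral>\<omega>. g (U (s + real 0) \<omega>) \<partial>M)\<^sup>2\<bar> \<le> e"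
    by blast
qed

text \<open>A general factor \<open>\<kappa>\<close> is carried along because squaring
  \<open>f\<close> doubles the exponent and the normalising constant rescales it.\<close>

lemma exp_moment_U:
  assumes \<gamma>: "0 < \<gamma>" "\<gamma> < 2 / real q" and \<kappa>: "\<kappa> > 0"
  shows "(\<integral>\<^sup>+\<omega>. ennreal (exp (\<kappa> * \<bar>U 0 \<omega>\<bar> powr \<gamma>)) \<partial>M) < \<infinity>"
proof -
  have m: "hermite_kernel q H (ou a 0) \<in> borel_measurable (lebesgue_pow q)" by (rule measurable_hermite_kernel)
  let ?I = "mwi_integral M B q (hermite_kernel q H (ou a 0))"
  have adm: "elem_admissible q [] (\<lambda>_. 0)" by (simp add: elem_admissible_def)
  have Im: "?I \<in> borel_measurable M" by (rule mwi_integral_elem_bound(2)[OF BM q adm m kernel_L2])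
  obtain D where D: "D > 0" and mom: "\<And>n. n \<ge> 1 \<Longrightarrow> (\<integral>\<^sup>+\<omega>. ennreal ((?I \<omega>)^(2*n)) \<partial>M) \<le> ennreal ((D * real (2*n-1)^q)^n)"
    using mwi_integral_moments[OF BM q m kernel_L2] by blast
  \<comment> \<open>The constant of the Hermite integral enters as
    \<open>\<bar>hconst\<bar> powr \<gamma>\<close>; the added \<open>1\<close> keeps
    \<open>k\<close> positive whatever that value is.\<close>
  define k where "k = \<kappa> * \<bar>hconst\<bar> powr \<gamma> + 1"
  have k: "k > 0" unfolding k_def using \<kappa> by (simp add: add_nonneg_pos)
  have "\<gamma> * real q < 2" using \<gamma> q by (simp add: field_simps)
  from exp_moment_finite[OF Im D k \<gamma>(1) this mom]
  have fin: "(\<integral>\<^sup>+\<omega>. ennreal (exp (k * \<bar>?I \<omega>\<bar> powr \<gamma>)) \<partial>M) < \<infinity>" .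
  have "(\<integral>\<^sup>+\<omega>. ennreal (exp (\<kappa> * \<bar>U 0 \<omega>\<bar> powr \<gamma>)) \<partial>M) \<le> (\<integral>\<^sup>+\<omega>. ennreal (exp (k * \<bar>?I \<omega>\<bar> powr \<gamma>)) \<partial>M)"
  proof (rule nn_integral_mono_AE)
    show "AE \<omega> in M. ennreal (exp (\<kappa> * \<bar>U 0 \<omega>\<bar> powr \<gamma>)) \<le> ennreal (exp (k * \<bar>?I \<omega>\<bar> powr \<gamma>))"
      using U_eq[OF order.refl]
    proof eventually_elim
      case (elim \<omega>)
      have "\<bar>U 0 \<omega>\<bar> powr \<gamma> = \<bar>hconst\<bar> powr \<gamma> * \<bar>?I \<omega>\<bar> powr \<gamma>"
        unfolding elim by (simp add: hermite_integral_def hconst_def abs_mult powr_mult)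
      then have "\<kappa> * \<bar>U 0 \<omega>\<bar> powr \<gamma> = \<kappa> * \<bar>hconst\<bar> powr \<gamma> * \<bar>?I \<omega>\<bar> powr \<gamma>" by simp
      also have "\<dots> \<le> k * \<bar>?I \<omega>\<bar> powr \<gamma>" by (intro mult_right_mono) (auto simp: k_def)
      finally show ?case by (intro ennreal_leI) simp
    qed
  qed
  with fin show ?thesis by (rule le_less_trans[rotated])
qed

text \<open>The bound on the mean supremum does not depend on the offset \<open>s\<close>, which
  permits integrating it over offsets.\<close>

lemma ergodic_average_ou:
  assumes s: "s \<ge> 0" and [measurable]: "f \<in> borel_measurable borel"
    and sq: "(\<integral>\<^sup>+\<omega>. ennreal ((f (U 0 \<omega>))\<^sup>2) \<partial>M) < \<infinity>"
  shows "AE \<omega> in M. (\<lambda>n. (\<Sum>i<n. f (U (s + real i) \<omega>)) / real n) \<longlonglongrightarrow> (\<integral>\<omega>. f (U 0 \<omega>) \<partial>M)"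
    and "(\<integral>\<^sup>+\<omega>. (SUP n. ennreal ((\<Sum>i<n. \<bar>f (U (s + real i) \<omega>)\<bar>) / real n)) \<partial>M)
      \<le> 2 + (\<Sum>n. ennreal (enn2real (\<integral>\<^sup>+\<omega>. ennreal ((f (U 0 \<omega>))\<^sup>2) \<partial>M) / (real (Suc n))\<^sup>2))"
proof -
  have X: "stationary M (\<lambda>n. U (s + real n))" using stationary_ou[OF s, of 1] by simp
  have sq': "(\<integral>\<^sup>+\<omega>. ennreal ((f (U s \<omega>))\<^sup>2) \<partial>M) = (\<integral>\<^sup>+\<omega>. ennreal ((f (U 0 \<omega>))\<^sup>2) \<partial>M)"
  proof -
    have "(\<integral>\<^sup>+\<omega>. ennreal ((f (U r \<omega>))\<^sup>2) \<partial>M) = (\<integral>\<^sup>+x. ennreal ((f x)\<^sup>2) \<partial>distr M borel (U r))" for r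
      by (subst nn_integral_distr) auto
    then show ?thesis using distr_U[OF s] by simp
  qed
  have mean: "(\<integral>\<omega>. f (U s \<omega>) \<partial>M) = (\<integral>\<omega>. f (U 0 \<omega>) \<partial>M)"
  proof -
    have "(\<integral>\<omega>. f (U r \<omega>) \<partial>M) = (\<integral>x. f x \<partial>distr M borel (U r))" for r by (subst integral_distr) auto
    then show ?thesis using distr_U[OF s] by simp
  qed
  show "AE \<omega> in M. (\<lambda>n. (\<Sum>i<n. f (U (s + real i) \<omega>)) / real n) \<longlonglongrightarrow> (\<integral>\<omega>. f (U 0 \<omega>) \<partial>M)"
    using ergodic_average[OF X mixing_ou[OF s], of f] sq sq' mean by simp
  have Y: "stationary M (\<lambda>n \<omega>. f (U (s + real n) \<omega>))" by (rule stationary_compose[OF X]) simp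
  show "(\<integral>\<^sup>+\<omega>. (SUP n. ennreal ((\<Sum>i<n. \<bar>f (U (s + real i) \<omega>)\<bar>) / real n)) \<partial>M)
      \<le> 2 + (\<Sum>n. ennreal (enn2real (\<integral>\<^sup>+\<omega>. ennreal ((f (U 0 \<omega>))\<^sup>2) \<partial>M) / (real (Suc n))\<^sup>2))"
    by (rule nn_integral_sup_averages_finite[OF Y]) (use sq sq' in \<open>simp_all add: less_top[symmetric]\<close>)
qed

end

section \<open>From integer times to continuous time\<close>

lemma lborel_shift_Ioc_1:
  fixes u :: "real \<Rightarrow> real"
  shows "(LINT s:{real n<..real n + 1}|lborel. u s) = (LINT s:{0<..1}|lborel. u (s + real n))"
proof -
  have "(LINT s:{real n<..real n + 1}|lborel. u s)
      = (\<integral>s. indicator {real n<..real n + 1} (real n + 1 * s) *\<^sub>R u (real n + 1 * s) \<partial>lborel)"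
    unfolding set_lebesgue_integral_def by (subst lborel_integral_real_affine[of 1 _ "real n"]) auto
  also have "\<dots> = (LINT s:{0<..1}|lborel. u (s + real n))"
    unfolding set_lebesgue_integral_def
    by (intro Bochner_Integration.integral_cong refl) (auto simp: indicator_def add.commute)
  finally show ?thesis .
qed

lemma set_integrable_shift_Ioc_1:
  fixes u :: "real \<Rightarrow> real"
  assumes "set_integrable lborel {real n<..real n + 1} u"
  shows "set_integrable lborel {0<..1} (\<lambda>s. u (s + real n))"
proof -
  have "integrable lborel (\<lambda>s. indicator {real n<..real n + 1} (real n + 1 * s) *\<^sub>R u (real n + 1 * s))"
    using assms unfolding set_integrable_def by (intro lborel_integrable_real_affine) auto
  also have "(\<lambda>s. indicator {real n<..real n + 1} (real n + 1 * s) *\<^sub>R u (real n + 1 * s)) = (\<lambda>s. indicator {0<..1} s *\<^sub>R u (s + real n))"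
    by (auto simp: indicator_def add.commute)
  finally show ?thesis unfolding set_integrable_def .
qed

text \<open>Expresses a time integral through sums along \<open>s + i\<close>, the form in which the
  ergodic theorem for sequences applies. Half-open pieces tile without overlap, and the missing
  point \<open>0\<close> is a null set.\<close>

lemma set_integral_eq_sum_unit_intervals:
  fixes u :: "real \<Rightarrow> real"
  assumes int: "\<And>n::nat. set_integrable lborel {0..real n} u"
  shows "(LINT s:{0..real n}|lborel. u s) = (LINT s:{0<..1}|lborel. (\<Sum>i<n. u (s + real i)))"
proof -
  have i1: "set_integrable lborel {real n<..real n + 1} u" for n
    using int[of "Suc n"] by (rule set_integrable_subset) auto
  have "(LINT s:{0..real n}|lborel. u s) = (\<Sum>i<n. (LINT s:{0<..1}|lborel. u (s + real i)))"
  proof (induction n)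
    case 0
    have "AE s in lborel. indicator {0..real 0} s *\<^sub>R u s = 0"
      using AE_lborel_singleton[of "0::real"] by eventually_elim (auto simp: indicator_def)
    then have "(LINT s:{0..real 0}|lborel. u s) = 0"
      unfolding set_lebesgue_integral_def by (rule integral_eq_zero_AE)
    then show ?case by simp
  next
    case (Suc n)
    have "{0..real (Suc n)} = {0..real n} \<union> {real n<..real n + 1}" by auto
    then have "(LINT s:{0..real (Suc n)}|lborel. u s) = (LINT s:{0..real n}|lborel. u s) + (LINT s:{real n<..real n + 1}|lborel. u s)"
      by (simp only:) (rule set_integral_Un[OF _ int i1], auto)
    then show ?case using Suc by (simp add: lborel_shift_Ioc_1)
  qed
  also have "\<dots> = (LINT s:{0<..1}|lborel. (\<Sum>i<n. u (s + real i)))"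
    using set_integrable_shift_Ioc_1[OF i1] unfolding set_lebesgue_integral_def set_integrable_def scaleR_sum_right
    by (intro Bochner_Integration.integral_sum[symmetric])
  finally show ?thesis .
qed

text \<open>Between consecutive integers the integral of \<open>u\<close> moves by at most the
  integral of \<open>\<bar>u\<bar>\<close> over that unit interval. Convergence of the averages of
  \<open>\<bar>u\<bar>\<close> makes this negligible against \<open>T\<close>, which is the purpose
  of \<open>lim_abs\<close>.\<close>

lemma average_tendsto_of_integer_averages:
  fixes u :: "real \<Rightarrow> real"
  assumes int: "\<And>n::nat. set_integrable lborel {0..real n} u"
    and lim: "(\<lambda>n. (LINT s:{0..real n}|lborel. u s) / real n) \<longlonglongrightarrow> \<mu>"
    and lim_abs: "(\<lambda>n. (LINT s:{0..real n}|lborel. \<bar>u s\<bar>) / real n) \<longlonglongrightarrow> \<nu>"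
  shows "((\<lambda>T. (LINT s:{0..T}|lborel. u s) / T) \<longlongrightarrow> \<mu>) at_top"
proof -
  define I where "I T = (LINT s:{0..T}|lborel. u s)" for T
  define J where "J T = (LINT s:{0..T}|lborel. \<bar>u s\<bar>)" for T
  define N where "N T = nat \<lfloor>T\<rfloor>" for T :: real
  have Nt: "filterlim N sequentially at_top" unfolding N_def
    by (intro filterlim_compose[OF filterlim_nat_sequentially] filterlim_floor_sequentially)
  have N: "real (N T) \<le> T" "T < real (N T) + 1" if "T \<ge> 0" for T using that unfolding N_def by linarith+
  have diff: "\<bar>I T - I (real (N T))\<bar> \<le> J (real (Suc (N T))) - J (real (N T))" if T: "T \<ge> 0" for T
  proof -
    have sub: "set_integrable lborel A u" if "A \<subseteq> {0..real (Suc (N T))}" "A \<in> sets lborel" for A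
      using int[of "Suc (N T)"] by (rule set_integrable_subset) (use that in auto)
    have s1: "set_integrable lborel {real (N T)<..T} u" and s2: "set_integrable lborel {real (N T)<..real (Suc (N T))} u"
      using N[OF T] by (auto intro!: sub)
    have "{0..T} = {0..real (N T)} \<union> {real (N T)<..T}" using N[OF T] by auto
    then have "I T = I (real (N T)) + (LINT s:{real (N T)<..T}|lborel. u s)"
      unfolding I_def by (simp only:) (rule set_integral_Un[OF _ int s1], auto)
    then have "\<bar>I T - I (real (N T))\<bar> = \<bar>LINT s:{real (N T)<..T}|lborel. u s\<bar>" by simp
    also have "\<dots> \<le> (LINT s:{real (N T)<..T}|lborel. \<bar>u s\<bar>)"
      using set_integral_norm_bound[OF s1] by simp
    also have "\<dots> \<le> (LINT s:{real (N T)<..real (Suc (N T))}|lborel. \<bar>u s\<bar>)"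
      unfolding set_lebesgue_integral_def
      using set_integrable_abs[OF s1] set_integrable_abs[OF s2] N[OF T]
      by (intro integral_mono) (auto simp: set_integrable_def indicator_def)
    also have "\<dots> = J (real (Suc (N T))) - J (real (N T))"
    proof -
      have "{0..real (Suc (N T))} = {0..real (N T)} \<union> {real (N T)<..real (Suc (N T))}" by auto
      then have "J (real (Suc (N T))) = J (real (N T)) + (LINT s:{real (N T)<..real (Suc (N T))}|lborel. \<bar>u s\<bar>)"
        unfolding J_def by (simp only:) (rule set_integral_Un[OF _ set_integrable_abs[OF int] set_integrable_abs[OF s2]], auto)
      then show ?thesis by simp
    qed
    finally show ?thesis .
  qed
  have inv: "(\<lambda>n. 1 / real n) \<longlonglongrightarrow> 0" by (rule lim_1_over_n)
  \<comment> \<open>Consecutive averages have the same limit, so the last unit interval contributes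
    \<open>\<nu> - \<nu>\<close> in the limit.\<close>
  have Jd: "(\<lambda>n. (J (real (Suc n)) - J (real n)) / real n) \<longlonglongrightarrow> 0"
  proof -
    have "(\<lambda>n. J (real (Suc n)) / real (Suc n) * (1 + 1 / real n) - J (real n) / real n) \<longlonglongrightarrow> \<nu> * (1 + 0) - \<nu>"
      unfolding J_def by (intro tendsto_diff tendsto_mult tendsto_add tendsto_const inv LIMSEQ_Suc[OF lim_abs] lim_abs)
    moreover have "\<forall>\<^sub>F n in sequentially. J (real (Suc n)) / real (Suc n) * (1 + 1 / real n) - J (real n) / real n = (J (real (Suc n)) - J (real n)) / real n"
      using eventually_gt_at_top[of 0]
    proof eventually_elim
      case (elim n)
      then have "1 + 1 / real n = real (Suc n) / real n" by (simp add: field_simps)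
      then show ?case by (simp add: diff_divide_distrib del: of_nat_Suc)
    qed
    ultimately show ?thesis by (simp add: tendsto_cong)
  qed
  have ev: "\<forall>\<^sub>F T in at_top. T \<ge> (1::real)" by (rule eventually_ge_at_top)
  have rat: "((\<lambda>T. real (N T) / T) \<longlongrightarrow> 1) at_top"
  proof (rule tendsto_sandwich)
    show "\<forall>\<^sub>F T in at_top. 1 - 1 / T \<le> real (N T) / T"
      using ev
    proof eventually_elim
      case (elim T)
      then have "T - 1 \<le> real (N T)" using N[of T] by linarith
      then have "(T - 1) / T \<le> real (N T) / T" using elim by (intro divide_right_mono) auto
      then show ?case using elim by (simp add: diff_divide_distrib)
    qed
    show "\<forall>\<^sub>F T in at_top. real (N T) / T \<le> 1"
      using ev
    proof eventually_elim
      case (elim T)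
      then show ?case using N(1)[of T] by (simp add: divide_le_eq)
    qed
    have "((\<lambda>T::real. 1 - 1 / T) \<longlongrightarrow> 1 - 0) at_top"
      by (intro tendsto_diff tendsto_const tendsto_divide_0[OF tendsto_const] filterlim_at_top_imp_at_infinity filterlim_ident)
    then show "((\<lambda>T::real. 1 - 1 / T) \<longlongrightarrow> 1) at_top" by simp
  qed simp
  have A: "((\<lambda>T. I (real (N T)) / real (N T) * (real (N T) / T)) \<longlongrightarrow> \<mu> * 1) at_top"
    using lim unfolding I_def[symmetric] by (intro tendsto_mult rat filterlim_compose[OF _ Nt])
  have R: "((\<lambda>T. (I T - I (real (N T))) / T) \<longlongrightarrow> 0) at_top"
  proof (rule Lim_null_comparison)
    show "((\<lambda>T. (J (real (Suc (N T))) - J (real (N T))) / real (N T)) \<longlongrightarrow> 0) at_top"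
      by (rule filterlim_compose[OF Jd Nt])
    show "\<forall>\<^sub>F T in at_top. norm ((I T - I (real (N T))) / T) \<le> (J (real (Suc (N T))) - J (real (N T))) / real (N T)"
      using ev
    proof eventually_elim
      case (elim T)
      have "N T \<ge> 1" using elim unfolding N_def by linarith
      then have "\<bar>I T - I (real (N T))\<bar> / T \<le> (J (real (Suc (N T))) - J (real (N T))) / real (N T)"
        using diff[of T] N(1)[of T] elim by (intro frac_le) auto
      then show ?case using elim by simp
    qed
  qed
  have "((\<lambda>T. I (real (N T)) / real (N T) * (real (N T) / T) + (I T - I (real (N T))) / T) \<longlongrightarrow> \<mu> * 1 + 0) at_top"
    by (intro tendsto_add A R)
  moreover have "\<forall>\<^sub>F T in at_top. I (real (N T)) / real (N T) * (real (N T) / T) + (I T - I (real (N T))) / T = I T / T"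
    using ev
  proof eventually_elim
    case (elim T)
    have "N T \<ge> 1" using elim unfolding N_def by linarith
    then show ?case using elim by (simp add: diff_divide_distrib)
  qed
  ultimately show ?thesis unfolding I_def by (simp add: tendsto_cong)
qed

text \<open>Convergence is encoded by a limsup so that the exchange of almost-everywhere quantifiers
  concerns a visibly measurable predicate.\<close>

lemma tendsto_of_limsup_ennreal_zero:
  fixes x :: "nat \<Rightarrow> real"
  assumes "limsup (\<lambda>n. ennreal \<bar>x n - c\<bar>) = 0"
  shows "(\<lambda>n. ennreal \<bar>x n - c\<bar>) \<longlonglongrightarrow> 0"
proof (rule Liminf_eq_Limsup)
  have "liminf (\<lambda>n. ennreal \<bar>x n - c\<bar>) \<le> 0"
    using Liminf_le_Limsup[OF sequentially_bot, of "\<lambda>n. ennreal \<bar>x n - c\<bar>"] assms by simp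
  then show "liminf (\<lambda>n. ennreal \<bar>x n - c\<bar>) = 0" by simp
qed (use assms in simp_all)

section \<open>Exchanging the time offset with the randomness\<close>

context hermite_ou
begin

text \<open>The time average up to \<open>n\<close> is the mean over \<open>s\<close> in the unit
  interval of the discrete averages \<open>F n s\<close>, so it suffices that these converge to
  \<open>\<mu>\<close> in mean over \<open>s\<close> for almost every path. The majorant
  \<open>S\<close> is integrable over offset and randomness jointly, hence over the offset for
  almost every path.\<close>

lemma AE_integer_averages:
  fixes f :: "real \<Rightarrow> real"
  assumes U_joint: "(\<lambda>(t, \<omega>). U t \<omega>) \<in> borel_measurable (borel \<Otimes>\<^sub>M M)"
    and f[measurable]: "f \<in> borel_measurable borel"
    and sq: "(\<integral>\<^sup>+\<omega>. ennreal ((f (U 0 \<omega>))\<^sup>2) \<partial>M) < \<infinity>"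
    and int: "AE \<omega> in M. \<forall>n::nat. set_integrable lborel {0..real n} (\<lambda>s. f (U s \<omega>))"
  shows "AE \<omega> in M. (\<lambda>n. (LINT s:{0..real n}|lborel. f (U s \<omega>)) / real n) \<longlonglongrightarrow> (\<integral>\<omega>. f (U 0 \<omega>) \<partial>M)"
proof -
  define \<mu> where "\<mu> = (\<integral>\<omega>. f (U 0 \<omega>) \<partial>M)"
  define R where "R = restrict_space lborel {0<..1::real}"
  have R_sets: "{0<..1::real} \<inter> space lborel \<in> sets lborel" by simp
  have R_sf: "sigma_finite_measure R" unfolding R_def by (rule sigma_finite_measure_restrict_space) (auto intro: sigma_finite_lborel)
  have R_space: "space R = {0<..1}" by (simp add: R_def space_restrict_space)
  have nnR: "(\<integral>\<^sup>+s. h s \<partial>R) = (\<integral>\<^sup>+s. h s * indicator {0<..1} s \<partial>lborel)" for h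
    unfolding R_def by (rule nn_integral_restrict_space[OF R_sets])
  interpret RM: pair_sigma_finite R M
    by (intro pair_sigma_finite.intro R_sf sigma_finite_measure_axioms)
  have shift: "(\<lambda>(s, \<omega>). U (s + real i) \<omega>) \<in> borel_measurable (R \<Otimes>\<^sub>M M)" for i
  proof -
    have "(\<lambda>s. s + real i) \<in> R \<rightarrow>\<^sub>M borel" unfolding R_def by (intro measurable_restrict_space1) simp
    then have "(\<lambda>z. (fst z + real i, snd z)) \<in> R \<Otimes>\<^sub>M M \<rightarrow>\<^sub>M borel \<Otimes>\<^sub>M M"
      by (intro measurable_Pair measurable_compose[OF measurable_fst] measurable_snd) auto
    from measurable_compose[OF this U_joint] show ?thesis by (simp add: case_prod_beta)
  qed
  define F where "F n s \<omega> = (\<Sum>i<n. f (U (s + real i) \<omega>)) / real n" for n s \<omega>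
  define S where "S s \<omega> = (SUP n. ennreal ((\<Sum>i<n. \<bar>f (U (s + real i) \<omega>)\<bar>) / real n))" for s \<omega>
  have fU[measurable]: "(\<lambda>z. f (U (fst z + real i) (snd z))) \<in> borel_measurable (R \<Otimes>\<^sub>M M)" for i
    using measurable_compose[OF shift f] by (simp add: case_prod_beta)
  have Fm[measurable]: "(\<lambda>z. F n (fst z) (snd z)) \<in> borel_measurable (R \<Otimes>\<^sub>M M)" for n unfolding F_def by measurable
  have Sm[measurable]: "(\<lambda>z. S (fst z) (snd z)) \<in> borel_measurable (R \<Otimes>\<^sub>M M)" unfolding S_def by measurable
  have "AE s in R. AE \<omega> in M. limsup (\<lambda>n. ennreal \<bar>F n s \<omega> - \<mu>\<bar>) = 0"
  proof (rule AE_I2)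
    fix s assume "s \<in> space R"
    then have "s \<ge> 0" by (simp add: R_space)
    from ergodic_average_ou(1)[OF this f sq]
    show "AE \<omega> in M. limsup (\<lambda>n. ennreal \<bar>F n s \<omega> - \<mu>\<bar>) = 0"
    proof eventually_elim
      case (elim \<omega>)
      then have "(\<lambda>n. ennreal \<bar>F n s \<omega> - \<mu>\<bar>) \<longlonglongrightarrow> ennreal \<bar>\<mu> - \<mu>\<bar>"
        unfolding F_def \<mu>_def by (intro tendsto_ennrealI tendsto_rabs tendsto_diff tendsto_const)
      then have "(\<lambda>n. ennreal \<bar>F n s \<omega> - \<mu>\<bar>) \<longlonglongrightarrow> 0" by simp
      then show ?case by (intro lim_imp_Limsup) auto
    qed
  qed
  \<comment> \<open>For each offset almost every path converges; after the exchange, for almost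
    every path almost every offset does.\<close>
  then have AE1: "AE \<omega> in M. AE s in R. limsup (\<lambda>n. ennreal \<bar>F n s \<omega> - \<mu>\<bar>) = 0"
    by (subst (asm) RM.AE_commute) measurable
  define C where "C = (\<Sum>n. ennreal (enn2real (\<integral>\<^sup>+\<omega>. ennreal ((f (U 0 \<omega>))\<^sup>2) \<partial>M) / (real (Suc n))\<^sup>2))"
  have C: "C < \<infinity>" unfolding C_def by (rule suminf_inverse_squares_finite) simp
  have "(\<integral>\<^sup>+\<omega>. \<integral>\<^sup>+s. S s \<omega> \<partial>R \<partial>M) = (\<integral>\<^sup>+s. \<integral>\<^sup>+\<omega>. S s \<omega> \<partial>M \<partial>R)"
    using RM.Fubini'[of S] Sm by (simp add: case_prod_beta')
  also have "\<dots> \<le> (\<integral>\<^sup>+s. 2 + C \<partial>R)"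
    unfolding S_def C_def by (intro nn_integral_mono ergodic_average_ou(2) sq f) (simp add: R_space)
  also have "\<dots> = (2 + C) * emeasure R (space R)"
    by simp
  also have "emeasure R (space R) = 1" by (simp add: R_def emeasure_restrict_space space_restrict_space)
  also have "(2 + C) * 1 < \<infinity>"
    using C by (simp add: less_top[symmetric])
  finally have "AE \<omega> in M. (\<integral>\<^sup>+s. S s \<omega> \<partial>R) \<noteq> \<infinity>"
  proof (intro nn_integral_noteq_infinite)
    have "(\<lambda>(\<omega>, s). S s \<omega>) \<in> borel_measurable (M \<Otimes>\<^sub>M R)"
      using measurable_pair_swap[OF Sm] by (simp add: case_prod_beta')
    then show "(\<lambda>\<omega>. \<integral>\<^sup>+s. S s \<omega> \<partial>R) \<in> borel_measurable M" by (rule RM.M1.borel_measurable_nn_integral)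
  qed simp
  \<comment> \<open>From here on \<open>\<omega>\<close> is fixed, and the dominated convergence
    argument takes place on the unit interval alone.\<close>
  with AE1 int AE_space show ?thesis
  proof eventually_elim
    case (elim \<omega>)
    have om[measurable]: "(\<lambda>s. h s \<omega>) \<in> borel_measurable R" if "(\<lambda>z. h (fst z) (snd z)) \<in> borel_measurable (R \<Otimes>\<^sub>M M)" for h :: "real \<Rightarrow> 'a \<Rightarrow> 'b::topological_space"
      using measurable_compose[OF measurable_Pair2'[OF \<open>\<omega> \<in> space M\<close>] that] by simp
    have [measurable]: "(\<lambda>s. F n s \<omega>) \<in> borel_measurable R" "(\<lambda>s. S s \<omega>) \<in> borel_measurable R" for n
      by (rule om[of "F n", OF Fm], rule om[of S, OF Sm])
    have conv: "(\<lambda>n. \<integral>\<^sup>+s. ennreal \<bar>F n s \<omega> - \<mu>\<bar> \<partial>R) \<longlonglongrightarrow> (\<integral>\<^sup>+s. 0 \<partial>R)"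
    proof (rule nn_integral_dominated_convergence[where w="\<lambda>s. S s \<omega> + ennreal \<bar>\<mu>\<bar>"])
      show "AE s in R. ennreal \<bar>F n s \<omega> - \<mu>\<bar> \<le> S s \<omega> + ennreal \<bar>\<mu>\<bar>" for n
      proof (rule AE_I2)
        fix s
        have "\<bar>F n s \<omega>\<bar> \<le> (\<Sum>i<n. \<bar>f (U (s + real i) \<omega>)\<bar>) / real n"
          unfolding F_def by (simp add: divide_right_mono sum_abs)
        then have "\<bar>F n s \<omega> - \<mu>\<bar> \<le> (\<Sum>i<n. \<bar>f (U (s + real i) \<omega>)\<bar>) / real n + \<bar>\<mu>\<bar>" by linarith
        then have "ennreal \<bar>F n s \<omega> - \<mu>\<bar> \<le> ennreal ((\<Sum>i<n. \<bar>f (U (s + real i) \<omega>)\<bar>) / real n + \<bar>\<mu>\<bar>)" by (rule ennreal_leI)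
        also have "\<dots> = ennreal ((\<Sum>i<n. \<bar>f (U (s + real i) \<omega>)\<bar>) / real n) + ennreal \<bar>\<mu>\<bar>"
          by (intro ennreal_plus divide_nonneg_nonneg sum_nonneg) auto
        also have "\<dots> \<le> S s \<omega> + ennreal \<bar>\<mu>\<bar>" unfolding S_def by (intro add_right_mono SUP_upper) simp
        finally show "ennreal \<bar>F n s \<omega> - \<mu>\<bar> \<le> S s \<omega> + ennreal \<bar>\<mu>\<bar>" .
      qed
      have "emeasure R (space R) = 1" by (simp add: R_def emeasure_restrict_space space_restrict_space)
      then show "(\<integral>\<^sup>+s. S s \<omega> + ennreal \<bar>\<mu>\<bar> \<partial>R) < \<infinity>"
        using elim(4) by (subst nn_integral_add) (auto simp: less_top[symmetric])
      show "AE s in R. (\<lambda>n. ennreal \<bar>F n s \<omega> - \<mu>\<bar>) \<longlonglongrightarrow> 0"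
        using elim(1) by eventually_elim (rule tendsto_of_limsup_ennreal_zero)
    qed measurable
    have bound: "ennreal \<bar>(LINT s:{0..real n}|lborel. f (U s \<omega>)) / real n - \<mu>\<bar> \<le> (\<integral>\<^sup>+s. ennreal \<bar>F n s \<omega> - \<mu>\<bar> \<partial>R)" if n: "n > 0" for n
    proof -
      have i1: "set_integrable lborel {0<..1} (\<lambda>s. f (U (s + real i) \<omega>))" for i
      proof (rule set_integrable_shift_Ioc_1)
        show "set_integrable lborel {real i<..real i + 1} (\<lambda>s. f (U s \<omega>))"
          using elim(2)[rule_format, of "Suc i"] by (rule set_integrable_subset) auto
      qed
      have iF: "set_integrable lborel {0<..1} (\<lambda>s. F n s \<omega>)"
      proof -
        have "integrable lborel (\<lambda>s. (\<Sum>i<n. indicator {0<..1} s *\<^sub>R f (U (s + real i) \<omega>)) / real n)"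
          using i1 unfolding set_integrable_def by (intro integrable_divide Bochner_Integration.integrable_sum)
        then show ?thesis unfolding set_integrable_def F_def by (simp add: sum_distrib_left)
      qed
      have iD: "set_integrable lborel {0<..1} (\<lambda>s. F n s \<omega> - \<mu>)"
        by (intro set_integral_diff iF) (simp add: set_integrable_def)
      have "(LINT s:{0..real n}|lborel. f (U s \<omega>)) / real n = (LINT s:{0<..1}|lborel. F n s \<omega>)"
        using set_integral_eq_sum_unit_intervals[of "\<lambda>s. f (U s \<omega>)" n] elim(2) unfolding F_def by simp
      moreover have "(LINT s:{0<..1::real}|lborel. \<mu>) = \<mu>" by (simp add: set_lebesgue_integral_def)
      ultimately have "(LINT s:{0..real n}|lborel. f (U s \<omega>)) / real n - \<mu> = (LINT s:{0<..1}|lborel. F n s \<omega> - \<mu>)"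
        using iF by (subst set_integral_diff) (auto simp: set_integrable_def)
      also have "ennreal \<bar>LINT s:{0<..1}|lborel. F n s \<omega> - \<mu>\<bar> \<le> ennreal (LINT s:{0<..1}|lborel. \<bar>F n s \<omega> - \<mu>\<bar>)"
        using set_integral_norm_bound[OF iD] by (intro ennreal_leI) simp
      also have "\<dots> \<le> (\<integral>\<^sup>+s. ennreal (indicator {0<..1} s *\<^sub>R \<bar>F n s \<omega> - \<mu>\<bar>) \<partial>lborel)"
        unfolding set_lebesgue_integral_def by (rule ennreal_integral_le) simp
      also have "\<dots> = (\<integral>\<^sup>+s. ennreal \<bar>F n s \<omega> - \<mu>\<bar> \<partial>R)"
        unfolding nnR by (intro nn_integral_cong) (auto simp: indicator_def)
      finally show ?thesis .
    qed
    have "(\<lambda>n. ennreal \<bar>(LINT s:{0..real n}|lborel. f (U s \<omega>)) / real n - \<mu>\<bar>) \<longlonglongrightarrow> 0"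
    proof (rule tendsto_sandwich[OF _ _ tendsto_const])
      show "\<forall>\<^sub>F n in sequentially. ennreal \<bar>(LINT s:{0..real n}|lborel. f (U s \<omega>)) / real n - \<mu>\<bar> \<le> (\<integral>\<^sup>+s. ennreal \<bar>F n s \<omega> - \<mu>\<bar> \<partial>R)"
        using eventually_gt_at_top[of 0] by eventually_elim (rule bound)
      show "(\<lambda>n. \<integral>\<^sup>+s. ennreal \<bar>F n s \<omega> - \<mu>\<bar> \<partial>R) \<longlonglongrightarrow> 0" using conv by simp
    qed simp
    then have "(\<lambda>n. \<bar>(LINT s:{0..real n}|lborel. f (U s \<omega>)) / real n - \<mu>\<bar>) \<longlonglongrightarrow> 0"
      by (subst (asm) tendsto_ennreal_iff[where x=0, simplified]) auto
    then show ?case unfolding \<mu>_def[symmetric] by (simp add: tendsto_rabs_zero_iff LIM_zero_iff)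
  qed
qed

text \<open>The mean of \<open>\<bar>f (U s)\<bar>\<close> does not depend on \<open>s\<close>, so
  by Fubini its time integral over \<open>{0..n}\<close> has mean \<open>n\<close> times a finite
  constant.\<close>

lemma AE_locally_integrable:
  fixes f :: "real \<Rightarrow> real"
  assumes U_joint: "(\<lambda>(t, \<omega>). U t \<omega>) \<in> borel_measurable (borel \<Otimes>\<^sub>M M)"
    and f[measurable]: "f \<in> borel_measurable borel"
    and fin: "integrable M (\<lambda>\<omega>. f (U 0 \<omega>))"
  shows "AE \<omega> in M. \<forall>n::nat. set_integrable lborel {0..real n} (\<lambda>s. f (U s \<omega>))"
proof -
  interpret LM: pair_sigma_finite lborel M
    by (intro pair_sigma_finite.intro sigma_finite_lborel sigma_finite_measure_axioms)
  have fU: "(\<lambda>z. f (U (fst z) (snd z))) \<in> borel_measurable (lborel \<Otimes>\<^sub>M M)"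
  proof -
    have "(\<lambda>z. U (fst z) (snd z)) \<in> borel_measurable (borel \<Otimes>\<^sub>M M)" using U_joint by (simp add: case_prod_beta')
    from measurable_compose[OF this f] show ?thesis by (simp cong: measurable_cong_sets)
  qed
  have "AE \<omega> in M. set_integrable lborel {0..real n} (\<lambda>s. f (U s \<omega>))" for n
  proof -
    define h where "h s \<omega> = ennreal \<bar>f (U s \<omega>)\<bar> * indicator {0..real n} s" for s \<omega>
    have hm[measurable]: "(\<lambda>z. h (fst z) (snd z)) \<in> borel_measurable (lborel \<Otimes>\<^sub>M M)"
      unfolding h_def using fU by measurable
    have "(\<integral>\<^sup>+\<omega>. \<integral>\<^sup>+s. h s \<omega> \<partial>lborel \<partial>M) = (\<integral>\<^sup>+s. \<integral>\<^sup>+\<omega>. h s \<omega> \<partial>M \<partial>lborel)"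
      using LM.Fubini'[of h] hm by (simp add: case_prod_beta')
    also have "\<dots> = (\<integral>\<^sup>+s. (\<integral>\<^sup>+\<omega>. ennreal \<bar>f (U 0 \<omega>)\<bar> \<partial>M) * indicator {0..real n} s \<partial>lborel)"
    proof (rule nn_integral_cong)
      fix s :: real
      have "(\<integral>\<^sup>+\<omega>. ennreal \<bar>f (U r \<omega>)\<bar> \<partial>M) = (\<integral>\<^sup>+x. ennreal \<bar>f x\<bar> \<partial>distr M borel (U r))" for r
        by (subst nn_integral_distr) auto
      then have "(\<integral>\<^sup>+\<omega>. ennreal \<bar>f (U s \<omega>)\<bar> \<partial>M) = (\<integral>\<^sup>+\<omega>. ennreal \<bar>f (U 0 \<omega>)\<bar> \<partial>M)" if "s \<ge> 0"
        using distr_U[OF that] by simp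
      then show "(\<integral>\<^sup>+\<omega>. h s \<omega> \<partial>M) = (\<integral>\<^sup>+\<omega>. ennreal \<bar>f (U 0 \<omega>)\<bar> \<partial>M) * indicator {0..real n} s"
        unfolding h_def by (cases "s \<ge> 0") (simp_all add: nn_integral_multc)
    qed
    also have "\<dots> = (\<integral>\<^sup>+\<omega>. ennreal \<bar>f (U 0 \<omega>)\<bar> \<partial>M) * ennreal (real n)"
      by (subst nn_integral_cmult) (auto simp: nn_integral_indicator)
    also have "\<dots> < \<infinity>" using fin by (simp add: integrable_iff_bounded ennreal_mult_less_top)
    finally have "AE \<omega> in M. (\<integral>\<^sup>+s. h s \<omega> \<partial>lborel) \<noteq> \<infinity>"
    proof (intro nn_integral_noteq_infinite)
      have "(\<lambda>(\<omega>, s). h s \<omega>) \<in> borel_measurable (M \<Otimes>\<^sub>M lborel)"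
        using measurable_pair_swap[OF hm] by (simp add: case_prod_beta')
      then show "(\<lambda>\<omega>. \<integral>\<^sup>+s. h s \<omega> \<partial>lborel) \<in> borel_measurable M" by (rule lborel.borel_measurable_nn_integral)
    qed simp
    with AE_space show ?thesis
    proof eventually_elim
      case (elim \<omega>)
      have [measurable]: "(\<lambda>s. f (U s \<omega>)) \<in> borel_measurable lborel"
        using measurable_compose[OF measurable_Pair2'[OF elim(1)] fU] by simp
      show ?case
        unfolding set_integrable_def
      proof (rule integrableI_bounded)
        have "(\<integral>\<^sup>+s. ennreal (norm (indicator {0..real n} s *\<^sub>R f (U s \<omega>))) \<partial>lborel) = (\<integral>\<^sup>+s. h s \<omega> \<partial>lborel)"
          by (intro nn_integral_cong) (auto simp: h_def indicator_def)
        then show "(\<integral>\<^sup>+s. ennreal (norm (indicator {0..real n} s *\<^sub>R f (U s \<omega>))) \<partial>lborel) < \<infinity>"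
          using elim(2) by (simp add: less_top[symmetric])
      qed measurable
    qed
  qed
  then show ?thesis by (simp add: AE_all_countable)
qed

end

text \<open>Integrability of \<open>f (U 0)\<close> and of the paths on bounded intervals is part of
  the conclusion: the Bochner integral of a non-integrable function is \<open>0\<close> by
  convention, so the limit alone would carry less information. Joint measurability gives access to
  the paths as functions of time.\<close>

theorem theorem6p2:
  fixes M :: "'a measure" and B U :: "real \<Rightarrow> 'a \<Rightarrow> real"
    and a H \<gamma> :: real and q :: nat and f :: "real \<Rightarrow> real"
  assumes BM: "two_sided_BM M B"
    and a_pos: "a > 0" and q_ge: "q \<ge> 1" and H_gt: "1/2 < H" and H_lt: "H < 1"
    and U_def: "\<forall>t\<ge>0. AE \<omega> in M. U t \<omega> =
                  hermite_integral M B q H (\<lambda>s. if s < t then exp (- a * (t - s)) else 0) \<omega>"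
    and U_meas: "(\<lambda>(t, \<omega>). U t \<omega>) \<in> borel_measurable (borel \<Otimes>\<^sub>M M)"
    and f_meas: "f \<in> borel_measurable borel"
    and \<gamma>_pos: "0 < \<gamma>" and \<gamma>_lt: "\<gamma> < 2 / real q"
    and f_bound: "\<forall>y. \<bar>f y\<bar> \<le> exp (\<bar>y\<bar> powr \<gamma>)"
  shows "integrable M (\<lambda>\<omega>. f (U 0 \<omega>)) \<and>
         (AE \<omega> in M. (\<forall>T\<ge>0. set_integrable lborel {0..T} (\<lambda>s. f (U s \<omega>))) \<and>
            ((\<lambda>T. (LINT s:{0..T}|lborel. f (U s \<omega>)) / T)
               \<longlongrightarrow> (\<integral>\<omega>'. f (U 0 \<omega>') \<partial>M)) at_top)"
proof -
  interpret hermite_ou M B U a H q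
  proof
    show "AE \<omega> in M. U t \<omega> = hermite_integral M B q H (ou a t) \<omega>" if "t \<ge> 0" for t
      using U_def that by (simp add: ou_def[abs_def])
    show "U t \<in> borel_measurable M" for t
      using measurable_compose[OF measurable_Pair1'[of t borel] U_meas] by simp
  qed (use BM a_pos q_ge H_gt H_lt in auto)
  note f_meas[measurable]
  have sq: "(\<integral>\<^sup>+\<omega>. ennreal ((f (U 0 \<omega>))\<^sup>2) \<partial>M) < \<infinity>"
  proof -
    have "(\<integral>\<^sup>+\<omega>. ennreal ((f (U 0 \<omega>))\<^sup>2) \<partial>M) \<le> (\<integral>\<^sup>+\<omega>. ennreal (exp (2 * \<bar>U 0 \<omega>\<bar> powr \<gamma>)) \<partial>M)"
    proof (intro nn_integral_mono ennreal_leI)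
      fix \<omega>
      have "\<bar>f (U 0 \<omega>)\<bar>\<^sup>2 \<le> (exp (\<bar>U 0 \<omega>\<bar> powr \<gamma>))\<^sup>2" using f_bound by (intro power_mono) auto
      then show "(f (U 0 \<omega>))\<^sup>2 \<le> exp (2 * \<bar>U 0 \<omega>\<bar> powr \<gamma>)" by (simp add: exp_double[symmetric])
    qed
    also have "\<dots> < \<infinity>" by (rule exp_moment_U[OF \<gamma>_pos \<gamma>_lt]) simp
    finally show ?thesis .
  qed
  have int: "integrable M (\<lambda>\<omega>. f (U 0 \<omega>))"
  proof (rule square_integrable_imp_integrable)
    show "integrable M (\<lambda>\<omega>. (f (U 0 \<omega>))\<^sup>2)" using sq by (intro integrableI_bounded) auto
  qed simp
  have loc: "AE \<omega> in M. \<forall>n::nat. set_integrable lborel {0..real n} (\<lambda>s. f (U s \<omega>))"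
    by (rule AE_locally_integrable[OF U_meas f_meas int])
  have avg: "AE \<omega> in M. (\<lambda>n. (LINT s:{0..real n}|lborel. f (U s \<omega>)) / real n) \<longlonglongrightarrow> (\<integral>\<omega>. f (U 0 \<omega>) \<partial>M)"
    by (rule AE_integer_averages[OF U_meas f_meas sq loc])
  \<comment> \<open>The averages of \<open>\<bar>f\<bar>\<close> are used to interpolate between
    integer times.\<close>
  have "AE \<omega> in M. (\<lambda>n. (LINT s:{0..real n}|lborel. \<bar>f (U s \<omega>)\<bar>) / real n) \<longlonglongrightarrow> (\<integral>\<omega>. \<bar>f (U 0 \<omega>)\<bar> \<partial>M)"
  proof (rule AE_integer_averages[OF U_meas])
    show "AE \<omega> in M. \<forall>n::nat. set_integrable lborel {0..real n} (\<lambda>s. \<bar>f (U s \<omega>)\<bar>)"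
      using loc by eventually_elim (auto intro: set_integrable_abs)
  qed (use sq in auto)
  with loc avg
  have "AE \<omega> in M. (\<forall>T\<ge>0. set_integrable lborel {0..T} (\<lambda>s. f (U s \<omega>))) \<and>
            ((\<lambda>T. (LINT s:{0..T}|lborel. f (U s \<omega>)) / T) \<longlongrightarrow> (\<integral>\<omega>'. f (U 0 \<omega>') \<partial>M)) at_top"
  proof eventually_elim
    case (elim \<omega>)
    have "set_integrable lborel {0..T} (\<lambda>s. f (U s \<omega>))" for T
    proof -
      obtain n :: nat where "T \<le> real n" using real_arch_simple by blast
      then have "{0..T} \<subseteq> {0..real n}" by simp
      then show ?thesis by (rule set_integrable_subset[OF spec[OF elim(1)], rotated]) simp
    qed
    moreover have "((\<lambda>T. (LINT s:{0..T}|lborel. f (U s \<omega>)) / T) \<longlongrightarrow> (\<integral>\<omega>'. f (U 0 \<omega>') \<partial>M)) at_top"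
      by (rule average_tendsto_of_integer_averages[OF elim(1)[rule_format] elim(2,3)])
    ultimately show ?case by simp
  qed
  with int show ?thesis by simp
qed

end
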